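(* $P\Gamma_L$ is a lattice in $\mathrm{PGL}_3(\mathbb{Q}_2)$ of covolume $1/21$ and is generated by $L_3(2)$ and (the image of) $\beta_L$. It acts with exactly two orbits on the vertices of the Bruhat-Tits building $\mathcal{B}$ of $\mathrm{PGL}_3(\mathbb{Q}_2)$, with vertex stabilizers isomorphic to $L_3(2)$ and $S_4$ respectively.
   Context: A lattice in $\mathrm{PGL}_3(\mathbb{Q}_2)$ means a discrete subgroup of finite covolume. Haar measure on $\mathrm{PGL}_3(\mathbb{Q}_2)$ is scaled so that $\mathrm{PGL}_3(\mathbb{Z}_2)$ (the image of $\mathrm{GL}_3(\mathbb{Z}_2)$) has mass $1$; the covolume of $P\Gamma$ is the resulting measure of $\mathrm{PGL}_3(\mathbb{Q}_2)/P\Gamma$. The building $\mathcal{B}$ is the simplicial complex with one vertex for each $\mathbb{Z}_2$-lattice in $\mathbb{Q}_2^3$ (finitely generated $\mathbb{Z}_2$-submodule spanning $\mathbb{Q}_2^3$) up to scaling; two vertices are joined iff, after scaling, one of the lattices contains the other with index $2$; whenever three vertices are pairwise joined there is a $2$-simplex spanning them. Let $\lambda,\bar\lambda=(-1\pm\sqrt{-7})/2$, so $\lambda+\bar\lambda=-1$, $\lambda\bar\lambda=2$; let $\mathcal{O}=\mathbb{Z}+\lambda\mathbb{Z}$ be the ring of integers of $\mathbb{Q}(\sqrt{-7})=\mathbb{Q}(\lambda)$. Embed $\mathbb{Q}(\lambda)$ in $\mathbb{Q}_2$ so that $\bar\lambda$ maps to a unit of $\mathbb{Z}_2$ and $\lambda$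 to twice a unit. On $\mathbb{Q}(\lambda)^3$ use the Hermitian form $\langle x|y\rangle=\frac12\sum x_i\bar y_i$. Define $$L=\{(x_1,x_2,x_3)\in\mathcal{O}^3 : x_i\equiv x_j \bmod \bar\lambda \text{ for all } i,j,\ \text{and } x_1+x_2+x_3\equiv 0\bmod\lambda\}.$$ Let $L[\frac12]=L\otimes_{\mathcal{O}}\mathcal{O}[\frac12]\subseteq\mathbb{Q}(\lambda)^3$, let $\Gamma_{L}$ be the group of all $\mathcal{O}[\frac12]$-linear automorphisms of $L[\frac12]$ preserving $\langle\cdot|\cdot\rangle$, regarded as a subgroup of $\mathrm{GL}_3(\mathbb{Q}(\lambda))\subseteq\mathrm{GL}_3(\mathbb{Q}_2)$, and let $P\Gamma_{L}$ be its image in $\mathrm{PGL}_3(\mathbb{Q}_2)$ (equivalently its quotient by its center, which consists of scalars). $L_3(2)$ denotes the simple group $\mathrm{PSL}_3(\mathbb{F}_2)=\mathrm{GL}_3(\mathbb{F}_2)$ of order $168$; the isometry group $\mathrm{Isom}\,L$ of $L$ over $\mathcal{O}$ is isomorphic to $L_3(2)\times\{\pm1\}$, and the subgroup $L_3(2)\subseteq P\Gamma_L$ in the statement is the image of $\mathrm{Isom}\,L$. The element $\beta_L\in\Gamma_L$ is $$\beta_L=\begin{pmatrix}1&0&0\\0&1/\lambda&1/\lambda\\0&1/\lambda&-1/\lambda\end{pmatrix}.$$ *)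

theory Defs
  imports
    "HOL-Analysis.Analysis"
    "HOL-Library.Z2"
    "HOL-Computational_Algebra.Fraction_Field"
    "HOL-Algebra.Coset"
    "HOL-Algebra.Left_Coset"
    "HOL-Algebra.Generated_Groups"
    "HOL-Algebra.Group_Action"
    "HOL-Algebra.Sym_Groups"
begin

section \<open>The 2-adic integers and the 2-adic numbers\<close>

text \<open>The ring of 2-adic integers is the inverse limit of the rings of integers modulo \<open>2 ^ n\<close>,
  each represented by its least nonnegative residues.\<close>

typedef z2 = "{f :: nat \<Rightarrow> int. \<forall>n. 0 \<le> f n \<and> f n < 2 ^ n \<and> f (Suc n) mod 2 ^ n = f n}"
  morphisms residue Abs_z2
  by (rule exI[of _ "\<lambda>_. 0"]) auto

setup_lifting type_definition_z2

lemma mod_Suc_power2: "(x :: int) mod 2 ^ Suc n mod 2 ^ n = x mod 2 ^ n"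
  by (rule mod_mod_cancel) simp

instantiation z2 :: comm_ring_1
begin

lift_definition zero_z2 :: z2 is "\<lambda>n. 0" by auto
lift_definition one_z2 :: z2 is "\<lambda>n. 1 mod 2 ^ n"
  using mod_Suc_power2[of 1] by auto
lift_definition plus_z2 :: "z2 \<Rightarrow> z2 \<Rightarrow> z2" is "\<lambda>f g n. (f n + g n) mod 2 ^ n"
  by (simp only: mod_Suc_power2) (metis mod_add_eq pos_mod_bound pos_mod_sign zero_less_numeral zero_less_power)
lift_definition times_z2 :: "z2 \<Rightarrow> z2 \<Rightarrow> z2" is "\<lambda>f g n. (f n * g n) mod 2 ^ n"
  by (simp only: mod_Suc_power2) (metis mod_mult_eq pos_mod_bound pos_mod_sign zero_less_numeral zero_less_power)
lift_definition uminus_z2 :: "z2 \<Rightarrow> z2" is "\<lambda>f n. (- f n) mod 2 ^ n"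
  by (simp only: mod_Suc_power2) (metis mod_minus_eq pos_mod_bound pos_mod_sign zero_less_numeral zero_less_power)
lift_definition minus_z2 :: "z2 \<Rightarrow> z2 \<Rightarrow> z2" is "\<lambda>f g n. (f n - g n) mod 2 ^ n"
  by (simp only: mod_Suc_power2) (metis mod_diff_eq pos_mod_bound pos_mod_sign zero_less_numeral zero_less_power)

instance
proof
  fix a b c :: z2
  show "a * b * c = a * (b * c)"
    by transfer (simp add: mod_mult_left_eq mod_mult_right_eq mult.assoc)
  show "a * b = b * a" by transfer (simp add: mult.commute)
  show "1 * a = a"
  proof (transfer, rule ext)
    fix f :: "nat \<Rightarrow> int" and n
    assume f: "\<forall>n. 0 \<le> f n \<and> f n < 2 ^ n \<and> f (Suc n) mod 2 ^ n = f n"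
    then have "f n mod 2 ^ n = f n" by simp
    then show "1 mod 2 ^ n * f n mod 2 ^ n = f n"
      by (metis mod_mult_left_eq mult_1)
  qed
  show "(a + b) * c = a * c + b * c"
    by transfer (simp add: mod_mult_left_eq mod_add_eq distrib_right)
  show "a + b + c = a + (b + c)"
    by transfer (simp add: mod_add_left_eq mod_add_right_eq add.assoc)
  show "a + b = b + a" by transfer (simp add: add.commute)
  show "0 + a = a" by transfer auto
  show "- a + a = 0" by transfer (simp add: mod_add_left_eq)
  show "a - b = a + - b" by transfer (simp add: mod_add_right_eq)
  show "(0 :: z2) \<noteq> 1"
  proof
    assume "(0 :: z2) = 1"
    then have "residue 0 1 = residue 1 1" by simp
    then show False by (simp add: zero_z2.rep_eq one_z2.rep_eq)
  qed
qed

end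

lemma residue_mod: "residue a (n + k) mod 2 ^ n = residue a n"
proof (induction k)
  case 0
  show ?case using residue[of a] by simp
next
  case (Suc k)
  have "residue a (Suc (n + k)) mod 2 ^ n = residue a (Suc (n + k)) mod 2 ^ (n + k) mod 2 ^ n"
    by (rule mod_mod_cancel[symmetric]) (simp add: le_imp_power_dvd)
  also have "\<dots> = residue a (n + k) mod 2 ^ n"
    using residue[of a] by simp
  finally show ?case using Suc by simp
qed

instance z2 :: idom
proof
  fix a b :: z2
  assume "a \<noteq> 0" "b \<noteq> 0"
  then obtain m n where m: "residue a m \<noteq> 0" and n: "residue b n \<noteq> 0"
    by (metis residue_inject zero_z2.rep_eq ext)
  let ?x = "residue a (m + n)" and ?y = "residue b (m + n)"
  have "\<not> 2 ^ m dvd ?x" "\<not> 2 ^ n dvd ?y"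
    using m n residue_mod[of a m n] residue_mod[of b n m]
    by (simp_all add: dvd_eq_mod_eq_0 add.commute)
  moreover have "2 ^ m dvd ?x \<or> 2 ^ n dvd ?y" if "2 ^ (m + n) dvd ?x * ?y"
  proof (rule ccontr)
    assume neg: "\<not> ?thesis"
    then have nz: "?x \<noteq> 0" "?y \<noteq> 0" by auto
    have "multiplicity 2 ?x < m" "multiplicity 2 ?y < n"
      using neg nz by (auto simp: power_dvd_iff_le_multiplicity not_le)
    moreover have "m + n \<le> multiplicity 2 (?x * ?y)"
      using that nz by (simp add: power_dvd_iff_le_multiplicity)
    moreover have "multiplicity 2 (?x * ?y) = multiplicity 2 ?x + multiplicity 2 ?y"
      using nz by (intro prime_elem_multiplicity_mult_distrib) auto
    ultimately show False by linarith
  qed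
  ultimately have "residue (a * b) (m + n) \<noteq> 0"
    by (auto simp: times_z2.rep_eq dvd_eq_mod_eq_0)
  then show "a * b \<noteq> 0" by (auto simp: zero_z2.rep_eq)
qed

lemma residue_of_nat: "residue (of_nat k) n = int k mod 2 ^ n"
  by (induction k) (simp_all add: zero_z2.rep_eq one_z2.rep_eq plus_z2.rep_eq mod_simps)

instance z2 :: ring_char_0
proof
  show "inj (of_nat :: nat \<Rightarrow> z2)"
  proof (rule injI)
    fix j k assume eq: "(of_nat j :: z2) = of_nat k"
    have "int j mod 2 ^ (j + k) = int k mod 2 ^ (j + k)"
      using arg_cong[OF eq, of "\<lambda>a. residue a (j + k)"] by (simp add: residue_of_nat)
    moreover have "j < 2 ^ (j + k)" "k < 2 ^ (j + k)"
      by (meson add_lessD1 less_exp le_add1 le_add2 order.strict_trans1)+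
    then have "int j < 2 ^ (j + k)" "int k < 2 ^ (j + k)"
      by (metis of_nat_less_iff of_nat_numeral of_nat_power)+
    ultimately show "j = k" by simp
  qed
qed

text \<open>The type \<open>q2\<close> is a copy of the fraction field of \<open>z2\<close>, made into a type of its own
  so that it can carry the 2-adic topology.\<close>

typedef q2 = "UNIV :: z2 fract set" morphisms fract_of_q2 q2_of_fract ..

setup_lifting type_definition_q2

instantiation q2 :: field
begin

lift_definition zero_q2 :: q2 is 0 .
lift_definition one_q2 :: q2 is 1 .
lift_definition plus_q2 :: "q2 \<Rightarrow> q2 \<Rightarrow> q2" is "(+)" .
lift_definition times_q2 :: "q2 \<Rightarrow> q2 \<Rightarrow> q2" is "(*)" .
lift_definition uminus_q2 :: "q2 \<Rightarrow> q2" is uminus .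
lift_definition minus_q2 :: "q2 \<Rightarrow> q2 \<Rightarrow> q2" is "(-)" .
lift_definition inverse_q2 :: "q2 \<Rightarrow> q2" is inverse .
lift_definition divide_q2 :: "q2 \<Rightarrow> q2 \<Rightarrow> q2" is "(/)" .

instance
  by standard (transfer; simp add: algebra_simps divide_inverse)+

end

definition of_z2 :: "z2 \<Rightarrow> q2" where
  "of_z2 a = q2_of_fract (Fract a 1)"

lemma of_z2_simps [simp]:
  "of_z2 0 = 0" "of_z2 1 = 1"
  "of_z2 (a + b) = of_z2 a + of_z2 b" "of_z2 (a - b) = of_z2 a - of_z2 b"
  "of_z2 (- a) = - of_z2 a" "of_z2 (a * b) = of_z2 a * of_z2 b"
  "of_z2 a = of_z2 b \<longleftrightarrow> a = b"
  by (simp_all add: of_z2_def zero_q2_def one_q2_def plus_q2.abs_eq minus_q2.abs_eq uminus_q2.abs_eq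
      times_q2.abs_eq q2_of_fract_inject Zero_fract_def One_fract_def eq_fract eq_onp_same_args)

lemma of_z2_of_nat [simp]: "of_z2 (of_nat n) = of_nat n"
  by (induction n) simp_all

instance q2 :: field_char_0
proof
  show "inj (of_nat :: nat \<Rightarrow> q2)"
    by (rule injI) (metis of_z2_of_nat of_z2_simps(7) of_nat_eq_iff)
qed

text \<open>The sets \<open>x + 2 ^ n * Z_2\<close> are a basis of neighbourhoods of \<open>x\<close>. Spaces of vectors and
  matrices over \<open>q2\<close> then carry the product topology through the library instance for \<open>vec\<close>.\<close>

instantiation q2 :: topological_space
begin

definition open_q2 :: "q2 set \<Rightarrow> bool" where
  "open_q2 U \<longleftrightarrow> (\<forall>x\<in>U. \<exists>n. \<forall>a. x + 2 ^ n * of_z2 a \<in> U)"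

instance
proof
  show "open (UNIV :: q2 set)" by (simp add: open_q2_def)
next
  fix S T :: "q2 set"
  assume S: "open S" and T: "open T"
  show "open (S \<inter> T)"
    unfolding open_q2_def
  proof
    fix x assume "x \<in> S \<inter> T"
    then obtain m n where m: "\<And>a. x + 2 ^ m * of_z2 a \<in> S" and n: "\<And>a. x + 2 ^ n * of_z2 a \<in> T"
      using S T unfolding open_q2_def by blast
    have two: "of_z2 2 = 2" using of_z2_of_nat[of 2] by simp
    have pow: "of_z2 (2 ^ k) = 2 ^ k" for k by (induction k) (simp_all add: two)
    have "x + 2 ^ (m + n) * of_z2 a \<in> S \<inter> T" for a
    proof -
      have "x + 2 ^ (m + n) * of_z2 a = x + 2 ^ m * of_z2 (2 ^ n * a)"
        by (simp add: power_add pow)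
      moreover have "x + 2 ^ (m + n) * of_z2 a = x + 2 ^ n * of_z2 (2 ^ m * a)"
        by (simp add: power_add pow)
      ultimately show ?thesis using m n by (metis IntI)
    qed
    then show "\<exists>n. \<forall>a. x + 2 ^ n * of_z2 a \<in> S \<inter> T" by blast
  qed
next
  fix K :: "q2 set set"
  assume "\<forall>S\<in>K. open S"
  then show "open (\<Union>K)" unfolding open_q2_def by (meson UnionE UnionI)
qed

end

section \<open>Linear groups\<close>

definition GL3 :: "('a::comm_ring_1 ^ 3 ^ 3) monoid" where
  "GL3 = \<lparr>carrier = {A. invertible A}, mult = (**), one = mat 1\<rparr>"

definition scalars :: "('a::field ^ 3 ^ 3) set" where
  "scalars = {mat c |c. c \<noteq> 0}"

definition PGL3 :: "(q2 ^ 3 ^ 3) set monoid" where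
  "PGL3 = GL3 Mod scalars"

definition to_PGL3 :: "q2 ^ 3 ^ 3 \<Rightarrow> (q2 ^ 3 ^ 3) set" where
  "to_PGL3 A = scalars #>\<^bsub>GL3\<^esub> A"

definition PGL3_Z2 :: "(q2 ^ 3 ^ 3) set set" where
  "PGL3_Z2 = to_PGL3 ` map_matrix of_z2 ` carrier GL3"

text \<open>The general linear group over the field with two elements; it coincides with \<open>PSL_3(F_2)\<close>
  because the only unit of that field is \<open>1\<close>.\<close>

abbreviation L3_2 :: "(bit ^ 3 ^ 3) monoid" where
  "L3_2 \<equiv> GL3"

section \<open>Topology, Haar measure, lattices and covolume\<close>

definition quotient_topology :: "'a topology \<Rightarrow> ('a \<Rightarrow> 'b) \<Rightarrow> 'b topology" where
  "quotient_topology T f =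
     topology (\<lambda>U. U \<subseteq> f ` topspace T \<and> openin T {x \<in> topspace T. f x \<in> U})"

lemma openin_quotient_topology:
  "openin (quotient_topology T f) U \<longleftrightarrow>
     U \<subseteq> f ` topspace T \<and> openin T {x \<in> topspace T. f x \<in> U}"
proof -
  let ?P = "\<lambda>U. U \<subseteq> f ` topspace T \<and> openin T {x \<in> topspace T. f x \<in> U}"
  have "istopology ?P"
    unfolding istopology_def
  proof (intro conjI allI impI; (elim conjE)?)
    fix S S' assume "openin T {x \<in> topspace T. f x \<in> S}" "openin T {x \<in> topspace T. f x \<in> S'}"
    then have "openin T ({x \<in> topspace T. f x \<in> S} \<inter> {x \<in> topspace T. f x \<in> S'})"
      by (rule openin_Int)
    then show "openin T {x \<in> topspace T. f x \<in> S \<inter> S'}"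
      by (rule back_subst[of "openin T"]) auto
  next
    fix \<K> assume K: "\<forall>S\<in>\<K>. ?P S"
    then have "openin T (\<Union>S\<in>\<K>. {x \<in> topspace T. f x \<in> S})"
      by (intro openin_Union) auto
    then show "openin T {x \<in> topspace T. f x \<in> \<Union>\<K>}"
      by (rule back_subst[of "openin T"]) auto
  qed auto
  then show ?thesis by (simp add: quotient_topology_def)
qed

lemma quotient_map_quotient_topology: "quotient_map T (quotient_topology T f) f"
proof -
  have "topspace (quotient_topology T f) = f ` topspace T"
  proof
    show "topspace (quotient_topology T f) \<subseteq> f ` topspace T"
      using openin_quotient_topology[of T f] openin_topspace by blast
    have "{x \<in> topspace T. f x \<in> f ` topspace T} = topspace T" by auto
    then have "openin (quotient_topology T f) (f ` topspace T)"
      by (simp add: openin_quotient_topology)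
    then show "f ` topspace T \<subseteq> topspace (quotient_topology T f)"
      by (rule openin_subset)
  qed
  then show ?thesis by (auto simp: quotient_map_def openin_quotient_topology)
qed

definition PGL3_top :: "(q2 ^ 3 ^ 3) set topology" where
  "PGL3_top = quotient_topology (top_of_set (carrier GL3)) to_PGL3"

definition borel_sets :: "'a topology \<Rightarrow> 'a set set" where
  "borel_sets T = sigma_sets (topspace T) {U. openin T U}"

text \<open>Left Haar measure on a locally compact second countable group. Inner and outer regularity
  are automatic for such groups and are not repeated here.\<close>

definition haar_measure :: "('a, 'b) monoid_scheme \<Rightarrow> 'a topology \<Rightarrow> 'a measure \<Rightarrow> bool" where
  "haar_measure G T \<mu> \<longleftrightarrow>
     space \<mu> = carrier G \<and> sets \<mu> = borel_sets T \<and>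
     (\<forall>g\<in>carrier G. \<forall>B\<in>sets \<mu>. emeasure \<mu> (g <#\<^bsub>G\<^esub> B) = emeasure \<mu> B) \<and>
     (\<forall>K. compactin T K \<longrightarrow> emeasure \<mu> K < \<infinity>) \<and>
     emeasure \<mu> (carrier G) \<noteq> 0"

text \<open>The measure \<open>\<nu>\<close> induced by \<open>\<mu>\<close> on the space of cosets \<open>g\<Gamma>\<close> of a discrete subgroup \<open>\<Gamma>\<close>:
  it is characterised by Weil's formula, in which the measure used on \<open>\<Gamma>\<close> is the counting measure.
  In particular \<open>\<nu>\<close> agrees with \<open>\<mu>\<close> on Borel sets that meet every coset at most once.\<close>

definition coset_measure ::
    "('a, 'b) monoid_scheme \<Rightarrow> 'a topology \<Rightarrow> 'a measure \<Rightarrow> 'a set \<Rightarrow> 'a set measure \<Rightarrow> bool" where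
  "coset_measure G T \<mu> \<Gamma> \<nu> \<longleftrightarrow>
     space \<nu> = lcosets\<^bsub>G\<^esub> \<Gamma> \<and>
     sets \<nu> = borel_sets (quotient_topology T (\<lambda>g. g <#\<^bsub>G\<^esub> \<Gamma>)) \<and>
     (\<forall>B\<in>sets \<mu>. emeasure \<mu> B = (\<integral>\<^sup>+ c. emeasure (count_space UNIV) (B \<inter> c) \<partial>\<nu>))"

definition covolume ::
    "('a, 'b) monoid_scheme \<Rightarrow> 'a topology \<Rightarrow> 'a measure \<Rightarrow> 'a set \<Rightarrow> ennreal" where
  "covolume G T \<mu> \<Gamma> = (THE c. \<exists>\<nu>. coset_measure G T \<mu> \<Gamma> \<nu> \<and> emeasure \<nu> (space \<nu>) = c)"

text \<open>The existence of the induced measure is required explicitly, so that finiteness of the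
  covolume does not rest on the value of an improper definite description.\<close>

definition is_lattice_in ::
    "('a, 'b) monoid_scheme \<Rightarrow> 'a topology \<Rightarrow> 'a measure \<Rightarrow> 'a set \<Rightarrow> bool" where
  "is_lattice_in G T \<mu> \<Gamma> \<longleftrightarrow>
     subgroup \<Gamma> G \<and> subtopology T \<Gamma> = discrete_topology \<Gamma> \<and>
     (\<exists>\<nu>. coset_measure G T \<mu> \<Gamma> \<nu>) \<and> covolume G T \<mu> \<Gamma> < \<infinity>"

section \<open>The building\<close>

interpretation z2_mod: Modules.module "\<lambda>(a :: z2) (x :: q2 ^ 3). of_z2 a *s x"
  by unfold_locales (simp_all add: vec_eq_iff algebra_simps)

definition is_z2_lattice :: "(q2 ^ 3) set \<Rightarrow> bool" where
  "is_z2_lattice M \<longleftrightarrow> (\<exists>S. finite S \<and> M = z2_mod.span S) \<and> vec.span M = UNIV"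

definition homothety_class :: "(q2 ^ 3) set \<Rightarrow> (q2 ^ 3) set set" where
  "homothety_class M = {((*s) c) ` M |c. c \<noteq> 0}"

definition building_vertices :: "(q2 ^ 3) set set set" where
  "building_vertices = {homothety_class M |M. is_z2_lattice M}"

definition contains_with_index :: "(q2 ^ 3) set \<Rightarrow> (q2 ^ 3) set \<Rightarrow> nat \<Rightarrow> bool" where
  "contains_with_index M N k \<longleftrightarrow> N \<subseteq> M \<and> card ((\<lambda>x. (+) x ` N) ` M) = k"

definition building_joined :: "(q2 ^ 3) set set \<Rightarrow> (q2 ^ 3) set set \<Rightarrow> bool" where
  "building_joined V W \<longleftrightarrow>
     (\<exists>M\<in>V. \<exists>N\<in>W. contains_with_index M N 2 \<or> contains_with_index N M 2)"

text \<open>A simplicial complex is given as the set of its nonempty simplices, each being the set of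
  its vertices.\<close>

definition building :: "(q2 ^ 3) set set set set" where
  "building = {\<sigma>. \<sigma> \<subseteq> building_vertices \<and> card \<sigma> \<in> {1, 2, 3} \<and>
                  (\<forall>V\<in>\<sigma>. \<forall>W\<in>\<sigma>. V \<noteq> W \<longrightarrow> building_joined V W)}"

text \<open>The action of an element of \<open>PGL3\<close>, which is a class of matrices modulo scalars, on a
  homothety class of lattices. The restriction to the vertices is the format required by the
  locale \<open>group_action\<close>.\<close>

definition vertex_action :: "(q2 ^ 3 ^ 3) set \<Rightarrow> (q2 ^ 3) set set \<Rightarrow> (q2 ^ 3) set set" where
  "vertex_action g = (\<lambda>V\<in>\<Union>building. {((*v) A) ` M |A M. A \<in> g \<and> M \<in> V})"

section \<open>The Hermitian lattice and its groups\<close>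

definition lam :: complex where
  "lam = Complex (- 1 / 2) (sqrt 7 / 2)"

abbreviation lambar :: complex where
  "lambar \<equiv> cnj lam"

definition Q_lam :: "complex set" where
  "Q_lam = {of_rat a + of_rat b * lam |a b. True}"

definition O_lam :: "complex set" where
  "O_lam = {of_int a + of_int b * lam |a b. True}"

definition cong_O :: "complex \<Rightarrow> complex \<Rightarrow> complex \<Rightarrow> bool" where
  "cong_O m x y \<longleftrightarrow> (\<exists>c\<in>O_lam. x - y = m * c)"

definition herm :: "complex ^ 3 \<Rightarrow> complex ^ 3 \<Rightarrow> complex" where
  "herm x y = 1 / 2 * (\<Sum>i\<in>UNIV. x $ i * cnj (y $ i))"

definition lat_L :: "(complex ^ 3) set" where
  "lat_L = {x. (\<forall>i. x $ i \<in> O_lam) \<and> (\<forall>i j. cong_O lambar (x $ i) (x $ j)) \<and>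
               cong_O lam (x $ 1 + x $ 2 + x $ 3) 0}"

definition lat_L_half :: "(complex ^ 3) set" where
  "lat_L_half = {(1 / 2 ^ n) *s x |n x. x \<in> lat_L}"

text \<open>For a subset \<open>M\<close> spanning \<open>Q(\<lambda>)^3\<close> that is a module over a subring of \<open>Q(\<lambda>)\<close>, the
  form-preserving automorphisms of the module are the restrictions of the following matrices,
  each of a unique one.\<close>

definition isom_group :: "(complex ^ 3) set \<Rightarrow> (complex ^ 3 ^ 3) set" where
  "isom_group M = {A. (\<forall>i j. A $ i $ j \<in> Q_lam) \<and> invertible A \<and> bij_betw ((*v) A) M M \<and>
                      (\<forall>x\<in>M. \<forall>y\<in>M. herm (A *v x) (A *v y) = herm x y)}"

definition Gamma_L :: "(complex ^ 3 ^ 3) set" where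
  "Gamma_L = isom_group lat_L_half"

definition Isom_L :: "(complex ^ 3 ^ 3) set" where
  "Isom_L = isom_group lat_L"

definition beta_L :: "complex ^ 3 ^ 3" where
  "beta_L = vector [vector [1, 0, 0],
                    vector [0, 1 / lam, 1 / lam],
                    vector [0, 1 / lam, - 1 / lam]]"

text \<open>The field embeddings of \<open>Q(\<lambda>)\<close> into \<open>Q_2\<close> sending \<open>\<lambda>\<close> to twice a unit. Only the values
  on \<open>Q(\<lambda>)\<close> matter.\<close>

definition dyadic_embedding :: "(complex \<Rightarrow> q2) \<Rightarrow> bool" where
  "dyadic_embedding \<iota> \<longleftrightarrow>
     \<iota> 1 = 1 \<and>
     (\<forall>x\<in>Q_lam. \<forall>y\<in>Q_lam. \<iota> (x + y) = \<iota> x + \<iota> y \<and> \<iota> (x * y) = \<iota> x * \<iota> y) \<and>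
     (\<exists>u. u dvd 1 \<and> \<iota> lambar = of_z2 u) \<and>
     (\<exists>u. u dvd 1 \<and> \<iota> lam = 2 * of_z2 u)"

text \<open>Such an embedding exists: Hensel lifting gives the root of \<open>X^2 + X + 2\<close> in \<open>2 * Z_2\<close>.\<close>

primrec hensel :: "nat \<Rightarrow> int" where
  "hensel 0 = 0"
| "hensel (Suc n) = - (2 + hensel n * hensel n)"

lemma even_hensel: "even (hensel n)"
  by (induction n) simp_all

lemma hensel_step: "2 ^ Suc n dvd hensel (Suc n) - hensel n"
proof (induction n)
  case 0
  show ?case by simp
next
  case (Suc n)
  have "2 dvd - (hensel (Suc n) + hensel n)" using even_hensel by simp
  with Suc have "2 ^ Suc n * 2 dvd (hensel (Suc n) - hensel n) * - (hensel (Suc n) + hensel n)"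
    by (rule mult_dvd_mono)
  also have "(hensel (Suc n) - hensel n) * - (hensel (Suc n) + hensel n) =
      hensel (Suc (Suc n)) - hensel (Suc n)"
    unfolding hensel.simps(2)[of "Suc n"] by (simp add: algebra_simps del: hensel.simps) simp
  finally show ?case by (simp del: hensel.simps add: mult.commute)
qed

lemma hensel_mod: "hensel (Suc n) mod 2 ^ n = hensel n mod 2 ^ n"
proof -
  have "2 ^ n dvd hensel (Suc n) - hensel n"
    using hensel_step[of n] by (rule dvd_trans[rotated]) simp
  then show ?thesis by (simp add: mod_eq_dvd_iff del: hensel.simps)
qed

lift_definition z2_root :: z2 is "\<lambda>n. hensel n mod 2 ^ n"
  by (simp only: mod_Suc_power2 hensel_mod) simp

lemma residue_numeral_2: "residue 2 n = 2 mod 2 ^ n"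
  using residue_of_nat[of 2 n] by simp

lemma z2_root: "z2_root * z2_root + z2_root + 2 = 0"
proof (rule iffD1[OF residue_inject], rule ext)
  fix n
  have "residue (z2_root * z2_root + z2_root + 2) n = (hensel n * hensel n + hensel n + 2) mod 2 ^ n"
    by (simp add: plus_z2.rep_eq times_z2.rep_eq z2_root.rep_eq residue_numeral_2 mod_simps)
  also have "\<dots> = (hensel n - hensel (Suc n)) mod 2 ^ n" by (simp add: algebra_simps)
  also have "\<dots> = 0" using hensel_mod[of n] by (metis mod_diff_cong diff_self mod_0)
  finally show "residue (z2_root * z2_root + z2_root + 2) n = residue 0 n"
    by (simp add: zero_z2.rep_eq)
qed

lemma residue_range: "0 \<le> residue a n" "residue a n < 2 ^ n" "residue a (Suc n) mod 2 ^ n = residue a n"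
  using residue[of a] by auto

definition z2_half :: "z2 \<Rightarrow> z2" where
  "z2_half a = Abs_z2 (\<lambda>n. residue a (Suc n) div 2)"

lemma residue_z2_half: "residue (z2_half a) n = residue a (Suc n) div 2"
proof -
  have "residue a (Suc (Suc n)) div 2 mod 2 ^ n = residue a (Suc n) div 2" for n
    using div_exp_mod_exp_eq[of "residue a (Suc (Suc n))" 1 n] residue_range(3)[of a "Suc n"] by simp
  moreover have "residue a (Suc n) div 2 < 2 ^ n" for n
    using residue_range(2)[of a "Suc n"] by auto
  ultimately show ?thesis
    unfolding z2_half_def by (subst Abs_z2_inverse) (auto simp: residue_range pos_imp_zdiv_nonneg_iff)
qed

lemma z2_half: "residue a 1 = 0 \<Longrightarrow> 2 * z2_half a = a"
proof (rule iffD1[OF residue_inject], rule ext)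
  fix n assume a: "residue a 1 = 0"
  have "residue a (Suc n) mod 2 = 0" using a residue_mod[of a 1 n] by simp
  then have ev: "2 * (residue a (Suc n) div 2) = residue a (Suc n)" by auto
  have "residue (2 * z2_half a) n = (2 * (residue a (Suc n) div 2)) mod 2 ^ n"
    by (simp add: times_z2.rep_eq residue_z2_half residue_numeral_2 mod_simps)
  also have "\<dots> = residue a n" using residue_mod[of a n 1] by (simp add: ev)
  finally show "residue (2 * z2_half a) n = residue a n" .
qed

lemma lam_square: "lam * lam = - lam - 2"
  by (simp add: lam_def complex_eq_iff)

lemma lambar_eq: "lambar = - 1 - lam"
  by (simp add: lam_def complex_eq_iff)

lemma ex_dyadic_embedding: "\<exists>\<iota>. dyadic_embedding \<iota>"
proof -
  define L where "L = of_z2 z2_root"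
  define k where "k = z2_half z2_root"
  have k: "2 * k = z2_root"
    unfolding k_def using even_hensel[of 1] by (intro z2_half) (simp add: z2_root.rep_eq)
  have "2 * ((- 1 - z2_root) * k) = (- 1 - z2_root) * (2 * k)" by (rule mult.left_commute)
  also have "\<dots> = 2 * 1 - (z2_root * z2_root + z2_root + 2)" unfolding k by (simp add: algebra_simps)
  finally have "2 * ((- 1 - z2_root) * k) = 2 * 1" unfolding z2_root by simp
  then have unit: "(- 1 - z2_root) * k = 1" by (metis mult_cancel_left zero_neq_numeral)
  have two: "of_z2 2 = 2" using of_z2_of_nat[of 2] by simp
  have "L * L = of_z2 (z2_root * z2_root + z2_root + 2) - L - 2"
    by (simp add: L_def two)
  then have L: "L * L = - L - 2" unfolding z2_root by simp
  define rt :: "real \<Rightarrow> q2" where "rt x = of_rat (THE r. of_rat r = x)" for x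
  have rt: "rt (of_rat r) = of_rat r" for r by (simp add: rt_def)
  define \<iota> where "\<iota> z = rt (Re z + Im z / sqrt 7) + rt (2 * Im z / sqrt 7) * L" for z
  have of_real: "of_rat r = complex_of_real (of_rat r)" for r
    by (cases r) (simp add: of_rat_rat)
  have ReIm: "Re (of_rat r :: complex) = of_rat r" "Im (of_rat r :: complex) = 0" for r
    by (simp_all add: of_real)
  have \<iota>: "\<iota> (of_rat a + of_rat b * lam) = of_rat a + of_rat b * L" for a b
  proof -
    have "\<iota> (of_rat a + of_rat b * lam) = rt (of_rat a) + rt (of_rat b) * L"
      by (simp add: \<iota>_def ReIm lam_def field_simps)
    then show ?thesis by (simp add: rt)
  qed
  have 1: "\<iota> 1 = 1" using \<iota>[of 1 0] by simp
  have lam: "\<iota> lam = L" using \<iota>[of 0 1] by simp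
  have bar: "\<iota> lambar = - 1 - L" using \<iota>[of "- 1" "- 1"] by (simp add: lambar_eq)
  have add: "\<iota> (x + y) = \<iota> x + \<iota> y" and mult: "\<iota> (x * y) = \<iota> x * \<iota> y"
    if xy: "x \<in> Q_lam" "y \<in> Q_lam" for x y
  proof -
    obtain a b c d where x: "x = of_rat a + of_rat b * lam" and y: "y = of_rat c + of_rat d * lam"
      using xy unfolding Q_lam_def by blast
    have "x + y = of_rat (a + c) + of_rat (b + d) * lam"
      by (simp add: x y of_rat_add algebra_simps)
    then show "\<iota> (x + y) = \<iota> x + \<iota> y"
      unfolding x y by (simp only: \<iota>) (simp add: of_rat_add algebra_simps)
    have *: "(p + q * l) * (r + s * l) = (p * r - 2 * q * s) + (p * s + q * r - q * s) * l"
      if "l * l = - l - 2" for p q r s l :: "'a :: comm_ring_1"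
    proof -
      have "(p + q * l) * (r + s * l) = p * r + (p * s + q * r) * l + q * s * (l * l)"
        by (simp add: algebra_simps)
      then show ?thesis unfolding that by (simp add: algebra_simps)
    qed
    have "x * y = of_rat (a * c - 2 * b * d) + of_rat (a * d + b * c - b * d) * lam"
      unfolding x y *[OF lam_square] by (simp add: of_rat_add of_rat_diff of_rat_mult)
    then have "\<iota> (x * y) = of_rat (a * c - 2 * b * d) + of_rat (a * d + b * c - b * d) * L"
      by (simp only: \<iota>)
    also have "\<dots> = (of_rat a + of_rat b * L) * (of_rat c + of_rat d * L)"
      unfolding *[OF L] by (simp add: of_rat_add of_rat_diff of_rat_mult)
    finally show "\<iota> (x * y) = \<iota> x * \<iota> y" unfolding x y \<iota> .
  qed
  have dvd: "(- 1 - z2_root) dvd 1" "k dvd 1"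
    using unit by (metis dvd_triv_left, metis dvd_triv_right)
  have "\<iota> lambar = of_z2 (- 1 - z2_root)" by (simp add: bar L_def)
  with dvd have "\<exists>u. u dvd 1 \<and> \<iota> lambar = of_z2 u" by metis
  moreover have "\<iota> lam = 2 * of_z2 k" unfolding lam L_def k[symmetric] by (simp add: two)
  with dvd have "\<exists>u. u dvd 1 \<and> \<iota> lam = 2 * of_z2 u" by metis
  ultimately have "dyadic_embedding \<iota>"
    unfolding dyadic_embedding_def using 1 add mult by (intro conjI ballI) assumption+
  then show ?thesis by (rule exI[where x = \<iota>])
qed

definition PGamma_L :: "(complex \<Rightarrow> q2) \<Rightarrow> (q2 ^ 3 ^ 3) set set" where
  "PGamma_L \<iota> = to_PGL3 ` map_matrix \<iota> ` Gamma_L"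

definition PIsom_L :: "(complex \<Rightarrow> q2) \<Rightarrow> (q2 ^ 3 ^ 3) set set" where
  "PIsom_L \<iota> = to_PGL3 ` map_matrix \<iota> ` Isom_L"

end

theory Submission
  imports Defs
begin

text \<open>
  Since \<open>L[1/2] = O[1/2]\<^sup>3\<close>, the group \<open>\<Gamma>\<^sub>L\<close> is the unitary group of the standard form over \<open>O[1/2]\<close>.
  The stabilizer of the standard vertex comes from the integral unitary matrices, that is the
  signed permutation matrices, and modulo \<open>\<plusminus>1\<close> these form \<open>S\<^sub>4\<close>. The stabilizer of the vertex of \<open>L\<close>
  comes from \<open>Isom L\<close>; reduction modulo \<open>\<lambda>\<close> maps it to \<open>GL\<^sub>3(F\<^sub>2)\<close> with kernel \<open>\<plusminus>1\<close>, and
  surjectively because reflections in minimal vectors reduce to transvections. Every matrix is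
  obtained from the identity by right multiplication with \<open>diag(2,1,1)\<close>, integral invertible
  matrices and scalars, so to see that the group generated by \<open>Isom L\<close> and \<open>\<beta>\<close> moves every vertex to
  one of these two, it suffices to move to them the seven index 2 sublattices of each. The two
  vertices are inequivalent because their stabilizers differ in order, and as the stabilizers lie
  in the generated group, that group is all of \<open>P\<Gamma>\<^sub>L\<close>. Finally \<open>PGL\<^sub>3(Q\<^sub>2)\<close> is unimodular, so the two
  double cosets of \<open>PGL\<^sub>3(Z\<^sub>2)\<close> and \<open>P\<Gamma>\<^sub>L\<close> have measure \<open>1/24\<close> and \<open>1/168\<close> modulo \<open>P\<Gamma>\<^sub>L\<close>, of sum \<open>1/21\<close>.
\<close>

section \<open>The 2-adic numbers\<close>

text \<open>The prime 2 splits in O as \<open>lam\<close> times \<open>lambar\<close>, and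
  \<open>\<iota>\<close> sees only the first factor. The second is controlled through the adjoint:
  for a unitary matrix, integrality of the inverse at \<open>lam\<close> amounts to integrality of
  the matrix at \<open>lambar\<close>. This is why vertex stabilizers, defined 2-adically, come from
  finite isometry groups over O. The obstacle for the covolume is that Haar measure is given only by
  left invariance and the measure on cosets only by Weil's formula. Uniqueness is proved on cosets
  of congruence subgroups, any two of which are nested or disjoint. Right translation then scales
  the measure by a constant; it is 1 because the group is generated by a compact subgroup and the
  class of \<open>dmat\<close>, whose product with a permutation matrix has scalar cube. In place of
  a measurable fundamental domain there is a weight function with sum 1 over each coset: a
  combination of indicators of two translates of PGL_3(Z_2), divided by the orders of the
  stabilizers.\<close>

definition ZZ :: "q2 set" where "ZZ = range of_z2"

definition UU :: "q2 set" where "UU = {x. x \<in> ZZ \<and> x \<noteq> 0 \<and> inverse x \<in> ZZ}"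

lemma ZZ_0 [simp, intro]: "0 \<in> ZZ" and ZZ_1 [simp, intro]: "1 \<in> ZZ"
  unfolding ZZ_def by (metis of_z2_simps(1) rangeI, metis of_z2_simps(2) rangeI)

lemma ZZ_add [simp, intro]: "x \<in> ZZ \<Longrightarrow> y \<in> ZZ \<Longrightarrow> x + y \<in> ZZ"
  and ZZ_mult [simp, intro]: "x \<in> ZZ \<Longrightarrow> y \<in> ZZ \<Longrightarrow> x * y \<in> ZZ"
  and ZZ_diff [simp, intro]: "x \<in> ZZ \<Longrightarrow> y \<in> ZZ \<Longrightarrow> x - y \<in> ZZ"
  and ZZ_minus [intro]: "x \<in> ZZ \<Longrightarrow> - x \<in> ZZ"
  unfolding ZZ_def by (metis (no_types, opaque_lifting) of_z2_simps rangeE rangeI)+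

lemma ZZ_minus_iff [simp]: "- x \<in> ZZ \<longleftrightarrow> x \<in> ZZ"
  using ZZ_minus[of x] ZZ_minus[of "- x"] by auto

lemma ZZ_of_nat [simp, intro]: "of_nat n \<in> ZZ"
  unfolding ZZ_def by (metis of_z2_of_nat rangeI)

lemma ZZ_numeral [simp, intro]: "numeral n \<in> ZZ"
  using ZZ_of_nat[of "numeral n"] by simp

lemma ZZ_of_int [simp, intro]: "of_int n \<in> ZZ"
  by (cases n) auto

lemma ZZ_power [simp, intro]: "x \<in> ZZ \<Longrightarrow> x ^ n \<in> ZZ"
  by (induction n) auto

lemma ZZ_sum [simp, intro]: "(\<And>i. i \<in> I \<Longrightarrow> f i \<in> ZZ) \<Longrightarrow> sum f I \<in> ZZ"
  by (induction I rule: infinite_finite_induct) auto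

lemma ZZ_of_z2 [simp, intro]: "of_z2 a \<in> ZZ"
  by (simp add: ZZ_def)

lemma of_z2_numeral [simp]: "of_z2 (numeral n) = numeral n"
  using of_z2_of_nat[of "numeral n"] by simp

lemma of_z2_power [simp]: "of_z2 (a ^ n) = of_z2 a ^ n"
  by (induction n) simp_all

text \<open>Each squaring gains another factor 2, because the cofactor \<open>x ^ 2 ^ n + 1\<close>
  is even. As a consequence \<open>x ^ (2 ^ n - 1)\<close> inverts x modulo 2 ^ n.\<close>

lemma odd_power_two_power: "odd x \<Longrightarrow> (2::int) ^ n dvd x ^ 2 ^ n - 1"
proof (induction n)
  case (Suc n)
  have "2 dvd x ^ 2 ^ n + 1" using Suc.prems by simp
  with Suc have "2 ^ n * 2 dvd (x ^ 2 ^ n - 1) * (x ^ 2 ^ n + 1)"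
    by (intro mult_dvd_mono)
  also have "\<dots> = x ^ 2 ^ Suc n - 1"
    by (simp add: algebra_simps flip: power_add) (simp add: mult_2)
  finally show ?case by (simp add: mult.commute)
qed simp

text \<open>The inverse is written down level by level as the power
  \<open>residue a n ^ (2 ^ n - 1)\<close>; what remains is that these residues are
  compatible.\<close>

lemma z2_odd_unit:
  assumes "residue a 1 = 1"
  shows "\<exists>b. a * b = 1"
proof -
  have odd: "odd (residue a n)" if "n > 0" for n
    using residue_mod[of a 1 "n - 1"] that assms by (auto simp: odd_iff_mod_2_eq_one)
  define f where "f n = residue a n ^ (2 ^ n - 1) mod 2 ^ n" for n
  have mul: "residue a n * f n mod 2 ^ n = 1 mod 2 ^ n" for n
  proof (cases "n = 0")
    case False
    have "residue a n * f n mod 2 ^ n = residue a n * residue a n ^ (2 ^ n - 1) mod 2 ^ n"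
      by (simp add: f_def mod_simps)
    also have "residue a n * residue a n ^ (2 ^ n - 1) = residue a n ^ 2 ^ n"
      by (simp flip: power_Suc)
    also have "\<dots> mod 2 ^ n = 1 mod 2 ^ n"
      using odd_power_two_power[OF odd[of n], of n] False by (simp only: mod_eq_dvd_iff)
    finally show ?thesis .
  qed auto
  \<comment> \<open>Both sides invert the same odd residue, and inverses modulo 2 ^ n are
    unique.\<close>
  have step: "f (Suc n) mod 2 ^ n = f n" for n
  proof (cases "n = 0")
    case False
    have "residue a n * f (Suc n) mod 2 ^ n = residue a (Suc n) * f (Suc n) mod 2 ^ Suc n mod 2 ^ n"
      by (metis mod_Suc_power2 mod_mult_left_eq residue_range(3))
    also have "\<dots> = 1 mod 2 ^ n" unfolding mul by (rule mod_Suc_power2)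
    finally have "residue a n * f (Suc n) mod 2 ^ n = residue a n * f n mod 2 ^ n"
      using mul by simp
    then have "2 ^ n dvd residue a n * (f (Suc n) - f n)"
      by (simp add: mod_eq_dvd_iff algebra_simps)
    moreover have "coprime (2 ^ n) (residue a n)" using odd[of n] False by simp
    ultimately have "2 ^ n dvd f (Suc n) - f n" using coprime_dvd_mult_right_iff by blast
    then have "f (Suc n) mod 2 ^ n = f n mod 2 ^ n" by (simp add: mod_eq_dvd_iff)
    then show ?thesis by (simp add: f_def)
  qed (simp add: f_def)
  then have "residue (Abs_z2 f) n = f n" for n
    by (subst Abs_z2_inverse) (auto simp: f_def)
  then have "residue (a * Abs_z2 f) n = residue 1 n" for n
    by (simp add: times_z2.rep_eq one_z2.rep_eq mul)
  then have "a * Abs_z2 f = 1" by (metis residue_inject ext)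
  then show ?thesis ..
qed

section \<open>Units of Z_2 and the valuation on Q_2\<close>

lemma residue_1_cases: "residue a 1 = 0 \<or> residue a 1 = 1"
  using residue_range(1,2)[of a 1] by auto

lemma UU_of_z2: "residue a 1 = 1 \<Longrightarrow> of_z2 a \<in> UU"
  using z2_odd_unit[of a] unfolding UU_def ZZ_def
  by (clarsimp) (metis mult_zero_left of_z2_simps(1,2,6) zero_neq_one inverse_unique rangeI)

lemma ZZ_cases:
  assumes "x \<in> ZZ"
  obtains "x \<in> UU" | "x / 2 \<in> ZZ"
proof -
  obtain a where a: "x = of_z2 a" using assms by (auto simp: ZZ_def)
  show ?thesis
  proof (cases "residue a 1 = 0")
    case True
    then have "x = 2 * of_z2 (z2_half a)" using z2_half[of a] a by (metis of_z2_numeral of_z2_simps(6))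
    then show ?thesis using that by simp
  next
    case False
    then show ?thesis using that UU_of_z2 a residue_1_cases by blast
  qed
qed

lemma half_not_ZZ: "inverse 2 \<notin> ZZ"
proof
  assume "inverse 2 \<in> ZZ"
  then obtain b where "inverse 2 = of_z2 b" by (auto simp: ZZ_def)
  then have "of_z2 (2 * b) = of_z2 1" by (simp add: field_simps)
  then have "residue (2 * b) 1 = residue 1 1" by (simp only: of_z2_simps(7))
  then show False by (simp add: times_z2.rep_eq one_z2.rep_eq residue_numeral_2)
qed

lemma UU_not_even: "x \<in> UU \<Longrightarrow> x / 2 \<notin> ZZ"
proof
  assume x: "x \<in> UU" "x / 2 \<in> ZZ"
  then have "x / 2 * inverse x \<in> ZZ" using ZZ_mult[of "x / 2" "inverse x"] by (simp only: UU_def) blast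
  moreover have "x / 2 * inverse x = inverse 2" using x by (simp add: UU_def field_simps)
  ultimately show False using half_not_ZZ by simp
qed

lemma UU_iff: "x \<in> UU \<longleftrightarrow> x \<in> ZZ \<and> x / 2 \<notin> ZZ"
  using UU_not_even ZZ_cases by (auto simp: UU_def)

lemma UU_mult: "x \<in> UU \<Longrightarrow> y \<in> UU \<Longrightarrow> x * y \<in> UU"
  by (auto simp: UU_def)

lemma UU_inverse: "x \<in> UU \<Longrightarrow> inverse x \<in> UU"
  by (auto simp: UU_def)

lemma UU_1 [simp]: "1 \<in> UU" by (simp add: UU_def)

lemma UU_ZZ: "x \<in> UU \<Longrightarrow> x \<in> ZZ" and UU_nz: "x \<in> UU \<Longrightarrow> x \<noteq> 0"
  by (auto simp: UU_def)

text \<open>Induction on a level at which the residue of \<open>a\<close> is nonzero: halving an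
  even \<open>a\<close> lowers that level by one.\<close>

lemma z2_decomp:
  "a \<noteq> 0 \<Longrightarrow> \<exists>k b. of_z2 b \<in> UU \<and> a = 2 ^ k * b"
proof -
  assume "a \<noteq> 0"
  then obtain n where "residue a n \<noteq> 0" by (metis residue_inject zero_z2.rep_eq ext)
  then show ?thesis
  proof (induction n arbitrary: a)
    case 0
    then show ?case using residue_range(1,2)[of a 0] by auto
  next
    case (Suc n)
    show ?case
    proof (cases "residue a 1 = 0")
      case True
      have "even (residue a (Suc n))" using residue_mod[of a 1 n] True by (auto simp: even_iff_mod_2_eq_zero)
      then have "residue (z2_half a) n \<noteq> 0" using Suc.prems by (auto simp: residue_z2_half)
      then obtain k b where "of_z2 b \<in> UU" "z2_half a = 2 ^ k * b" using Suc.IH by blast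
      then have "a = 2 ^ Suc k * b" using z2_half[OF True] by (simp add: mult.assoc)
      then show ?thesis using \<open>of_z2 b \<in> UU\<close> by blast
    next
      case False
      then have "of_z2 a \<in> UU" using UU_of_z2 residue_1_cases by blast
      then show ?thesis by (intro exI[of _ 0] exI[of _ a]) simp
    qed
  qed
qed

lemma q2_decomp:
  assumes "x \<noteq> 0"
  obtains k u where "u \<in> UU" "x = 2 powi k * u"
proof -
  obtain a b where ab: "x = q2_of_fract (Fract a b)" "b \<noteq> 0"
    by (metis q2_of_fract_cases Fract_cases)
  then have x: "x = of_z2 a / of_z2 b"
    by (simp add: of_z2_def divide_q2.abs_eq eq_onp_same_args)
  have "a \<noteq> 0" using assms x by auto
  then obtain j a' where a: "of_z2 a' \<in> UU" "a = 2 ^ j * a'" using z2_decomp by blast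
  obtain k b' where b: "of_z2 b' \<in> UU" "b = 2 ^ k * b'" using z2_decomp ab by blast
  have "x = 2 powi (int j - int k) * (of_z2 a' * inverse (of_z2 b'))"
    unfolding x a(2) b(2) by (simp add: power_int_diff field_simps)
  then show thesis using that UU_mult UU_inverse a b by blast
qed

lemma two_powi_nonneg_ZZ: "k \<ge> 0 \<Longrightarrow> 2 powi k \<in> ZZ"
  by (auto simp: power_int_def)

lemma powi_UU_ZZ_iff:
  assumes "u \<in> UU"
  shows "2 powi k * u \<in> ZZ \<longleftrightarrow> k \<ge> 0"
proof
  assume *: "2 powi k * u \<in> ZZ"
  show "k \<ge> 0"
  proof (rule ccontr)
    assume "\<not> k \<ge> 0"
    then obtain n where n: "k = - int (Suc n)" using negD[of k] by auto
    have "2 powi k * u * (inverse u * 2 ^ n) \<in> ZZ"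
      using * assms by (auto simp: UU_def)
    moreover have "2 powi k * u * (inverse u * 2 ^ n) = inverse 2"
      using UU_nz[OF assms] by (simp only: n power_int_minus power_int_of_nat) (simp add: field_simps)
    ultimately show False using half_not_ZZ by simp
  qed
next
  assume "k \<ge> 0" then show "2 powi k * u \<in> ZZ" using assms two_powi_nonneg_ZZ by (auto simp: UU_def)
qed

text \<open>Z_2 is a valuation ring. This is what makes it possible to select a least valuation in
  \<open>finite_ZZ_max\<close>.\<close>

lemma ZZ_total: "x \<noteq> 0 \<or> y \<noteq> 0 \<Longrightarrow> x / y \<in> ZZ \<or> y / x \<in> ZZ"
proof (cases "x = 0 \<or> y = 0")
  case False
  then obtain k u where x: "u \<in> UU" "x = 2 powi k * u" using q2_decomp by blast
  obtain l v where y: "v \<in> UU" "y = 2 powi l * v" using q2_decomp False by blast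
  have "x / y = 2 powi (k - l) * (u * inverse v)" "y / x = 2 powi (l - k) * (v * inverse u)"
    by (simp_all add: x y power_int_diff field_simps)
  then show ?thesis using powi_UU_ZZ_iff UU_mult UU_inverse x(1) y(1)
    by (metis diff_ge_0_iff_ge linear)
qed auto

lemma ex_denominator: "\<exists>n. 2 ^ n * x \<in> ZZ"
proof (cases "x = 0")
  case False
  then obtain k u where x: "u \<in> UU" "x = 2 powi k * u" using q2_decomp by blast
  have "2 ^ nat \<bar>k\<bar> * x = 2 powi (\<bar>k\<bar> + k) * u"
    by (simp add: x power_int_add flip: power_int_of_nat)
  then have "2 ^ nat \<bar>k\<bar> * x \<in> ZZ" using powi_UU_ZZ_iff[OF x(1)] by simp
  then show ?thesis ..
qed auto

text \<open>The residue map from Z_2 to F_2. Outside \<open>ZZ\<close> the value is 1 and has no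
  meaning, so the homomorphism laws assume membership in \<open>ZZ\<close>.\<close>

definition red :: "q2 \<Rightarrow> bit" where "red x = of_bool (x / 2 \<notin> ZZ)"

lemma red_0 [simp]: "red 0 = 0" by (simp add: red_def)

lemma red_1 [simp]: "red 1 = 1" using half_not_ZZ by (simp add: red_def inverse_eq_divide)

lemma UU_diff_one: "x \<in> UU \<Longrightarrow> (x - 1) / 2 \<in> ZZ"
proof -
  assume "x \<in> UU"
  then obtain a where a: "x = of_z2 a" by (auto simp: UU_def ZZ_def)
  have "residue a 1 \<noteq> 0"
  proof
    assume "residue a 1 = 0"
    then have "x / 2 = of_z2 (z2_half a)" using z2_half[of a] a by (metis of_z2_numeral of_z2_simps(6) nonzero_mult_div_cancel_left zero_neq_numeral)
    then show False using UU_not_even[OF \<open>x \<in> UU\<close>] by (metis ZZ_of_z2)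
  qed
  then have "residue (a - 1) 1 = 0"
    using residue_1_cases[of a] by (simp add: minus_z2.rep_eq one_z2.rep_eq)
  then have "2 * of_z2 (z2_half (a - 1)) = x - 1"
    using z2_half[of "a - 1"] a by (metis of_z2_numeral of_z2_simps(2,4,6))
  then have "(x - 1) / 2 = of_z2 (z2_half (a - 1))" by (simp add: field_simps)
  then show ?thesis by simp
qed

lemma half_cancel: "x = 1 + 2 * ((x - 1) / 2)" for x :: q2
proof -
  have "2 * ((x - 1) / 2) = x - 1"
    by (metis nonzero_mult_div_cancel_left times_divide_eq_right zero_neq_numeral)
  then show ?thesis by (simp only:) simp
qed

lemma ZZ_parity: "x \<in> ZZ \<Longrightarrow> \<exists>y\<in>ZZ. x = 2 * y \<and> red x = 0 \<or> x = 1 + 2 * y \<and> red x = 1"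
proof -
  assume x: "x \<in> ZZ"
  then show ?thesis
  proof (cases rule: ZZ_cases)
    case 1
    then show ?thesis
      using half_cancel by (intro bexI[of _ "(x - 1) / 2"]) (simp_all only: UU_diff_one red_def UU_not_even not_False_eq_True of_bool_eq simp_thms)
  next
    case 2
    then show ?thesis by (intro bexI[of _ "x / 2"]) (auto simp: red_def)
  qed
qed

lemma red_even [simp]: "y \<in> ZZ \<Longrightarrow> red (2 * y) = 0" by (simp add: red_def)

lemma red_odd [simp]: "y \<in> ZZ \<Longrightarrow> red (1 + 2 * y) = 1"
  using half_not_ZZ ZZ_diff[of "(1 + 2 * y) / 2" y] by (auto simp: red_def add_divide_distrib inverse_eq_divide)

lemma red_add: assumes "x \<in> ZZ" "y \<in> ZZ" shows "red (x + y) = red x + red y"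
proof -
  obtain a b where a: "a \<in> ZZ" "x = 2 * a \<and> red x = 0 \<or> x = 1 + 2 * a \<and> red x = 1"
    and b: "b \<in> ZZ" "y = 2 * b \<and> red y = 0 \<or> y = 1 + 2 * b \<and> red y = 1"
    using ZZ_parity[OF assms(1)] ZZ_parity[OF assms(2)] by blast
  have e: "2 * a + 2 * b = 2 * (a + b)" "1 + 2 * a + 2 * b = 1 + 2 * (a + b)"
    "2 * a + (1 + 2 * b) = 1 + 2 * (a + b)" "1 + 2 * a + (1 + 2 * b) = 2 * (1 + a + b)"
    by (simp_all add: algebra_simps)
  show ?thesis using a b by (elim disjE; simp only: e red_even red_odd ZZ_add ZZ_1) auto
qed

lemma red_mult: assumes "x \<in> ZZ" "y \<in> ZZ" shows "red (x * y) = red x * red y"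
proof -
  obtain a b where a: "a \<in> ZZ" "x = 2 * a \<and> red x = 0 \<or> x = 1 + 2 * a \<and> red x = 1"
    and b: "b \<in> ZZ" "y = 2 * b \<and> red y = 0 \<or> y = 1 + 2 * b \<and> red y = 1"
    using ZZ_parity[OF assms(1)] ZZ_parity[OF assms(2)] by blast
  have e: "2 * a * (2 * b) = 2 * (2 * a * b)" "(1 + 2 * a) * (2 * b) = 2 * (b * (1 + 2 * a))"
    "2 * a * (1 + 2 * b) = 2 * (a * (1 + 2 * b))" "(1 + 2 * a) * (1 + 2 * b) = 1 + 2 * (a + b + 2 * a * b)"
    by (simp_all add: algebra_simps)
  show ?thesis using a b by (elim disjE; simp only: e red_even red_odd ZZ_add ZZ_mult ZZ_numeral ZZ_1) auto
qed

lemma red_minus: "x \<in> ZZ \<Longrightarrow> red (- x) = red x"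
  by (simp add: red_def)

lemma red_sum: "(\<And>i. i \<in> I \<Longrightarrow> f i \<in> ZZ) \<Longrightarrow> red (sum f I) = (\<Sum>i\<in>I. red (f i))"
  by (induction I rule: infinite_finite_induct) (auto simp: red_add ZZ_sum)

lemma red_eq_0_iff: "red x = 0 \<longleftrightarrow> x / 2 \<in> ZZ" by (simp add: red_def)

lemma red_eq_1_iff: "x \<in> ZZ \<Longrightarrow> red x = 1 \<longleftrightarrow> x \<in> UU" by (simp add: red_def UU_iff)

section \<open>Matrices over the 2-adic numbers and homothety classes of lattices\<close>

lemma mat_mult_nth [simp]: "(mat c ** A) $ i $ j = c * A $ i $ j" for A :: "'a::semiring_1 ^ 'n ^ 'm"
  by (simp add: matrix_matrix_mult_def mat_def if_distrib[of "\<lambda>x. x * _"] cong: if_cong)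

lemma mult_mat_nth [simp]: "(A ** mat c) $ i $ j = A $ i $ j * c" for A :: "'a::semiring_1 ^ 'n ^ 'm"
  by (simp add: matrix_matrix_mult_def mat_def if_distrib[of "\<lambda>x. _ * x"] cong: if_cong)

lemma mat_commute: "A ** mat c = mat c ** A" for A :: "'a::comm_semiring_1 ^ 'n ^ 'n"
  by (simp add: vec_eq_iff mult.commute)

lemma mat_mat [simp]: "mat c ** mat d = (mat (c * d) :: 'a::semiring_1 ^ 'n ^ 'n)"
  by (simp add: vec_eq_iff) (simp add: mat_def)

lemma mat_vec [simp]: "mat c *v x = c *s x" for x :: "'a::semiring_1 ^ 'n"
  by (simp add: vec_eq_iff matrix_vector_mult_def mat_def if_distrib[of "\<lambda>x. x * _"] cong: if_cong)

lemma matrix_vector_mul_axis [simp]: "(A *v axis j 1) $ i = A $ i $ j" for A :: "'a::semiring_1 ^ 'n ^ 'm"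
  by (simp add: matrix_vector_mult_def axis_def if_distrib[of "\<lambda>x. _ * x"] cong: if_cong)

lemma invertible_mat: "c \<noteq> 0 \<Longrightarrow> invertible (mat c :: 'a::field ^ 'n ^ 'n)"
  unfolding invertible_def by (rule exI[of _ "mat (inverse c)"]) simp

lemma matrix_inv_right [simp]: "invertible A \<Longrightarrow> A ** matrix_inv A = mat 1"
  and matrix_inv_left [simp]: "invertible A \<Longrightarrow> matrix_inv A ** A = mat 1"
  for A :: "'a::semiring_1 ^ 'n ^ 'n"
  unfolding invertible_def matrix_inv_def by (metis (mono_tags, lifting) someI_ex)+

lemma invertible_matrix_inv: "invertible A \<Longrightarrow> invertible (matrix_inv A)"
  for A :: "'a::semiring_1 ^ 'n ^ 'n"
  using matrix_inv_left matrix_inv_right unfolding invertible_def by blast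

lemma invertible_mult': "invertible A \<Longrightarrow> invertible B \<Longrightarrow> invertible (A ** B)"
  for A B :: "'a::comm_ring_1 ^ 'n ^ 'n"
  unfolding invertible_def by (metis matrix_mul_assoc matrix_mul_lid)

lemma invertible_mat1 [simp]: "invertible (mat 1 :: 'a::semiring_1 ^ 'n ^ 'n)"
  unfolding invertible_def by (metis matrix_mul_lid)

lemma group_GL3: "group (GL3 :: ('a::comm_ring_1 ^ 3 ^ 3) monoid)"
  by (rule groupI) (auto simp: GL3_def matrix_mul_assoc invertible_mult'
      intro!: bexI[of _ "matrix_inv _"] invertible_matrix_inv)

interpretation GL3: group "GL3 :: ('a::comm_ring_1 ^ 3 ^ 3) monoid"
  by (rule group_GL3)

lemma GL3_simps [simp]:
  "carrier GL3 = {A. invertible A}" "A \<otimes>\<^bsub>GL3\<^esub> B = A ** B" "\<one>\<^bsub>GL3\<^esub> = mat 1"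
  by (simp_all add: GL3_def)

lemma inv_GL3: "invertible A \<Longrightarrow> inv\<^bsub>GL3\<^esub> A = matrix_inv A" for A :: "'a::comm_ring_1 ^ 3 ^ 3"
  by (rule GL3.inv_equality) (simp_all add: invertible_matrix_inv)

lemma normal_scalars: "scalars \<lhd> (GL3 :: ('a::field ^ 3 ^ 3) monoid)"
proof -
  have "subgroup scalars (GL3 :: ('a::field ^ 3 ^ 3) monoid)"
  proof (rule GL3.subgroupI)
    fix a :: "'a ^ 3 ^ 3" assume "a \<in> scalars"
    then obtain c where c: "a = mat c" "c \<noteq> 0" by (auto simp: scalars_def)
    have "inv\<^bsub>GL3\<^esub> a = mat (inverse c)"
      by (rule GL3.inv_equality) (use c in \<open>auto intro: invertible_mat\<close>)
    then show "inv\<^bsub>GL3\<^esub> a \<in> scalars" using c by (auto simp: scalars_def)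
  next
    fix a b :: "'a ^ 3 ^ 3" assume "a \<in> scalars" "b \<in> scalars"
    then show "a \<otimes>\<^bsub>GL3\<^esub> b \<in> scalars"
      by (auto simp: scalars_def)
  qed (auto simp: scalars_def invertible_mat intro: exI[of _ 1])
  then show ?thesis
  proof (rule GL3.normal_invI)
    fix x h :: "'a ^ 3 ^ 3" assume "x \<in> carrier GL3" "h \<in> scalars"
    then obtain c where "invertible x" "h = mat c" "c \<noteq> 0" by (auto simp: scalars_def)
    moreover from this have "x ** mat c ** matrix_inv x = mat c"
      by (metis mat_commute matrix_mul_assoc matrix_inv_right matrix_mul_rid)
    ultimately show "x \<otimes>\<^bsub>GL3\<^esub> h \<otimes>\<^bsub>GL3\<^esub> inv\<^bsub>GL3\<^esub> x \<in> scalars"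
      by (simp add: inv_GL3 scalars_def) blast
  qed
qed

lemma to_PGL3_eq: "to_PGL3 A = {mat c ** A |c. c \<noteq> 0}"
  by (auto simp: to_PGL3_def r_coset_def scalars_def)

lemma to_PGL3_eq_iff: "to_PGL3 A = to_PGL3 B \<longleftrightarrow> (\<exists>c. c \<noteq> 0 \<and> B = mat c ** A)"
proof
  assume "to_PGL3 A = to_PGL3 B"
  moreover have "B \<in> to_PGL3 B" by (auto simp: to_PGL3_eq intro: exI[of _ 1])
  ultimately show "\<exists>c. c \<noteq> 0 \<and> B = mat c ** A" by (auto simp: to_PGL3_eq)
next
  assume "\<exists>c. c \<noteq> 0 \<and> B = mat c ** A"
  then obtain c where c: "c \<noteq> 0" "B = mat c ** A" by blast
  have "\<exists>d. mat e ** A = mat d ** B \<and> d \<noteq> 0" if "e \<noteq> 0" for e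
    using c that by (intro exI[of _ "e / c"]) (simp add: matrix_mul_assoc)
  moreover have "\<exists>d. mat e ** B = mat d ** A \<and> d \<noteq> 0" if "e \<noteq> 0" for e
    using c that by (intro exI[of _ "e * c"]) (simp add: matrix_mul_assoc)
  ultimately show "to_PGL3 A = to_PGL3 B" by (auto simp: to_PGL3_eq)
qed

lemma to_PGL3_smult [simp]: "c \<noteq> 0 \<Longrightarrow> to_PGL3 (mat c ** A) = to_PGL3 A"
  using to_PGL3_eq_iff by metis

lemma group_PGL3: "group PGL3"
  unfolding PGL3_def using normal.factorgroup_is_group[OF normal_scalars] .

interpretation PGL3: group PGL3 by (rule group_PGL3)

lemma carrier_PGL3: "carrier PGL3 = to_PGL3 ` {A. invertible A}"
  by (auto simp: PGL3_def FactGroup_def RCOSETS_def to_PGL3_def)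

lemma to_PGL3_carrier [simp]: "invertible A \<Longrightarrow> to_PGL3 A \<in> carrier PGL3"
  by (auto simp: carrier_PGL3)

lemma PGL3_mult [simp]:
  "invertible A \<Longrightarrow> invertible B \<Longrightarrow> to_PGL3 A \<otimes>\<^bsub>PGL3\<^esub> to_PGL3 B = to_PGL3 (A ** B)"
  using normal.rcos_sum[OF normal_scalars, of A B] by (simp add: PGL3_def FactGroup_def to_PGL3_def)

lemma PGL3_one: "\<one>\<^bsub>PGL3\<^esub> = to_PGL3 (mat 1)"
  by (auto simp: PGL3_def FactGroup_def to_PGL3_eq scalars_def)

lemma PGL3_inv: "invertible A \<Longrightarrow> inv\<^bsub>PGL3\<^esub> (to_PGL3 A) = to_PGL3 (matrix_inv A)"
  by (rule PGL3.inv_equality) (simp_all add: PGL3_one invertible_matrix_inv)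

section \<open>GL_3(Z_2) as the integral matrices of unit determinant\<close>

definition zmat :: "q2 ^ 'n ^ 'm \<Rightarrow> bool" where "zmat A \<longleftrightarrow> (\<forall>i j. A $ i $ j \<in> ZZ)"

text \<open>GL_3(Z_2), kept inside the matrices over Q_2 so that its elements multiply with
  arbitrary elements of GL_3(Q_2); \<open>GLZ_eq\<close> identifies it with the image of
  \<open>GL3\<close> over \<open>z2\<close>.\<close>

definition GLZ :: "(q2 ^ 3 ^ 3) set" where
  "GLZ = {A. zmat A \<and> (\<exists>B. zmat B \<and> A ** B = mat 1 \<and> B ** A = mat 1)}"

lemma zmat_mult [intro]: "zmat A \<Longrightarrow> zmat B \<Longrightarrow> zmat (A ** B)"
  by (simp add: zmat_def matrix_matrix_mult_def)

lemma zmat_1 [simp]: "zmat (mat 1)"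
  by (simp add: zmat_def mat_def)

lemma zmat_det: "zmat A \<Longrightarrow> det A \<in> ZZ" for A :: "q2 ^ 3 ^ 3"
  by (simp add: zmat_def det_3)

lemma GLZ_mult: "A \<in> GLZ \<Longrightarrow> B \<in> GLZ \<Longrightarrow> A ** B \<in> GLZ"
proof -
  assume "A \<in> GLZ" "B \<in> GLZ"
  then obtain A' B' where A: "zmat A" "zmat A'" "A ** A' = mat 1" "A' ** A = mat 1"
    and B: "zmat B" "zmat B'" "B ** B' = mat 1" "B' ** B = mat 1" by (auto simp: GLZ_def)
  have "A ** B ** (B' ** A') = mat 1" by (metis A(3) B(3) matrix_mul_assoc matrix_mul_rid)
  moreover have "B' ** A' ** (A ** B) = mat 1" by (metis A(4) B(4) matrix_mul_assoc matrix_mul_rid)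
  ultimately show ?thesis unfolding GLZ_def using A B by (blast intro: zmat_mult)
qed

lemma GLZ_1 [simp]: "mat 1 \<in> GLZ"
  unfolding GLZ_def by (auto intro!: exI[of _ "mat 1"])

lemma GLZ_invertible: "A \<in> GLZ \<Longrightarrow> invertible A"
  by (auto simp: GLZ_def invertible_def)

lemma GLZ_zmat: "A \<in> GLZ \<Longrightarrow> zmat A"
  by (auto simp: GLZ_def)

lemma matrix_inv_unique: "A ** B = mat 1 \<Longrightarrow> B ** A = mat 1 \<Longrightarrow> matrix_inv A = B"
  for A B :: "'a::comm_ring_1 ^ 'n ^ 'n"
  by (metis invertible_def matrix_inv_left matrix_mul_assoc matrix_mul_lid matrix_mul_rid)

lemma GLZ_inv: "A \<in> GLZ \<Longrightarrow> matrix_inv A \<in> GLZ"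
  unfolding GLZ_def using matrix_inv_unique by blast

lemma GLZ_iff: "A \<in> GLZ \<longleftrightarrow> invertible A \<and> zmat A \<and> zmat (matrix_inv A)"
proof
  assume "A \<in> GLZ" then show "invertible A \<and> zmat A \<and> zmat (matrix_inv A)"
    by (simp add: GLZ_invertible GLZ_zmat GLZ_inv)
next
  assume "invertible A \<and> zmat A \<and> zmat (matrix_inv A)" then show "A \<in> GLZ"
    unfolding GLZ_def using matrix_inv_left matrix_inv_right by blast
qed

text \<open>By Cramer's rule the entries of the inverse are integral determinants divided by
  \<open>det A\<close>, so a unit determinant suffices.\<close>

lemma GLZ_det: "A \<in> GLZ \<longleftrightarrow> zmat A \<and> det A \<in> UU"
proof
  assume A: "A \<in> GLZ"
  then obtain B where B: "zmat A" "zmat B" "A ** B = mat 1" by (auto simp: GLZ_def)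
  then have "det A * det B = 1" by (metis det_mul det_I)
  then show "zmat A \<and> det A \<in> UU"
    using B zmat_det[of A] zmat_det[of B] by (auto simp: UU_def) (metis inverse_unique)
next
  assume A: "zmat A \<and> det A \<in> UU"
  then have inv: "invertible A" by (simp add: invertible_det_nz UU_nz)
  have "matrix_inv A $ k $ j \<in> ZZ" for k j
  proof -
    let ?b = "axis j 1 :: q2 ^ 3"
    let ?x = "matrix_inv A *v ?b"
    have "A *v ?x = ?b" using inv by (simp add: matrix_vector_mul_assoc)
    then have "?x = (\<chi> k. det (\<chi> i l. if l = k then ?b $ i else A $ i $ l) / det A)"
      using cramer[of A ?x ?b] A UU_nz by auto
    moreover have "zmat (\<chi> i l. if l = k then ?b $ i else A $ i $ l)"
      using A by (auto simp: zmat_def axis_def)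
    ultimately have "?x $ k \<in> ZZ"
      using zmat_det A by (auto simp: UU_def divide_inverse)
    then show ?thesis by simp
  qed
  then show "A \<in> GLZ" using A inv by (simp add: GLZ_iff zmat_def)
qed

lemma map_matrix_of_z2_mult:
  "map_matrix of_z2 (A ** B) = map_matrix of_z2 A ** map_matrix of_z2 (B :: z2 ^ 3 ^ 3)"
  by (simp add: vec_eq_iff matrix_matrix_mult_def sum_3)

lemma zmat_lift: "zmat A \<Longrightarrow> \<exists>a. A = map_matrix of_z2 a"
  by (intro exI[of _ "map_matrix (inv_into UNIV of_z2) A"])
    (simp add: vec_eq_iff zmat_def ZZ_def f_inv_into_f)

lemma zmat_map_of_z2 [simp]: "zmat (map_matrix of_z2 a)"
  by (simp add: zmat_def)

lemma map_matrix_of_z2_eq_iff: "map_matrix of_z2 a = map_matrix of_z2 b \<longleftrightarrow> a = b"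
  by (simp add: vec_eq_iff)

lemma map_matrix_of_z2_1: "map_matrix of_z2 (mat 1) = mat 1"
  by (simp add: vec_eq_iff mat_def)

lemma GLZ_eq: "GLZ = map_matrix of_z2 ` carrier GL3"
proof (intro equalityI subsetI)
  fix A assume "A \<in> GLZ"
  then obtain B where A: "zmat A" and B: "zmat B" and AB: "A ** B = mat 1" "B ** A = mat 1"
    by (auto simp: GLZ_def)
  obtain a b where a: "A = map_matrix of_z2 a" and b: "B = map_matrix of_z2 b"
    using zmat_lift[OF A] zmat_lift[OF B] by blast
  have "a ** b = mat 1" "b ** a = mat 1"
    using AB unfolding a b map_matrix_of_z2_mult[symmetric] map_matrix_of_z2_1[symmetric] map_matrix_of_z2_eq_iff
    by auto
  then have "a \<in> carrier GL3" by (auto simp: invertible_def)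
  then show "A \<in> map_matrix of_z2 ` carrier GL3" using a by blast
next
  fix A assume "A \<in> map_matrix of_z2 ` carrier GL3"
  then obtain a b where A: "A = map_matrix of_z2 a" and ab: "a ** b = mat 1" "b ** a = mat 1"
    by (auto simp: invertible_def)
  have "A ** map_matrix of_z2 b = mat 1" "map_matrix of_z2 b ** A = mat 1"
    unfolding A map_matrix_of_z2_mult[symmetric] ab map_matrix_of_z2_1 by auto
  then show "A \<in> GLZ" unfolding GLZ_def using A zmat_map_of_z2 by blast
qed

lemma PGL3_Z2_eq: "PGL3_Z2 = to_PGL3 ` GLZ"
  by (simp only: PGL3_Z2_def GLZ_eq)

section \<open>Lattices as column spans\<close>

definition Zvec :: "(q2 ^ 3) set" where "Zvec = {x. \<forall>i. x $ i \<in> ZZ}"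

text \<open>The Z_2-span of the columns of the matrix. A change of basis is right multiplication by
  an element of \<open>GLZ\<close>, while the group acts from the left.\<close>

definition Lat :: "q2 ^ 3 ^ 3 \<Rightarrow> (q2 ^ 3) set" where "Lat A = (*v) A ` Zvec"

lemma zmat_Zvec: "zmat A \<Longrightarrow> x \<in> Zvec \<Longrightarrow> A *v x \<in> Zvec"
  by (simp add: zmat_def Zvec_def matrix_vector_mult_def)

lemma axis_Zvec [simp]: "axis j 1 \<in> Zvec"
  by (auto simp: Zvec_def axis_def)


lemma mult_Lat: "(*v) g ` Lat A = Lat (g ** A)"
  by (auto simp: Lat_def image_image matrix_vector_mul_assoc)

lemma smult_Lat: "(*s) c ` Lat A = Lat (mat c ** A)"
  using mult_Lat[of "mat c" A] by simp

lemma Lat_subset_iff: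
  assumes "invertible A"
  shows "Lat B \<subseteq> Lat A \<longleftrightarrow> zmat (matrix_inv A ** B)"
proof
  assume sub: "Lat B \<subseteq> Lat A"
  have "(matrix_inv A ** B) $ i $ j \<in> ZZ" for i j
  proof -
    have "B *v axis j 1 \<in> Lat B" by (auto simp: Lat_def)
    then obtain x where x: "x \<in> Zvec" "B *v axis j 1 = A *v x" using sub unfolding Lat_def by blast
    have "matrix_inv A ** B *v axis j 1 = x"
      using x assms by (simp add: matrix_vector_mul_assoc[symmetric]) (simp add: matrix_vector_mul_assoc assms)
    then show ?thesis using x by (metis (mono_tags) Zvec_def matrix_vector_mul_axis mem_Collect_eq)
  qed
  then show "zmat (matrix_inv A ** B)" by (simp add: zmat_def)
next
  assume z: "zmat (matrix_inv A ** B)"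
  have "B *v x = A *v (matrix_inv A ** B *v x)" for x
    using assms by (simp add: matrix_vector_mul_assoc matrix_mul_assoc)
  then show "Lat B \<subseteq> Lat A" unfolding Lat_def using zmat_Zvec[OF z] by blast
qed

lemma Lat_eq_iff:
  assumes "invertible A" "invertible B"
  shows "Lat A = Lat B \<longleftrightarrow> matrix_inv A ** B \<in> GLZ"
proof -
  have inv: "invertible (matrix_inv A ** B)" using assms by (simp add: invertible_mult' invertible_matrix_inv)
  have "matrix_inv (matrix_inv A ** B) = matrix_inv B ** A"
    by (rule matrix_inv_unique)
      (metis assms matrix_mul_assoc matrix_mul_lid matrix_inv_left matrix_inv_right)+
  then show ?thesis
    using Lat_subset_iff[of A B] Lat_subset_iff[of B A] assms inv by (auto simp: GLZ_iff)
qed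

lemma Lat_mult_GLZ [simp]: "U \<in> GLZ \<Longrightarrow> Lat (A ** U) = Lat A"
proof -
  assume U: "U \<in> GLZ"
  then have "Lat U = Lat (mat 1)"
    using Lat_eq_iff[of "mat 1" U] GLZ_invertible[OF U] matrix_inv_unique[of "mat 1" "mat 1 :: q2^3^3"] by simp
  then show ?thesis using mult_Lat[of A U] mult_Lat[of A "mat 1"] by simp
qed

lemma invertible_inv_eq: "invertible A \<Longrightarrow> matrix_inv A ** B = C \<Longrightarrow> B = A ** C"
  for A :: "'a::comm_ring_1 ^ 'n ^ 'n"
  by (metis matrix_inv_right matrix_mul_assoc matrix_mul_lid)

section \<open>Reduction modulo 2 and elementary divisors\<close>

lemma z2_mod_span_Lat_subset:
  assumes "\<And>s. s \<in> S \<Longrightarrow> s \<in> Lat A"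
  shows "z2_mod.span S \<subseteq> Lat A"
proof (rule z2_mod.span_minimal)
  show "S \<subseteq> Lat A" using assms by blast
  show "z2_mod.subspace (Lat A)"
  proof (rule z2_mod.subspaceI)
    show "0 \<in> Lat A" by (auto simp: Lat_def Zvec_def intro!: image_eqI[of _ _ 0])
    fix x y assume "x \<in> Lat A" "y \<in> Lat A"
    then obtain u v where "x = A *v u" "y = A *v v" "u \<in> Zvec" "v \<in> Zvec" by (auto simp: Lat_def)
    then show "x + y \<in> Lat A"
      by (auto simp: Lat_def Zvec_def matrix_vector_right_distrib intro!: image_eqI[of _ _ "u + v"])
  next
    fix c x assume "x \<in> Lat A"
    then obtain u where "x = A *v u" "u \<in> Zvec" by (auto simp: Lat_def)
    then show "of_z2 c *s x \<in> Lat A"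
      by (auto simp: Lat_def Zvec_def matrix_vector_mult_def vec_eq_iff sum_distrib_left algebra_simps
          intro!: image_eqI[of _ _ "of_z2 c *s u"])
  qed
qed

lemma Lat_subset_z2_span: "Lat A \<subseteq> z2_mod.span (columns A)"
proof
  fix y assume "y \<in> Lat A"
  then obtain x where x: "x \<in> Zvec" "y = A *v x" by (auto simp: Lat_def)
  have "y = (\<Sum>i\<in>UNIV. x $ i *s column i A)" by (simp add: x matrix_mult_sum)
  moreover have "x $ i *s column i A \<in> z2_mod.span (columns A)" for i
  proof -
    obtain a where "x $ i = of_z2 a" using x(1) by (auto simp: Zvec_def ZZ_def)
    then show ?thesis
      using z2_mod.span_scale[OF z2_mod.span_base, of "column i A" "columns A" a]
      by (auto simp: columns_def)
  qed
  ultimately show "y \<in> z2_mod.span (columns A)" by (simp add: z2_mod.span_sum)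
qed

lemma column_Lat: "column i A \<in> Lat A"
  by (auto simp: Lat_def vec_eq_iff column_def intro!: image_eqI[of _ _ "axis i 1"])

lemma Lat_eq_span: "Lat A = z2_mod.span (columns A)"
  using z2_mod_span_Lat_subset[of "columns A" A] Lat_subset_z2_span column_Lat
  by (auto simp: columns_def)

lemma finite_columns [simp]: "finite (columns A)"
  by (simp add: columns_def full_SetCompr_eq)

lemma is_z2_lattice_Lat:
  assumes "invertible A"
  shows "is_z2_lattice (Lat A)"
proof -
  have "vec.span (columns A) = UNIV"
    using matrix_right_invertible_span_columns[of A] assms by (auto simp: invertible_def)
  moreover have "columns A \<subseteq> Lat A" using column_Lat by (auto simp: columns_def)
  ultimately have "vec.span (Lat A) = UNIV" using vec.span_mono by blast
  then show ?thesis unfolding is_z2_lattice_def using Lat_eq_span finite_columns by blast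
qed

text \<open>Selects a value of least 2-adic valuation; divisibility in a valuation ring is a total
  preorder.\<close>

lemma finite_ZZ_max:
  assumes "finite T" "T \<noteq> {}" "\<And>x. x \<in> T \<Longrightarrow> f x \<noteq> 0"
  shows "\<exists>a\<in>T. \<forall>b\<in>T. f b / f a \<in> ZZ"
  using assms
proof (induction T rule: finite_ne_induct)
  case (singleton x)
  then show ?case by simp
next
  case (insert x F)
  then obtain a where a: "a \<in> F" "\<forall>b\<in>F. f b / f a \<in> ZZ" by auto
  have nz: "f a \<noteq> 0" "f x \<noteq> 0" using a insert by auto
  then consider "f x / f a \<in> ZZ" | "f a / f x \<in> ZZ" using ZZ_total by blast
  then show ?case
  proof cases
    case 1 then show ?thesis using a by auto
  next
    case 2
    have "f b / f x \<in> ZZ" if "b \<in> F" for b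
      using ZZ_mult[OF 2 bspec[OF a(2) that]] nz by simp
    then show ?thesis using nz by (intro bexI[of _ x]) auto
  qed
qed

text \<open>Among the matrices with columns in the finite generating set and nonzero determinant,
  one is taken whose determinant has least valuation. Cramer's rule writes any generator in terms of
  its columns with coefficients \<open>det ?C / det A\<close>. Since \<open>?C\<close> is again
  built from generators, these coefficients are integral.\<close>

lemma z2_lattice_cases:
  assumes "is_z2_lattice M"
  obtains A where "invertible A" "M = Lat A"
proof -
  obtain S where S: "finite S" "M = z2_mod.span S" "vec.span M = UNIV"
    using assms by (auto simp: is_z2_lattice_def)
  have "M \<subseteq> vec.span S"
    unfolding S(2)
  proof (rule z2_mod.span_minimal)
    show "S \<subseteq> vec.span S" by (rule vec.span_superset)
    show "z2_mod.subspace (vec.span S)"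
      by (rule z2_mod.subspaceI) (auto intro: vec.span_zero vec.span_add vec.span_scale)
  qed
  then have "vec.span S = UNIV" using S(3) vec.span_minimal[OF _ vec.subspace_span] by blast
  \<comment> \<open>A basis of Q_2^3 inside the generating set shows that there is a candidate
    matrix.\<close>
  then obtain B where B: "B \<subseteq> S" "vec.independent B" "vec.span B = UNIV"
    by (metis vec.maximal_independent_subset vec.span_eq top.extremum_uniqueI vec.span_mono vec.span_span)
  have "card B = 3"
    using vec.dim_span_eq_card_independent[OF B(2)] vec_dim_card[where 'a = q2 and 'n = 3]
    unfolding B(3) by simp
  then obtain b1 b2 b3 where b: "B = {b1, b2, b3}" by (auto simp: card_3_iff)
  define M0 where "M0 = (\<chi> i j. (if j = 1 then b1 else if j = 2 then b2 else b3) $ i :: q2 ^ 3 ^ 3)"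
  define T where "T = {A :: q2 ^ 3 ^ 3. (\<forall>j. column j A \<in> S) \<and> det A \<noteq> 0}"
  have c0: "column j M0 = (if j = 1 then b1 else if j = 2 then b2 else b3)" for j
    by (simp add: M0_def column_def vec_eq_iff)
  have "columns M0 = (\<lambda>j. column j M0) ` {1, 2, 3}"
    unfolding UNIV_3[symmetric] by (auto simp: columns_def)
  then have "columns M0 = B" by (simp add: c0 b insert_commute)
  then have "det M0 \<noteq> 0"
    using matrix_right_invertible_span_columns[of M0] B(3) matrix_left_right_inverse
    by (metis invertible_def invertible_det_nz)
  then have "M0 \<in> T" using B(1) b by (auto simp: T_def c0)
  moreover have "finite T"
  proof (rule finite_subset)
    show "T \<subseteq> (\<lambda>(a, b, c). \<chi> i j. (if j = 1 then a else if j = 2 then b else c) $ i) ` (S \<times> S \<times> S)"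
    proof
      fix A assume A: "A \<in> T"
      have "A = (\<chi> i j. (if j = 1 then column 1 A else if j = 2 then column 2 A else column 3 A) $ i)"
        by (simp add: vec_eq_iff forall_3 column_def)
      then show "A \<in> (\<lambda>(a, b, c). \<chi> i j. (if j = 1 then a else if j = 2 then b else c) $ i) ` (S \<times> S \<times> S)"
        using A by (intro image_eqI[of _ _ "(column 1 A, column 2 A, column 3 A)"]) (auto simp: T_def)
    qed
  qed (use S(1) in auto)
  ultimately have "\<exists>a\<in>T. \<forall>b\<in>T. det b / det a \<in> ZZ"
    by (intro finite_ZZ_max) (blast, blast, simp add: T_def)
  then obtain A where A: "A \<in> T" "\<forall>C\<in>T. det C / det A \<in> ZZ" by blast
  have dA: "det A \<noteq> 0" using A by (simp add: T_def)
  then have inv: "invertible A" by (simp add: invertible_det_nz)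
  have "s \<in> Lat A" if s: "s \<in> S" for s
  proof -
    let ?x = "matrix_inv A *v s"
    have eq: "A *v ?x = s" using inv by (simp add: matrix_vector_mul_assoc)
    have "?x $ k \<in> ZZ" for k
    proof -
      let ?C = "(\<chi> i j. if j = k then s $ i else A $ i $ j) :: q2 ^ 3 ^ 3"
      have "column j ?C \<in> S" for j
        using s A(1) by (cases "j = k") (auto simp: column_def T_def)
      then have "det ?C / det A \<in> ZZ" using A(2) by (cases "det ?C = 0") (auto simp: T_def)
      then show ?thesis using cramer[OF dA, of ?x s] eq by simp
    qed
    then have "?x \<in> Zvec" by (simp add: Zvec_def)
    then show ?thesis unfolding Lat_def using eq by (metis image_eqI)
  qed
  then have "M \<subseteq> Lat A" unfolding S(2) by (rule z2_mod_span_Lat_subset)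
  moreover have "Lat A \<subseteq> M"
    unfolding S(2) Lat_eq_span using A(1) by (intro z2_mod.span_mono) (auto simp: T_def columns_def)
  ultimately show thesis using that inv by blast
qed

definition vtx :: "q2 ^ 3 ^ 3 \<Rightarrow> (q2 ^ 3) set set" where "vtx A = homothety_class (Lat A)"

lemma vtx_eq: "vtx A = {Lat (mat c ** A) |c. c \<noteq> 0}"
  by (simp add: vtx_def homothety_class_def smult_Lat)

lemma building_vertices_eq: "building_vertices = vtx ` {A. invertible A}"
  unfolding building_vertices_def vtx_def
  by (auto intro: is_z2_lattice_Lat elim!: z2_lattice_cases)

lemma vtx_smult [simp]: "c \<noteq> 0 \<Longrightarrow> vtx (mat c ** A) = vtx A"
proof -
  assume c: "c \<noteq> 0"
  have "\<exists>d. Lat (mat (e * c) ** A) = Lat (mat d ** A) \<and> d \<noteq> 0" if "e \<noteq> 0" for e using c that by (intro exI[of _ "e * c"]) auto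
  moreover have "\<exists>d. Lat (mat e ** A) = Lat (mat (d * c) ** A) \<and> d \<noteq> 0" if "e \<noteq> 0" for e using c that by (intro exI[of _ "e / c"]) auto
  ultimately show ?thesis by (auto simp: vtx_eq matrix_mul_assoc)
qed

lemma vtx_mult_GLZ [simp]: "U \<in> GLZ \<Longrightarrow> vtx (A ** U) = vtx A"
  by (simp add: vtx_def)

text \<open>Identifies the vertices with the cosets in GL_3(Q_2) of the product of the scalars and
  GL_3(Z_2). From here on vertices are handled through matrices.\<close>

lemma vtx_eq_iff:
  assumes "invertible A" "invertible B"
  shows "vtx A = vtx B \<longleftrightarrow> (\<exists>c U. c \<noteq> 0 \<and> U \<in> GLZ \<and> B = mat c ** A ** U)"
proof
  assume "vtx A = vtx B"
  moreover have "Lat B \<in> vtx B" unfolding vtx_eq by (auto intro!: exI[of _ 1])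
  ultimately have "Lat B \<in> vtx A" by simp
  then obtain c where c: "c \<noteq> 0" "Lat B = Lat (mat c ** A)" unfolding vtx_eq by blast
  have inv: "invertible (mat c ** A)" using c assms by (simp add: invertible_mult' invertible_mat)
  then have "matrix_inv (mat c ** A) ** B \<in> GLZ" using Lat_eq_iff[OF inv assms(2)] c by simp
  then show "\<exists>c U. c \<noteq> 0 \<and> U \<in> GLZ \<and> B = mat c ** A ** U"
    using c inv invertible_inv_eq[OF inv refl, of B] by blast
next
  assume "\<exists>c U. c \<noteq> 0 \<and> U \<in> GLZ \<and> B = mat c ** A ** U"
  then show "vtx A = vtx B" by auto
qed

lemma Union_building: "\<Union>building = building_vertices"
proof -
  have "{V} \<in> building" if "V \<in> building_vertices" for V using that by (simp add: building_def)
  then show ?thesis by (auto simp: building_def)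
qed

section \<open>The action of PGL_3(Q_2) on vertices\<close>

lemma vertex_action_vtx [simp]:
  assumes "invertible A"
  shows "vertex_action (to_PGL3 g) (vtx A) = vtx (g ** A)"
proof -
  have "vtx A \<in> building_vertices" using assms by (simp add: building_vertices_eq)
  then have "vertex_action (to_PGL3 g) (vtx A) = {(*v) (mat c ** g) ` Lat (mat d ** A) |c d. c \<noteq> 0 \<and> d \<noteq> 0}"
    unfolding vertex_action_def Union_building by (auto simp: to_PGL3_eq vtx_eq)
  also have "\<dots> = {Lat (mat (c * d) ** (g ** A)) |c d. c \<noteq> 0 \<and> d \<noteq> 0}"
  proof -
    have "mat c ** g ** (mat d ** A) = mat (c * d) ** (g ** A)" for c d
      by (metis mat_commute mat_mat matrix_mul_assoc)
    then show ?thesis by (simp add: mult_Lat)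
  qed
  also have "\<dots> = vtx (g ** A)"
  proof -
    have "\<exists>c' d. Lat (mat c ** (g ** A)) = Lat (mat (c' * d) ** (g ** A)) \<and> c' \<noteq> 0 \<and> d \<noteq> 0" if "c \<noteq> 0" for c
      using that by (intro exI[of _ c] exI[of _ 1]) auto
    then show ?thesis unfolding vtx_eq by auto
  qed
  finally show ?thesis .
qed

lemma vertex_action_hom: "group_hom PGL3 (BijGroup building_vertices) vertex_action"
proof -
  have dom: "vertex_action g V \<in> building_vertices" if gV: "g \<in> carrier PGL3" "V \<in> building_vertices" for g V
    using gV by (auto simp: carrier_PGL3 building_vertices_eq invertible_mult')
  have mult: "vertex_action (g \<otimes>\<^bsub>PGL3\<^esub> h) V = vertex_action g (vertex_action h V)"
    if gV: "g \<in> carrier PGL3" "h \<in> carrier PGL3" "V \<in> building_vertices" for g h V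
    using gV by (auto simp: carrier_PGL3 building_vertices_eq invertible_mult' matrix_mul_assoc)
  have one: "vertex_action \<one>\<^bsub>PGL3\<^esub> V = V" if "V \<in> building_vertices" for V
    using that by (auto simp: building_vertices_eq PGL3_one)
  have ext: "vertex_action g \<in> extensional building_vertices" for g
    by (simp add: vertex_action_def Union_building)
  have bij: "vertex_action g \<in> Bij building_vertices" if g: "g \<in> carrier PGL3" for g
  proof -
    have "bij_betw (vertex_action g) building_vertices building_vertices"
      by (rule bij_betw_byWitness[where f' = "vertex_action (inv\<^bsub>PGL3\<^esub> g)"])
        (use g in \<open>simp_all add: image_subset_iff dom one mult[symmetric]\<close>)
    then show ?thesis by (simp add: Bij_def ext)
  qed
  show ?thesis
  proof (rule group_hom.intro[OF group_PGL3 group_BijGroup], unfold_locales, rule homI)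
    fix g h assume g: "g \<in> carrier PGL3" "h \<in> carrier PGL3"
    have "vertex_action (g \<otimes>\<^bsub>PGL3\<^esub> h) = compose building_vertices (vertex_action g) (vertex_action h)"
      by (rule extensionalityI[OF ext compose_extensional]) (simp add: compose_eq mult g)
    then show "vertex_action (g \<otimes>\<^bsub>PGL3\<^esub> h) = vertex_action g \<otimes>\<^bsub>BijGroup building_vertices\<^esub> vertex_action h"
      using g bij by (simp add: BijGroup_def)
  qed (simp add: BijGroup_def bij)
qed

lemma subgroup_group_action:
  assumes "subgroup H PGL3"
  shows "group_action (PGL3\<lparr>carrier := H\<rparr>) building_vertices vertex_action"
  unfolding group_action_def
proof -
  interpret group_hom PGL3 "BijGroup building_vertices" vertex_action by (rule vertex_action_hom)
  have "group (PGL3\<lparr>carrier := H\<rparr>)" using assms by (rule PGL3.subgroup_imp_group)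
  then show "group_hom (PGL3\<lparr>carrier := H\<rparr>) (BijGroup building_vertices) vertex_action"
    using homh subgroup.subset[OF assms] hom_mult
    by (auto simp: group_hom_def group_hom_axioms_def hom_def subset_iff)
qed

section \<open>Index 2 sublattices and reduction of matrices modulo 2\<close>

definition dmat :: "q2 ^ 3 ^ 3" where
  "dmat = vector [vector [2, 0, 0], vector [0, 1, 0], vector [0, 0, 1]]"

lemma det_dmat: "det dmat = 2"
  by (simp add: dmat_def det_3)

lemma mult_dmat_nth [simp]: "(A ** dmat) $ i $ j = (if j = 1 then 2 * A $ i $ 1 else A $ i $ j)"
  using exhaust_3[of j] by (auto simp: matrix_matrix_mult_def dmat_def sum_3)

lemma invertible_dmat [simp]: "invertible dmat"
  by (simp add: invertible_det_nz det_dmat)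

definition bmat :: "q2 ^ 3 ^ 3 \<Rightarrow> bit ^ 3 ^ 3" where "bmat = map_matrix red"

lemma bmat_nth [simp]: "bmat A $ i $ j = red (A $ i $ j)"
  by (simp add: bmat_def)

lemma bmat_mult: "zmat A \<Longrightarrow> zmat B \<Longrightarrow> bmat (A ** B) = bmat A ** bmat B"
  by (simp add: vec_eq_iff zmat_def matrix_matrix_mult_def red_sum red_mult)

lemma bmat_1 [simp]: "bmat (mat 1) = mat 1"
  by (simp add: vec_eq_iff mat_def)

lemma bmat_det: "zmat A \<Longrightarrow> red (det A) = det (bmat A)"
  by (simp add: det_3 zmat_def red_add red_mult red_minus diff_conv_add_uminus del: add_uminus_conv_diff)

lemma GLZ_iff_bmat: "A \<in> GLZ \<longleftrightarrow> zmat A \<and> invertible (bmat A)"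
  by (auto simp: GLZ_det invertible_det_nz bmat_det[symmetric] red_eq_1_iff zmat_det)

text \<open>A section of reduction modulo 2 that is only set-theoretic: it does not respect sums or
  products, but it lifts invertible matrices to \<open>GLZ\<close>.\<close>

definition blift :: "bit ^ 3 ^ 3 \<Rightarrow> q2 ^ 3 ^ 3" where "blift M = map_matrix (\<lambda>b. of_bool (b = 1)) M"

lemma zmat_blift [simp]: "zmat (blift M)" and bmat_blift [simp]: "bmat (blift M) = M"
  by (simp_all add: blift_def zmat_def vec_eq_iff)

lemma blift_GLZ: "invertible M \<Longrightarrow> blift M \<in> GLZ"
  by (simp add: GLZ_iff_bmat)

text \<open>An even determinant makes the matrix singular modulo 2. Completing a kernel vector to a
  basis of F_2^3 and lifting that basis gives \<open>U\<close>. The first column of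
  \<open>A ** U\<close> is then even, and halving it removes one factor \<open>dmat\<close>.\<close>

lemma split_off_dmat:
  assumes "zmat A" "det A / 2 \<in> ZZ"
  obtains A' U where "zmat A'" "U \<in> GLZ" "A ** U = A' ** dmat"
proof -
  have "det (bmat A) = 0" using assms by (metis bmat_det red_eq_0_iff)
  then have "\<not> invertible (bmat A)" by (simp add: invertible_det_nz)
  then obtain v where v: "bmat A *v v = 0" "v \<noteq> 0"
    using matrix_left_invertible_ker[of "bmat A"] matrix_left_right_inverse
    by (metis invertible_def)
  then obtain W :: "bit ^ 3 ^ 3" where W: "invertible W" "column 1 W = v"
  proof -
    assume *: "\<And>W :: bit ^ 3 ^ 3. invertible W \<Longrightarrow> column 1 W = v \<Longrightarrow> thesis"
    have "v $ 1 \<noteq> 0 \<or> v $ 2 \<noteq> 0 \<or> v $ 3 \<noteq> 0"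
      using v(2) by (simp only: vec_eq_iff forall_3 zero_index) blast
    then consider "v $ 1 = 1" | "v $ 1 = 0" "v $ 2 = 1" | "v $ 1 = 0" "v $ 2 = 0" "v $ 3 = 1"
      unfolding bit_not_zero_iff using bit_not_one_iff by blast
    then show thesis
    proof cases
      case 1
      show ?thesis by (rule *[of "vector [vector [v $ 1, 0, 0], vector [v $ 2, 1, 0], vector [v $ 3, 0, 1]]"])
          (simp_all add: invertible_det_nz det_3 column_def vec_eq_iff forall_3 1)
    next
      case 2
      show ?thesis by (rule *[of "vector [vector [v $ 1, 1, 0], vector [v $ 2, 0, 0], vector [v $ 3, 0, 1]]"])
          (simp_all add: invertible_det_nz det_3 column_def vec_eq_iff forall_3 2)
    next
      case 3
      show ?thesis by (rule *[of "vector [vector [v $ 1, 1, 0], vector [v $ 2, 0, 1], vector [v $ 3, 0, 0]]"])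
          (simp_all add: invertible_det_nz det_3 column_def vec_eq_iff forall_3 3)
    qed
  qed
  define U where "U = blift W"
  have U: "U \<in> GLZ" "zmat U" "bmat U = W" using W by (simp_all add: U_def blift_GLZ)
  have z: "zmat (A ** U)" using assms U by blast
  have "red ((A ** U) $ i $ 1) = 0" for i
  proof -
    have "red ((A ** U) $ i $ 1) = (bmat A ** W) $ i $ 1" using bmat_mult[OF assms(1) U(2)] U(3) bmat_nth by metis
    also have "\<dots> = (bmat A *v v) $ i" by (simp add: W(2)[symmetric] column_def matrix_matrix_mult_def matrix_vector_mult_def)
    finally show ?thesis using v by simp
  qed
  then have even: "(A ** U) $ i $ 1 / 2 \<in> ZZ" for i by (simp add: red_eq_0_iff)
  define A' where "A' = (\<chi> i j. if j = 1 then (A ** U) $ i $ j / 2 else (A ** U) $ i $ j)"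
  have "zmat A'" using even z by (simp add: A'_def zmat_def)
  moreover have "A ** U = A' ** dmat"
    by (simp add: vec_eq_iff A'_def)
  ultimately show thesis using that U by blast
qed

lemma matrix_denominator: "\<exists>n. zmat (mat (2 ^ n) ** (A :: q2 ^ 3 ^ 3))"
proof -
  define n where "n i j = (LEAST k. 2 ^ k * A $ i $ j \<in> ZZ)" for i j
  have n: "2 ^ n i j * A $ i $ j \<in> ZZ" for i j
    unfolding n_def using ex_denominator by (rule LeastI_ex)
  define N where "N = (\<Sum>i\<in>UNIV. \<Sum>j\<in>UNIV. n i j)"
  have "2 ^ N * A $ i $ j \<in> ZZ" for i j
  proof -
    have "n i j \<le> (\<Sum>j\<in>UNIV. n i j)" by (rule member_le_sum) auto
    also have "\<dots> \<le> N" unfolding N_def by (rule member_le_sum[of i UNIV "\<lambda>i. \<Sum>j\<in>UNIV. n i j"]) auto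
    finally have "2 ^ N * A $ i $ j = 2 ^ (N - n i j) * (2 ^ n i j * A $ i $ j)"
      by (simp add: power_add[symmetric] mult.assoc[symmetric])
    then show ?thesis by (metis ZZ_mult ZZ_numeral ZZ_power n)
  qed
  then show ?thesis by (auto simp: zmat_def)
qed

text \<open>Takes the place of the elementary divisor theorem. After denominators are cleared by a
  power of 2, \<open>split_off_dmat\<close> removes factors \<open>dmat\<close> from the right, each
  lowering the valuation of the determinant by one, until an element of \<open>GLZ\<close> is left.
  In terms of the building, every vertex is reached from the standard one along edges.\<close>

lemma GL3_induct [consumes 1, case_names one smult GLZ dmat]:
  assumes "invertible A"
    and one: "P (mat 1)"
    and smult: "\<And>c A. c \<noteq> 0 \<Longrightarrow> invertible A \<Longrightarrow> P A \<Longrightarrow> P (mat c ** A)"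
    and GLZ: "\<And>A U. invertible A \<Longrightarrow> U \<in> GLZ \<Longrightarrow> P A \<Longrightarrow> P (A ** U)"
    and dmat: "\<And>A. invertible A \<Longrightarrow> P A \<Longrightarrow> P (A ** dmat)"
  shows "P A"
proof -
  have integral: "P A" if "zmat A" "u \<in> UU" "det A = 2 ^ n * u" for A :: "q2 ^ 3 ^ 3" and n u
    using that
  proof (induction n arbitrary: A u)
    case 0
    then have "A \<in> GLZ" by (simp add: GLZ_det)
    then show ?case using GLZ[OF invertible_mat1 _ one, of A] by simp
  next
    case (Suc n)
    have "det A / 2 = 2 ^ n * u" by (simp add: Suc.prems)
    then have "det A / 2 \<in> ZZ" using Suc.prems by (simp add: UU_ZZ)
    then obtain A' U where A': "zmat A'" "U \<in> GLZ" "A ** U = A' ** dmat"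
      using split_off_dmat Suc.prems(1) by blast
    have U: "det U \<in> UU" using A' by (simp add: GLZ_det)
    have "det A * det U = det A' * 2" using arg_cong[OF A'(3), of det] by (simp add: det_mul det_dmat)
    then have d: "det A' = 2 ^ n * (u * det U)" using Suc.prems by (simp add: field_simps)
    have inv: "invertible A'"
      using d UU_nz[OF U] UU_nz[OF Suc.prems(2)] by (simp add: invertible_det_nz)
    obtain W where W: "U ** W = mat 1" "W \<in> GLZ"
      using A'(2) GLZ_inv GLZ_invertible matrix_inv_right by blast
    have "P A'"
      using Suc.IH[OF A'(1) UU_mult[OF Suc.prems(2) U] d] .
    then have "P (A' ** dmat ** W)"
      using dmat GLZ inv W by (simp add: invertible_mult')
    moreover have "A' ** dmat ** W = A" unfolding A'(3)[symmetric] matrix_mul_assoc[symmetric] W by simp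
    ultimately show ?case by simp
  qed
  obtain n where n: "zmat (mat (2 ^ n) ** A)" using matrix_denominator by blast
  let ?B = "mat (2 ^ n) ** A"
  have inv: "invertible ?B" using assms(1) by (simp add: invertible_mult' invertible_mat)
  then have "det ?B \<noteq> 0" by (simp add: invertible_det_nz)
  then obtain k u where ku: "u \<in> UU" "det ?B = 2 powi k * u" using q2_decomp by blast
  then have "k \<ge> 0" using zmat_det[OF n] powi_UU_ZZ_iff by simp
  then have "det ?B = 2 ^ nat k * u" using ku by (simp add: power_int_def)
  then have "P ?B" using integral n ku by blast
  then have "P (mat (1 / 2 ^ n) ** ?B)" using smult inv by simp
  then show ?thesis by (simp add: matrix_mul_assoc)
qed

section \<open>The ring O and the unitary group over O[1/2]\<close>

lemma O_lam_cases: assumes "x \<in> O_lam" obtains a b where "x = of_int a + of_int b * lam"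
  using assms by (auto simp: O_lam_def)

lemma O_lamI: "of_int a + of_int b * lam \<in> O_lam"
  by (auto simp: O_lam_def)

lemma O_lam_of_int [simp]: "of_int a \<in> O_lam"
  using O_lamI[of a 0] by simp

lemma O_lam_consts [simp]: "0 \<in> O_lam" "1 \<in> O_lam" "numeral n \<in> O_lam" "lam \<in> O_lam" "lambar \<in> O_lam"
  using O_lam_of_int[of 0] O_lam_of_int[of 1] O_lam_of_int[of "numeral n"] O_lamI[of 0 1] O_lamI[of "-1" "-1"]
  by (simp_all add: lambar_eq)

lemma O_lam_add [simp]: "x \<in> O_lam \<Longrightarrow> y \<in> O_lam \<Longrightarrow> x + y \<in> O_lam"
proof (elim O_lam_cases)
  fix a b c d assume "x = of_int a + of_int b * lam" "y = of_int c + of_int d * lam"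
  then have "x + y = of_int (a + c) + of_int (b + d) * lam" by (simp add: algebra_simps)
  then show ?thesis by (metis O_lamI)
qed

lemma lam_mult_formula:
  "(p + q * lam) * (r + s * lam) = (p * r - 2 * q * s) + (p * s + q * r - q * s) * lam"
proof -
  have "(p + q * lam) * (r + s * lam) = p * r + (p * s + q * r) * lam + q * s * (lam * lam)"
    by (simp add: algebra_simps)
  then show ?thesis unfolding lam_square by (simp add: algebra_simps)
qed

lemma O_lam_mult [simp]: "x \<in> O_lam \<Longrightarrow> y \<in> O_lam \<Longrightarrow> x * y \<in> O_lam"
proof (elim O_lam_cases)
  fix a b c d assume "x = of_int a + of_int b * lam" "y = of_int c + of_int d * lam"
  then have "x * y = of_int (a * c - 2 * b * d) + of_int (a * d + b * c - b * d) * lam"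
    by (simp add: lam_mult_formula)
  then show ?thesis by (metis O_lamI)
qed

lemma O_lam_minus_iff [simp]: "- x \<in> O_lam \<longleftrightarrow> x \<in> O_lam"
  using O_lam_mult[of "-1" x] O_lam_mult[of "-1" "-x"] O_lam_of_int[of "-1"] by auto

lemma O_lam_diff [simp]: "x \<in> O_lam \<Longrightarrow> y \<in> O_lam \<Longrightarrow> x - y \<in> O_lam"
  using O_lam_add[of x "- y"] by simp

lemma O_lam_power [simp]: "x \<in> O_lam \<Longrightarrow> x ^ n \<in> O_lam"
  by (induction n) simp_all

lemma O_lam_cnj_aux: "x \<in> O_lam \<Longrightarrow> cnj x \<in> O_lam"
  by (elim O_lam_cases) (simp del: of_int_add of_int_mult)

lemma O_lam_cnj [simp]: "cnj x \<in> O_lam \<longleftrightarrow> x \<in> O_lam"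
  using O_lam_cnj_aux[of x] O_lam_cnj_aux[of "cnj x"] by auto

lemma lam_lambar: "lam * lambar = 2" "lambar * lam = 2"
  using lam_square by (simp_all add: lambar_eq algebra_simps)

lemma lam_nonzero [simp]: "lam \<noteq> 0"
  by (simp add: lam_def complex_eq_iff)

lemma cmod_O_lam: "(cmod (of_int a + of_int b * lam))\<^sup>2 = of_int (a\<^sup>2 - a * b + 2 * b\<^sup>2)"
proof -
  have "(cmod (of_int a + of_int b * lam))\<^sup>2 = (a - b / 2)\<^sup>2 + (b * sqrt 7 / 2)\<^sup>2"
    by (simp add: cmod_power2 lam_def)
  also have "\<dots> = of_int (a\<^sup>2 - a * b + 2 * b\<^sup>2)"
    by (simp add: power2_eq_square algebra_simps)
  finally show ?thesis .
qed

lemma O_lam_norm_Ints: "x \<in> O_lam \<Longrightarrow> \<exists>n::int. n \<ge> 0 \<and> (cmod x)\<^sup>2 = of_int n \<and> (x \<noteq> 0 \<longrightarrow> n \<ge> 1)"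
proof -
  assume "x \<in> O_lam"
  then obtain a b where x: "x = of_int a + of_int b * lam" by (rule O_lam_cases)
  let ?n = "a\<^sup>2 - a * b + 2 * b\<^sup>2"
  have n: "(cmod x)\<^sup>2 = of_int ?n" using cmod_O_lam x by simp
  then have "(0::real) \<le> of_int ?n" by (metis zero_le_power2)
  then have "?n \<ge> 0" by (simp only: of_int_0_le_iff)
  moreover have "?n \<noteq> 0" if "x \<noteq> 0" using that n by (metis norm_eq_zero of_int_0 power_eq_0_iff)
  ultimately show ?thesis using n by (intro exI[of _ ?n]) linarith
qed

text \<open>Four times the norm form is \<open>(2 * a - b)^2 + 7 * b^2\<close>, so norm 1 leaves no
  room for a nonzero b.\<close>

lemma O_lam_norm1: "x \<in> O_lam \<Longrightarrow> (cmod x)\<^sup>2 = 1 \<Longrightarrow> x = 1 \<or> x = - 1"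
proof -
  assume "x \<in> O_lam" and n: "(cmod x)\<^sup>2 = 1"
  then obtain a b where x: "x = of_int a + of_int b * lam" by (elim O_lam_cases)
  have "of_int (a\<^sup>2 - a * b + 2 * b\<^sup>2) = (1::real)" using n unfolding x cmod_O_lam .
  then have "a\<^sup>2 - a * b + 2 * b\<^sup>2 = 1" by (simp only: of_int_eq_1_iff)
  then have eq: "(2 * a - b)\<^sup>2 + 7 * b\<^sup>2 = 4" by (simp add: power2_eq_square algebra_simps)
  have "b = 0"
  proof (rule ccontr)
    assume "b \<noteq> 0" then have "b\<^sup>2 \<ge> 1" by (simp add: int_one_le_iff_zero_less)
    then show False using eq zero_le_power2[of "2 * a - b"] by linarith
  qed
  then have "a\<^sup>2 = 1" using eq by (simp add: power2_eq_square)
  then show ?thesis using \<open>b = 0\<close> x by (auto simp: power2_eq_1_iff)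
qed

definition O_half :: "complex set" where "O_half = {x / 2 ^ n |x n. x \<in> O_lam}"

lemma O_half_cases:
  assumes "x \<in> O_half" obtains y n where "y \<in> O_lam" "x = y / 2 ^ n"
  using assms by (auto simp: O_half_def)

lemma O_halfI: "y \<in> O_lam \<Longrightarrow> y / 2 ^ n \<in> O_half"
  by (auto simp: O_half_def)

lemma O_half_O [simp]: "x \<in> O_lam \<Longrightarrow> x \<in> O_half"
  using O_halfI[of x 0] by simp

lemma O_half_add [simp]: "x \<in> O_half \<Longrightarrow> y \<in> O_half \<Longrightarrow> x + y \<in> O_half"
proof (elim O_half_cases)
  fix a b m n assume "a \<in> O_lam" "b \<in> O_lam" "x = a / 2 ^ m" "y = b / 2 ^ n"
  then have "x + y = (2 ^ n * a + 2 ^ m * b) / 2 ^ (m + n)" "2 ^ n * a + 2 ^ m * b \<in> O_lam"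
    by (simp_all add: power_add add_divide_distrib)
  then show ?thesis by (metis O_halfI)
qed

lemma O_half_mult [simp]: "x \<in> O_half \<Longrightarrow> y \<in> O_half \<Longrightarrow> x * y \<in> O_half"
proof (elim O_half_cases)
  fix a b m n assume "a \<in> O_lam" "b \<in> O_lam" "x = a / 2 ^ m" "y = b / 2 ^ n"
  then have "x * y = (a * b) / 2 ^ (m + n)" "a * b \<in> O_lam"
    by (simp_all add: power_add)
  then show ?thesis by (metis O_halfI)
qed

lemma O_half_minus_iff [simp]: "- x \<in> O_half \<longleftrightarrow> x \<in> O_half"
  using O_half_mult[of "-1" x] O_half_mult[of "-1" "-x"] O_half_O[of "-1"] by auto

lemma O_half_half [simp]: "x \<in> O_half \<Longrightarrow> x / 2 \<in> O_half"
  using O_half_mult[of x "1 / 2"] O_halfI[of 1 1] by simp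

lemma O_half_cnj [simp]: "x \<in> O_half \<Longrightarrow> cnj x \<in> O_half"
  by (elim O_half_cases) (auto intro!: O_halfI)

section \<open>The field Q(lambda)\<close>

lemma Q_lamI: "of_rat a + of_rat b * lam \<in> Q_lam"
  by (auto simp: Q_lam_def)

lemma Q_lam_cases: assumes "x \<in> Q_lam" obtains a b where "x = of_rat a + of_rat b * lam"
  using assms by (auto simp: Q_lam_def)

lemma O_half_Q [simp]: "x \<in> O_half \<Longrightarrow> x \<in> Q_lam"
proof (elim O_half_cases O_lam_cases)
  fix y n a b assume "x = y / 2 ^ n" "y = of_int a + of_int b * lam"
  then have "x = of_rat (of_int a / 2 ^ n) + of_rat (of_int b / 2 ^ n) * lam"
    by (simp add: of_rat_divide of_rat_power add_divide_distrib)
  then show ?thesis by (metis Q_lamI)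
qed

lemma O_lam_Q [simp]: "x \<in> O_lam \<Longrightarrow> x \<in> Q_lam"
  by simp

lemma Q_lam_add [simp]: "x \<in> Q_lam \<Longrightarrow> y \<in> Q_lam \<Longrightarrow> x + y \<in> Q_lam"
proof (elim Q_lam_cases)
  fix a b c d assume "x = of_rat a + of_rat b * lam" "y = of_rat c + of_rat d * lam"
  then have "x + y = of_rat (a + c) + of_rat (b + d) * lam" by (simp add: of_rat_add algebra_simps)
  then show ?thesis by (metis Q_lamI)
qed

lemma Q_lam_mult [simp]: "x \<in> Q_lam \<Longrightarrow> y \<in> Q_lam \<Longrightarrow> x * y \<in> Q_lam"
proof (elim Q_lam_cases)
  fix a b c d assume "x = of_rat a + of_rat b * lam" "y = of_rat c + of_rat d * lam"
  then have "x * y = of_rat (a * c - 2 * b * d) + of_rat (a * d + b * c - b * d) * lam"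
    by (simp add: lam_mult_formula of_rat_add of_rat_mult of_rat_diff)
  then show ?thesis by (metis Q_lamI)
qed

lemma Q_lam_of_rat [simp]: "of_rat a \<in> Q_lam"
  using Q_lamI[of a 0] by simp

lemma Q_lam_minus [simp]: "x \<in> Q_lam \<Longrightarrow> - x \<in> Q_lam"
  using Q_lam_mult[of "of_rat (- 1)" x] by simp

lemma Q_lam_diff [simp]: "x \<in> Q_lam \<Longrightarrow> y \<in> Q_lam \<Longrightarrow> x - y \<in> Q_lam"
  using Q_lam_add[of x "- y"] by simp

lemma Q_lam_inverse [simp]: "x \<in> Q_lam \<Longrightarrow> inverse x \<in> Q_lam"
proof (elim Q_lam_cases)
  fix a b assume x: "x = of_rat a + of_rat b * lam"
  let ?n = "a\<^sup>2 - a * b + 2 * b\<^sup>2"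
  \<comment> \<open>This is the complex conjugate of x, and \<open>?n\<close> is the norm of
    x.\<close>
  let ?y = "of_rat (a - b) + of_rat (- b) * lam"
  have xy: "x * ?y = of_rat ?n"
    unfolding x lam_mult_formula
    by (simp add: of_rat_add of_rat_mult of_rat_diff of_rat_power of_rat_minus power2_eq_square algebra_simps)
  show ?thesis
  proof (cases "?n = 0")
    case True
    have "4 * ?n = (2 * a - b)\<^sup>2 + 7 * b\<^sup>2" by (simp add: power2_eq_square algebra_simps)
    then have "(2 * a - b)\<^sup>2 + 7 * b\<^sup>2 = 0" using True by simp
    then have "(2 * a - b)\<^sup>2 = 0" "b\<^sup>2 = 0"
      using zero_le_power2[of "2 * a - b"] zero_le_power2[of b] by linarith+
    then have "x = 0" by (simp add: x)
    then show ?thesis using Q_lam_of_rat[of 0] by simp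
  next
    case False
    have "x * (?y * of_rat (inverse ?n)) = 1"
      using False xy by (simp add: mult.assoc[symmetric] of_rat_inverse)
    then have "inverse x = ?y * of_rat (inverse ?n)" by (rule inverse_unique)
    then show ?thesis using Q_lam_mult[OF Q_lamI Q_lam_of_rat] by metis
  qed
qed

section \<open>Matrices over subrings and adjoints\<close>

definition over :: "'a set \<Rightarrow> 'a ^ 'n ^ 'm \<Rightarrow> bool" where "over S A \<longleftrightarrow> (\<forall>i j. A $ i $ j \<in> S)"

lemma over_O_half [simp]: "over O_lam A \<Longrightarrow> over O_half A"
  and over_O_Q [simp]: "over O_lam A \<Longrightarrow> over Q_lam A"
  and over_half_Q [simp]: "over O_half A \<Longrightarrow> over Q_lam A"
  by (simp_all add: over_def)

lemma over_mult [simp]: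
  fixes A B :: "complex ^ 3 ^ 3"
  shows "over O_lam A \<Longrightarrow> over O_lam B \<Longrightarrow> over O_lam (A ** B)"
    and "over O_half A \<Longrightarrow> over O_half B \<Longrightarrow> over O_half (A ** B)"
    and "over Q_lam A \<Longrightarrow> over Q_lam B \<Longrightarrow> over Q_lam (A ** B)"
  by (simp_all add: over_def matrix_matrix_mult_def sum_3)

lemma over_mat [simp]: "0 \<in> S \<Longrightarrow> over S (mat c) \<longleftrightarrow> c \<in> S"
  by (auto simp: over_def mat_def)

lemma zero_mem [simp]: "0 \<in> O_half" "0 \<in> Q_lam"
  by simp_all

definition adj :: "complex ^ 'n ^ 'm \<Rightarrow> complex ^ 'm ^ 'n" where "adj A = (\<chi> i j. cnj (A $ j $ i))"

lemma adj_nth [simp]: "adj A $ i $ j = cnj (A $ j $ i)"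
  by (simp add: adj_def)

lemma adj_adj [simp]: "adj (adj A) = A"
  by (simp add: vec_eq_iff)

lemma adj_mult: "adj (A ** B) = adj B ** adj A"
  by (simp add: vec_eq_iff matrix_matrix_mult_def mult.commute)

lemma adj_mat [simp]: "adj (mat c) = mat (cnj c)"
  by (simp add: vec_eq_iff mat_def)

lemma over_adj [simp]: "over O_lam A \<Longrightarrow> over O_lam (adj A)" "over O_half A \<Longrightarrow> over O_half (adj A)"
  by (simp_all add: over_def)

section \<open>The embedding into Q_2 and reduction modulo lambda\<close>

locale dyadic =
  fixes \<iota> :: "complex \<Rightarrow> q2"
  assumes emb: "dyadic_embedding \<iota>"
begin

lemma iota_add [simp]: "x \<in> Q_lam \<Longrightarrow> y \<in> Q_lam \<Longrightarrow> \<iota> (x + y) = \<iota> x + \<iota> y"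
  and iota_mult [simp]: "x \<in> Q_lam \<Longrightarrow> y \<in> Q_lam \<Longrightarrow> \<iota> (x * y) = \<iota> x * \<iota> y"
  and iota_1 [simp]: "\<iota> 1 = 1"
  using emb unfolding dyadic_embedding_def by blast+

lemma iota_0 [simp]: "\<iota> 0 = 0"
  using iota_add[of 0 0] by simp

lemma iota_minus [simp]: "x \<in> Q_lam \<Longrightarrow> \<iota> (- x) = - \<iota> x"
  using iota_add[of x "- x"] by (simp add: add_eq_0_iff)

lemma iota_diff [simp]: "x \<in> Q_lam \<Longrightarrow> y \<in> Q_lam \<Longrightarrow> \<iota> (x - y) = \<iota> x - \<iota> y"
  using iota_add[of x "- y"] by simp

lemma iota_of_nat [simp]: "\<iota> (of_nat n) = of_nat n"
proof (induction n)
  case (Suc n)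
  have "of_nat n \<in> Q_lam" using O_lam_of_int[of "int n"] by (metis O_lam_Q of_int_of_nat_eq)
  then show ?case using Suc by simp
qed simp

lemma iota_numeral [simp]: "\<iota> (numeral n) = numeral n"
  using iota_of_nat[of "numeral n"] by simp

lemma iota_of_int [simp]: "\<iota> (of_int a) = of_int a"
proof (cases a rule: int_cases2)
  case (nonneg n)
  then show ?thesis by simp
next
  case (nonpos n)
  have "of_nat n \<in> Q_lam" using O_lam_of_int[of "int n"] by (metis O_lam_Q of_int_of_nat_eq)
  then show ?thesis using nonpos by simp
qed

lemma iota_power [simp]: "x \<in> O_lam \<Longrightarrow> \<iota> (x ^ n) = \<iota> x ^ n"
  by (induction n) simp_all

lemma iota_inverse [simp]: "x \<in> Q_lam \<Longrightarrow> \<iota> (inverse x) = inverse (\<iota> x)"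
proof (cases "x = 0")
  case False
  assume x: "x \<in> Q_lam"
  then have "\<iota> x * \<iota> (inverse x) = 1" using False iota_mult[of x "inverse x"] by simp
  then show ?thesis using inverse_unique by metis
qed simp

lemma iota_divide [simp]: "x \<in> Q_lam \<Longrightarrow> y \<in> Q_lam \<Longrightarrow> \<iota> (x / y) = \<iota> x / \<iota> y"
  by (simp add: divide_inverse)

lemma iota_eq_0 [simp]: "x \<in> Q_lam \<Longrightarrow> \<iota> x = 0 \<longleftrightarrow> x = 0"
  using iota_mult[of x "inverse x"] by (cases "x = 0") auto

lemma iota_inj: "x \<in> Q_lam \<Longrightarrow> y \<in> Q_lam \<Longrightarrow> \<iota> x = \<iota> y \<longleftrightarrow> x = y"
  using iota_eq_0[of "x - y"] by simp

lemma UU_dvd: "u dvd 1 \<Longrightarrow> of_z2 u \<in> UU"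
proof -
  assume "u dvd 1"
  then obtain v where "1 = u * v" by (elim dvdE)
  then have "of_z2 u * of_z2 v = 1" by (metis of_z2_simps(2,6))
  moreover from this have "inverse (of_z2 u) = of_z2 v" by (rule inverse_unique)
  ultimately show ?thesis by (auto simp: UU_def)
qed

lemma iota_lambar: "\<iota> lambar \<in> UU"
  using emb UU_dvd unfolding dyadic_embedding_def by auto

lemma iota_lam: "\<exists>u\<in>UU. \<iota> lam = 2 * u"
  using emb UU_dvd unfolding dyadic_embedding_def by blast

lemma iota_O_ZZ [simp]: "x \<in> O_lam \<Longrightarrow> \<iota> x \<in> ZZ"
proof (elim O_lam_cases)
  fix a b assume x: "x = of_int a + of_int b * lam"
  obtain u where "u \<in> UU" "\<iota> lam = 2 * u" using iota_lam by blast
  then show ?thesis by (simp add: x UU_ZZ)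
qed

text \<open>On O this is the reduction to O/lambda = F_2, computed through the embedding. It
  vanishes on \<open>lam\<close> and is 1 on \<open>lambar\<close>, which becomes a unit of
  Z_2.\<close>

definition par :: "complex \<Rightarrow> bit" where "par x = red (\<iota> x)"

lemma par_add [simp]: "x \<in> O_lam \<Longrightarrow> y \<in> O_lam \<Longrightarrow> par (x + y) = par x + par y"
  and par_mult [simp]: "x \<in> O_lam \<Longrightarrow> y \<in> O_lam \<Longrightarrow> par (x * y) = par x * par y"
  and par_minus [simp]: "x \<in> O_lam \<Longrightarrow> par (- x) = par x"
  and par_diff [simp]: "x \<in> O_lam \<Longrightarrow> y \<in> O_lam \<Longrightarrow> par (x - y) = par x + par y"
  and par_0 [simp]: "par 0 = 0" and par_1 [simp]: "par 1 = 1"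
  by (simp_all add: par_def red_add red_mult red_minus diff_conv_add_uminus del: add_uminus_conv_diff)

lemma par_lam [simp]: "par lam = 0"
proof -
  obtain u where "u \<in> UU" "\<iota> lam = 2 * u" using iota_lam by blast
  then show ?thesis by (simp add: par_def UU_ZZ)
qed

lemma par_lambar [simp]: "par lambar = 1"
  using iota_lambar by (simp add: par_def red_eq_1_iff UU_ZZ)

lemma par_numeral [simp]: "par (numeral (num.Bit0 n)) = 0" "par (numeral (num.Bit1 n)) = 1"
proof -
  have "numeral (num.Bit0 n) = 2 * (numeral n :: q2)" by (subst numeral_Bit0) (rule mult_2[symmetric])
  then show "par (numeral (num.Bit0 n)) = 0" by (simp only: par_def iota_numeral red_even ZZ_numeral)
  have "numeral (num.Bit1 n) = 1 + 2 * (numeral n :: q2)" by (subst numeral_Bit1) (simp only: mult_2 add.commute)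
  then show "par (numeral (num.Bit1 n)) = 1" by (simp only: par_def iota_numeral red_odd ZZ_numeral)
qed

lemma par_of_int: "par (of_int a) = of_bool (odd a)"
proof -
  have "par (of_int (2 * k)) = 0" "par (of_int (2 * k + 1)) = 1" for k
  proof -
    have e: "complex_of_int (2 * k) = 2 * of_int k" "complex_of_int (2 * k + 1) = 2 * of_int k + 1" by simp_all
    show "par (of_int (2 * k)) = 0" "par (of_int (2 * k + 1)) = 1" unfolding e by simp_all
  qed
  then show ?thesis by (cases "even a") (auto elim!: evenE oddE)
qed

lemma par_O: "par (of_int a + of_int b * lam) = of_bool (odd a)"
  by (simp add: par_of_int)

text \<open>The kernel of the reduction is the ideal generated by \<open>lam\<close>. The cofactor
  comes from 2 = \<open>lam * lambar\<close>, applied to the even integer coordinate.\<close>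

lemma par_eq_0_iff: "x \<in> O_lam \<Longrightarrow> par x = 0 \<longleftrightarrow> (\<exists>y\<in>O_lam. x = lam * y)"
proof -
  assume "x \<in> O_lam"
  then obtain a b where x: "x = of_int a + of_int b * lam" by (rule O_lam_cases)
  show ?thesis
  proof
    assume "par x = 0"
    then have "even a" unfolding x par_O by (auto split: if_splits)
    then obtain k where "a = 2 * k" by (elim evenE)
    then have "x = lam * (lambar * of_int k + of_int b)"
      by (simp add: x algebra_simps) (simp add: lam_lambar mult.assoc[symmetric])
    then show "\<exists>y\<in>O_lam. x = lam * y" by (metis O_lam_add O_lam_consts(5) O_lam_mult O_lam_of_int)
  next
    assume "\<exists>y\<in>O_lam. x = lam * y"
    then show "par x = 0" by auto
  qed
qed

text \<open>Conjugation exchanges the two primes above 2, so the two hypotheses express integrality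
  at both. They force both integer coordinates of the numerator to be even as long as the
  denominator contains a factor 2.\<close>

lemma O_half_integral:
  assumes "x \<in> O_half" "\<iota> x \<in> ZZ" "\<iota> (cnj x) \<in> ZZ"
  shows "x \<in> O_lam"
proof -
  obtain y n where y: "y \<in> O_lam" "x = y / 2 ^ n" using assms(1) by (rule O_half_cases)
  show ?thesis using y assms(2,3)
  proof (induction n arbitrary: y)
    case (Suc n)
    obtain a b where yab: "y = of_int a + of_int b * lam" using Suc.prems(1) by (rule O_lam_cases)
    have "\<iota> y = 2 * (2 ^ n * \<iota> x)" "\<iota> (cnj y) = 2 * (2 ^ n * \<iota> (cnj x))" using Suc.prems(1,2) by simp_all
    then have "par y = 0" "par (cnj y) = 0" using Suc.prems(3,4) by (simp_all only: par_def) auto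
    moreover have "cnj y = of_int (a - b) + of_int (- b) * lam"
      by (simp add: yab lambar_eq algebra_simps)
    ultimately have "(of_bool (odd a) :: bit) = 0" "(of_bool (odd (a - b)) :: bit) = 0"
      by (metis par_O yab, metis par_O)
    then have "even a" "even (a - b)" by (auto simp only: of_bool_eq_0_iff)
    then obtain k l where "a = 2 * k" "b = 2 * l" by (auto elim!: evenE)
    then have "x = (of_int k + of_int l * lam) / 2 ^ n" by (simp add: Suc.prems yab field_simps)
    then show ?case using Suc.IH[OF O_lamI] Suc.prems by blast
  qed simp
qed

definition im :: "complex ^ 3 ^ 3 \<Rightarrow> q2 ^ 3 ^ 3" where "im = map_matrix \<iota>"

lemma im_nth [simp]: "im A $ i $ j = \<iota> (A $ i $ j)"
  by (simp add: im_def)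

lemma im_mult: "over Q_lam A \<Longrightarrow> over Q_lam B \<Longrightarrow> im (A ** B) = im A ** im B"
  by (simp add: vec_eq_iff over_def matrix_matrix_mult_def sum_3)

lemma im_mat [simp]: "im (mat c) = mat (\<iota> c)"
  by (simp add: vec_eq_iff mat_def)

lemma im_invertible:
  assumes "over Q_lam A" "over Q_lam B" "A ** B = mat 1"
  shows "invertible (im A)" "matrix_inv (im A) = im B"
proof -
  have AB: "im A ** im B = mat 1" using im_mult[OF assms(1,2)] assms(3) by simp
  then have BA: "im B ** im A = mat 1" by (simp add: matrix_left_right_inverse)
  show "invertible (im A)" using AB BA by (auto simp: invertible_def)
  show "matrix_inv (im A) = im B" using AB BA by (rule matrix_inv_unique)
qed

lemma im_zmat [simp]: "over O_lam A \<Longrightarrow> zmat (im A)"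
  by (simp add: zmat_def over_def)

lemma bmat_im_nth: "bmat (im A) $ i $ j = par (A $ i $ j)"
  by (simp add: par_def)

end

section \<open>The Hermitian lattice L\<close>

lemma vec3_eqI: "x $ 1 = y $ 1 \<Longrightarrow> x $ 2 = y $ 2 \<Longrightarrow> x $ 3 = y $ 3 \<Longrightarrow> x = (y :: 'a ^ 3)"
  by (simp add: vec_eq_iff forall_3)

lemma mult3_nth: "(A ** B) $ i $ j = A $ i $ 1 * B $ 1 $ j + A $ i $ 2 * B $ 2 $ j + A $ i $ 3 * B $ 3 $ j"
  for A B :: "'a::semiring_1 ^ 3 ^ 3"
  by (simp add: matrix_matrix_mult_def sum_3)

lemma vmult3_nth: "(A *v x) $ i = A $ i $ 1 * x $ 1 + A $ i $ 2 * x $ 2 + A $ i $ 3 * x $ 3"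
  for A :: "'a::semiring_1 ^ 3 ^ 3"
  by (simp add: matrix_vector_mult_def sum_3)

section \<open>Unitary matrices and the Hermitian form\<close>

definition unitary :: "complex ^ 3 ^ 3 \<Rightarrow> bool" where "unitary A \<longleftrightarrow> adj A ** A = mat 1"

lemma unitary_right: "unitary A \<Longrightarrow> A ** adj A = mat 1"
  by (simp add: unitary_def matrix_left_right_inverse)

lemma unitary_mult: "unitary A \<Longrightarrow> unitary B \<Longrightarrow> unitary (A ** B)"
  unfolding unitary_def adj_mult by (metis matrix_mul_assoc matrix_mul_lid)

lemma unitary_adj: "unitary A \<Longrightarrow> unitary (adj A)"
  using unitary_right by (simp add: unitary_def)

lemma unitary_mat1 [simp]: "unitary (mat 1)"
  by (simp add: unitary_def)

lemma unitary_invertible: "unitary A \<Longrightarrow> invertible A"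
  using unitary_right unitary_def unfolding invertible_def by blast

lemma herm_adj: "herm (A *v x) y = herm x (adj A *v y)"
  by (simp add: herm_def vmult3_nth sum_3 algebra_simps)

lemma unitary_herm: "unitary A \<Longrightarrow> herm (A *v x) (A *v y) = herm x y"
  unfolding herm_adj by (simp add: matrix_vector_mul_assoc unitary_def)

lemma herm_axis: "herm (A *v axis i c) (A *v axis j c) = 1 / 2 * (c * cnj c) * (adj A ** A) $ j $ i"
  by (simp add: herm_def matrix_matrix_mult_def matrix_vector_mult_def axis_def if_distrib[of "\<lambda>x. _ * x"]
      sum_distrib_left sum_3 algebra_simps cong: if_cong)

text \<open>The scale \<open>c\<close> allows test vectors that lie in the lattice at hand: L
  contains the vectors \<open>axis i 2\<close> but not the unit vectors, which lie in
  \<open>lat_L_half\<close>.\<close>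

lemma unitary_if_herm:
  assumes "c \<noteq> 0" "\<And>i j. herm (A *v axis i c) (A *v axis j c) = herm (axis i c) (axis j c)"
  shows "unitary A"
proof -
  have "(adj A ** A) $ j $ i = mat 1 $ j $ i" for i j
  proof -
    have "1 / 2 * (c * cnj c) * (adj A ** A) $ j $ i = 1 / 2 * (c * cnj c) * (mat 1 :: complex ^ 3 ^ 3) $ j $ i"
      using assms(2)[of i j] herm_axis[of A i c j] herm_axis[of "mat 1" i c j] by simp
    then show ?thesis using assms(1) by simp
  qed
  then show ?thesis by (simp add: unitary_def vec_eq_iff)
qed

text \<open>The columns (2, 0, 0), (\<open>lambar\<close>, \<open>lambar\<close>, 0) and
  (\<open>lam\<close>, 1, 1) form an O-basis of L in triangular shape.\<close>

definition Bmat :: "complex ^ 3 ^ 3" where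
  "Bmat = vector [vector [2, lambar, lam], vector [0, lambar, 1], vector [0, 0, 1]]"

definition Binv :: "complex ^ 3 ^ 3" where
  "Binv = vector [vector [1 / 2, - 1 / 2, (1 - lam) / 2], vector [0, lam / 2, - lam / 2], vector [0, 0, 1]]"

text \<open>The Gram matrix of the basis \<open>Bmat\<close> for the form with its factor 1/2. The
  inverse \<open>Hinv\<close> also has entries in O, that is, L is unimodular; this turns
  integrality of an adjoint into integrality of an inverse.\<close>

definition Hmat :: "complex ^ 3 ^ 3" where
  "Hmat = vector [vector [2, lambar, lam], vector [lam, 2, -1], vector [lambar, -1, 2]]"

definition Hinv :: "complex ^ 3 ^ 3" where
  "Hinv = vector [vector [3, 2 + lam, 1 - lam], vector [1 - lam, 2, - lam], vector [2 + lam, 1 + lam, 2]]"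

lemmas mat3_simps = vec_eq_iff forall_3 mult3_nth

lemma lam_cancel: "lam * (lambar * x) = 2 * x" "lambar * (lam * x) = 2 * x"
  by (simp_all add: mult.assoc[symmetric] lam_lambar)

lemma Bmat_Binv: "Bmat ** Binv = mat 1" and Binv_Bmat: "Binv ** Bmat = mat 1"
proof -
  have l2: "lam * lam = - lam - 2" by (rule lam_square)
  show "Bmat ** Binv = mat 1"
    unfolding Bmat_def Binv_def lambar_eq by (simp add: mat3_simps mat_def field_simps) (use l2 in algebra)
  then show "Binv ** Bmat = mat 1" by (simp add: matrix_left_right_inverse)
qed

lemma adj_Bmat_Bmat: "adj Bmat ** Bmat = mat 2 ** Hmat"
  unfolding vec_eq_iff forall_3 mat_mult_nth
  using lam_square by (simp add: mult3_nth Bmat_def Hmat_def lambar_eq) algebra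

lemma Hmat_Hinv: "Hmat ** Hinv = mat 1"
  unfolding Hmat_def Hinv_def lambar_eq
  using lam_square by (simp add: mat3_simps mat_def) algebra

lemma over_Bmat [simp]: "over O_lam Bmat" and over_Hmat [simp]: "over O_lam Hmat"
  and over_Hinv [simp]: "over O_lam Hinv" and over_Binv [simp]: "over O_half Binv"
  by (simp_all add: over_def forall_3 Bmat_def Hmat_def Hinv_def Binv_def)

definition Ovec :: "(complex ^ 3) set" where "Ovec = {x. \<forall>i. x $ i \<in> O_lam}"

lemma lat_L_eq: "lat_L = (*v) Bmat ` Ovec"
proof (intro equalityI subsetI)
  fix x assume "x \<in> lat_L"
  then have O: "\<And>i. x $ i \<in> O_lam" and c: "\<And>i j. \<exists>c\<in>O_lam. x $ i - x $ j = lambar * c"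
    and s: "\<exists>c\<in>O_lam. x $ 1 + x $ 2 + x $ 3 = lam * c"
    by (auto simp: lat_L_def cong_O_def)
  obtain p where p: "p \<in> O_lam" "x $ 1 - x $ 2 = lambar * p" using c by blast
  obtain q where q: "q \<in> O_lam" "x $ 2 - x $ 3 = lambar * q" using c by blast
  obtain r where r: "r \<in> O_lam" "x $ 1 + x $ 2 + x $ 3 = lam * r" using s by blast
  text \<open>The element \<open>x1 - x2 + (1 - \<lambda>) x3\<close> equals \<open>\<lambda>\<close> times one element of \<open>O\<close>
    and the conjugate of \<open>\<lambda>\<close> times another, and \<open>1\<close> is an \<open>O\<close>-combination of \<open>\<lambda>\<close> and its conjugate.\<close>
  let ?t = "x $ 1 - x $ 2 + (1 - lam) * x $ 3"
  have l2: "lam * lam = - lam - 2" by (rule lam_square)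
  have u: "1 - lam = lambar * (1 + lam)" using l2 by (simp add: lambar_eq) algebra
  have t2: "?t = lambar * (p + (1 + lam) * x $ 3)" unfolding p(2) u by (simp add: algebra_simps)
  have t3: "?t = lam * (r - lambar * x $ 2 - x $ 3)" using r(2) l2 unfolding lambar_eq by algebra
  have "?t = - (lam + lambar) * ?t" by (simp add: lambar_eq)
  also have "\<dots> = - (lam * ?t) - lambar * ?t" by (simp add: algebra_simps)
  also have "lam * ?t = 2 * (p + (1 + lam) * x $ 3)" unfolding t2 by (simp add: lam_cancel)
  also have "lambar * ?t = 2 * (r - lambar * x $ 2 - x $ 3)" unfolding t3 by (simp add: lam_cancel)
  finally have t: "?t = 2 * (- (p + (1 + lam) * x $ 3) - (r - lambar * x $ 2 - x $ 3))" by (simp add: algebra_simps)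
  \<comment> \<open>Back substitution in the triangular system: the coordinates are
    \<open>?t / 2\<close>, \<open>(x $ 2 - x $ 3) / lambar\<close> and \<open>x $ 3\<close>.\<close>
  define y where "y = (vector [- (p + (1 + lam) * x $ 3) - (r - lambar * x $ 2 - x $ 3), q, x $ 3] :: complex ^ 3)"
  have "y \<in> Ovec" using O p q r by (simp add: y_def Ovec_def forall_3)
  moreover have "x = Bmat *v y"
  proof (rule vec3_eqI)
    show "x $ 1 = (Bmat *v y) $ 1" using t q(2) by (simp add: vmult3_nth Bmat_def y_def algebra_simps)
    show "x $ 2 = (Bmat *v y) $ 2" using q(2) by (simp add: vmult3_nth Bmat_def y_def algebra_simps)
    show "x $ 3 = (Bmat *v y) $ 3" by (simp add: vmult3_nth Bmat_def y_def)
  qed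
  ultimately show "x \<in> (*v) Bmat ` Ovec" by blast
next
  fix x assume "x \<in> (*v) Bmat ` Ovec"
  then obtain y where y: "\<And>i. y $ i \<in> O_lam" and x: "x = Bmat *v y" by (auto simp: Ovec_def)
  have x1: "x $ 1 = 2 * y $ 1 + lambar * y $ 2 + lam * y $ 3" and x2: "x $ 2 = lambar * y $ 2 + y $ 3" and x3: "x $ 3 = y $ 3"
    by (simp_all add: x vmult3_nth Bmat_def)
  have l2: "lam * lam = - lam - 2" by (rule lam_square)
  \<comment> \<open>Every coordinate is congruent to \<open>y $ 3\<close> modulo
    \<open>lambar\<close>; for the first one this rests on \<open>lam - 1\<close> and 2 being
    multiples of \<open>lambar\<close>.\<close>
  have 2: "x $ 2 = y $ 3 + lambar * y $ 2" by (simp add: x2)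
  have 1: "x $ 1 = y $ 3 + lambar * (lam * y $ 1 + y $ 2 - (1 + lam) * y $ 3)" unfolding x1 lambar_eq using l2 by algebra
  have cong: "\<exists>c\<in>O_lam. x $ i = y $ 3 + lambar * c" for i
    using 1 2 x3 y exhaust_3[of i] by (elim disjE) (auto intro!: bexI[of _ 0] bexI[of _ "y $ 2"] bexI[of _ "lam * y $ 1 + y $ 2 - (1 + lam) * y $ 3"])
  have "cong_O lambar (x $ i) (x $ j)" for i j
  proof -
    obtain c d where "c \<in> O_lam" "x $ i = y $ 3 + lambar * c" "d \<in> O_lam" "x $ j = y $ 3 + lambar * d"
      using cong by meson
    then show ?thesis unfolding cong_O_def by (intro bexI[of _ "c - d"]) (simp_all add: algebra_simps)
  qed
  moreover have "x $ 1 + x $ 2 + x $ 3 = lam * (lambar * y $ 1 + lambar * lambar * y $ 2 + (1 + lambar) * y $ 3)"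
    unfolding x1 x2 x3 lambar_eq using l2 by algebra
  then have "cong_O lam (x $ 1 + x $ 2 + x $ 3) 0"
    unfolding cong_O_def using y by (intro bexI) auto
  moreover have "x $ i \<in> O_lam" for i using cong[of i] y by auto
  ultimately show "x \<in> lat_L" by (simp add: lat_L_def)
qed

text \<open>Both congruences are modulo divisors of 2, so L contains 2 O^3 and inverting 2 removes
  them.\<close>

lemma lat_L_half_eq: "lat_L_half = {x. \<forall>i. x $ i \<in> O_half}"
proof (intro equalityI subsetI)
  fix x assume "x \<in> lat_L_half"
  then obtain n y where "x = (1 / 2 ^ n) *s y" "y \<in> lat_L" by (auto simp: lat_L_half_def)
  then show "x \<in> {x. \<forall>i. x $ i \<in> O_half}"
    by (auto simp: lat_L_def intro!: O_halfI)
next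
  fix x :: "complex ^ 3" assume "x \<in> {x. \<forall>i. x $ i \<in> O_half}"
  then have x: "x $ i \<in> O_half" for i by simp
  obtain a l where a: "a \<in> O_lam" "x $ 1 = a / 2 ^ l" using x by (meson O_half_cases)
  obtain b m where b: "b \<in> O_lam" "x $ 2 = b / 2 ^ m" using x by (meson O_half_cases)
  obtain c n where c: "c \<in> O_lam" "x $ 3 = c / 2 ^ n" using x by (meson O_half_cases)
  define y where "y = (vector [a * 2 ^ (m + n), b * 2 ^ (l + n), c * 2 ^ (l + m)] :: complex ^ 3)"
  have y: "y $ i \<in> O_lam" for i using exhaust_3[of i] a b c by (auto simp: y_def)
  have "2 *s y \<in> lat_L"
    unfolding lat_L_def cong_O_def
  proof (clarsimp simp: y, intro conjI allI)
    fix i j show "\<exists>c\<in>O_lam. 2 * y $ i - 2 * y $ j = lambar * c"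
      using y by (intro bexI[of _ "lam * (y $ i - y $ j)"]) (simp_all add: lam_cancel)
    show "\<exists>c\<in>O_lam. 2 * y $ 1 + 2 * y $ 2 + 2 * y $ 3 = lam * c"
      using y by (intro bexI[of _ "lambar * (y $ 1 + y $ 2 + y $ 3)"]) (simp_all add: lam_cancel)
  qed
  moreover have "x = (1 / 2 ^ Suc (l + m + n)) *s (2 *s y)"
    by (rule vec3_eqI) (simp_all add: a b c y_def power_add)
  ultimately show "x \<in> lat_L_half" unfolding lat_L_half_def by blast
qed

lemma over_half_vec:
  assumes "over O_half A" "x \<in> lat_L_half" shows "A *v x \<in> lat_L_half"
  using assms by (simp add: lat_L_half_eq over_def vmult3_nth)

lemma Gamma_L_eq: "Gamma_L = {A. over O_half A \<and> unitary A}"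
proof (intro equalityI subsetI CollectI conjI)
  fix A assume "A \<in> Gamma_L"
  then have bij: "bij_betw ((*v) A) lat_L_half lat_L_half"
    and herm: "\<And>x y. x \<in> lat_L_half \<Longrightarrow> y \<in> lat_L_half \<Longrightarrow> herm (A *v x) (A *v y) = herm x y"
    by (auto simp: Gamma_L_def isom_group_def)
  have ax: "axis i 1 \<in> lat_L_half" for i by (simp add: lat_L_half_eq axis_def)
  show "unitary A" by (rule unitary_if_herm[of 1]) (simp_all add: herm ax)
  have "A *v axis j 1 \<in> lat_L_half" for j using bij ax by (auto simp: bij_betw_def)
  then show "over O_half A" by (simp add: over_def lat_L_half_eq)
next
  fix A assume "A \<in> {A. over O_half A \<and> unitary A}"
  then have A: "over O_half A" "unitary A" by auto
  have "bij_betw ((*v) A) lat_L_half lat_L_half"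
    by (rule bij_betw_byWitness[where f' = "(*v) (adj A)"])
      (use A unitary_right in \<open>auto simp: matrix_vector_mul_assoc unitary_def over_half_vec\<close>)
  then show "A \<in> Gamma_L"
    using A over_half_Q[OF A(1)] by (auto simp: Gamma_L_def isom_group_def unitary_herm unitary_invertible over_def)
qed

lemma over_O_vec:
  assumes "over O_lam A" "x \<in> Ovec" shows "A *v x \<in> Ovec"
  using assms by (simp add: Ovec_def over_def vmult3_nth)

text \<open>If \<open>C\<close> is the matrix of the isometry in the basis of L, its inverse has the
  matrix \<open>Hinv ** adj C ** Hmat\<close>, which is integral because L is unimodular.\<close>

lemma adj_conj_integral:
  assumes "unitary A" "over O_lam (Binv ** A ** Bmat)"
  shows "over O_lam (Binv ** adj A ** Bmat)"
proof -
  have BB: "Hinv ** Hmat = mat 1" using Hmat_Hinv by (simp add: matrix_left_right_inverse)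
  have aB: "adj Binv ** adj Bmat = mat 1" "adj Bmat ** adj Binv = mat 1"
    unfolding adj_mult[symmetric] by (simp_all add: Bmat_Binv Binv_Bmat)
  let ?C = "Binv ** A ** Bmat"
  have "mat 2 ** (Hmat ** (Binv ** adj A ** Bmat)) = adj Bmat ** Bmat ** (Binv ** adj A ** Bmat)"
    by (simp add: adj_Bmat_Bmat matrix_mul_assoc)
  also have "\<dots> = adj Bmat ** adj A ** Bmat"
    by (metis Bmat_Binv matrix_mul_assoc matrix_mul_rid)
  also have "\<dots> = adj Bmat ** adj A ** adj Binv ** (adj Bmat ** Bmat)"
    by (metis aB(1) matrix_mul_assoc matrix_mul_rid)
  also have "\<dots> = adj ?C ** (mat 2 ** Hmat)"
    by (simp add: adj_mult adj_Bmat_Bmat matrix_mul_assoc)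
  also have "\<dots> = mat 2 ** (adj ?C ** Hmat)"
    by (metis mat_commute matrix_mul_assoc)
  finally have "Hmat ** (Binv ** adj A ** Bmat) = adj ?C ** Hmat"
    by (simp add: vec_eq_iff)
  then have "Binv ** adj A ** Bmat = Hinv ** (adj ?C ** Hmat)"
    by (metis BB matrix_mul_assoc matrix_mul_lid)
  then show ?thesis using assms(2) by simp
qed

lemma Isom_L_eq: "Isom_L = {A. over O_half A \<and> unitary A \<and> over O_lam (Binv ** A ** Bmat)}"
proof (intro equalityI subsetI CollectI conjI)
  fix A assume "A \<in> Isom_L"
  then have bij: "bij_betw ((*v) A) lat_L lat_L"
    and herm: "\<And>x y. x \<in> lat_L \<Longrightarrow> y \<in> lat_L \<Longrightarrow> herm (A *v x) (A *v y) = herm x y"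
    by (auto simp: Isom_L_def isom_group_def)
  \<comment> \<open>Twice a unit vector satisfies both congruences, since 2 =
    \<open>lam * lambar\<close>.\<close>
  have ax: "axis i 2 \<in> lat_L" for i
  proof -
    have "\<exists>c\<in>O_lam. axis i 2 $ a - axis i 2 $ b = lambar * c" for a b :: 3
      by (rule bexI[of _ "(if a = i then lam else 0) - (if b = i then lam else 0)"]) (auto simp: axis_def lam_lambar)
    moreover have "axis i 2 $ 1 + axis i 2 $ 2 + axis i 2 $ 3 = lam * lambar"
      using exhaust_3[of i] by (auto simp: axis_def lam_lambar)
    moreover have "axis i (2 :: complex) $ a \<in> O_lam" for a :: 3 by (simp add: axis_def)
    ultimately show ?thesis by (auto simp: lat_L_def cong_O_def)
  qed
  show "unitary A" by (rule unitary_if_herm[of 2]) (simp_all add: herm ax)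
  have "A *v axis j 2 \<in> lat_L" for j using bij ax by (auto simp: bij_betw_def)
  then have "(A *v axis j 2) $ i \<in> O_lam" for i j by (auto simp: lat_L_def)
  then have "(A *v axis j 2) $ i / 2 \<in> O_half" for i j by simp
  moreover have "(A *v axis j 2) $ i / 2 = A $ i $ j" for i j
    by (simp add: matrix_vector_mult_def axis_def if_distrib[of "\<lambda>x. _ * x"] cong: if_cong)
  ultimately show "over O_half A" by (simp add: over_def)
  show "over O_lam (Binv ** A ** Bmat)"
    unfolding over_def
  proof (intro allI)
    fix i j
    have "axis j 1 \<in> Ovec" by (simp add: Ovec_def axis_def)
    then have "A *v (Bmat *v axis j 1) \<in> lat_L" using bij by (auto simp: bij_betw_def lat_L_eq)
    then obtain y where y: "y \<in> Ovec" "A *v (Bmat *v axis j 1) = Bmat *v y" by (auto simp: lat_L_eq)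
    have "(Binv ** A ** Bmat) *v axis j 1 = y"
      using arg_cong[OF y(2), of "(*v) Binv"] by (simp add: matrix_vector_mul_assoc Binv_Bmat matrix_mul_assoc)
    then show "(Binv ** A ** Bmat) $ i $ j \<in> O_lam" using y(1)
      by (metis (mono_tags) Ovec_def matrix_vector_mul_axis mem_Collect_eq)
  qed
next
  fix A assume "A \<in> {A. over O_half A \<and> unitary A \<and> over O_lam (Binv ** A ** Bmat)}"
  then have A: "over O_half A" "unitary A" "over O_lam (Binv ** A ** Bmat)" by auto
  have maps: "X *v x \<in> lat_L" if X: "over O_lam (Binv ** X ** Bmat)" and x: "x \<in> lat_L" for X x
  proof -
    obtain y where y: "y \<in> Ovec" "x = Bmat *v y" using x by (auto simp: lat_L_eq)
    have "X *v x = Bmat *v ((Binv ** X ** Bmat) *v y)"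
      by (simp add: y matrix_vector_mul_assoc matrix_mul_assoc Bmat_Binv)
    then show ?thesis using over_O_vec[OF X y(1)] by (auto simp: lat_L_eq)
  qed
  have "bij_betw ((*v) A) lat_L lat_L"
    by (rule bij_betw_byWitness[where f' = "(*v) (adj A)"])
      (use A unitary_right adj_conj_integral maps in \<open>auto simp: matrix_vector_mul_assoc unitary_def\<close>)
  then show "A \<in> Isom_L"
    using A over_half_Q[OF A(1)] by (auto simp: Isom_L_def isom_group_def unitary_herm unitary_invertible over_def)
qed

lemma beta_Gamma: "beta_L \<in> Gamma_L"
proof -
  have inv: "1 / lam = lambar / 2" "- 1 / lam = - lambar / 2" using lam_lambar by (simp_all add: field_simps)
  have b: "beta_L = vector [vector [1, 0, 0], vector [0, lambar / 2, lambar / 2], vector [0, lambar / 2, - lambar / 2]]"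
    unfolding beta_L_def inv ..
  have "over O_half beta_L" by (simp add: b over_def forall_3)
  moreover have "unitary beta_L"
    unfolding unitary_def b by (simp add: mat3_simps mat_def lam_lambar)
  ultimately show ?thesis by (simp add: Gamma_L_eq)
qed

section \<open>The action on vertices and stabilizers\<close>

text \<open>The squared absolute values are nonnegative integers with sum 1, so a single coordinate
  is nonzero and it is a unit of O.\<close>

lemma O_vec_norm1:
  fixes x :: "complex ^ 3"
  assumes "\<And>i. x $ i \<in> O_lam" "(\<Sum>i\<in>UNIV. (cmod (x $ i))\<^sup>2) = 1"
  obtains j s where "s = 1 \<or> s = -1" "x = axis j s"
proof -
  obtain n :: "3 \<Rightarrow> int" where n: "\<And>i. n i \<ge> 0 \<and> (cmod (x $ i))\<^sup>2 = of_int (n i) \<and> (x $ i \<noteq> 0 \<longrightarrow> n i \<ge> 1)"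
    using O_lam_norm_Ints[OF assms(1)] by metis
  have "of_int (n 1 + n 2 + n 3) = (1 :: real)" using assms(2) n by (simp add: sum_3)
  then have s: "n 1 + n 2 + n 3 = 1" by (simp only: of_int_eq_1_iff)
  have ge: "n 1 \<ge> 0" "n 2 \<ge> 0" "n 3 \<ge> 0" using n by auto
  have "\<exists>j. n j = 1 \<and> (\<forall>i. i \<noteq> j \<longrightarrow> n i = 0)"
  proof -
    consider "n 1 = 1" "n 2 = 0" "n 3 = 0" | "n 1 = 0" "n 2 = 1" "n 3 = 0" | "n 1 = 0" "n 2 = 0" "n 3 = 1"
      using s ge by linarith
    then show ?thesis by cases (auto simp: forall_3)
  qed
  then obtain j where j: "n j = 1" "\<And>i. i \<noteq> j \<Longrightarrow> n i = 0" by blast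
  have "x $ j = 1 \<or> x $ j = -1" using O_lam_norm1[OF assms(1), of j] n[of j] j(1) by simp
  moreover have "x = axis j (x $ j)" using j(2) n by (force simp: axis_def vec_eq_iff)
  ultimately show thesis using that by blast
qed

lemma unitary_row_norm: "unitary A \<Longrightarrow> (\<Sum>j\<in>UNIV. (cmod (A $ i $ j))\<^sup>2) = 1"
proof -
  assume "unitary A"
  then have "(A ** adj A) $ i $ i = 1" by (simp add: unitary_right mat_def)
  then have "complex_of_real (\<Sum>j\<in>UNIV. (cmod (A $ i $ j))\<^sup>2) = 1"
    by (simp add: matrix_matrix_mult_def complex_norm_square[symmetric] del: of_real_power)
  then show ?thesis by (simp only: of_real_eq_1_iff)
qed

lemma unitary_column_norm: "unitary A \<Longrightarrow> (\<Sum>i\<in>UNIV. (cmod (A $ i $ j))\<^sup>2) = 1"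
  using unitary_row_norm[OF unitary_adj, of A j] by simp

text \<open>Each row has norm 1 and hence one nonzero entry, and orthogonality keeps two rows from
  sharing a column. Thus integral unitary matrices are signed permutation matrices.\<close>

lemma integral_unitary_monomial:
  assumes "over O_lam A" "unitary A"
  obtains \<pi> s where "inj \<pi>" "\<And>i. s i = 1 \<or> s i = -1" "A = (\<chi> i j. if j = \<pi> i then s i else 0)"
proof -
  have "\<exists>j s. (s = 1 \<or> s = -1) \<and> A $ i = axis j s" for i
    using O_vec_norm1[of "A $ i"] assms unitary_row_norm by (metis over_def)
  then obtain \<pi> s where s: "\<And>i. s i = 1 \<or> s i = -1" and A: "\<And>i. A $ i = axis (\<pi> i) (s i)" by metis
  have "inj \<pi>"
  proof (rule injI, rule ccontr)
    fix i j assume "\<pi> i = \<pi> j" "i \<noteq> j"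
    have "(A ** adj A) $ i $ j = 0" using \<open>i \<noteq> j\<close> assms by (simp add: unitary_right mat_def)
    then have "s i * cnj (s j) = 0"
      using \<open>\<pi> i = \<pi> j\<close> by (simp add: matrix_matrix_mult_def A axis_def if_distrib[of "\<lambda>x. x * _"] cong: if_cong)
    then show False using s[of i] s[of j] by auto
  qed
  moreover have "A = (\<chi> i j. if j = \<pi> i then s i else 0)" by (simp add: vec_eq_iff A axis_def)
  ultimately show thesis using that s by blast
qed

definition U_half :: "(complex ^ 3 ^ 3) set" where "U_half = {A. over O_half A \<and> unitary A}"

lemma U_half_mult: "A \<in> U_half \<Longrightarrow> B \<in> U_half \<Longrightarrow> A ** B \<in> U_half"
  by (simp add: U_half_def unitary_mult)

lemma U_half_adj: "A \<in> U_half \<Longrightarrow> adj A \<in> U_half"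
  by (simp add: U_half_def unitary_adj)

lemma U_half_1 [simp]: "mat 1 \<in> U_half"
  by (simp add: U_half_def)

lemma U_half_unitary: "A \<in> U_half \<Longrightarrow> unitary A"
  by (simp add: U_half_def)

lemma U_halfI: "over O_half A \<Longrightarrow> unitary A \<Longrightarrow> A \<in> U_half"
  by (simp add: U_half_def)

lemma U_half_over [simp]: "A \<in> U_half \<Longrightarrow> over O_half A" "A \<in> U_half \<Longrightarrow> over Q_lam A"
  by (simp_all add: U_half_def)

lemma vtx_mult_cong:
  assumes "invertible X" "invertible Y" "vtx X = vtx Y"
  shows "vtx (g ** X) = vtx (g ** Y)"
  using vertex_action_vtx[OF assms(1), of g] vertex_action_vtx[OF assms(2), of g] assms(3) by simp

lemma mat_GLZ: "c \<in> UU \<Longrightarrow> mat c \<in> GLZ"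
proof -
  assume c: "c \<in> UU"
  have z: "zmat (mat x)" if "x \<in> ZZ" for x using that by (simp add: zmat_def mat_def)
  show ?thesis
    unfolding GLZ_def using c z by (auto simp: UU_def intro!: exI[of _ "mat (inverse c)"])
qed

section \<open>Images in PGL_3(Q_2) and vertex stabilizers\<close>

context dyadic
begin

lemma im_1 [simp]: "im (mat 1) = mat 1"
  by simp

lemma im_smult: "c \<in> Q_lam \<Longrightarrow> over Q_lam A \<Longrightarrow> im (mat c ** A) = mat (\<iota> c) ** im A"
  by (simp add: im_mult)

lemma im_unitary_invertible:
  assumes "A \<in> U_half"
  shows "invertible (im A)" "matrix_inv (im A) = im (adj A)"
  using im_invertible[of A "adj A"] assms U_half_adj[OF assms]
  by (simp_all add: unitary_right[OF U_half_unitary])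

definition PG :: "(q2 ^ 3 ^ 3) set set" where "PG = (\<lambda>A. to_PGL3 (im A)) ` U_half"

lemma PGamma_L_eq: "PGamma_L \<iota> = PG"
  by (simp add: PGamma_L_def PG_def Gamma_L_eq U_half_def im_def image_image del: U_half_over)

lemma PIsom_L_eq: "PIsom_L \<iota> = (\<lambda>A. to_PGL3 (im A)) ` Isom_L"
  by (simp add: PIsom_L_def im_def image_image)

lemma PG_mult: "A \<in> U_half \<Longrightarrow> B \<in> U_half \<Longrightarrow> to_PGL3 (im A) \<otimes>\<^bsub>PGL3\<^esub> to_PGL3 (im B) = to_PGL3 (im (A ** B))"
  by (simp add: im_mult im_unitary_invertible)

lemma PG_inv: "A \<in> U_half \<Longrightarrow> inv\<^bsub>PGL3\<^esub> (to_PGL3 (im A)) = to_PGL3 (im (adj A))"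
  by (simp add: PGL3_inv im_unitary_invertible)

lemma PG_subgroup: "subgroup PG PGL3"
proof (rule PGL3.subgroupI)
  show "PG \<subseteq> carrier PGL3" by (auto simp: PG_def im_unitary_invertible)
  show "PG \<noteq> {}" using U_half_1 unfolding PG_def by blast
qed (auto simp: PG_def PG_mult PG_inv U_half_mult U_half_adj)

lemma O_half_power [simp]: "x \<in> O_half \<Longrightarrow> x ^ n \<in> O_half"
  by (induction n) simp_all

lemma iota_half_power: "x \<in> O_half \<Longrightarrow> \<iota> (x ^ n) = \<iota> x ^ n"
  by (induction n) simp_all

lemma UU_power: "x \<in> UU \<Longrightarrow> x ^ n \<in> UU"
  by (induction n) (simp_all add: UU_mult)

text \<open>The element z = \<open>lam * lam / 2\<close> equals \<open>lam / lambar\<close>: it has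
  absolute value 1, but valuation 1 under the embedding. Its powers compensate a 2-adic scalar, up
  to a unit of Z_2, without leaving the unitary group.\<close>

lemma unit_of_valuation:
  obtains y w where "y \<in> O_half" "y * cnj y = 1" "w \<in> UU" "\<iota> y = 2 powi k * w"
proof -
  define z where "z = lam * lam / 2"
  have z: "z \<in> O_half" "z * cnj z = 1"
    by (simp_all add: z_def) (simp add: lam_cancel lam_lambar mult.assoc mult.left_commute)
  obtain u where u: "u \<in> UU" "\<iota> lam = 2 * u" using iota_lam by blast
  have "\<iota> z = 2 * (u * u)" by (simp add: z_def u)
  then have iz: "\<iota> (z ^ n) = 2 ^ n * (u * u) ^ n" for n
    using z(1) by (simp only: iota_half_power power_mult_distrib[of 2])
  have uu: "(u * u) ^ n \<in> UU" for n using u by (simp add: UU_power UU_mult)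
  have zz: "z ^ n * cnj z ^ n = 1" for n using z(2) by (simp only: power_mult_distrib[symmetric]) simp
  show thesis
  proof (cases k rule: int_cases2)
    case (nonneg n)
    have "\<iota> (z ^ n) = 2 powi k * (u * u) ^ n" using iz[of n] nonneg by simp
    then show ?thesis using that[of "z ^ n" "(u * u) ^ n"] uu zz z by simp
  next
    case (nonpos n)
    have c: "cnj z ^ n \<in> O_half" using z(1) by simp
    have "\<iota> (z ^ n) * \<iota> (cnj z ^ n) = 1"
      using zz[of n] c z(1) iota_mult[of "z ^ n" "cnj z ^ n"] by simp
    then have "inverse (\<iota> (z ^ n)) = \<iota> (cnj z ^ n)" by (rule inverse_unique)
    then have "\<iota> (cnj z ^ n) = 2 powi k * inverse ((u * u) ^ n)"
      using iz[of n] unfolding nonpos power_int_minus power_int_of_nat by (simp only: inverse_mult_distrib)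
    moreover have "cnj z ^ n * cnj (cnj z ^ n) = 1" using zz[of n] by (simp add: mult.commute)
    ultimately show ?thesis
      using that[of "cnj z ^ n" "inverse ((u * u) ^ n)"] UU_inverse[OF uu] c by blast
  qed
qed

text \<open>The scalar is a power of \<open>\<lambda>\<close> over its conjugate; unitarity turns integrality of the inverse
  at \<open>\<lambda>\<close> into integrality at the conjugate prime.\<close>

lemma stabilizer_frame:
  assumes P: "over O_half P" "over O_half P'" "P ** P' = mat 1"
    and H: "over O_lam H" "over O_lam H'" "H ** H' = mat 1"
    and adjP: "\<And>A. unitary A \<Longrightarrow> adj (P' ** A ** P) = H ** (P' ** adj A ** P) ** H'"
  shows "stabilizer (PGL3\<lparr>carrier := PG\<rparr>) vertex_action (vtx (im P)) =
    (\<lambda>A. to_PGL3 (im A)) ` {A \<in> U_half. over O_lam (P' ** A ** P)}"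
proof -
  have P'P: "P' ** P = mat 1" using P(3) by (simp add: matrix_left_right_inverse)
  have H'H: "H' ** H = mat 1" using H(3) by (simp add: matrix_left_right_inverse)
  have invP: "invertible (im P)" "matrix_inv (im P) = im P'"
    using im_invertible[of P P'] P by simp_all
  have imP: "im P' ** im P = mat 1" using invP by (metis matrix_inv_left)
  have CC: "(P' ** A ** P) ** (P' ** adj A ** P) = mat 1" if "unitary A" for A
  proof -
    have "(P' ** A ** P) ** (P' ** adj A ** P) = P' ** A ** (P ** P') ** adj A ** P"
      by (simp only: matrix_mul_assoc)
    also have "\<dots> = P' ** (A ** adj A) ** P" by (simp only: P(3) matrix_mul_rid matrix_mul_assoc)
    finally show ?thesis by (simp add: unitary_right that P'P)
  qed
  have fwd: "\<exists>A'\<in>U_half. over O_lam (P' ** A' ** P) \<and> to_PGL3 (im A) = to_PGL3 (im A')"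
    if A: "A \<in> U_half" "vtx (im A ** im P) = vtx (im P)" for A
  proof -
    have "invertible (im A ** im P)" using A invP by (simp add: invertible_mult' im_unitary_invertible)
    then obtain c U where c: "c \<noteq> 0" "U \<in> GLZ" "im A ** im P = mat c ** im P ** U"
      using vtx_eq_iff[OF invP(1)] A(2) by metis
    obtain k u where k: "u \<in> UU" "c = 2 powi k * u" using q2_decomp[OF c(1)] by blast
    obtain y w where y: "y \<in> O_half" "y * cnj y = 1" "w \<in> UU" "\<iota> y = 2 powi (- k) * w"
      by (rule unit_of_valuation)
    define A' where "A' = mat y ** A"
    have "adj A' ** A' = mat (cnj y * y) ** (adj A ** A)"
      by (simp add: A'_def adj_mult) (metis mat_commute mat_mat matrix_mul_assoc)
    then have uA': "unitary A'"
      using U_half_unitary[OF A(1)] y by (simp add: unitary_def mult.commute)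
    have A': "A' \<in> U_half" by (rule U_halfI[OF _ uA']) (use A y in \<open>simp add: A'_def\<close>)
    have "y \<noteq> 0" using y(2) by auto
    then have iy: "\<iota> y \<noteq> 0" using y(1) by simp
    have imA': "im A' = mat (\<iota> y) ** im A" using A y by (simp add: A'_def im_smult)
    have e: "\<iota> y * c = w * u" by (simp add: k y power_int_minus)
    define V where "V = mat (w * u) ** U"
    have "w * u \<in> UU" using k y UU_mult by blast
    then have "mat (w * u) \<in> GLZ"
      by (rule mat_GLZ)
    then have V: "V \<in> GLZ" unfolding V_def using c(2) by (rule GLZ_mult)
    let ?C = "P' ** A' ** P" and ?D = "P' ** adj A' ** P"
    have ov: "over O_half ?C" "over O_half ?D" using P A' U_half_adj[OF A'] by simp_all
    have "im A' ** im P = im P ** V"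
      unfolding imA' V_def e[symmetric] matrix_mul_assoc[symmetric] c(3)
      by (metis mat_commute mat_mat matrix_mul_assoc)
    then have imC: "im ?C = V"
      using P A' by (simp add: im_mult matrix_mul_assoc[symmetric]) (simp add: matrix_mul_assoc imP)
    have "matrix_inv (im ?C) = im ?D"
      using im_invertible(2)[OF _ _ CC[OF uA']] ov by simp
    then have "im ?D \<in> GLZ" using V imC GLZ_inv by metis
    then have "zmat (im H ** im ?D ** im H')" using H GLZ_zmat by (intro zmat_mult) auto
    moreover have "im (adj ?C) = im H ** im ?D ** im H'"
      unfolding adjP[OF uA'] using H ov by (simp add: im_mult)
    ultimately have "zmat (im (adj ?C))" by simp
    then have "\<iota> (?C $ i $ j) \<in> ZZ" "\<iota> (cnj (?C $ i $ j)) \<in> ZZ" for i j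
      using GLZ_zmat[OF V] unfolding imC[symmetric] zmat_def im_nth adj_nth by blast+
    then have "over O_lam ?C" using O_half_integral ov(1) unfolding over_def by blast
    moreover have "to_PGL3 (im A) = to_PGL3 (im A')" using imA' iy by simp
    ultimately show ?thesis using A' by blast
  qed
  have bwd: "vtx (im A ** im P) = vtx (im P)" if A: "A \<in> U_half" "over O_lam (P' ** A ** P)" for A
  proof -
    let ?C = "P' ** A ** P" and ?D = "P' ** adj A ** P"
    have uA: "unitary A" using A by (simp add: U_half_unitary)
    have "H' ** adj ?C ** H = (H' ** H) ** ?D ** (H' ** H)"
      unfolding adjP[OF uA] by (simp only: matrix_mul_assoc)
    then have "?D = H' ** adj ?C ** H" by (simp add: H'H)
    then have oD: "over O_lam ?D" using A(2) H by simp
    have CD: "im ?C ** im ?D = mat 1" using im_mult[of ?C ?D] CC[OF uA] A(2) oD by simp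
    then have "im ?D ** im ?C = mat 1" by (simp add: matrix_left_right_inverse)
    moreover have "zmat (im ?C)" "zmat (im ?D)" using A(2) oD by simp_all
    ultimately have "im ?C \<in> GLZ" unfolding GLZ_def using CD by blast
    moreover have "im A ** im P = im P ** im ?C"
    proof -
      have "A ** P = P ** ?C" by (metis P(3) matrix_mul_assoc matrix_mul_lid)
      then show ?thesis using P A by (metis U_half_over(2) im_mult over_O_Q over_half_Q)
    qed
    ultimately show ?thesis by simp
  qed
  show ?thesis
  proof (intro equalityI subsetI)
    fix g assume "g \<in> stabilizer (PGL3\<lparr>carrier := PG\<rparr>) vertex_action (vtx (im P))"
    then obtain A where "A \<in> U_half" "g = to_PGL3 (im A)" "vtx (im A ** im P) = vtx (im P)"
      using invP by (auto simp: stabilizer_def PG_def)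
    then show "g \<in> (\<lambda>A. to_PGL3 (im A)) ` {A \<in> U_half. over O_lam (P' ** A ** P)}"
      using fwd[of A] by auto
  next
    fix g assume "g \<in> (\<lambda>A. to_PGL3 (im A)) ` {A \<in> U_half. over O_lam (P' ** A ** P)}"
    then show "g \<in> stabilizer (PGL3\<lparr>carrier := PG\<rparr>) vertex_action (vtx (im P))"
      using invP bwd by (auto simp: stabilizer_def PG_def)
  qed
qed

lemma stabilizer_standard:
  "stabilizer (PGL3\<lparr>carrier := PG\<rparr>) vertex_action (vtx (mat 1)) =
    (\<lambda>A. to_PGL3 (im A)) ` {A. over O_lam A \<and> unitary A}"
proof -
  have "{A \<in> U_half. over O_lam (mat 1 ** A ** mat 1)} = {A. over O_lam A \<and> unitary A}"
    using U_halfI U_half_unitary by auto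
  then show ?thesis
    using stabilizer_frame[of "mat 1" "mat 1" "mat 1" "mat 1"] by simp
qed

lemma stabilizer_L:
  "stabilizer (PGL3\<lparr>carrier := PG\<rparr>) vertex_action (vtx (im Bmat)) = PIsom_L \<iota>"
proof -
  have e: "adj Bmat ** Bmat ** Hinv = mat 2"
    by (metis adj_Bmat_Bmat Hmat_Hinv matrix_mul_assoc matrix_mul_rid)
  \<comment> \<open>In the coordinates of \<open>Bmat\<close> the adjoint is the inverse conjugated
    by the Gram matrix. The factor 2 from \<open>adj_Bmat_Bmat\<close> is carried along and
    cancelled at the end.\<close>
  have adjB: "adj (Binv ** A ** Bmat) = Hmat ** (Binv ** adj A ** Bmat) ** Hinv" if "unitary A" for A
  proof -
    have "mat 2 ** (Hmat ** (Binv ** adj A ** Bmat) ** Hinv) = adj Bmat ** Bmat ** (Binv ** adj A ** Bmat) ** Hinv"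
      by (simp add: adj_Bmat_Bmat matrix_mul_assoc)
    also have "\<dots> = adj Bmat ** adj A ** Bmat ** Hinv"
      by (metis Bmat_Binv matrix_mul_assoc matrix_mul_rid)
    also have "\<dots> = adj Bmat ** adj A ** (adj Binv ** adj Bmat) ** Bmat ** Hinv"
      unfolding adj_mult[symmetric] Bmat_Binv by simp
    also have "\<dots> = adj (Binv ** A ** Bmat) ** (adj Bmat ** Bmat ** Hinv)"
      by (simp only: adj_mult matrix_mul_assoc)
    also have "\<dots> = mat 2 ** adj (Binv ** A ** Bmat)"
      unfolding e by (rule mat_commute)
    finally show ?thesis by (simp add: vec_eq_iff)
  qed
  show ?thesis
    unfolding PIsom_L_eq
    by (subst stabilizer_frame[of Bmat Binv Hmat Hinv])
      (auto simp: Bmat_Binv Hmat_Hinv adjB U_half_def Isom_L_eq simp del: U_half_over)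
qed

end

section \<open>The isometry group of L\<close>

definition mk3 :: "'a \<Rightarrow> 'a \<Rightarrow> 'a \<Rightarrow> 'a \<Rightarrow> 'a \<Rightarrow> 'a \<Rightarrow> 'a \<Rightarrow> 'a \<Rightarrow> 'a \<Rightarrow> 'a::zero ^ 3 ^ 3" where
  "mk3 a b c d e f g h i = vector [vector [a, b, c], vector [d, e, f], vector [g, h, i]]"

lemma mk3_nth [simp]:
  "mk3 a b c d e f g h i $ 1 $ 1 = a" "mk3 a b c d e f g h i $ 1 $ 2 = b" "mk3 a b c d e f g h i $ 1 $ 3 = c"
  "mk3 a b c d e f g h i $ 2 $ 1 = d" "mk3 a b c d e f g h i $ 2 $ 2 = e" "mk3 a b c d e f g h i $ 2 $ 3 = f"
  "mk3 a b c d e f g h i $ 3 $ 1 = g" "mk3 a b c d e f g h i $ 3 $ 2 = h" "mk3 a b c d e f g h i $ 3 $ 3 = i"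
  by (simp_all add: mk3_def)

lemma mk3_eta: "A = mk3 (A$1$1) (A$1$2) (A$1$3) (A$2$1) (A$2$2) (A$2$3) (A$3$1) (A$3$2) (A$3$3)"
  by (simp add: vec_eq_iff forall_3)

lemma mk3_eq_iff: "mk3 a b c d e f g h i = mk3 a' b' c' d' e' f' g' h' i' \<longleftrightarrow>
  a = a' \<and> b = b' \<and> c = c' \<and> d = d' \<and> e = e' \<and> f = f' \<and> g = g' \<and> h = h' \<and> i = i'"
  by (auto simp: vec_eq_iff forall_3)

lemma mk3_mult:
  fixes a :: "'a::semiring_1"
  shows "mk3 a b c d e f g h i ** mk3 a' b' c' d' e' f' g' h' i' =
    mk3 (a * a' + b * d' + c * g') (a * b' + b * e' + c * h') (a * c' + b * f' + c * i')
        (d * a' + e * d' + f * g') (d * b' + e * e' + f * h') (d * c' + e * f' + f * i')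
        (g * a' + h * d' + i * g') (g * b' + h * e' + i * h') (g * c' + h * f' + i * i')"
  by (simp add: vec_eq_iff forall_3 mult3_nth)

lemma mat1_mk3: "mat 1 = mk3 1 0 0 0 1 0 0 0 1"
  by (simp add: vec_eq_iff forall_3 mat_def)

section \<open>Generation and order of GL_3(F_2)\<close>

lemma bit_cases: obtains "x = (0 :: bit)" | "x = 1"
  by (cases x) auto

lemma bit_cancel: "b + (x + b) = x" "x + b + b = x" "b + (b + x) = (x :: bit)"
  by (cases x; cases b; simp)+

text \<open>Gaussian elimination by transvections: the lower right block, then the first row, then
  the first column, and finally matrices whose upper left entry vanishes. Closure under products is
  enough, since transvections over F_2 are involutions.\<close>

lemma GL3_F2_generated:
  fixes M :: "bit ^ 3 ^ 3"
  assumes "invertible M"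
    and mult: "\<And>A B. P A \<Longrightarrow> P B \<Longrightarrow> P (A ** B)"
    and E: "P (mk3 1 1 0 0 1 0 0 0 1)" "P (mk3 1 0 1 0 1 0 0 0 1)" "P (mk3 1 0 0 1 1 0 0 0 1)"
      "P (mk3 1 0 0 0 1 1 0 0 1)" "P (mk3 1 0 0 0 1 0 1 0 1)" "P (mk3 1 0 0 0 1 0 0 1 1)"
  shows "P M"
proof -
  note E12 = E(1) and E13 = E(2) and E21 = E(3) and E23 = E(4) and E31 = E(5) and E32 = E(6)
  have L0: "P (mk3 1 0 0 0 e f 0 h i)" if d: "det (mk3 1 0 0 0 e f 0 h i :: bit ^ 3 ^ 3) \<noteq> 0" for e f h i
  proof -
    \<comment> \<open>The six elements of GL_2(F_2) are the two transvections, their two products,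
      the swap, and the identity as a square.\<close>
    have 1: "P (mk3 1 0 0 0 1 0 0 0 1)" using mult[OF E12 E12] by (simp add: mk3_mult)
    have 2: "P (mk3 1 0 0 0 0 1 0 1 1)" using mult[OF E23 E32] mult[OF E32 E23] by (simp add: mk3_mult)
    have 3: "P (mk3 1 0 0 0 1 1 0 1 0)" using mult[OF E23 E32] mult[OF E32 E23] by (simp add: mk3_mult)
    have 4: "P (mk3 1 0 0 0 0 1 0 1 0)" using mult[OF mult[OF E23 E32] E23] by (simp add: mk3_mult)
    show ?thesis using d 1 2 3 4 E23 E32
      by (cases e rule: bit_cases; cases f rule: bit_cases; cases h rule: bit_cases; cases i rule: bit_cases)
        (simp_all add: det_3)
  qed
  have L1: "P (mk3 1 b c 0 e f 0 h i)" if d: "det (mk3 1 b c 0 e f 0 h i :: bit ^ 3 ^ 3) \<noteq> 0" for b c e f h i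
  proof -
    have P0: "P (mk3 1 0 0 0 e f 0 h i)" using d by (intro L0) (simp add: det_3)
    have "P (mk3 1 b 0 0 e f 0 h i)"
      using P0 mult[OF P0 E12] by (cases b rule: bit_cases) (simp_all add: mk3_mult del: add_bit_eq_xor mult_bit_eq_and)
    from this mult[OF this E13] show ?thesis
      by (cases c rule: bit_cases) (simp_all add: mk3_mult del: add_bit_eq_xor mult_bit_eq_and)
  qed
  have L2: "P (mk3 1 b c d e f g h i)" if dt: "det (mk3 1 b c d e f g h i :: bit ^ 3 ^ 3) \<noteq> 0" for b c d e f g h i
  proof -
    have a: "P (mk3 1 b c 0 e f g h i)" if "det (mk3 1 b c 0 e f g h i :: bit ^ 3 ^ 3) \<noteq> 0" for e f h i
    proof (cases g rule: bit_cases)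
      case 1 then show ?thesis using L1 that by simp
    next
      case 2
      have "det (mk3 1 b c 0 e f 0 (h + b) (i + c)) \<noteq> 0"
        using that 2 by (simp add: det_3 algebra_simps del: add_bit_eq_xor mult_bit_eq_and)
      then have "P (mk3 1 0 0 0 1 0 1 0 1 ** mk3 1 b c 0 e f 0 (h + b) (i + c))"
        by (intro mult E31 L1)
      then show ?thesis unfolding mk3_mult 2 by (simp add: bit_cancel del: add_bit_eq_xor mult_bit_eq_and)
    qed
    show ?thesis
    proof (cases d rule: bit_cases)
      case 1 then show ?thesis using a dt by simp
    next
      case 2
      have "det (mk3 1 b c 0 (e + b) (f + c) g h i) \<noteq> 0"
        using dt 2 by (simp add: det_3 algebra_simps del: add_bit_eq_xor mult_bit_eq_and)
      then have "P (mk3 1 0 0 1 1 0 0 0 1 ** mk3 1 b c 0 (e + b) (f + c) g h i)"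
        by (intro mult E21 a)
      then show ?thesis unfolding mk3_mult 2 by (simp add: bit_cancel del: add_bit_eq_xor mult_bit_eq_and)
    qed
  qed
  define a b c d e f g h i where abc: "a = M$1$1" "b = M$1$2" "c = M$1$3" "d = M$2$1" "e = M$2$2" "f = M$2$3"
    "g = M$3$1" "h = M$3$2" "i = M$3$3"
  have M: "M = mk3 a b c d e f g h i" unfolding abc by (rule mk3_eta)
  have dM: "det (mk3 a b c d e f g h i) \<noteq> 0" using assms(1) by (simp add: M[symmetric] invertible_det_nz)
  show ?thesis
  proof (cases a rule: bit_cases)
    case 2 then show ?thesis using L2 dM by (simp add: M)
  next
    case 1
    show ?thesis
    proof (cases d rule: bit_cases)
      case 2
      have "det (mk3 1 (b + e) (c + f) 1 e f g h i) \<noteq> 0"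
        using dM 1 2 by (simp add: det_3 algebra_simps del: add_bit_eq_xor mult_bit_eq_and)
      then have "P (mk3 1 1 0 0 1 0 0 0 1 ** mk3 1 (b + e) (c + f) 1 e f g h i)"
        by (intro mult E12 L2)
      then show ?thesis unfolding mk3_mult M 1 2 by (simp add: bit_cancel del: add_bit_eq_xor mult_bit_eq_and)
    next
      case d: 1
      have g: "g = 1" using dM 1 d by (cases g rule: bit_cases) (simp_all add: det_3)
      have "det (mk3 1 (b + h) (c + i) 0 e f 1 h i) \<noteq> 0"
        using dM 1 d g by (simp add: det_3 algebra_simps del: add_bit_eq_xor mult_bit_eq_and)
      then have "P (mk3 1 0 1 0 1 0 0 0 1 ** mk3 1 (b + h) (c + i) 0 e f 1 h i)"
        by (intro mult E13 L2)
      then show ?thesis unfolding mk3_mult M 1 d g by (simp add: bit_cancel del: add_bit_eq_xor mult_bit_eq_and)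
    qed
  qed
qed

lemma card_filter: "finite S \<Longrightarrow> card {t \<in> S. P t} = (\<Sum>t\<in>S. if P t then 1 else 0)"
  by (simp add: sum.If_cases Int_def)

lemma det_mk3_bit: "det (mk3 a b c d e f g h i) = g * (b * f + c * e) + h * (c * d + a * f) + i * (a * e + b * d)"
  for a :: bit
  by (simp add: det_3 algebra_simps del: add_bit_eq_xor mult_bit_eq_and)

text \<open>Here x, y, z play the role of the minors of the first two rows. A nonzero linear form on
  F_2^3 is nonzero at four of the eight vectors.\<close>

lemma sum_last_row: "(\<Sum>g\<in>{0, 1}. \<Sum>h\<in>{0, 1}. \<Sum>i\<in>{0, 1}. if g * x + h * y + i * z \<noteq> 0 then 1 else 0) =
    (if x = 0 \<and> y = 0 \<and> z = 0 then 0 else 4 :: nat)" for x y z :: bit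
  by (cases x rule: bit_cases; cases y rule: bit_cases; cases z rule: bit_cases) simp_all

text \<open>For a nonzero first row, the minors all vanish only if the second row is zero or equal
  to the first. Six second rows remain, each with four third rows.\<close>

lemma sum_middle_row: "(\<Sum>d\<in>{0, 1}. \<Sum>e\<in>{0, 1}. \<Sum>f\<in>{0, 1}.
      if b * f + c * e = 0 \<and> c * d + a * f = 0 \<and> a * e + b * d = 0 then 0 else 4) =
    (if a = 0 \<and> b = 0 \<and> c = 0 then 0 else 24 :: nat)" for a b c :: bit
  by (cases a rule: bit_cases; cases b rule: bit_cases; cases c rule: bit_cases) simp_all

lemma card_GL3_F2: "card {M :: bit ^ 3 ^ 3. invertible M} = 168"
proof -
  define D :: "bit \<times> bit \<times> bit \<times> bit \<times> bit \<times> bit \<times> bit \<times> bit \<times> bit \<Rightarrow> bit" where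
    "D = (\<lambda>(a, b, c, d, e, f, g, h, i). det (mk3 a b c d e f g h i))"
  define m :: "bit \<times> bit \<times> bit \<times> bit \<times> bit \<times> bit \<times> bit \<times> bit \<times> bit \<Rightarrow> bit ^ 3 ^ 3" where
    "m = (\<lambda>(a, b, c, d, e, f, g, h, i). mk3 a b c d e f g h i)"
  define T :: "bit set" where "T = {0, 1}"
  have T: "finite T" "x \<in> T" for x by (auto simp: T_def)
  let ?S = "T \<times> T \<times> T \<times> T \<times> T \<times> T \<times> T \<times> T \<times> T"
  have "inj m" by (auto simp: m_def inj_on_def mk3_eq_iff)
  moreover have "{M :: bit ^ 3 ^ 3. invertible M} = m ` {t \<in> ?S. D t \<noteq> 0}"
  proof (intro equalityI subsetI)
    fix M :: "bit ^ 3 ^ 3" assume "M \<in> {M. invertible M}"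
    then have "det (mk3 (M$1$1) (M$1$2) (M$1$3) (M$2$1) (M$2$2) (M$2$3) (M$3$1) (M$3$2) (M$3$3)) \<noteq> 0"
      unfolding mk3_eta[symmetric] invertible_det_nz[symmetric] by simp
    then show "M \<in> m ` {t \<in> ?S. D t \<noteq> 0}"
      using mk3_eta[of M] T(2)
      by (intro image_eqI[of _ _ "(M$1$1, M$1$2, M$1$3, M$2$1, M$2$2, M$2$3, M$3$1, M$3$2, M$3$3)"])
        (auto simp: m_def D_def)
  qed (auto simp: m_def D_def invertible_det_nz)
  ultimately have "card {M :: bit ^ 3 ^ 3. invertible M} = card {t \<in> ?S. D t \<noteq> 0}"
    by (simp only: card_image[OF inj_on_subset[OF _ subset_UNIV]])
  also have "\<dots> = (\<Sum>t\<in>?S. if D t \<noteq> 0 then 1 else 0)"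
    by (rule card_filter) (intro finite_cartesian_product T(1))
  also have "\<dots> = (\<Sum>a\<in>T. \<Sum>b\<in>T. \<Sum>c\<in>T. \<Sum>d\<in>T. \<Sum>e\<in>T. \<Sum>f\<in>T. \<Sum>g\<in>T. \<Sum>h\<in>T. \<Sum>i\<in>T.
      if D (a, b, c, d, e, f, g, h, i) \<noteq> 0 then 1 else 0)"
    by (simp only: sum.cartesian_product split_def prod.collapse)
  also have "\<dots> = (\<Sum>a\<in>T. \<Sum>b\<in>T. \<Sum>c\<in>T. \<Sum>d\<in>T. \<Sum>e\<in>T. \<Sum>f\<in>T.
      if b * f + c * e = 0 \<and> c * d + a * f = 0 \<and> a * e + b * d = 0 then 0 else 4)"
    unfolding D_def prod.case det_mk3_bit T_def sum_last_row ..
  also have "\<dots> = (\<Sum>a\<in>T. \<Sum>b\<in>T. \<Sum>c\<in>T. if a = 0 \<and> b = 0 \<and> c = 0 then 0 else 24)"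
    unfolding T_def sum_middle_row ..
  also have "\<dots> = 168" unfolding T_def by simp
  finally show ?thesis .
qed

lemma adj_mk3: "adj (mk3 a b c d e f g h i) =
  mk3 (cnj a) (cnj d) (cnj g) (cnj b) (cnj e) (cnj h) (cnj c) (cnj f) (cnj i)"
  by (simp add: vec_eq_iff forall_3)

lemma over_mk3 [simp]: "over S (mk3 a b c d e f g h i) \<longleftrightarrow>
  a \<in> S \<and> b \<in> S \<and> c \<in> S \<and> d \<in> S \<and> e \<in> S \<and> f \<in> S \<and> g \<in> S \<and> h \<in> S \<and> i \<in> S"
  by (auto simp: over_def forall_3)

lemma Hmat_mk3: "Hmat = mk3 2 lambar lam lam 2 (-1) lambar (-1) 2"
  by (simp add: Hmat_def mk3_def)

section \<open>Reduction of the isometries of L modulo lambda\<close>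

context dyadic
begin

text \<open>For an isometry of L this is the action on L / lambda L, a space of dimension 3 over
  F_2, in the basis \<open>Bmat\<close>.\<close>

definition rho :: "complex ^ 3 ^ 3 \<Rightarrow> bit ^ 3 ^ 3" where "rho A = bmat (im (Binv ** A ** Bmat))"

lemma Isom_L_U_half: "A \<in> Isom_L \<Longrightarrow> A \<in> U_half"
  by (simp add: Isom_L_eq U_halfI)

lemma Isom_L_frame: "A \<in> Isom_L \<Longrightarrow> over O_lam (Binv ** A ** Bmat)"
  by (simp add: Isom_L_eq)

lemma frame_mult: "Binv ** (A ** A') ** Bmat = (Binv ** A ** Bmat) ** (Binv ** A' ** Bmat)"
  by (metis Bmat_Binv matrix_mul_assoc matrix_mul_rid)

lemma Isom_L_mult: "A \<in> Isom_L \<Longrightarrow> B \<in> Isom_L \<Longrightarrow> A ** B \<in> Isom_L"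
  unfolding Isom_L_eq mem_Collect_eq frame_mult using unitary_mult by simp

lemma Isom_L_adj: "A \<in> Isom_L \<Longrightarrow> adj A \<in> Isom_L"
  unfolding Isom_L_eq mem_Collect_eq using unitary_adj adj_conj_integral by simp

lemma rho_mult:
  assumes "A \<in> Isom_L" "B \<in> Isom_L"
  shows "rho (A ** B) = rho A ** rho B"
proof -
  have "over O_lam (Binv ** A ** Bmat)" "over O_lam (Binv ** B ** Bmat)" using assms Isom_L_frame by auto
  then show ?thesis unfolding rho_def frame_mult by (simp add: im_mult bmat_mult)
qed

lemma rho_1 [simp]: "rho (mat 1) = mat 1"
  by (simp add: rho_def Binv_Bmat)

lemma Isom_L_1 [simp]: "mat 1 \<in> Isom_L"
  by (simp add: Isom_L_eq Binv_Bmat)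

text \<open>Isometries are constructed from their matrices in the basis of L, where being an
  isometry means preserving the Gram matrix.\<close>

lemma Isom_L_conj:
  assumes "over O_lam C" "adj C ** Hmat ** C = Hmat"
  shows "Bmat ** C ** Binv \<in> Isom_L" "rho (Bmat ** C ** Binv) = bmat (im C)"
proof -
  let ?A = "Bmat ** C ** Binv"
  have C: "Binv ** ?A ** Bmat = C"
    by (metis Binv_Bmat matrix_mul_assoc matrix_mul_lid matrix_mul_rid)
  have aB: "adj Binv ** adj Bmat = mat 1" unfolding adj_mult[symmetric] by (simp add: Bmat_Binv)
  have "adj ?A ** ?A = adj Binv ** (adj C ** (adj Bmat ** Bmat) ** C) ** Binv"
    by (simp only: adj_mult matrix_mul_assoc)
  also have "adj C ** (adj Bmat ** Bmat) ** C = mat 2 ** (adj C ** Hmat ** C)"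
    unfolding adj_Bmat_Bmat by (metis mat_commute matrix_mul_assoc)
  also have "\<dots> = adj Bmat ** Bmat" unfolding assms(2) adj_Bmat_Bmat ..
  also have "adj Binv ** (adj Bmat ** Bmat) ** Binv = mat 1"
    by (metis aB Bmat_Binv matrix_mul_assoc matrix_mul_rid)
  finally have "unitary ?A" by (simp add: unitary_def)
  then show "?A \<in> Isom_L" unfolding Isom_L_eq using assms(1) C by simp
  show "rho ?A = bmat (im C)" by (simp add: rho_def C)
qed

lemma bmat_im_mk3: "bmat (im (mk3 a b c d e f g h i)) =
  mk3 (par a) (par b) (par c) (par d) (par e) (par f) (par g) (par h) (par i)"
  by (simp add: vec_eq_iff forall_3 bmat_im_nth del: bmat_nth im_nth)

text \<open>The six isometries are reflections in minimal vectors of \<open>L\<close>, in coordinates with respect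
  to the basis \<open>Bmat\<close>; modulo \<open>\<lambda>\<close> a reflection is a transvection.\<close>

lemma transvections:
  "\<exists>A\<in>Isom_L. rho A = mk3 1 1 0 0 1 0 0 0 1" "\<exists>A\<in>Isom_L. rho A = mk3 1 0 1 0 1 0 0 0 1"
  "\<exists>A\<in>Isom_L. rho A = mk3 1 0 0 1 1 0 0 0 1" "\<exists>A\<in>Isom_L. rho A = mk3 1 0 0 0 1 1 0 0 1"
  "\<exists>A\<in>Isom_L. rho A = mk3 1 0 0 0 1 0 1 0 1" "\<exists>A\<in>Isom_L. rho A = mk3 1 0 0 0 1 0 0 1 1"
proof -
  have l2: "lam * lam = - lam - 2" by (rule lam_square)
  have *: "\<exists>A\<in>Isom_L. rho A = M" if "over O_lam C" "adj C ** Hmat ** C = Hmat" "bmat (im C) = M" for C M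
    using Isom_L_conj[OF that(1,2)] that(3) by blast
  note mk = adj_mk3 Hmat_mk3 mk3_mult mk3_eq_iff
  show "\<exists>A\<in>Isom_L. rho A = mk3 1 1 0 0 1 0 0 0 1"
  proof (rule *[of "mk3 (-1) (1 + lam) (- lam) 0 1 0 0 0 1"])
    show "adj (mk3 (-1) (1 + lam) (- lam) 0 1 0 0 0 1) ** Hmat ** mk3 (-1) (1 + lam) (- lam) 0 1 0 0 0 1 = Hmat"
      unfolding mk using l2 by (simp add: lambar_eq) ((intro conjI)?; (algebra | simp add: algebra_simps))
  qed (simp_all add: bmat_im_mk3 mk3_eq_iff)
  show "\<exists>A\<in>Isom_L. rho A = mk3 1 0 1 0 1 0 0 0 1"
  proof (rule *[of "mk3 1 0 (-1 + lam) 0 1 lam 0 0 (-1)"])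
    show "adj (mk3 1 0 (-1 + lam) 0 1 lam 0 0 (-1)) ** Hmat ** mk3 1 0 (-1 + lam) 0 1 lam 0 0 (-1) = Hmat"
      unfolding mk using l2 by (simp add: lambar_eq) ((intro conjI)?; (algebra | simp add: algebra_simps))
  qed (simp_all add: bmat_im_mk3 mk3_eq_iff)
  show "\<exists>A\<in>Isom_L. rho A = mk3 1 0 0 1 1 0 0 0 1"
  proof (rule *[of "mk3 (1 + lam) 0 (-2 - lam) (1 + lam) 1 (-2) lam 0 (-1 - lam)"])
    show "adj (mk3 (1 + lam) 0 (-2 - lam) (1 + lam) 1 (-2) lam 0 (-1 - lam)) ** Hmat **
        mk3 (1 + lam) 0 (-2 - lam) (1 + lam) 1 (-2) lam 0 (-1 - lam) = Hmat"
      unfolding mk using l2 by (simp add: lambar_eq) ((intro conjI)?; (algebra | simp add: algebra_simps))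
  qed (simp_all add: bmat_im_mk3 mk3_eq_iff)
  show "\<exists>A\<in>Isom_L. rho A = mk3 1 0 0 0 1 1 0 0 1"
  proof (rule *[of "mk3 1 0 0 (- lam) (-1) 1 0 0 1"])
    show "adj (mk3 1 0 0 (- lam) (-1) 1 0 0 1) ** Hmat ** mk3 1 0 0 (- lam) (-1) 1 0 0 1 = Hmat"
      unfolding mk by (simp add: lambar_eq)
  qed (simp_all add: bmat_im_mk3 mk3_eq_iff)
  show "\<exists>A\<in>Isom_L. rho A = mk3 1 0 0 0 1 0 1 0 1"
  proof (rule *[of "mk3 (-1) (2 + lam) 0 0 1 0 (-1 - lam) lam 1"])
    show "adj (mk3 (-1) (2 + lam) 0 0 1 0 (-1 - lam) lam 1) ** Hmat ** mk3 (-1) (2 + lam) 0 0 1 0 (-1 - lam) lam 1 = Hmat"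
      unfolding mk using l2 by (simp add: lambar_eq) ((intro conjI)?; (algebra | simp add: algebra_simps))
  qed (simp_all add: bmat_im_mk3 mk3_eq_iff)
  show "\<exists>A\<in>Isom_L. rho A = mk3 1 0 0 0 1 0 0 1 1"
  proof (rule *[of "mk3 1 (-2 - lam) 0 0 (-1) 0 0 (-1 - lam) 1"])
    show "adj (mk3 1 (-2 - lam) 0 0 (-1) 0 0 (-1 - lam) 1) ** Hmat ** mk3 1 (-2 - lam) 0 0 (-1) 0 0 (-1 - lam) 1 = Hmat"
      unfolding mk using l2 by (simp add: lambar_eq) ((intro conjI)?; (algebra | simp add: algebra_simps))
  qed (simp_all add: bmat_im_mk3 mk3_eq_iff)
qed

lemma rho_surj: "invertible M \<Longrightarrow> \<exists>A\<in>Isom_L. rho A = M"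
  by (erule GL3_F2_generated[where P = "\<lambda>M. \<exists>A\<in>Isom_L. rho A = M"])
    (metis Isom_L_mult rho_mult, rule transvections, rule transvections, rule transvections,
      rule transvections, rule transvections, rule transvections)

lemma rho_invertible: "A \<in> Isom_L \<Longrightarrow> invertible (rho A)"
proof -
  assume A: "A \<in> Isom_L"
  then have "adj A ** A = mat 1" "A ** adj A = mat 1"
    using Isom_L_U_half U_half_unitary unitary_right by (auto simp: unitary_def)
  then show ?thesis
    unfolding invertible_def using rho_mult[OF A Isom_L_adj[OF A]] rho_mult[OF Isom_L_adj[OF A] A]
    by (intro exI[of _ "rho (adj A)"]) simp
qed

text \<open>The main point is that all entries of \<open>A\<close> lie in O, although integrality is
  given only in the basis of L. Then \<open>A\<close> is a signed permutation matrix, and triviality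
  modulo \<open>lam\<close> in the basis \<open>Bmat\<close> fixes the permutation and makes the
  signs equal.\<close>

lemma rho_kernel:
  assumes A: "A \<in> Isom_L" and r: "rho A = mat 1"
  shows "A = mat 1 \<or> A = mat (-1)"
proof -
  define C where "C = Binv ** A ** Bmat"
  have C: "over O_lam C" using Isom_L_frame A by (simp add: C_def)
  have uA: "unitary A" using A by (simp add: Isom_L_eq)
  have parC: "par (C $ i $ j) = (if i = j then 1 else 0)" for i j
    using r bmat_im_nth[of C i j] by (simp add: rho_def C_def[symmetric] mat_def)
  have AB: "A ** Bmat = Bmat ** C"
    by (simp add: C_def matrix_mul_assoc Bmat_Binv)
  have OA: "A $ k $ j \<in> O_lam" for k j
  proof -
    \<comment> \<open>The coordinates of twice the j-th unit vector in the basis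
      \<open>Bmat\<close>. For every j they reduce to (1, 0, 0) modulo \<open>lam\<close>, and so do
      their images under \<open>C\<close>.\<close>
    define w :: "complex ^ 3" where "w = Binv *v axis j 2"
    have w: "w = (if j = 1 then vector [1, 0, 0] else if j = 2 then vector [-1, lam, 0] else vector [1 - lam, - lam, 2])"
      using exhaust_3[of j] by (auto simp: w_def vec_eq_iff forall_3 vmult3_nth Binv_def axis_def)
    have ow: "w $ i \<in> O_lam" and pw: "par (w $ i) = (if i = 1 then 1 else 0)" for i
      using exhaust_3[of i] exhaust_3[of j] by (auto simp: w)
    define u where "u = C *v w"
    have Oij: "C $ i $ k \<in> O_lam" for i k using C by (simp add: over_def)
    have ou: "u $ i \<in> O_lam" for i using ow Oij by (simp add: u_def vmult3_nth)
    have pu: "par (u $ i) = par (w $ i)" for i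
      using exhaust_3[of i] ow Oij by (auto simp: u_def vmult3_nth parC)
    obtain p where p: "p \<in> O_lam" "u $ 1 - 1 = lam * p"
      using par_eq_0_iff[of "u $ 1 - 1"] ou pu pw by auto
    obtain q where q: "q \<in> O_lam" "u $ 2 = lam * q" using par_eq_0_iff[of "u $ 2"] ou pu pw by auto
    obtain r where r: "r \<in> O_lam" "u $ 3 = lam * r" using par_eq_0_iff[of "u $ 3"] ou pu pw by auto
    have "A *v axis j 2 = A *v (Bmat *v w)"
      by (simp add: w_def matrix_vector_mul_assoc Bmat_Binv)
    also have "\<dots> = Bmat *v u"
      by (simp add: u_def matrix_vector_mul_assoc AB)
    finally have y: "A *v axis j 2 = Bmat *v u" .
    have Aij: "2 * A $ i $ j = (Bmat *v u) $ i" for i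
      unfolding y[symmetric] using exhaust_3[of j] by (auto simp: vmult3_nth axis_def)
    \<comment> \<open>One factor \<open>lam\<close> can be taken out of twice the j-th column of
      \<open>A\<close>, because every term of \<open>Bmat *v u\<close> contains it.\<close>
    define z where "z = (vector [lambar * (1 + lam * p + q) + lam * r, lambar * q + r, r] :: complex ^ 3)"
    have oz: "z $ i \<in> O_lam" for i using exhaust_3[of i] p q r by (auto simp: z_def)
    have u1: "u $ 1 = 1 + lam * p" using p(2) by (simp add: algebra_simps)
    have Az: "2 * A $ i $ j = lam * z $ i" for i
    proof -
      have "2 * (1 + lam * p) + lambar * (lam * q) + lam * (lam * r) = lam * (lambar * (1 + lam * p + q) + lam * r)"
        unfolding distrib_left[of lam] lam_cancel by (simp add: algebra_simps)
      moreover have "lambar * (lam * q) + lam * r = lam * (lambar * q + r)"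
        by (simp add: algebra_simps)
      ultimately have e: "2 * (1 + lam * p) + lambar * (lam * q) + lam * (lam * r) = lam * (lambar * (1 + lam * p + q) + lam * r)"
        "lambar * (lam * q) + lam * r = lam * (lambar * q + r)" by blast+
      show ?thesis
        unfolding Aij using exhaust_3[of i] e
        by (elim disjE) (simp_all only: vmult3_nth Bmat_def z_def u1 q(2) r(2) vector_3 mult_zero_left mult_1 add_0)
    qed
    have lamn: "(cmod lam)\<^sup>2 = 2" by (simp add: lam_def cmod_power2 power_divide)
    have "2 * (\<Sum>i\<in>UNIV. (cmod (z $ i))\<^sup>2) = (\<Sum>i\<in>UNIV. (cmod (lam * z $ i))\<^sup>2)"
      by (simp add: norm_mult power_mult_distrib lamn sum_distrib_left)
    also have "\<dots> = 4 * (\<Sum>i\<in>UNIV. (cmod (A $ i $ j))\<^sup>2)"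
      unfolding Az[symmetric] by (simp add: norm_mult power_mult_distrib sum_distrib_left)
    finally have sz: "(\<Sum>i\<in>UNIV. (cmod (z $ i))\<^sup>2) = 2" using unitary_column_norm[OF uA, of j] by simp
    \<comment> \<open>Modulo \<open>lambar\<close> each coordinate of z is r up to sign. If
      \<open>lambar\<close> did not divide r, all three would be nonzero and the squared norm of z
      would be at least 3 instead of 2.\<close>
    have "\<exists>r'\<in>O_lam. r = lambar * r'"
    proof (rule ccontr)
      assume no: "\<not> ?thesis"
      have "z $ i \<noteq> 0" for i
      proof
        assume "z $ i = 0"
        moreover have "\<exists>s\<in>O_lam. z $ i = lambar * s - r \<or> z $ i = lambar * s + r"
        proof -
          have "z $ 1 = lambar * (1 + lam * p + q - r) - r" by (simp add: z_def lambar_eq algebra_simps)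
          moreover have "z $ 2 = lambar * q + r" "z $ 3 = lambar * 0 + r" by (simp_all add: z_def)
          ultimately show ?thesis using exhaust_3[of i] p q r
            by (metis O_lam_add O_lam_consts(1,2,4) O_lam_diff O_lam_mult)
        qed
        ultimately obtain s where "s \<in> O_lam" "r = lambar * s \<or> r = lambar * (- s)"
          by (auto simp: algebra_simps add_eq_0_iff)
        then show False using no by (metis O_lam_minus_iff)
      qed
      then have "(cmod (z $ i))\<^sup>2 \<ge> 1" for i
        using O_lam_norm_Ints[OF oz[of i]] by (metis of_int_1 of_int_le_iff)
      then show False using sz by (simp add: sum_3) (smt (verit))
    qed
    then obtain r' where r': "r' \<in> O_lam" "r = lambar * r'" by blast
    \<comment> \<open>With the factor \<open>lambar\<close> removed as well, the 2 cancels and t is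
      the j-th column of \<open>A\<close>.\<close>
    define t where "t = (vector [1 + lam * p + q + lam * r', q + r', r'] :: complex ^ 3)"
    have zt: "z $ i = lambar * t $ i" for i
      using exhaust_3[of i] by (auto simp: z_def t_def r' algebra_simps)
    have "2 * A $ i $ j = 2 * t $ i" for i unfolding Az zt by (simp add: lam_cancel)
    then have "A $ k $ j = t $ k" by simp
    moreover have "t $ k \<in> O_lam" using exhaust_3[of k] p q r' by (auto simp: t_def)
    ultimately show ?thesis by simp
  qed
  obtain \<pi> s where inj: "inj \<pi>" and s: "\<And>i. s i = 1 \<or> s i = -1" and Am: "A = (\<chi> i j. if j = \<pi> i then s i else 0)"
    using integral_unitary_monomial[OF _ uA] OA by (auto simp: over_def)
  have ps: "par (s i) = 1" for i using s[of i] by auto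
  have pAB: "par ((A ** Bmat) $ i $ j) = par (Bmat $ i $ j)" for i j
  proof -
    have "over O_lam A" using OA by (simp add: over_def)
    have oB: "Bmat $ i $ k \<in> O_lam" "C $ k $ j \<in> O_lam" for i k j using over_Bmat C by (simp_all add: over_def del: over_Bmat)
    show ?thesis unfolding AB using exhaust_3[of j] oB by (auto simp: mult3_nth parC)
  qed
  have pA: "par (A $ i $ j) = (if j = \<pi> i then 1 else 0)" for i j by (simp add: Am ps)
  have c2: "(A ** Bmat) $ i $ 2 = A $ i $ 1 * lambar + A $ i $ 2 * lambar" for i
    by (simp add: mult3_nth Bmat_def)
  have c3: "(A ** Bmat) $ i $ 3 = A $ i $ 1 * lam + A $ i $ 2 + A $ i $ 3" for i
    by (simp add: mult3_nth Bmat_def)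
  \<comment> \<open>Modulo \<open>lam\<close> the matrix \<open>A\<close> fixes the columns (1, 1,
    0) and (0, 1, 1) of \<open>Bmat\<close>, so the permutation fixes the position of the zero in
    each.\<close>
  have "\<pi> 3 = 3"
    using pAB[of 3 2] exhaust_3[of "\<pi> 3"] OA unfolding c2 by (auto simp: pA Bmat_def)
  moreover have "\<pi> 1 = 1"
    using pAB[of 1 3] exhaust_3[of "\<pi> 1"] OA unfolding c3 by (auto simp: pA Bmat_def)
  ultimately have \<pi>: "\<pi> 1 = 1" "\<pi> 2 = 2" "\<pi> 3 = 3"
    using exhaust_3[of "\<pi> 2"] injD[OF inj, of 2 1] injD[OF inj, of 2 3] by auto
  have Ad: "A = mk3 (s 1) 0 0 0 (s 2) 0 0 0 (s 3)"
    by (simp add: vec_eq_iff forall_3 Am \<pi>)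
  \<comment> \<open>The off-diagonal entries of \<open>C\<close> are divisible by
    \<open>lam\<close>. Unequal signs would turn one of them into \<open>lambar\<close> or
    \<open>lam - 1\<close> up to sign, and neither is divisible by \<open>lam\<close>.\<close>
  have C12: "C $ 1 $ 2 = (s 1 - s 2) / 2 * lambar"
    by (simp add: C_def Ad mult3_nth Binv_def Bmat_def algebra_simps)
  have "s 1 = s 2"
  proof (rule ccontr)
    assume "s 1 \<noteq> s 2"
    then have "C $ 1 $ 2 = lambar \<or> C $ 1 $ 2 = - lambar" unfolding C12 using s[of 1] s[of 2] by auto
    then show False using parC[of 1 2] by auto
  qed
  have C13: "C $ 1 $ 3 = (s 1 * lam - s 2 + (1 - lam) * s 3) / 2"
    by (simp add: C_def Ad mult3_nth Binv_def Bmat_def field_simps)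
  have "s 1 = s 3"
  proof (rule ccontr)
    assume "s 1 \<noteq> s 3"
    then have "s 3 = - s 1" using s[of 1] s[of 3] by auto
    then have "C $ 1 $ 3 = s 1 * (lam - 1)" unfolding C13 \<open>s 1 = s 2\<close>[symmetric] by (simp add: field_simps)
    then have "C $ 1 $ 3 = lam - 1 \<or> C $ 1 $ 3 = - (lam - 1)" using s[of 1] by auto
    then show False using parC[of 1 3] by auto
  qed
  then have "A = mat (s 1)" using \<open>s 1 = s 2\<close> unfolding Ad by (simp add: vec_eq_iff forall_3 mat_def)
  then show ?thesis using s[of 1] by auto
qed

end

section \<open>The stabilizer of the standard vertex\<close>

lemma unit_norm_cnj: "y * cnj y = 1 \<longleftrightarrow> (cmod y)\<^sup>2 = 1"
  by (simp add: complex_norm_square[symmetric] del: of_real_power)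

text \<open>The sign vectors with product 1: this condition selects one end of each long diagonal of
  the cube.\<close>

definition dv :: "nat \<Rightarrow> complex ^ 3" where
  "dv k = (if k = 1 then vector [1, 1, 1] else if k = 2 then vector [1, -1, -1]
    else if k = 3 then vector [-1, 1, -1] else vector [-1, -1, 1])"

lemma dv_simps [simp]:
  "dv 1 $ 1 = 1" "dv 1 $ 2 = 1" "dv 1 $ 3 = 1" "dv 2 $ 1 = 1" "dv 2 $ 2 = -1" "dv 2 $ 3 = -1"
  "dv 3 $ 1 = -1" "dv 3 $ 2 = 1" "dv 3 $ 3 = -1" "dv 4 $ 1 = -1" "dv 4 $ 2 = -1" "dv 4 $ 3 = 1"
  "dv (Suc 0) $ 1 = 1" "dv (Suc 0) $ 2 = 1" "dv (Suc 0) $ 3 = 1"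
  by (simp_all add: dv_def)

lemma atLeastAtMost_1_4: "{1..4::nat} = {1, 2, 3, 4}"
  by auto

lemma dv_signs: "dv k $ i = 1 \<or> dv k $ i = -1"
  using exhaust_3[of i] by (auto simp: dv_def)

lemma prod_3: "prod f (UNIV :: 3 set) = f 1 * f 2 * f 3"
  for f :: "3 \<Rightarrow> 'a::comm_monoid_mult"
  unfolding UNIV_3 by (simp add: ac_simps)

lemma dv_prod: "(\<Prod>i\<in>UNIV. dv k $ i) = 1"
  by (simp add: prod_3 dv_def)

lemma dv_inner:
  assumes "k \<in> {1..4}" "l \<in> {1..4}"
  shows "(\<Sum>i\<in>UNIV. dv k $ i * dv l $ i) = (if k = l then 3 else -1)"
  using assms unfolding atLeastAtMost_1_4 by (auto simp: sum_3)

lemma dv_inj: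
  assumes "k \<in> {1..4}" "l \<in> {1..4}" "dv k = dv l"
  shows "k = l"
  using dv_inner[OF assms(1,2)] dv_inner[OF assms(1,1)] assms(3) by (auto split: if_splits)

lemma sign_vector_dv:
  fixes x :: "complex ^ 3"
  assumes "\<And>i. x $ i = 1 \<or> x $ i = -1" "x $ 1 * x $ 2 * x $ 3 = 1"
  shows "\<exists>k\<in>{1..4}. x = dv k"
proof -
  have "x = dv 1 \<or> x = dv 2 \<or> x = dv 3 \<or> x = dv 4"
    using assms(2) assms(1)[of 1] assms(1)[of 2] assms(1)[of 3]
    by (elim disjE) (simp_all add: vec_eq_iff forall_3)
  then show ?thesis by auto
qed

lemma sum_dv: "dv 1 + dv 2 + dv 3 + dv 4 = 0"
  by (rule vec3_eqI) simp_all

text \<open>Designed to send \<open>dv k\<close> to \<open>dv (\<sigma> k)\<close>: the j-th unit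
  vector is half the sum of \<open>dv 1\<close> and the vector \<open>dv\<close> of index j + 1, so
  the j-th column is half the sum of their images.\<close>

definition Phi :: "(nat \<Rightarrow> nat) \<Rightarrow> complex ^ 3 ^ 3" where
  "Phi \<sigma> = (\<chi> i j. (dv (\<sigma> 1) $ i + dv (\<sigma> (if j = 1 then 2 else if j = 2 then 3 else 4)) $ i) / 2)"

text \<open>The only linear relation among the four vectors is that their sum is 0, and permutations
  preserve it.\<close>

lemma Phi_dv:
  assumes "\<sigma> permutes {1..4}" "k \<in> {1..4}"
  shows "Phi \<sigma> *v dv k = dv (\<sigma> k)"
proof -
  have "(\<Sum>k\<in>{1..4}. dv (\<sigma> k)) = (\<Sum>k\<in>{1..4}. dv k)"
    by (rule sum.permute[OF assms(1), of dv, symmetric, unfolded o_def])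
  then have z: "dv (\<sigma> 1) + dv (\<sigma> 2) + dv (\<sigma> 3) + dv (\<sigma> 4) = 0"
    using sum_dv unfolding atLeastAtMost_1_4 by (simp add: add.assoc)
  have s: "dv (\<sigma> 1) $ i = - (dv (\<sigma> 2) $ i + dv (\<sigma> 3) $ i + dv (\<sigma> 4) $ i)" for i
    using arg_cong[OF z, of "\<lambda>x. x $ i"] by (simp only: vector_add_component zero_index eq_neg_iff_add_eq_0 add.assoc)
  have "(Phi \<sigma> *v dv k) $ i = dv (\<sigma> k) $ i" for i
    using assms(2) unfolding atLeastAtMost_1_4
    by (auto simp: vmult3_nth Phi_def s field_simps simp del: One_nat_def)
  then show ?thesis by (simp add: vec_eq_iff)
qed

lemma dv_determines:
  fixes A B :: "complex ^ 3 ^ 3"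
  assumes "\<And>k. k \<in> {1..4} \<Longrightarrow> A *v dv k = B *v dv k"
  shows "A = B"
proof -
  have c: "A $ i $ 1 + A $ i $ 2 + A $ i $ 3 = B $ i $ 1 + B $ i $ 2 + B $ i $ 3"
    "A $ i $ 1 - A $ i $ 2 - A $ i $ 3 = B $ i $ 1 - B $ i $ 2 - B $ i $ 3"
    "- A $ i $ 1 + A $ i $ 2 - A $ i $ 3 = - B $ i $ 1 + B $ i $ 2 - B $ i $ 3" for i
    using arg_cong[OF assms[of 1], of "\<lambda>x. x $ i"] arg_cong[OF assms[of 2], of "\<lambda>x. x $ i"]
      arg_cong[OF assms[of 3], of "\<lambda>x. x $ i"] by (simp_all add: vmult3_nth)
  have "A $ i $ 1 = B $ i $ 1 \<and> A $ i $ 2 = B $ i $ 2 \<and> A $ i $ 3 = B $ i $ 3" for i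
    using c[of i] by algebra
  then show ?thesis by (simp add: vec_eq_iff forall_3)
qed

lemma permutes_1_4_distinct:
  fixes \<sigma> :: "nat \<Rightarrow> nat"
  assumes "\<sigma> permutes {1..4}"
  shows "\<sigma> 1 \<in> {1..4}" "\<sigma> 2 \<in> {1..4}" "\<sigma> 3 \<in> {1..4}" "\<sigma> 4 \<in> {1..4}"
    "\<sigma> 1 \<noteq> \<sigma> 2" "\<sigma> 1 \<noteq> \<sigma> 3" "\<sigma> 1 \<noteq> \<sigma> 4" "\<sigma> 2 \<noteq> \<sigma> 3" "\<sigma> 2 \<noteq> \<sigma> 4" "\<sigma> 3 \<noteq> \<sigma> 4"
  unfolding permutes_in_image[OF assms] inj_eq[OF permutes_inj[OF assms]] by simp_all

text \<open>The inner product of two of the vectors is 3 or -1 according to whether they are equal,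
  so a permutation preserves all inner products. The columns have inner products (3 - 1 - 1 + 3) / 4
  = 1 and (3 - 1 - 1 - 1) / 4 = 0.\<close>

lemma Phi_unitary:
  assumes "\<sigma> permutes {1..4}"
  shows "over O_lam (Phi \<sigma>)" "unitary (Phi \<sigma>)"
proof -
  have r: "cnj (dv k $ i) = dv k $ i" for k i using dv_signs[of k i] by auto
  have "Phi \<sigma> $ i $ j \<in> {0, 1, -1}" for i j
    using dv_signs[of "\<sigma> 1" i] dv_signs[of "\<sigma> 2" i] dv_signs[of "\<sigma> 3" i] dv_signs[of "\<sigma> 4" i]
    by (auto simp: Phi_def)
  moreover have "{0, 1, -1} \<subseteq> O_lam" by auto
  ultimately show "over O_lam (Phi \<sigma>)" unfolding over_def by blast
  note d = permutes_1_4_distinct[OF assms]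
  note g = dv_inner[OF d(1) d(1)] dv_inner[OF d(1) d(2)] dv_inner[OF d(1) d(3)] dv_inner[OF d(1) d(4)]
     dv_inner[OF d(2) d(2)] dv_inner[OF d(2) d(3)] dv_inner[OF d(2) d(4)]
     dv_inner[OF d(3) d(3)] dv_inner[OF d(3) d(4)] dv_inner[OF d(4) d(4)]
  have "(adj (Phi \<sigma>) ** Phi \<sigma>) $ j $ k = mat 1 $ j $ k" for j k
  proof -
    define jn where "jn j = (if j = 1 then 2 else if j = 2 then 3 else 4 :: nat)" for j :: 3
    have "(adj (Phi \<sigma>) ** Phi \<sigma>) $ j $ k =
      ((\<Sum>i\<in>UNIV. dv (\<sigma> 1) $ i * dv (\<sigma> 1) $ i) + (\<Sum>i\<in>UNIV. dv (\<sigma> 1) $ i * dv (\<sigma> (jn k)) $ i) +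
       (\<Sum>i\<in>UNIV. dv (\<sigma> 1) $ i * dv (\<sigma> (jn j)) $ i) + (\<Sum>i\<in>UNIV. dv (\<sigma> (jn j)) $ i * dv (\<sigma> (jn k)) $ i)) / 4"
      unfolding matrix_matrix_mult_def
      by (simp add: Phi_def jn_def[symmetric] r sum.distrib[symmetric] sum_divide_distrib algebra_simps)
    also have "\<dots> = mat 1 $ j $ k"
    proof -
      have j: "jn j \<in> {1..4}" "jn k \<in> {1..4}" "jn j \<noteq> 1" "jn k \<noteq> 1" "jn j = jn k \<longleftrightarrow> j = k"
        using exhaust_3[of j] exhaust_3[of k] by (auto simp: jn_def)
      have inj: "inj \<sigma>" using assms by (rule permutes_inj)
      have m: "\<sigma> (jn j) \<in> {1..4}" "\<sigma> (jn k) \<in> {1..4}" using j permutes_in_image[OF assms] by auto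
      have n: "\<sigma> 1 \<noteq> \<sigma> (jn j)" "\<sigma> 1 \<noteq> \<sigma> (jn k)" "\<sigma> (jn j) = \<sigma> (jn k) \<longleftrightarrow> j = k"
        using j inj by (metis injD)+
      show ?thesis
        unfolding dv_inner[OF d(1) d(1)] dv_inner[OF d(1) m(1)] dv_inner[OF d(1) m(2)] dv_inner[OF m] using n
        by (simp add: mat_def)
    qed
    finally show ?thesis .
  qed
  then show "unitary (Phi \<sigma>)" by (simp add: unitary_def vec_eq_iff)
qed

lemma Phi_comp:
  assumes "\<sigma> permutes {1..4}" "\<tau> permutes {1..4}"
  shows "Phi (\<sigma> \<circ> \<tau>) = Phi \<sigma> ** Phi \<tau>"
proof (rule dv_determines)
  fix k :: nat assume k: "k \<in> {1..4}"
  have "\<tau> k \<in> {1..4}" using k permutes_in_image[OF assms(2)] by blast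
  then show "Phi (\<sigma> \<circ> \<tau>) *v dv k = (Phi \<sigma> ** Phi \<tau>) *v dv k"
    using k assms permutes_compose[OF assms(2,1)]
    by (simp add: Phi_dv matrix_vector_mul_assoc[symmetric] del: atLeastAtMost_iff)
qed

text \<open>Signed permutation matrices permute the four long diagonals of the cube, and up to a global sign
  they permute the four vertices \<open>dv k\<close> of a regular tetrahedron.\<close>

lemma Phi_surj:
  assumes "over O_lam A" "unitary A"
  shows "\<exists>\<sigma> p. \<sigma> permutes {1..4} \<and> (p = 1 \<or> p = -1) \<and> Phi \<sigma> = mat p ** A"
proof -
  obtain \<pi> s where \<pi>: "inj \<pi>" "\<And>i. s i = 1 \<or> s i = -1" "A = (\<chi> i j. if j = \<pi> i then s i else 0)"
    using integral_unitary_monomial[OF assms] by blast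
  \<comment> \<open>After scaling by this sign the product of all signs is \<open>p ^ 3 * p\<close>
    = 1, so that sign vectors with product 1 are mapped to such vectors.\<close>
  define p where "p = s 1 * s 2 * s 3"
  have p: "p = 1 \<or> p = -1" using \<pi>(2)[of 1] \<pi>(2)[of 2] \<pi>(2)[of 3] by (auto simp: p_def)
  define A' where "A' = mat p ** A"
  have A'v: "(A' *v x) $ i = p * s i * x $ \<pi> i" for x i
    by (simp add: matrix_vector_mult_def A'_def \<pi>(3) if_distrib[of "\<lambda>x. x * _"] if_distrib[of "\<lambda>x. _ * x"] cong: if_cong)
  have "\<exists>l\<in>{1..4}. A' *v dv k = dv l" for k
  proof (rule sign_vector_dv)
    show "(A' *v dv k) $ i = 1 \<or> (A' *v dv k) $ i = -1" for i
      unfolding A'v using p \<pi>(2)[of i] dv_signs[of k "\<pi> i"] by auto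
    have "bij \<pi>" using \<pi>(1) by (simp add: bij_def finite_UNIV_inj_surj)
    then have "(\<Prod>i\<in>UNIV. dv k $ \<pi> i) = 1"
      using prod.reindex_bij_betw[of \<pi> UNIV UNIV "\<lambda>i. dv k $ i"] dv_prod by simp
    then have "dv k $ \<pi> 1 * dv k $ \<pi> 2 * dv k $ \<pi> 3 = 1" by (simp add: prod_3)
    moreover have "p * p * p * (s 1 * s 2 * s 3) = 1" using p by (auto simp: p_def)
    ultimately show "(A' *v dv k) $ 1 * (A' *v dv k) $ 2 * (A' *v dv k) $ 3 = 1"
      unfolding A'v by algebra
  qed
  then obtain t where t: "\<And>k. t k \<in> {1..4} \<and> A' *v dv k = dv (t k)" by metis
  define \<sigma> where "\<sigma> k = (if k \<in> {1..4} then t k else k)" for k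
  have "p \<noteq> 0" using p by auto
  then have "invertible A'" unfolding A'_def by (intro invertible_mult' invertible_mat unitary_invertible assms)
  have inj: "inj_on \<sigma> {1..4}"
  proof (rule inj_onI)
    fix k l assume kl: "k \<in> {1..4}" "l \<in> {1..4}" "\<sigma> k = \<sigma> l"
    then have "A' *v dv k = A' *v dv l" using t by (simp add: \<sigma>_def del: atLeastAtMost_iff)
    then have "matrix_inv A' *v (A' *v dv k) = matrix_inv A' *v (A' *v dv l)" by simp
    then have "dv k = dv l" using \<open>invertible A'\<close> by (simp add: matrix_vector_mul_assoc)
    then show "k = l" using kl dv_inj by blast
  qed
  have "\<sigma> ` {1..4} \<subseteq> {1..4}" using t by (auto simp: \<sigma>_def simp del: atLeastAtMost_iff)
  then have "bij_betw \<sigma> {1..4} {1..4}"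
    using inj by (simp add: bij_betw_def endo_inj_surj)
  then have perm: "\<sigma> permutes {1..4}" by (rule bij_imp_permutes) (auto simp: \<sigma>_def)
  moreover have "Phi \<sigma> = mat p ** A"
  proof (rule dv_determines)
    fix k :: nat assume "k \<in> {1..4}"
    then show "Phi \<sigma> *v dv k = (mat p ** A) *v dv k"
      using Phi_dv[OF perm] t[of k] by (simp add: A'_def[symmetric] \<sigma>_def del: atLeastAtMost_iff)
  qed
  ultimately show ?thesis using p by blast
qed

section \<open>Isomorphism types of the two stabilizers\<close>

context dyadic
begin

text \<open>The scalar relating the two images lies a priori in Q_2. It is the image of a diagonal
  entry of \<open>adj A ** B\<close>, so injectivity of \<open>\<iota>\<close> on Q(lambda) brings
  it back to O[1/2], and unitarity gives it absolute value 1.\<close>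

lemma to_PGL3_im_eq:
  assumes A: "A \<in> U_half" and B: "B \<in> U_half" and eq: "to_PGL3 (im A) = to_PGL3 (im B)"
  obtains y where "y \<in> O_half" "y * cnj y = 1" "B = mat y ** A"
proof -
  obtain c where c: "c \<noteq> 0" "im B = mat c ** im A" using eq to_PGL3_eq_iff by metis
  define D where "D = adj A ** B"
  have D: "D \<in> U_half" unfolding D_def using A B U_half_mult U_half_adj by blast
  have "im D = im (adj A) ** im B" unfolding D_def using A B U_half_adj[OF A] by (simp add: im_mult)
  also have "\<dots> = mat c ** (im (adj A) ** im A)" unfolding c(2) by (metis mat_commute matrix_mul_assoc)
  also have "im (adj A) ** im A = mat 1" using im_unitary_invertible[OF A] by (metis matrix_inv_left)
  finally have "im D = mat c" by simp
  then have "im D $ i $ j = mat c $ i $ j" for i j by simp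
  then have Dij: "\<iota> (D $ i $ j) = (if i = j then c else 0)" for i j
    by (simp add: mat_def)
  define d where "d = D $ 1 $ 1"
  have DQ: "D $ i $ j \<in> Q_lam" for i j using U_half_over(2)[OF D] by (simp add: over_def)
  have "D $ i $ j = (if i = j then d else 0)" for i j
    using Dij[of i j] Dij[of 1 1] iota_inj[OF DQ[of i j] DQ[of 1 1]] iota_eq_0[OF DQ[of i j]]
    unfolding d_def by (cases "i = j") simp_all
  then have Dm: "D = mat d" by (simp add: vec_eq_iff mat_def)
  have BD: "B = A ** D" unfolding D_def matrix_mul_assoc using A by (simp add: unitary_right U_half_unitary)
  have "B = mat d ** A" using BD Dm by (metis mat_commute)
  moreover have "d \<in> O_half" using U_half_over(1)[OF D] by (simp add: d_def over_def)
  moreover have "d * cnj d = 1"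
  proof -
    have "D ** adj D = mat 1" using D by (simp add: unitary_right U_half_unitary)
    then have "mat d ** adj (mat d) = (mat 1 :: complex ^ 3 ^ 3)" using Dm by metis
    then have "(mat (d * cnj d) :: complex ^ 3 ^ 3) = mat 1" by simp
    from arg_cong[OF this, of "\<lambda>M. M $ 1 $ 1"] show ?thesis by (simp add: mat_def)
  qed
  ultimately show thesis using that by blast
qed

text \<open>A scalar that preserves L lies in O, and absolute value 1 leaves only 1 and -1, both
  trivial modulo \<open>lam\<close>. The converse rests on \<open>rho_kernel\<close>.\<close>

lemma Isom_L_eq_up_to_sign:
  assumes A: "A \<in> Isom_L" and B: "B \<in> Isom_L"
  shows "to_PGL3 (im A) = to_PGL3 (im B) \<longleftrightarrow> rho A = rho B"
proof
  assume "to_PGL3 (im A) = to_PGL3 (im B)"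
  then obtain y where y: "y \<in> O_half" "y * cnj y = 1" "B = mat y ** A"
    using to_PGL3_im_eq[of A B] A B Isom_L_U_half by metis
  have "B ** adj A = mat y"
    using y(3) A by (simp add: matrix_mul_assoc[symmetric] unitary_right U_half_unitary Isom_L_U_half)
  then have "mat y \<in> Isom_L" using A B Isom_L_mult Isom_L_adj by metis
  then have "over O_lam (Binv ** mat y ** Bmat)" by (rule Isom_L_frame)
  moreover have "Binv ** mat y ** Bmat = mat y"
    by (metis mat_commute Binv_Bmat matrix_mul_assoc matrix_mul_rid)
  ultimately have "y \<in> O_lam" by simp
  then have "y = 1 \<or> y = -1" using O_lam_norm1 y(2) unit_norm_cnj by blast
  moreover have "rho (mat y ** A) = bmat (im (mat y)) ** rho A" if "y \<in> O_lam"
  proof -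
    have "Binv ** (mat y ** A) ** Bmat = mat y ** (Binv ** A ** Bmat)"
      by (metis mat_commute matrix_mul_assoc)
    then show ?thesis using that Isom_L_frame[OF A] by (simp add: rho_def im_mult bmat_mult del: im_mat)
  qed
  moreover have "bmat (im (mat (-1))) = mat 1"
    by (simp add: vec_eq_iff bmat_im_nth del: bmat_nth im_nth im_mat) (simp add: mat_def)
  ultimately show "rho A = rho B" using y(3) by (auto simp del: im_mat)
next
  assume eq: "rho A = rho B"
  let ?D = "adj A ** B"
  have D: "?D \<in> Isom_L" using A B Isom_L_mult Isom_L_adj by blast
  have "rho (adj A) ** rho A = mat 1"
    using rho_mult[OF Isom_L_adj[OF A] A] U_half_unitary[OF Isom_L_U_half[OF A]] by (simp add: unitary_def)
  then have "rho ?D = mat 1" using rho_mult[OF Isom_L_adj[OF A] B] eq by simp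
  then have "?D = mat 1 \<or> ?D = mat (-1)" using D rho_kernel by blast
  moreover have "B = A ** ?D"
    using A by (simp add: matrix_mul_assoc unitary_right U_half_unitary Isom_L_U_half)
  ultimately have "B = A \<or> B = mat (-1) ** A" by (metis mat_commute matrix_mul_rid)
  then show "to_PGL3 (im A) = to_PGL3 (im B)"
    using A by (auto simp: im_smult Isom_L_U_half)
qed

lemma PIsom_L_iso: "PGL3\<lparr>carrier := PIsom_L \<iota>\<rparr> \<cong> L3_2"
proof -
  \<comment> \<open>Independent of the chosen representative, since isometries in the same class
    have the same reduction.\<close>
  define h where "h g = rho (SOME A. A \<in> Isom_L \<and> g = to_PGL3 (im A))" for g
  have h: "h (to_PGL3 (im A)) = rho A" if "A \<in> Isom_L" for A
  proof -
    let ?B = "SOME B. B \<in> Isom_L \<and> to_PGL3 (im A) = to_PGL3 (im B)"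
    have "\<exists>B. B \<in> Isom_L \<and> to_PGL3 (im A) = to_PGL3 (im B)" using that by blast
    then have "?B \<in> Isom_L \<and> to_PGL3 (im A) = to_PGL3 (im ?B)" by (rule someI_ex)
    then have "rho A = rho ?B" using Isom_L_eq_up_to_sign[OF that, of ?B] by blast
    then show ?thesis unfolding h_def by (rule sym)
  qed
  have "h \<in> iso (PGL3\<lparr>carrier := PIsom_L \<iota>\<rparr>) L3_2"
  proof (rule isoI)
    show "h \<in> hom (PGL3\<lparr>carrier := PIsom_L \<iota>\<rparr>) L3_2"
      by (rule homI) (auto simp: PIsom_L_eq h PG_mult Isom_L_U_half Isom_L_mult rho_mult rho_invertible)
    show "bij_betw h (carrier (PGL3\<lparr>carrier := PIsom_L \<iota>\<rparr>)) (carrier L3_2)"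
      unfolding bij_betw_def
    proof
      show "inj_on h (carrier (PGL3\<lparr>carrier := PIsom_L \<iota>\<rparr>))"
        by (rule inj_onI) (clarsimp simp: PIsom_L_eq h Isom_L_eq_up_to_sign)
      show "h ` carrier (PGL3\<lparr>carrier := PIsom_L \<iota>\<rparr>) = carrier L3_2"
        using rho_surj by (force simp: PIsom_L_eq image_image h rho_invertible)
    qed
  qed
  then show ?thesis by (auto simp: is_iso_def)
qed

lemma card_PIsom_L: "card (PIsom_L \<iota>) = 168"
proof -
  obtain h where "bij_betw h (PIsom_L \<iota>) {M :: bit ^ 3 ^ 3. invertible M}"
    using PIsom_L_iso by (auto simp: is_iso_def iso_def)
  then show ?thesis using bij_betw_same_card card_GL3_F2 by metis
qed

definition PS :: "(q2 ^ 3 ^ 3) set set" where "PS = (\<lambda>A. to_PGL3 (im A)) ` {A. over O_lam A \<and> unitary A}"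

lemma Phi_iso: "(\<lambda>\<sigma>. to_PGL3 (im (Phi \<sigma>))) \<in> iso (sym_group 4) (PGL3\<lparr>carrier := PS\<rparr>)"
proof (rule isoI)
  have U: "Phi \<sigma> \<in> U_half" if "\<sigma> permutes {1..4}" for \<sigma> using Phi_unitary[OF that] by (intro U_halfI) auto
  show "(\<lambda>\<sigma>. to_PGL3 (im (Phi \<sigma>))) \<in> hom (sym_group 4) (PGL3\<lparr>carrier := PS\<rparr>)"
    by (rule homI) (auto simp: sym_group_def PS_def Phi_unitary Phi_comp PG_mult U simp del: One_nat_def)
  show "bij_betw (\<lambda>\<sigma>. to_PGL3 (im (Phi \<sigma>))) (carrier (sym_group 4)) (carrier (PGL3\<lparr>carrier := PS\<rparr>))"
    unfolding bij_betw_def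
  proof
    show "inj_on (\<lambda>\<sigma>. to_PGL3 (im (Phi \<sigma>))) (carrier (sym_group 4))"
    proof (rule inj_onI)
      fix \<sigma> \<tau> assume "\<sigma> \<in> carrier (sym_group 4)" "\<tau> \<in> carrier (sym_group 4)"
        and eq: "to_PGL3 (im (Phi \<sigma>)) = to_PGL3 (im (Phi \<tau>))"
      then have \<sigma>: "\<sigma> permutes {1..4}" and \<tau>: "\<tau> permutes {1..4}" by (auto simp: sym_group_def)
      obtain y where y: "Phi \<tau> = mat y ** Phi \<sigma>" using to_PGL3_im_eq[OF U[OF \<sigma>] U[OF \<tau>] eq] by metis
      have e: "dv (\<tau> k) $ i = y * dv (\<sigma> k) $ i" if "k \<in> {1..4}" for k i
        using arg_cong[OF Phi_dv[OF \<tau> that], of "\<lambda>x. x $ i"] Phi_dv[OF \<sigma> that]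
        by (simp add: y matrix_vector_mul_assoc[symmetric])
      have y1: "y = 1 \<or> y = -1"
      proof -
        have "y = dv (\<tau> 1) $ 1 * dv (\<sigma> 1) $ 1"
          using e[of 1 1] dv_signs[of "\<sigma> 1" 1] by auto
        then show ?thesis using dv_signs[of "\<tau> 1" 1] dv_signs[of "\<sigma> 1" 1] by auto
      qed
      \<comment> \<open>All vectors \<open>dv k\<close> have coordinate product 1; comparing
        products excludes the sign -1.\<close>
      have "1 = y * y * y"
      proof -
        have "(\<Prod>i\<in>UNIV. dv (\<tau> 1) $ i) = y * y * y * (\<Prod>i\<in>UNIV. dv (\<sigma> 1) $ i)"
          using e[of 1] by (simp add: prod_3 algebra_simps)
        then show ?thesis by (simp add: dv_prod)
      qed
      then have "y = 1" using y1 by auto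
      then have "dv (\<tau> k) = dv (\<sigma> k)" if "k \<in> {1..4}" for k using e[OF that] by (simp add: vec_eq_iff)
      then have "\<tau> k = \<sigma> k" if "k \<in> {1..4}" for k
        using that dv_inj permutes_in_image[OF \<sigma>] permutes_in_image[OF \<tau>] by meson
      then show "\<sigma> = \<tau>" using \<sigma> \<tau> by (metis ext permutes_def)
    qed
    show "(\<lambda>\<sigma>. to_PGL3 (im (Phi \<sigma>))) ` carrier (sym_group 4) = carrier (PGL3\<lparr>carrier := PS\<rparr>)"
    proof (intro equalityI subsetI)
      fix g assume "g \<in> carrier (PGL3\<lparr>carrier := PS\<rparr>)"
      then obtain A where A: "over O_lam A" "unitary A" "g = to_PGL3 (im A)" by (auto simp: PS_def)
      obtain \<sigma> p where \<sigma>: "\<sigma> permutes {1..4}" "p = 1 \<or> p = -1" "Phi \<sigma> = mat p ** A"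
        using Phi_surj[OF A(1,2)] by blast
      have "im (Phi \<sigma>) = mat (\<iota> p) ** im A" "\<iota> p \<noteq> 0" using \<sigma>(2,3) A(1) by (auto simp: im_smult)
      then have "g = to_PGL3 (im (Phi \<sigma>))" using A(3) by simp
      then show "g \<in> (\<lambda>\<sigma>. to_PGL3 (im (Phi \<sigma>))) ` carrier (sym_group 4)"
        using \<sigma>(1) by (auto simp: sym_group_def)
    qed (auto simp: sym_group_def PS_def Phi_unitary simp del: One_nat_def)
  qed
qed

lemma PS_iso:
  shows "PGL3\<lparr>carrier := PS\<rparr> \<cong> sym_group 4" "card PS = 24"
proof -
  show "PGL3\<lparr>carrier := PS\<rparr> \<cong> sym_group 4"
    using group.iso_sym[OF sym_group_is_group] Phi_iso by (auto simp: is_iso_def)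
  have "card (carrier (sym_group 4)) = card PS"
    using Phi_iso by (auto simp: iso_def intro: bij_betw_same_card)
  then show "card PS = 24" using sym_group_card_carrier[of 4] by (simp add: fact_numeral)
qed

end

section \<open>Neighbours, orbits and generation\<close>

text \<open>Serves two purposes: separating the two orbits by the orders of their stabilizers, and
  transporting the isomorphism type of a stabilizer along an orbit.\<close>

lemma (in group_action) stabilizer_conjugate:
  assumes "x \<in> E" "g \<in> carrier G"
  shows "G\<lparr>carrier := stabilizer G \<phi> x\<rparr> \<cong> G\<lparr>carrier := stabilizer G \<phi> (\<phi> g x)\<rparr>"
proof -
  interpret group G using group_hom group_hom.axioms(1) by auto
  have comp: "\<phi> (a \<otimes> b) y = \<phi> a (\<phi> b y)" if "a \<in> carrier G" "b \<in> carrier G" "y \<in> E" for a b y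
    using composition_rule that by blast
  have one: "\<phi> \<one> y = y" if "y \<in> E" for y using id_eq_one that by (metis restrict_apply')
  have closed: "\<phi> a y \<in> E" if "a \<in> carrier G" "y \<in> E" for a y using element_image that by blast
  let ?c = "\<lambda>s. g \<otimes> s \<otimes> inv g"
  have cancel: "inv g \<otimes> (g \<otimes> y) = y" "g \<otimes> (inv g \<otimes> y) = y" if "y \<in> carrier G" for y
    using that assms by (simp_all add: m_assoc[symmetric])
  have inv_g: "\<phi> (inv g) (\<phi> g x) = x" using assms comp[of "inv g" g x] one by simp
  have in1: "?c s \<in> stabilizer G \<phi> (\<phi> g x)" if "s \<in> stabilizer G \<phi> x" for s
    using that assms inv_g closed by (auto simp: stabilizer_def comp)
  have in2: "inv g \<otimes> s \<otimes> g \<in> stabilizer G \<phi> x" if "s \<in> stabilizer G \<phi> (\<phi> g x)" for s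
    using that assms inv_g closed by (auto simp: stabilizer_def comp)
  have "?c \<in> iso (G\<lparr>carrier := stabilizer G \<phi> x\<rparr>) (G\<lparr>carrier := stabilizer G \<phi> (\<phi> g x)\<rparr>)"
  proof (rule isoI)
    show "?c \<in> hom (G\<lparr>carrier := stabilizer G \<phi> x\<rparr>) (G\<lparr>carrier := stabilizer G \<phi> (\<phi> g x)\<rparr>)"
    proof (rule homI)
      fix s t assume "s \<in> carrier (G\<lparr>carrier := stabilizer G \<phi> x\<rparr>)" "t \<in> carrier (G\<lparr>carrier := stabilizer G \<phi> x\<rparr>)"
      then have st: "s \<in> carrier G" "t \<in> carrier G" by (auto simp: stabilizer_def)
      have "g \<otimes> (s \<otimes> t) \<otimes> inv g = (g \<otimes> s \<otimes> inv g) \<otimes> (g \<otimes> t \<otimes> inv g)"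
        using st assms by (simp add: m_assoc cancel)
      then show "?c (s \<otimes>\<^bsub>G\<lparr>carrier := stabilizer G \<phi> x\<rparr>\<^esub> t) =
          ?c s \<otimes>\<^bsub>G\<lparr>carrier := stabilizer G \<phi> (\<phi> g x)\<rparr>\<^esub> ?c t" by simp
    qed (use in1 in simp)
    show "bij_betw ?c (carrier (G\<lparr>carrier := stabilizer G \<phi> x\<rparr>)) (carrier (G\<lparr>carrier := stabilizer G \<phi> (\<phi> g x)\<rparr>))"
    proof (rule bij_betw_byWitness[where f' = "\<lambda>s. inv g \<otimes> s \<otimes> g"])
      have "inv g \<otimes> (g \<otimes> s \<otimes> inv g) \<otimes> g = s" "g \<otimes> (inv g \<otimes> s \<otimes> g) \<otimes> inv g = s" if "s \<in> carrier G" for s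
        using that assms by (simp_all add: m_assoc cancel)
      then show "\<forall>a\<in>carrier (G\<lparr>carrier := stabilizer G \<phi> x\<rparr>). inv g \<otimes> (g \<otimes> a \<otimes> inv g) \<otimes> g = a"
        "\<forall>a'\<in>carrier (G\<lparr>carrier := stabilizer G \<phi> (\<phi> g x)\<rparr>). g \<otimes> (inv g \<otimes> a' \<otimes> g) \<otimes> inv g = a'"
        by (auto simp: stabilizer_def)
    qed (use in1 in2 in auto)
  qed
  then show ?thesis by (auto simp: is_iso_def)
qed

lemma iso_card: "G \<cong> H \<Longrightarrow> card (carrier G) = card (carrier H)"
  by (auto simp: is_iso_def iso_def intro: bij_betw_same_card)

section \<open>Neighbours of a vertex as linear forms modulo 2\<close>

lemma dmat_mult_nth [simp]: "(dmat ** A) $ i $ j = (if i = 1 then 2 * A $ 1 $ j else A $ i $ j)"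
  for A :: "q2 ^ 3 ^ 3"
  using exhaust_3[of i] by (auto simp: mult3_nth dmat_def)

text \<open>A right coset representative \<open>U ** dmat\<close> only depends on the linear form modulo 2 whose
  kernel is the corresponding sublattice of index 2.\<close>

lemma index_two_criterion:
  assumes X: "zmat X" "det X / 2 \<in> UU" "f v* bmat X = 0"
    and U: "U \<in> GLZ" "f v* bmat U = axis 1 1"
  shows "\<exists>W\<in>GLZ. X = U ** dmat ** W"
proof -
  have inv: "invertible U" "matrix_inv U \<in> GLZ" using U GLZ_invertible GLZ_inv by auto
  define Y where "Y = matrix_inv U ** X"
  have Y: "zmat Y" unfolding Y_def using inv(2) X(1) GLZ_zmat by blast
  have XY: "X = U ** Y" using inv by (simp add: Y_def matrix_mul_assoc)
  have "bmat X = bmat U ** bmat Y"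
    using XY Y U GLZ_zmat by (simp add: bmat_mult)
  \<comment> \<open>In the basis \<open>U\<close> the form f is the first coordinate; its vanishing
    on \<open>X\<close> therefore makes the first row of \<open>Y\<close> even.\<close>
  then have "axis 1 1 v* bmat Y = 0"
    using X(3) U(2) by (metis vector_matrix_mul_assoc)
  then have "(axis 1 1 v* bmat Y) $ j = 0" for j by simp
  then have even: "Y $ 1 $ j / 2 \<in> ZZ" for j
    by (simp add: vector_matrix_mult_def sum_3 axis_def red_eq_0_iff)
  define W where "W = (\<chi> i j. if i = 1 then Y $ i $ j / 2 else Y $ i $ j)"
  have YW: "Y = dmat ** W" by (simp add: vec_eq_iff W_def)
  have dU: "det U \<in> UU" using U by (simp add: GLZ_det)
  have "det X = det U * (2 * det W)" unfolding XY YW by (simp add: det_mul det_dmat)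
  then have "det W = (det X / 2) * inverse (det U)" using UU_nz[OF dU] by (simp add: field_simps)
  then have "det W \<in> UU" using X(2) dU UU_mult UU_inverse by metis
  moreover have "zmat W" using Y even by (simp add: zmat_def W_def)
  ultimately have "W \<in> GLZ" by (simp add: GLZ_det)
  then show ?thesis using XY YW by (auto simp: matrix_mul_assoc)
qed

lemma invertible_transpose: "invertible A \<Longrightarrow> invertible (transpose A)"
  for A :: "'a::comm_ring_1 ^ 'n ^ 'n"
  unfolding invertible_def by (metis matrix_transpose_mul transpose_mat)

text \<open>The form is the first coordinate with respect to the basis \<open>bmat U\<close>; it
  cuts out the sublattice spanned by \<open>U ** dmat\<close>.\<close>

lemma GLZ_row_form:
  assumes "U \<in> GLZ"
  obtains f where "f \<noteq> 0" "f v* bmat U = axis 1 1"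
proof -
  have inv: "invertible (bmat U)" using assms by (simp add: GLZ_iff_bmat)
  let ?f = "axis 1 1 v* matrix_inv (bmat U)"
  have eq: "?f v* bmat U = axis 1 1"
    using inv by (simp add: vector_matrix_mul_assoc)
  moreover have "?f \<noteq> 0"
  proof
    assume "?f = 0"
    then have "axis (1 :: 3) (1 :: bit) = 0" using eq by (simp add: vector_matrix_mult_def zero_vec_def)
    then show False by (simp add: axis_eq_0_iff)
  qed
  ultimately show thesis using that by blast
qed

lemma bit_vector_extends:
  fixes v :: "bit ^ 3"
  assumes "v \<noteq> 0"
  obtains W :: "bit ^ 3 ^ 3" where "invertible W" "W *v axis 2 1 = v"
proof -
  have "v $ 1 \<noteq> 0 \<or> v $ 2 \<noteq> 0 \<or> v $ 3 \<noteq> 0"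
    using assms by (simp only: vec_eq_iff forall_3 zero_index) blast
  then consider "v $ 1 = 1" | "v $ 1 = 0" "v $ 2 = 1" | "v $ 1 = 0" "v $ 2 = 0" "v $ 3 = 1"
    unfolding bit_not_zero_iff using bit_not_one_iff by blast
  then show thesis
  proof cases
    case 1
    show ?thesis by (rule that[of "mk3 0 (v$1) 0 1 (v$2) 0 0 (v$3) 1"])
        (simp_all add: invertible_det_nz det_3 vec_eq_iff forall_3 1)
  next
    case 2
    show ?thesis by (rule that[of "mk3 1 (v$1) 0 0 (v$2) 0 0 (v$3) 1"])
        (simp_all add: invertible_det_nz det_3 vec_eq_iff forall_3 2)
  next
    case 3
    show ?thesis by (rule that[of "mk3 1 (v$1) 0 0 (v$2) 1 0 (v$3) 0"])
        (simp_all add: invertible_det_nz det_3 vec_eq_iff forall_3 3)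
  qed
qed

lemma beta_mk3: "beta_L = mk3 1 0 0 0 (lambar / 2) (lambar / 2) 0 (lambar / 2) (- lambar / 2)"
proof -
  have inv: "1 / lam = lambar / 2" "- 1 / lam = - lambar / 2" using lam_lambar by (simp_all add: field_simps)
  show ?thesis unfolding beta_L_def inv mk3_def ..
qed

lemma Bmat_mk3: "Bmat = mk3 2 lambar lam 0 lambar 1 0 0 1"
  by (simp add: Bmat_def mk3_def)

lemma mat_mk3: "mat x ** mk3 a b c d e f g h i = mk3 (x * a) (x * b) (x * c) (x * d) (x * e) (x * f) (x * g) (x * h) (x * i)"
  by (simp add: vec_eq_iff forall_3)

text \<open>This matrix and the one in \<open>lambar_adj_beta\<close> are integral with determinant
  \<open>lam * lambar ^ 2\<close> up to sign, hence of valuation 1 under the embedding. Their images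
  span index 2 sublattices of the standard lattice.\<close>

lemma lam_beta_square: "mat lam ** (beta_L ** beta_L) = mk3 lam 0 0 0 lambar 0 0 0 lambar"
  unfolding beta_mk3 mk3_mult mat_mk3 mk3_eq_iff by (simp add: lam_cancel)

lemma lambar_adj_beta: "mat lambar ** adj beta_L = mk3 lambar 0 0 0 1 1 0 1 (-1)"
  unfolding beta_mk3 adj_mk3 mat_mk3 mk3_eq_iff by (simp add: lam_lambar)

definition w12 :: "complex ^ 3 ^ 3" where "w12 = mk3 0 1 0 1 0 0 0 0 1"
definition w13 :: "complex ^ 3 ^ 3" where "w13 = mk3 0 0 1 0 1 0 1 0 0"

text \<open>The conditions defining L are symmetric in the three coordinates. The integral matrices
  in the proof express the two transpositions in the basis \<open>Bmat\<close>.\<close>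

lemma w_Isom: "w12 \<in> Isom_L" "w13 \<in> Isom_L"
proof -
  have l2: "lam * lam = - lam - 2" by (rule lam_square)
  have 1: "w12 ** Bmat = Bmat ** mk3 (-1) 0 (1 - lam) lam 1 (- lam - 1) 0 0 1"
    unfolding w12_def Bmat_mk3 mk3_mult mk3_eq_iff using l2 by (simp add: lambar_eq) algebra
  have 2: "w13 ** Bmat = Bmat ** mk3 (1 - lam) (-1) (lam + 1) (- lam) 0 (lam + 1) 2 lambar lam"
    unfolding w13_def Bmat_mk3 mk3_mult mk3_eq_iff using l2 by (simp add: lambar_eq) algebra
  have "unitary w12" "unitary w13" "over O_half w12" "over O_half w13"
    by (simp_all add: unitary_def w12_def w13_def adj_mk3 mk3_mult mat1_mk3)
  moreover have "Binv ** w ** Bmat = C" if "w ** Bmat = Bmat ** C" for w C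
    by (metis that Binv_Bmat matrix_mul_assoc matrix_mul_lid)
  then have "over O_lam (Binv ** w12 ** Bmat)" "over O_lam (Binv ** w13 ** Bmat)"
    using 1 2 by simp_all
  ultimately show "w12 \<in> Isom_L" "w13 \<in> Isom_L" by (simp_all add: Isom_L_eq)
qed

text \<open>The integral right factor has determinant \<open>- (lam * lambar ^ 2)\<close>, so the
  vertex of \<open>beta_L\<close> is a neighbour of that of L. One explicit neighbour is enough, as
  the isometries of L permute all seven transitively.\<close>

lemma Bmat_neighbor: "Bmat ** mk3 1 (-1) (1 - lambar) 0 0 2 0 lambar (- lambar) = mat 2 ** beta_L"
  unfolding beta_mk3 Bmat_mk3 mk3_mult mat_mk3 mk3_eq_iff
  using lam_square by (simp add: lambar_eq) algebra

section \<open>The generated group reaches every vertex\<close>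

context dyadic
begin

lemma im_det: "over Q_lam A \<Longrightarrow> det (im A) = \<iota> (det A)"
  by (simp add: det_3 over_def)

lemma det_O_lam: "over O_lam A \<Longrightarrow> det A \<in> O_lam" for A :: "complex ^ 3 ^ 3"
  by (simp add: det_3 over_def)

lemma UU_par: "x \<in> O_lam \<Longrightarrow> par x = 1 \<Longrightarrow> \<iota> x \<in> UU"
  by (simp add: par_def red_eq_1_iff)

text \<open>Both matrices span sublattices of index 2 cut out by the same form, so
  \<open>index_two_criterion\<close> identifies them. The hypotheses on the determinant say that its
  valuation at \<open>lam\<close> is exactly 1.\<close>

lemma neighbor_vtx:
  assumes X: "over O_lam X" "det X = lam * d" "d \<in> O_lam" "par d = 1" "f v* bmat (im X) = 0"
    and U: "U \<in> GLZ" "f v* bmat U = axis 1 1"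
  shows "vtx (g ** (U ** dmat)) = vtx (g ** im X)"
proof -
  obtain u where u: "u \<in> UU" "\<iota> lam = 2 * u" using iota_lam by blast
  have "det (im X) / 2 = u * \<iota> d" using X u by (simp add: im_det)
  then have "det (im X) / 2 \<in> UU" using UU_mult u UU_par X by metis
  then obtain W where W: "W \<in> GLZ" "im X = U ** dmat ** W"
    using index_two_criterion[OF _ _ X(5) U] X by auto
  then have "g ** im X = (g ** (U ** dmat)) ** W" by (simp add: matrix_mul_assoc)
  then show ?thesis using W by simp
qed

definition Gen :: "(q2 ^ 3 ^ 3) set set" where
  "Gen = generate PGL3 (PIsom_L \<iota> \<union> {to_PGL3 (im beta_L)})"

text \<open>The generated group lifted to unitary matrices, so that its elements can be multiplied
  over O[1/2].\<close>

definition GG :: "(complex ^ 3 ^ 3) set" where "GG = {A \<in> U_half. to_PGL3 (im A) \<in> Gen}"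

lemma beta_U_half: "beta_L \<in> U_half"
  using beta_Gamma by (simp add: Gamma_L_eq U_halfI)

lemma generators_PG: "PIsom_L \<iota> \<union> {to_PGL3 (im beta_L)} \<subseteq> PG"
  using Isom_L_U_half beta_U_half by (auto simp: PIsom_L_eq PG_def)

lemma Gen_subgroup: "subgroup Gen PGL3"
  unfolding Gen_def using generators_PG subgroup.subset[OF PG_subgroup]
  by (intro PGL3.generate_is_subgroup) blast

lemma Gen_subset_PG: "Gen \<subseteq> PG"
  unfolding Gen_def by (rule PGL3.generate_subgroup_incl[OF generators_PG PG_subgroup])

lemma GG_U_half: "A \<in> GG \<Longrightarrow> A \<in> U_half"
  by (simp add: GG_def)

lemma GG_mult: "A \<in> GG \<Longrightarrow> B \<in> GG \<Longrightarrow> A ** B \<in> GG"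
  using subgroup.m_closed[OF Gen_subgroup] by (auto simp: GG_def U_half_mult PG_mult[symmetric])

lemma GG_adj: "A \<in> GG \<Longrightarrow> adj A \<in> GG"
  using subgroup.m_inv_closed[OF Gen_subgroup] by (auto simp: GG_def U_half_adj PG_inv[symmetric])

lemma Isom_GG: "A \<in> Isom_L \<Longrightarrow> A \<in> GG"
  unfolding GG_def Gen_def by (auto simp: Isom_L_U_half PIsom_L_eq intro!: generate.incl)

lemma beta_GG: "beta_L \<in> GG"
  unfolding GG_def Gen_def by (auto simp: beta_U_half intro!: generate.incl)

text \<open>The property carried through \<open>GL3_induct\<close>. It refers to the generated group
  rather than to all of \<open>PG\<close>, so that one induction yields both the orbits and the
  statement on generators.\<close>

definition good :: "q2 ^ 3 ^ 3 \<Rightarrow> bool" where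
  "good X \<longleftrightarrow> (\<exists>A\<in>GG. vtx X = vtx (im A) \<or> vtx X = vtx (im A ** im Bmat))"

lemma invertible_im_Bmat [simp]: "invertible (im Bmat)"
  using im_invertible(1)[of Bmat Binv] by (simp add: Bmat_Binv)

lemma good_translate:
  assumes "A \<in> GG" "invertible X" "good X"
  shows "good (im A ** X)"
proof -
  obtain A' where A': "A' \<in> GG" "vtx X = vtx (im A') \<or> vtx X = vtx (im A' ** im Bmat)"
    using assms by (auto simp: good_def)
  have inv: "invertible (im A')" using A' GG_U_half im_unitary_invertible by blast
  have m: "im (A ** A') = im A ** im A'" using assms A' GG_U_half by (simp add: im_mult)
  have "vtx (im A ** X) = vtx (im (A ** A')) \<or> vtx (im A ** X) = vtx (im (A ** A') ** im Bmat)"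
    unfolding m matrix_mul_assoc[symmetric]
    using A'(2) vtx_mult_cong[of X "im A'"] vtx_mult_cong[of X "im A' ** im Bmat"] assms(2) inv
    by (auto simp: invertible_mult')
  then show ?thesis using GG_mult[OF assms(1) A'(1)] unfolding good_def by blast
qed

lemma good_smult_im: "A \<in> GG \<Longrightarrow> X = mat c ** A \<Longrightarrow> c \<in> O_lam \<Longrightarrow> c \<noteq> 0 \<Longrightarrow> vtx Y = vtx (im X) \<Longrightarrow> good Y"
  unfolding good_def using GG_U_half[of A] by (auto simp: im_smult intro!: bexI[of _ A])

lemma vmult_bmat_im_mk3:
  "v v* bmat (im (mk3 a b c d e f g h i)) = vector [
    v $ 1 * par a + v $ 2 * par d + v $ 3 * par g, v $ 1 * par b + v $ 2 * par e + v $ 3 * par h,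
    v $ 1 * par c + v $ 2 * par f + v $ 3 * par i]"
  unfolding bmat_im_mk3
  by (rule vec3_eqI) (simp_all add: vector_matrix_mult_def sum_3 mult.commute del: mult_bit_eq_and add_bit_eq_xor)

lemma vector3_eq_0: "vector [a, b, c] = (0 :: 'a::zero ^ 3) \<longleftrightarrow> a = 0 \<and> b = 0 \<and> c = 0"
  by (simp add: vec_eq_iff forall_3)

text \<open>The neighbours correspond to the seven nonzero forms over F_2. Forms with one nonzero
  coefficient come from \<open>beta_L ** beta_L\<close>, those with two from
  \<open>adj beta_L\<close>, each moved around by coordinate permutations; the form with three gives
  L.\<close>

lemma base_neighbor:
  assumes U: "U \<in> GLZ"
  shows "good (U ** dmat)"
proof -
  obtain f where f: "f \<noteq> 0" "f v* bmat U = axis 1 1" using GLZ_row_form[OF U] by blast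
  have nb: "vtx (U ** dmat) = vtx (im X)"
    if "over O_lam X" "det X = lam * d" "d \<in> O_lam" "par d = 1" "f v* bmat (im X) = 0" for X d
    using neighbor_vtx[OF that U f(2), of "mat 1"] by simp
  have bb: "beta_L ** beta_L \<in> GG" and ab: "adj beta_L \<in> GG" using beta_GG GG_mult GG_adj by blast+
  have w: "w12 \<in> GG" "w13 \<in> GG" using w_Isom Isom_GG by blast+
  have mwc: "w ** (mat c ** A) = mat c ** (w ** A)" for c and w A :: "complex ^ 3 ^ 3"
    by (metis mat_commute matrix_mul_assoc)
  note simps = det_3 lam_cancel lam_lambar vmult_bmat_im_mk3 vector3_eq_0
  have ll: "lam * (lambar * lambar) = 2 * lambar" by (simp add: lam_cancel)
  consider "f = vector [1, 0, 0]" | "f = vector [0, 1, 0]" | "f = vector [0, 0, 1]" | "f = vector [0, 1, 1]"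
    | "f = vector [1, 0, 1]" | "f = vector [1, 1, 0]" | "f = vector [1, 1, 1]"
  proof -
    have "f = vector [f $ 1, f $ 2, f $ 3]" by (simp add: vec_eq_iff forall_3)
    then show thesis using that f(1)
      by (cases "f $ 1" rule: bit_cases; cases "f $ 2" rule: bit_cases; cases "f $ 3" rule: bit_cases)
        (simp_all add: vector3_eq_0)
  qed
  then show ?thesis
  proof cases
    case 1
    show ?thesis
      by (rule good_smult_im[OF bb lam_beta_square[symmetric] _ _ nb[of _ "lambar * lambar"]])
        (simp_all add: simps 1)
  next
    case 2
    have e: "mk3 0 lambar 0 lam 0 0 0 0 lambar = mat lam ** (w12 ** (beta_L ** beta_L))"
      by (subst mwc[symmetric]) (simp only: lam_beta_square w12_def, simp add: mk3_mult)
    show ?thesis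
      by (rule good_smult_im[OF GG_mult[OF w(1) bb] e _ _ nb[of _ "- (lambar * lambar)"]])
        (simp_all add: simps 2)
  next
    case 3
    have e: "mk3 0 0 lambar 0 lambar 0 lam 0 0 = mat lam ** (w13 ** (beta_L ** beta_L))"
      by (subst mwc[symmetric]) (simp only: lam_beta_square w13_def, simp add: mk3_mult)
    show ?thesis
      by (rule good_smult_im[OF GG_mult[OF w(2) bb] e _ _ nb[of _ "- (lambar * lambar)"]])
        (simp_all add: simps 3)
  next
    case 4
    show ?thesis
      by (rule good_smult_im[OF ab lambar_adj_beta[symmetric] _ _ nb[of _ "- (lambar * lambar)"]])
        (simp_all add: simps 4)
  next
    case 5
    have e: "mk3 0 1 1 lambar 0 0 0 1 (-1) = mat lambar ** (w12 ** adj beta_L)"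
      by (subst mwc[symmetric]) (simp only: lambar_adj_beta w12_def, simp add: mk3_mult)
    show ?thesis
      by (rule good_smult_im[OF GG_mult[OF w(1) ab] e _ _ nb[of _ "lambar * lambar"]])
        (simp_all add: simps 5)
  next
    case 6
    have e: "mk3 0 1 (-1) 0 1 1 lambar 0 0 = mat lambar ** (w13 ** adj beta_L)"
      by (subst mwc[symmetric]) (simp only: lambar_adj_beta w13_def, simp add: mk3_mult)
    show ?thesis
      by (rule good_smult_im[OF GG_mult[OF w(2) ab] e _ _ nb[of _ "lambar * lambar"]])
        (simp_all add: simps 6)
  next
    case 7
    \<comment> \<open>Since \<open>lambar\<close> becomes a unit, the congruences modulo
      \<open>lambar\<close> disappear 2-adically, and L is cut out by x1 + x2 + x3 alone.\<close>
    have "vtx (U ** dmat) = vtx (im Bmat)"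
      by (rule nb[of _ "lambar * lambar"]) (simp_all add: simps 7 Bmat_mk3)
    moreover have "mat 1 \<in> GG" using Isom_GG Isom_L_1 by blast
    ultimately show ?thesis unfolding good_def by (intro bexI[of _ "mat 1"]) simp_all
  qed
qed

text \<open>The isometries of L induce all of GL_3(F_2), so any nonzero form can be moved to the one
  that belongs to \<open>Bmat_neighbor\<close>.\<close>

lemma L_neighbor:
  assumes U: "U \<in> GLZ"
  shows "good (im Bmat ** (U ** dmat))"
proof -
  obtain f where f: "f \<noteq> 0" "f v* bmat U = axis 1 1" using GLZ_row_form[OF U] by blast
  obtain W :: "bit ^ 3 ^ 3" where W: "invertible W" "W *v axis 2 1 = f" using bit_vector_extends[OF f(1)] by blast
  \<comment> \<open>Forms transform by the inverse transpose: this choice takes f to the second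
    coordinate, and the second row of \<open>X'\<close> is even.\<close>
  define M where "M = transpose (matrix_inv W)"
  have "invertible M" unfolding M_def using W by (intro invertible_transpose invertible_matrix_inv)
  then obtain A where A: "A \<in> Isom_L" "rho A = M" using rho_surj by blast
  define C where "C = Binv ** A ** Bmat"
  have C: "over O_lam C" "bmat (im C) = M" using A Isom_L_frame by (simp_all add: C_def rho_def)
  have Mf: "f v* M = axis 2 1"
    unfolding W(2)[symmetric] using W(1) by (simp add: M_def matrix_vector_mul_assoc)
  define X' where "X' = mk3 1 (-1) (1 - lambar) 0 0 2 0 lambar (- lambar)"
  have X': "over O_lam X'" by (simp add: X'_def)
  have "vtx (im Bmat ** (U ** dmat)) = vtx (im Bmat ** im (C ** X'))"
  proof (rule neighbor_vtx[OF _ _ _ _ _ U f(2)])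
    show "over O_lam (C ** X')" using C X' by simp
    have "det X' = lam * - (lambar * lambar)" by (simp add: X'_def det_3 lam_cancel)
    then show "det (C ** X') = lam * (det C * - (lambar * lambar))" by (simp add: det_mul)
    have dC: "det C \<in> O_lam" using C det_O_lam by blast
    then show "det C * - (lambar * lambar) \<in> O_lam" by simp
    have "par (det C) = det M"
      unfolding C(2)[symmetric] using bmat_det[of "im C"] C(1) by (simp add: par_def im_det)
    moreover have "det M = 1" using \<open>invertible M\<close> by (simp add: invertible_det_nz)
    ultimately show "par (det C * - (lambar * lambar)) = 1" using dC by simp
    have "bmat (im (C ** X')) = M ** bmat (im X')"
      using C X' by (simp add: im_mult bmat_mult)
    then have "f v* bmat (im (C ** X')) = axis 2 1 v* bmat (im X')"
      by (metis vector_matrix_mul_assoc Mf)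
    also have "\<dots> = 0" unfolding X'_def vmult_bmat_im_mk3 vector3_eq_0 by (simp add: axis_def)
    finally show "f v* bmat (im (C ** X')) = 0" .
  qed
  also have "im Bmat ** im (C ** X') = im (Bmat ** (C ** X'))" using C X' by (simp add: im_mult)
  also have "Bmat ** (C ** X') = A ** (Bmat ** X')"
    unfolding C_def by (metis Bmat_Binv matrix_mul_assoc matrix_mul_lid)
  also have "\<dots> = mat 2 ** (A ** beta_L)"
    unfolding X'_def Bmat_neighbor by (metis mat_commute matrix_mul_assoc)
  finally show ?thesis
    using good_smult_im[OF GG_mult[OF Isom_GG[OF A(1)] beta_GG] refl, of 2] by simp
qed

lemma all_good: "invertible X \<Longrightarrow> good X"
proof (induction X rule: GL3_induct)
  case one
  have "mat 1 \<in> GG" using Isom_GG Isom_L_1 by blast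
  then show ?case unfolding good_def by (intro bexI[of _ "mat 1"]) simp_all
next
  case (smult c A)
  then show ?case by (simp add: good_def)
next
  case (GLZ A U)
  then show ?case by (simp add: good_def)
next
  case (dmat X)
  then obtain A where A: "A \<in> GG" "vtx X = vtx (im A) \<or> vtx X = vtx (im A ** im Bmat)"
    by (auto simp: good_def)
  have inv: "invertible (im A)" using A GG_U_half im_unitary_invertible by blast
  \<comment> \<open>The frame of the base vertex to which \<open>X\<close> is equivalent;
    translating by \<open>A\<close> reduces the claim to a neighbour of a base vertex.\<close>
  define Y where "Y = (if vtx X = vtx (im A) then mat 1 else im Bmat)"
  have Y: "invertible (im A ** Y)" "vtx (im A ** Y) = vtx X" using A inv by (auto simp: Y_def invertible_mult')
  obtain c U where U: "c \<noteq> 0" "U \<in> GLZ" "X = mat c ** (im A ** Y) ** U"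
    using vtx_eq_iff[OF Y(1) dmat.hyps] Y(2) by metis
  have "good (Y ** (U ** dmat))" using base_neighbor[OF U(2)] L_neighbor[OF U(2)] by (simp add: Y_def)
  moreover have "invertible (Y ** (U ** dmat))"
    using U(2) GLZ_invertible by (intro invertible_mult') (auto simp: Y_def)
  ultimately have "good (im A ** (Y ** (U ** dmat)))" using good_translate A(1) by blast
  moreover have "X ** dmat = mat c ** (im A ** (Y ** (U ** dmat)))"
    unfolding U(3) by (simp add: matrix_mul_assoc)
  ultimately show ?case using U(1) by (simp add: good_def)
qed

section \<open>Orbits and the generated group\<close>

interpretation PG_act: group_action "PGL3\<lparr>carrier := PG\<rparr>" building_vertices vertex_action
  by (rule subgroup_group_action[OF PG_subgroup])

lemma vtx_not_equivalent:
  assumes "A \<in> U_half"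
  shows "vtx (im A ** im Bmat) \<noteq> vtx (mat 1)"
proof
  assume eq: "vtx (im A ** im Bmat) = vtx (mat 1)"
  have "to_PGL3 (im A) \<in> PG" using assms by (auto simp: PG_def)
  moreover have "vtx (im Bmat) \<in> building_vertices" by (simp add: building_vertices_eq)
  ultimately have "PGL3\<lparr>carrier := PG, carrier := stabilizer (PGL3\<lparr>carrier := PG\<rparr>) vertex_action (vtx (im Bmat))\<rparr> \<cong>
    PGL3\<lparr>carrier := PG, carrier := stabilizer (PGL3\<lparr>carrier := PG\<rparr>) vertex_action (vertex_action (to_PGL3 (im A)) (vtx (im Bmat)))\<rparr>"
    by (intro PG_act.stabilizer_conjugate) simp_all
  then have "card (stabilizer (PGL3\<lparr>carrier := PG\<rparr>) vertex_action (vtx (im Bmat))) =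
    card (stabilizer (PGL3\<lparr>carrier := PG\<rparr>) vertex_action (vtx (mat 1)))"
    using iso_card eq by fastforce
  then have "card (PIsom_L \<iota>) = card PS"
    unfolding stabilizer_L stabilizer_standard PS_def .
  then show False by (simp add: card_PIsom_L PS_iso)
qed

lemma PG_eq_Gen: "PG = Gen"
proof
  show "PG \<subseteq> Gen"
  proof
    fix g assume "g \<in> PG"
    then obtain A where A: "A \<in> U_half" "g = to_PGL3 (im A)" by (auto simp: PG_def)
    have invA: "invertible (im A)" using A im_unitary_invertible by blast
    \<comment> \<open>The vertex of L serves as test vertex because its stabilizer
      \<open>PIsom_L \<iota>\<close> consists of generators.\<close>
    then have "good (im A ** im Bmat)" by (intro all_good invertible_mult') simp_all
    then obtain A' where A': "A' \<in> GG" "vtx (im A ** im Bmat) = vtx (im A') \<or> vtx (im A ** im Bmat) = vtx (im A' ** im Bmat)"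
      by (auto simp: good_def)
    note UA' = GG_U_half[OF A'(1)]
    have invA': "invertible (im A')" using UA' im_unitary_invertible by blast
    have aA': "im (adj A') ** im A' = mat 1" using im_unitary_invertible[OF UA'] by (metis matrix_inv_left)
    have D: "adj A' ** A \<in> U_half" using A UA' U_half_mult U_half_adj by blast
    have imD: "im (adj A' ** A) = im (adj A') ** im A" using A U_half_adj[OF UA'] by (simp add: im_mult)
    have invAB: "invertible (im A ** im Bmat)" using invA by (simp add: invertible_mult')
    have "vtx (im A ** im Bmat) \<noteq> vtx (im A')"
    proof
      assume "vtx (im A ** im Bmat) = vtx (im A')"
      then have "vtx (im (adj A') ** (im A ** im Bmat)) = vtx (im (adj A') ** im A')"
        by (rule vtx_mult_cong[OF invAB invA'])
      then show False using vtx_not_equivalent[OF D] by (simp add: imD aA' matrix_mul_assoc)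
    qed
    then have "vtx (im A ** im Bmat) = vtx (im A' ** im Bmat)" using A' by blast
    then have "vtx (im (adj A') ** (im A ** im Bmat)) = vtx (im (adj A') ** (im A' ** im Bmat))"
      using invA' by (intro vtx_mult_cong[OF invAB]) (simp_all add: invertible_mult')
    then have "vtx (im (adj A' ** A) ** im Bmat) = vtx (im Bmat)"
      by (simp add: imD aA' matrix_mul_assoc)
    then have "to_PGL3 (im (adj A' ** A)) \<in> stabilizer (PGL3\<lparr>carrier := PG\<rparr>) vertex_action (vtx (im Bmat))"
      using D by (simp add: stabilizer_def PG_def)
    then have "to_PGL3 (im (adj A' ** A)) \<in> Gen"
      unfolding stabilizer_L Gen_def by (auto intro: generate.incl)
    then have "adj A' ** A \<in> GG" using D by (simp add: GG_def)
    then have "A' ** (adj A' ** A) \<in> GG" by (rule GG_mult[OF A'(1)])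
    moreover have "A' ** (adj A' ** A) = A"
      using UA' by (simp add: matrix_mul_assoc unitary_right U_half_unitary)
    ultimately show "g \<in> Gen" using A(2) by (simp add: GG_def)
  qed
qed (rule Gen_subset_PG)

lemma vertex_cases:
  assumes "V \<in> building_vertices"
  shows "\<exists>A\<in>U_half. V = vtx (im A) \<or> V = vtx (im A ** im Bmat)"
  using assms all_good GG_U_half by (fastforce simp: building_vertices_eq good_def)

lemma orbits_PG:
  "\<exists>O1 O2. O1 \<noteq> O2 \<and> orbits (PGL3\<lparr>carrier := PG\<rparr>) building_vertices vertex_action = {O1, O2} \<and>
    (\<forall>V\<in>O1. PGL3\<lparr>carrier := stabilizer (PGL3\<lparr>carrier := PG\<rparr>) vertex_action V\<rparr> \<cong> L3_2) \<and>
    (\<forall>V\<in>O2. PGL3\<lparr>carrier := stabilizer (PGL3\<lparr>carrier := PG\<rparr>) vertex_action V\<rparr> \<cong> sym_group 4)"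
proof -
  let ?G = "PGL3\<lparr>carrier := PG\<rparr>"
  let ?VL = "vtx (im Bmat)" and ?V1 = "vtx (mat 1)"
  have in_b: "?VL \<in> building_vertices" "?V1 \<in> building_vertices"
    by (auto simp: building_vertices_eq)
  have orbL: "orbit ?G vertex_action ?VL = (\<lambda>A. vtx (im A ** im Bmat)) ` U_half"
    unfolding orbit_def PG_def by (simp add: Setcompr_eq_image image_image im_unitary_invertible)
  have orb1: "orbit ?G vertex_action ?V1 = (\<lambda>A. vtx (im A)) ` U_half"
    unfolding orbit_def PG_def by (simp add: Setcompr_eq_image image_image im_unitary_invertible)
  have ne: "orbit ?G vertex_action ?VL \<noteq> orbit ?G vertex_action ?V1"
  proof
    assume "orbit ?G vertex_action ?VL = orbit ?G vertex_action ?V1"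
    then have "?V1 \<in> orbit ?G vertex_action ?VL" using PG_act.orbit_refl[OF in_b(2)] by simp
    then obtain A where "A \<in> U_half" "vtx (mat 1) = vtx (im A ** im Bmat)"
      unfolding orbL by blast
    then show False using vtx_not_equivalent[of A] by simp
  qed
  have "orbit ?G vertex_action V \<in> {orbit ?G vertex_action ?VL, orbit ?G vertex_action ?V1}"
    if V: "V \<in> building_vertices" for V
  proof -
    have "V \<in> orbit ?G vertex_action ?VL \<or> V \<in> orbit ?G vertex_action ?V1"
      using vertex_cases[OF V] unfolding orbL orb1 by blast
    moreover have "orbit ?G vertex_action V = orbit ?G vertex_action W"
      if "W \<in> building_vertices" "V \<in> orbit ?G vertex_action W" for W
    proof -
      have sub: "orbit ?G vertex_action X \<subseteq> building_vertices" if "X \<in> building_vertices" for X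
        using that PG_act.element_image by (auto simp: orbit_def)
      have trans: "orbit ?G vertex_action Y \<subseteq> orbit ?G vertex_action X"
        if "X \<in> building_vertices" "Y \<in> building_vertices" "Y \<in> orbit ?G vertex_action X" for X Y
        using PG_act.orbit_trans[OF that(1,2) _ that(3)] sub[OF that(2)] by blast
      show ?thesis
        using trans[OF that(1) V that(2)] trans[OF V that(1) PG_act.orbit_sym[OF that(1) V that(2)]] by blast
    qed
    ultimately show ?thesis using in_b by blast
  qed
  then have "orbits ?G building_vertices vertex_action = {orbit ?G vertex_action ?VL, orbit ?G vertex_action ?V1}"
    using in_b unfolding orbits_def by blast
  moreover have conj: "PGL3\<lparr>carrier := stabilizer ?G vertex_action V\<rparr> \<cong> H"
    if W: "W \<in> building_vertices" "V \<in> orbit ?G vertex_action W" "PGL3\<lparr>carrier := stabilizer ?G vertex_action W\<rparr> \<cong> H"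
    for V W and H :: "('h, 'i) monoid_scheme"
  proof -
    obtain g where g: "g \<in> PG" "V = vertex_action g W" using W(2) by (auto simp: orbit_def)
    have grp: "group (PGL3\<lparr>carrier := stabilizer ?G vertex_action W\<rparr>)"
      using group.subgroup_imp_group[OF PGL3.subgroup_imp_group[OF PG_subgroup] PG_act.stabilizer_subgroup[OF W(1)]] by simp
    have "PGL3\<lparr>carrier := stabilizer ?G vertex_action W\<rparr> \<cong> PGL3\<lparr>carrier := stabilizer ?G vertex_action V\<rparr>"
      using PG_act.stabilizer_conjugate[OF W(1), of g] g by simp
    then have "PGL3\<lparr>carrier := stabilizer ?G vertex_action V\<rparr> \<cong> PGL3\<lparr>carrier := stabilizer ?G vertex_action W\<rparr>"
      using group.iso_sym[OF grp] by blast
    then show ?thesis using iso_trans W(3) by blast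
  qed
  moreover have "PGL3\<lparr>carrier := stabilizer ?G vertex_action ?VL\<rparr> \<cong> L3_2"
    unfolding stabilizer_L by (rule PIsom_L_iso)
  moreover have "PGL3\<lparr>carrier := stabilizer ?G vertex_action ?V1\<rparr> \<cong> sym_group 4"
    unfolding stabilizer_standard PS_def[symmetric] by (rule PS_iso)
  ultimately show ?thesis using ne in_b by metis
qed

end

section \<open>Haar measure on filtered groups\<close>

text \<open>A group topologized by the cosets of a decreasing sequence of subgroups. The assumptions
  express continuity of conjugation, finite index among the subgroups and a countable number of
  cosets; the measure theory is carried out from these before matrices enter.\<close>

locale filtered_group = group G for G (structure) +
  fixes T :: "'a topology" and Kn :: "nat \<Rightarrow> 'a set"
  assumes sub: "\<And>n. subgroup (Kn n) G"
    and dec: "\<And>n. Kn (Suc n) \<subseteq> Kn n"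
    and openin_iff: "\<And>U. openin T U \<longleftrightarrow> U \<subseteq> carrier G \<and> (\<forall>x\<in>U. \<exists>n. x <#\<^bsub>G\<^esub> Kn n \<subseteq> U)"
    and conj: "\<And>g n. g \<in> carrier G \<Longrightarrow> \<exists>m. \<forall>k\<in>Kn m. g \<otimes> k \<otimes> inv g \<in> Kn n"
    and finite_index: "\<And>n. \<exists>F. finite F \<and> F \<subseteq> Kn 0 \<and> Kn 0 \<subseteq> (\<Union>f\<in>F. f <#\<^bsub>G\<^esub> Kn n)"
    and countable_index: "\<exists>C. countable C \<and> C \<subseteq> carrier G \<and> carrier G \<subseteq> (\<Union>c\<in>C. c <#\<^bsub>G\<^esub> Kn 0)"
begin

lemma l_cosetI: "h \<in> H \<Longrightarrow> x = a \<otimes> h \<Longrightarrow> x \<in> a <#\<^bsub>G\<^esub> H"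
  by (auto simp: l_coset_def)

lemma Kn_antimono: "m \<le> n \<Longrightarrow> Kn n \<subseteq> Kn m"
  by (rule lift_Suc_antimono_le[of Kn]) (rule dec)

lemma Kn_carrier: "k \<in> Kn n \<Longrightarrow> k \<in> carrier G"
  using subgroup.subset[OF sub] by blast

lemma topspace_T: "topspace T = carrier G"
proof
  show "topspace T \<subseteq> carrier G" using openin_iff[of "topspace T"] by simp
  have "openin T (carrier G)"
    using openin_iff[of "carrier G"] Kn_carrier by (auto simp: l_coset_def)
  then show "carrier G \<subseteq> topspace T" by (rule openin_subset)
qed

lemma coset_eq: "x \<in> carrier G \<Longrightarrow> y \<in> x <#\<^bsub>G\<^esub> Kn n \<Longrightarrow> x <#\<^bsub>G\<^esub> Kn n = y <#\<^bsub>G\<^esub> Kn n"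
  using l_repr_independence sub by blast

lemma coset_carrier: "x \<in> carrier G \<Longrightarrow> x <#\<^bsub>G\<^esub> Kn n \<subseteq> carrier G"
  using Kn_carrier by (auto simp: l_coset_def)

lemma coset_self: "x \<in> carrier G \<Longrightarrow> x \<in> x <#\<^bsub>G\<^esub> Kn n"
  using lcos_self sub by blast

lemma coset_open: "x \<in> carrier G \<Longrightarrow> openin T (x <#\<^bsub>G\<^esub> Kn n)"
  unfolding openin_iff using coset_carrier coset_eq by blast

lemma coset_mono: "m \<le> n \<Longrightarrow> x <#\<^bsub>G\<^esub> Kn n \<subseteq> x <#\<^bsub>G\<^esub> Kn m"
  using Kn_antimono by (fastforce simp: l_coset_def)

definition cosets :: "nat \<Rightarrow> 'a set set" where "cosets n = (\<lambda>x. x <#\<^bsub>G\<^esub> Kn n) ` carrier G"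

lemma countable_cosets: "countable (cosets n)"
proof -
  obtain F where F: "finite F" "F \<subseteq> Kn 0" "Kn 0 \<subseteq> (\<Union>f\<in>F. f <#\<^bsub>G\<^esub> Kn n)" using finite_index[of n] by auto
  obtain C where C: "countable C" "C \<subseteq> carrier G" "carrier G \<subseteq> (\<Union>c\<in>C. c <#\<^bsub>G\<^esub> Kn 0)" using countable_index by auto
  have "cosets n \<subseteq> (\<lambda>(c, f). (c \<otimes> f) <#\<^bsub>G\<^esub> Kn n) ` (C \<times> F)"
  proof
    fix D assume "D \<in> cosets n"
    then obtain x where x: "x \<in> carrier G" "D = x <#\<^bsub>G\<^esub> Kn n" by (auto simp: cosets_def)
    obtain c k where c: "c \<in> C" "k \<in> Kn 0" "x = c \<otimes> k" using C(3) x(1) by (auto simp: l_coset_def)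
    obtain f k' where f: "f \<in> F" "k' \<in> Kn n" "k = f \<otimes> k'" using F(3) c(2) by (auto simp: l_coset_def)
    have cc: "c \<in> carrier G" "f \<in> carrier G" "k' \<in> carrier G" using c f C F Kn_carrier by blast+
    have "x \<in> (c \<otimes> f) <#\<^bsub>G\<^esub> Kn n" by (rule l_cosetI[OF f(2)]) (simp add: c f cc m_assoc)
    then have "D = (c \<otimes> f) <#\<^bsub>G\<^esub> Kn n" using coset_eq[of "c \<otimes> f" x n] cc x by simp
    then show "D \<in> (\<lambda>(c, f). (c \<otimes> f) <#\<^bsub>G\<^esub> Kn n) ` (C \<times> F)" using c f by auto
  qed
  then show ?thesis
    by (rule countable_subset) (use C F in \<open>auto intro: countable_finite\<close>)
qed

text \<open>There are only countably many cosets of the subgroups \<open>Kn n\<close>, so every open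
  set is a countable union of cosets.\<close>

lemma sigma_sets_cosets: "borel_sets T = sigma_sets (carrier G) (insert {} (\<Union>n. cosets n))"
proof
  show "borel_sets T \<subseteq> sigma_sets (carrier G) (insert {} (\<Union>n. cosets n))"
    unfolding borel_sets_def topspace_T
  proof (rule sigma_sets_mono, rule subsetI)
    fix U assume "U \<in> {U. openin T U}"
    then have U: "U \<subseteq> carrier G" "\<And>x. x \<in> U \<Longrightarrow> \<exists>n. x <#\<^bsub>G\<^esub> Kn n \<subseteq> U" using openin_iff by auto
    have "U = \<Union>{D \<in> (\<Union>n. cosets n). D \<subseteq> U}"
    proof (intro equalityI subsetI)
      fix x assume x: "x \<in> U"
      then obtain n where "x <#\<^bsub>G\<^esub> Kn n \<subseteq> U" using U by blast
      then show "x \<in> \<Union>{D \<in> (\<Union>n. cosets n). D \<subseteq> U}"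
        using x U coset_self[of x n] by (intro UnionI[of "x <#\<^bsub>G\<^esub> Kn n"]) (auto simp: cosets_def)
    qed auto
    moreover have "countable {D \<in> (\<Union>n. cosets n). D \<subseteq> U}"
      by (rule countable_subset[of _ "\<Union>n. cosets n"]) (auto intro: countable_cosets)
    then have "\<Union>{D \<in> (\<Union>n. cosets n). D \<subseteq> U} \<in> sigma_sets (carrier G) (insert {} (\<Union>n. cosets n))"
      by (rule sigma_sets_UNION) (auto intro: sigma_sets.Basic)
    ultimately show "U \<in> sigma_sets (carrier G) (insert {} (\<Union>n. cosets n))" by simp
  qed
  show "sigma_sets (carrier G) (insert {} (\<Union>n. cosets n)) \<subseteq> borel_sets T"
    unfolding borel_sets_def topspace_T
    by (rule sigma_sets_mono') (auto simp: cosets_def coset_open)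
qed

text \<open>As with balls in an ultrametric space, two cosets are disjoint or nested. The cosets
  thus form a generator on which measures can be compared.\<close>

lemma Int_stable_cosets: "Int_stable (insert {} (\<Union>n. cosets n))"
proof (rule Int_stableI)
  fix a b assume a: "a \<in> insert {} (\<Union>n. cosets n)" and b: "b \<in> insert {} (\<Union>n. cosets n)"
  show "a \<inter> b \<in> insert {} (\<Union>n. cosets n)"
  proof (cases "a \<inter> b = {}")
    case False
    then obtain y where y: "y \<in> a" "y \<in> b" by blast
    obtain x m where x: "x \<in> carrier G" "a = x <#\<^bsub>G\<^esub> Kn m" using a y by (auto simp: cosets_def)
    obtain z n where z: "z \<in> carrier G" "b = z <#\<^bsub>G\<^esub> Kn n" using b y by (auto simp: cosets_def)
    have yc: "y \<in> carrier G" using x y coset_carrier by blast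
    have a': "a = y <#\<^bsub>G\<^esub> Kn m" using coset_eq[OF x(1), of y m] x(2) y(1) by simp
    have b': "b = y <#\<^bsub>G\<^esub> Kn n" using coset_eq[OF z(1), of y n] z(2) y(2) by simp
    have "a \<inter> b = y <#\<^bsub>G\<^esub> Kn (max m n)"
    proof (cases "m \<le> n")
      case True
      then show ?thesis unfolding a' b' using coset_mono[OF True, of y] by (simp add: max_def Int_absorb1)
    next
      case False
      then have "n \<le> m" by simp
      then show ?thesis unfolding a' b' using coset_mono[of n m y] by (simp add: max_def Int_absorb2 False)
    qed
    then show ?thesis using yc unfolding cosets_def by blast
  qed simp
qed

text \<open>Right translation need not permute the left cosets; writing x k g as x g times the
  conjugate of k by the inverse of g reduces the claim to continuity of conjugation.\<close>

lemma open_right_translate: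
  assumes "openin T U" "g \<in> carrier G"
  shows "openin T {x \<in> carrier G. x \<otimes> g \<in> U}"
  unfolding openin_iff
proof (intro conjI ballI)
  fix x assume "x \<in> {x \<in> carrier G. x \<otimes> g \<in> U}"
  then have x: "x \<in> carrier G" "x \<otimes> g \<in> U" by auto
  obtain n where n: "(x \<otimes> g) <#\<^bsub>G\<^esub> Kn n \<subseteq> U" using assms(1) x openin_iff by blast
  obtain m where m: "\<And>k. k \<in> Kn m \<Longrightarrow> inv g \<otimes> k \<otimes> g \<in> Kn n"
    using conj[of "inv g" n] assms(2) by auto
  have "x \<otimes> k \<otimes> g \<in> U" if "k \<in> Kn m" for k
  proof -
    have "x \<otimes> k \<otimes> g = (x \<otimes> g) \<otimes> (inv g \<otimes> k \<otimes> g)"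
      using x assms(2) Kn_carrier[OF that] by (simp add: m_assoc inv_solve_left) (simp add: m_assoc[symmetric])
    then show ?thesis using n m[OF that] by (auto simp: l_coset_def)
  qed
  then have "x <#\<^bsub>G\<^esub> Kn m \<subseteq> {x \<in> carrier G. x \<otimes> g \<in> U}"
    using x Kn_carrier by (auto simp: l_coset_def)
  then show "\<exists>n. x <#\<^bsub>G\<^esub> Kn n \<subseteq> {x \<in> carrier G. x \<otimes> g \<in> U}" ..
qed auto

end

section \<open>Uniqueness of Haar measure and the modular function\<close>

locale filtered_group_haar = filtered_group +
  fixes \<mu> :: "'a measure"
  assumes haar: "haar_measure G T \<mu>" and normalized: "emeasure \<mu> (Kn 0) = 1"
begin

lemma space_mu: "space \<mu> = carrier G" and sets_mu: "sets \<mu> = borel_sets T"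
  and left_invariant: "\<And>g B. g \<in> carrier G \<Longrightarrow> B \<in> sets \<mu> \<Longrightarrow> emeasure \<mu> (g <#\<^bsub>G\<^esub> B) = emeasure \<mu> B"
  using haar by (auto simp: haar_measure_def)

lemma open_measurable: "openin T U \<Longrightarrow> U \<in> sets \<mu>"
  by (auto simp: sets_mu borel_sets_def)

lemma coset_measurable: "x \<in> carrier G \<Longrightarrow> x <#\<^bsub>G\<^esub> Kn n \<in> sets \<mu>"
  by (rule open_measurable[OF coset_open])

lemma one_coset: "\<one> <#\<^bsub>G\<^esub> Kn n = Kn n"
  using Kn_carrier by (force simp: l_coset_def)

lemma Kn_measurable: "Kn n \<in> sets \<mu>"
  using coset_measurable[of \<one> n] by (simp add: one_coset)

lemma right_translation_measurable:
  assumes "g \<in> carrier G"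
  shows "(\<lambda>x. x \<otimes> g) \<in> measurable \<mu> \<mu>"
proof (rule measurable_sigma_sets[where \<Omega> = "carrier G" and A = "{U. openin T U}"])
  show "sets \<mu> = sigma_sets (carrier G) {U. openin T U}" by (simp add: sets_mu borel_sets_def topspace_T)
  show "{U. openin T U} \<subseteq> Pow (carrier G)" using openin_subset topspace_T by blast
  show "(\<lambda>x. x \<otimes> g) \<in> space \<mu> \<rightarrow> carrier G" using assms by (auto simp: space_mu)
  fix U assume "U \<in> {U. openin T U}"
  then have "{x \<in> carrier G. x \<otimes> g \<in> U} \<in> sets \<mu>" using open_right_translate assms open_measurable by blast
  then show "(\<lambda>x. x \<otimes> g) -` U \<inter> space \<mu> \<in> sets \<mu>"
    by (simp add: space_mu vimage_def Int_def conj_commute)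
qed

lemma left_coset_preimage:
  assumes "h \<in> carrier G" "g \<in> carrier G" "B \<subseteq> carrier G"
  shows "{x \<in> carrier G. x \<otimes> g \<in> h <#\<^bsub>G\<^esub> B} = h <#\<^bsub>G\<^esub> {x \<in> carrier G. x \<otimes> g \<in> B}"
proof (intro equalityI subsetI)
  fix x assume "x \<in> {x \<in> carrier G. x \<otimes> g \<in> h <#\<^bsub>G\<^esub> B}"
  then obtain b where x: "x \<in> carrier G" "b \<in> B" "x \<otimes> g = h \<otimes> b" by (auto simp: l_coset_def)
  have "inv h \<otimes> x \<otimes> g = b" using x assms by (metis inv_solve_left m_assoc inv_closed subsetD m_closed)
  moreover have "x = h \<otimes> (inv h \<otimes> x)" using x assms by (simp add: m_assoc[symmetric])
  moreover have "inv h \<otimes> x \<in> carrier G" using x assms by simp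
  ultimately show "x \<in> h <#\<^bsub>G\<^esub> {x \<in> carrier G. x \<otimes> g \<in> B}" using x(2) unfolding l_coset_def by blast
next
  fix x assume "x \<in> h <#\<^bsub>G\<^esub> {x \<in> carrier G. x \<otimes> g \<in> B}"
  then show "x \<in> {x \<in> carrier G. x \<otimes> g \<in> h <#\<^bsub>G\<^esub> B}" using assms by (auto simp: l_coset_def m_assoc)
qed

lemma measurable_subset: "B \<in> sets \<mu> \<Longrightarrow> B \<subseteq> carrier G"
  using sets.sets_into_space space_mu by blast

text \<open>The group \<open>Kn 0\<close> is a disjoint union of finitely many cosets of
  \<open>Kn n\<close>. The measure \<open>L\<close> is general because the formula is applied both
  to Haar measure and to a measure compared with it.\<close>

lemma index_formula:
  assumes "sets L = sets \<mu>"
    and "\<And>x. x \<in> carrier G \<Longrightarrow> emeasure L (x <#\<^bsub>G\<^esub> Kn n) = emeasure L (Kn n)"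
  shows "emeasure L (Kn 0) = of_nat (card ((\<lambda>x. x <#\<^bsub>G\<^esub> Kn n) ` Kn 0)) * emeasure L (Kn n)"
    and "finite ((\<lambda>x. x <#\<^bsub>G\<^esub> Kn n) ` Kn 0)" "card ((\<lambda>x. x <#\<^bsub>G\<^esub> Kn n) ` Kn 0) \<noteq> 0"
proof -
  let ?D = "(\<lambda>x. x <#\<^bsub>G\<^esub> Kn n) ` Kn 0"
  obtain F where F: "finite F" "F \<subseteq> Kn 0" "Kn 0 \<subseteq> (\<Union>f\<in>F. f <#\<^bsub>G\<^esub> Kn n)" using finite_index[of n] by auto
  have "?D \<subseteq> (\<lambda>x. x <#\<^bsub>G\<^esub> Kn n) ` F"
  proof
    fix D assume "D \<in> ?D"
    then obtain x where x: "x \<in> Kn 0" "D = x <#\<^bsub>G\<^esub> Kn n" by blast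
    then obtain f where f: "f \<in> F" "x \<in> f <#\<^bsub>G\<^esub> Kn n" using F by blast
    then have "f <#\<^bsub>G\<^esub> Kn n = x <#\<^bsub>G\<^esub> Kn n" using coset_eq F Kn_carrier by blast
    then show "D \<in> (\<lambda>x. x <#\<^bsub>G\<^esub> Kn n) ` F" using x f by blast
  qed
  then show fin: "finite ?D" using F(1) finite_subset by blast
  have "\<one> \<in> Kn 0" using subgroup.one_closed[OF sub] .
  then show "card ?D \<noteq> 0" using fin by auto
  have un: "\<Union>?D = Kn 0"
  proof
    show "\<Union>?D \<subseteq> Kn 0"
      using subgroup.m_closed[OF sub[of 0]] Kn_antimono[of 0 n] by (auto simp: l_coset_def)
    show "Kn 0 \<subseteq> \<Union>?D" using coset_self Kn_carrier by blast
  qed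
  have disj: "disjoint_family_on (\<lambda>D. D) ?D"
    unfolding disjoint_family_on_def
  proof (intro ballI impI)
    fix D E assume "D \<in> ?D" "E \<in> ?D" "D \<noteq> E"
    then obtain x y where xy: "x \<in> carrier G" "y \<in> carrier G" "D = x <#\<^bsub>G\<^esub> Kn n" "E = y <#\<^bsub>G\<^esub> Kn n"
      using Kn_carrier by blast
    then show "D \<inter> E = {}" using coset_eq[of x _ n] coset_eq[of y _ n] \<open>D \<noteq> E\<close> by (metis disjoint_iff)
  qed
  have "emeasure L (\<Union>D\<in>?D. D) = (\<Sum>D\<in>?D. emeasure L D)"
    by (rule sum_emeasure[symmetric, OF _ disj fin]) (use assms(1) coset_measurable Kn_carrier in auto)
  also have "\<dots> = (\<Sum>D\<in>?D. emeasure L (Kn n))"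
    by (rule sum.cong) (use assms(2) Kn_carrier in auto)
  finally show "emeasure L (Kn 0) = of_nat (card ?D) * emeasure L (Kn n)" using un by simp
qed

text \<open>The index formula determines the measure of every \<open>Kn n\<close> from that of
  \<open>Kn 0\<close>, left invariance extends this to all cosets, and the cosets generate the
  sigma-algebra and are closed under intersection up to the empty set.\<close>

lemma haar_unique:
  assumes L: "sets L = sets \<mu>" "\<And>g B. g \<in> carrier G \<Longrightarrow> B \<in> sets \<mu> \<Longrightarrow> emeasure L (g <#\<^bsub>G\<^esub> B) = emeasure L B"
    and fin: "emeasure L (Kn 0) \<noteq> \<infinity>"
  shows "L = scale_measure (emeasure L (Kn 0)) \<mu>"
proof -
  let ?r = "emeasure L (Kn 0)"
  let ?E = "insert {} (\<Union>n. cosets n)"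
  have eqK: "emeasure L (Kn n) = ?r * emeasure \<mu> (Kn n)" for n
  proof -
    let ?N = "of_nat (card ((\<lambda>x. x <#\<^bsub>G\<^esub> Kn n) ` Kn 0)) :: ennreal"
    have 1: "?r = ?N * emeasure L (Kn n)" "?N \<noteq> 0"
      using index_formula(1)[of L n] index_formula(3)[of \<mu> n] L Kn_measurable left_invariant by auto
    have 2: "1 = ?N * emeasure \<mu> (Kn n)"
      using index_formula(1)[of \<mu> n] Kn_measurable left_invariant normalized by auto
    have "?N * emeasure L (Kn n) = ?N * (?r * emeasure \<mu> (Kn n))"
      using 1(1) 2 by (metis mult.left_commute mult.right_neutral)
    then show ?thesis using 1(2) by (subst (asm) ennreal_mult_cancel_left) (auto simp: ennreal_of_nat_eq_real_of_nat)
  qed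
  obtain C where C: "countable C" "C \<subseteq> carrier G" "carrier G \<subseteq> (\<Union>c\<in>C. c <#\<^bsub>G\<^esub> Kn 0)" using countable_index by auto
  have Cne: "C \<noteq> {}" using C by auto
  define A where "A i = from_nat_into C i <#\<^bsub>G\<^esub> Kn 0" for i
  have Ain: "from_nat_into C i \<in> carrier G" for i using from_nat_into[OF Cne] C by blast
  show ?thesis
  proof (rule measure_eqI_generator_eq[OF Int_stable_cosets])
    show "?E \<subseteq> Pow (carrier G)" using coset_carrier by (auto simp: cosets_def)
    show "sets L = sigma_sets (carrier G) ?E" using L sets_mu sigma_sets_cosets by simp
    show "sets (scale_measure ?r \<mu>) = sigma_sets (carrier G) ?E" using sets_mu sigma_sets_cosets by simp
    show "range A \<subseteq> ?E" using Ain by (auto simp: A_def cosets_def)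
    show "(\<Union>i. A i) = carrier G"
    proof
      show "(\<Union>i. A i) \<subseteq> carrier G" using Ain coset_carrier by (auto simp: A_def)
      show "carrier G \<subseteq> (\<Union>i. A i)"
      proof
        fix x assume "x \<in> carrier G"
        then obtain c where "c \<in> C" "x \<in> c <#\<^bsub>G\<^esub> Kn 0" using C by blast
        then show "x \<in> (\<Union>i. A i)" using from_nat_into_surj[OF C(1), of c] by (force simp: A_def)
      qed
    qed
    show "emeasure L (A i) \<noteq> \<infinity>" for i
      using L(2)[OF Ain Kn_measurable] fin by (simp add: A_def)
    fix X assume "X \<in> ?E"
    then consider "X = {}" | x n where "x \<in> carrier G" "X = x <#\<^bsub>G\<^esub> Kn n" by (auto simp: cosets_def)
    then show "emeasure L X = emeasure (scale_measure ?r \<mu>) X"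
    proof cases
      case (2 x n)
      have "emeasure L X = emeasure L (Kn n)" unfolding 2(2) by (rule L(2)[OF 2(1) Kn_measurable])
      moreover have "emeasure \<mu> X = emeasure \<mu> (Kn n)"
        unfolding 2(2) by (rule left_invariant[OF 2(1) Kn_measurable])
      ultimately show ?thesis using eqK[of n] by simp
    qed simp
  qed
qed

text \<open>Says that \<open>B\<close> translated on the right by the inverse of g has r times the
  measure of \<open>B\<close>. As a relation it can be multiplied and compared without first
  choosing the factor.\<close>

definition modular :: "'a \<Rightarrow> ennreal \<Rightarrow> bool" where
  "modular g r \<longleftrightarrow> distr \<mu> \<mu> (\<lambda>x. x \<otimes> g) = scale_measure r \<mu>"

lemma emeasure_right_translate:
  assumes "g \<in> carrier G" "B \<in> sets \<mu>"
  shows "emeasure (distr \<mu> \<mu> (\<lambda>x. x \<otimes> g)) B = emeasure \<mu> {x \<in> carrier G. x \<otimes> g \<in> B}"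
  using emeasure_distr[OF right_translation_measurable[OF assms(1)] assms(2)]
  by (simp add: space_mu vimage_def Int_def conj_commute)

text \<open>Right and left translations commute, so the translated measure is again left invariant,
  and \<open>haar_unique\<close> applies once it is known to be finite on
  \<open>Kn 0\<close>.\<close>

lemma modular_ex:
  assumes g: "g \<in> carrier G"
  shows "modular g (emeasure \<mu> {x \<in> carrier G. x \<otimes> g \<in> Kn 0})"
    and "emeasure \<mu> {x \<in> carrier G. x \<otimes> g \<in> Kn 0} \<noteq> \<infinity>"
proof -
  let ?L = "distr \<mu> \<mu> (\<lambda>x. x \<otimes> g)"
  have meas: "{x \<in> carrier G. x \<otimes> g \<in> B} \<in> sets \<mu>" if "B \<in> sets \<mu>" for B
    using measurable_sets[OF right_translation_measurable[OF g] that]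
    by (simp add: space_mu vimage_def Int_def conj_commute)
  obtain m where m: "\<And>k. k \<in> Kn m \<Longrightarrow> g \<otimes> k \<otimes> inv g \<in> Kn 0" using conj[OF g, of 0] by blast
  obtain F where F: "finite F" "F \<subseteq> Kn 0" "Kn 0 \<subseteq> (\<Union>f\<in>F. f <#\<^bsub>G\<^esub> Kn m)" using finite_index[of m] by auto
  have Fc: "f \<otimes> inv g \<in> carrier G" if "f \<in> F" for f using F that Kn_carrier g by blast
  \<comment> \<open>The set is \<open>Kn 0\<close> translated on the right by the inverse of g.
    Finitely many left cosets cover it because conjugation by g takes \<open>Kn m\<close> into
    \<open>Kn 0\<close>.\<close>
  have "{x \<in> carrier G. x \<otimes> g \<in> Kn 0} \<subseteq> (\<Union>f\<in>F. (f \<otimes> inv g) <#\<^bsub>G\<^esub> Kn 0)"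
  proof
    fix x assume "x \<in> {x \<in> carrier G. x \<otimes> g \<in> Kn 0}"
    then have x: "x \<in> carrier G" "x \<otimes> g \<in> Kn 0" by auto
    then obtain f k where f: "f \<in> F" "k \<in> Kn m" "x \<otimes> g = f \<otimes> k" using F(3) by (force simp: l_coset_def)
    have fk: "f \<in> carrier G" "k \<in> carrier G" using f F Kn_carrier by blast+
    have "x = f \<otimes> k \<otimes> inv g" using f(3) x g fk by (metis inv_solve_right m_closed)
    also have "\<dots> = (f \<otimes> inv g) \<otimes> (g \<otimes> k \<otimes> inv g)"
      using fk g by (simp add: m_assoc) (simp add: m_assoc[symmetric])
    finally show "x \<in> (\<Union>f\<in>F. (f \<otimes> inv g) <#\<^bsub>G\<^esub> Kn 0)" using f m by (auto simp: l_coset_def)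
  qed
  then have "emeasure \<mu> {x \<in> carrier G. x \<otimes> g \<in> Kn 0} \<le> emeasure \<mu> (\<Union>f\<in>F. (f \<otimes> inv g) <#\<^bsub>G\<^esub> Kn 0)"
    using coset_measurable Fc F(1) by (intro emeasure_mono) auto
  also have "\<dots> \<le> (\<Sum>f\<in>F. emeasure \<mu> ((f \<otimes> inv g) <#\<^bsub>G\<^esub> Kn 0))"
    by (rule emeasure_subadditive_finite[OF F(1)]) (use coset_measurable Fc in auto)
  also have "\<dots> = (\<Sum>f\<in>F. 1)"
    by (rule sum.cong) (use left_invariant Kn_measurable Fc normalized in auto)
  also have "\<dots> < \<infinity>" by (simp add: ennreal_of_nat_eq_real_of_nat)
  finally show fin: "emeasure \<mu> {x \<in> carrier G. x \<otimes> g \<in> Kn 0} \<noteq> \<infinity>" by simp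
  have "?L = scale_measure (emeasure ?L (Kn 0)) \<mu>"
  proof (rule haar_unique)
    fix h B assume h: "h \<in> carrier G" "B \<in> sets \<mu>"
    have hB: "h <#\<^bsub>G\<^esub> B \<in> sets \<mu>"
    proof -
      have "h <#\<^bsub>G\<^esub> B = {x \<in> carrier G. inv h \<otimes> x \<in> B}"
      proof (intro equalityI subsetI)
        fix x assume "x \<in> {x \<in> carrier G. inv h \<otimes> x \<in> B}"
        then have "x = h \<otimes> (inv h \<otimes> x)" "inv h \<otimes> x \<in> B" using h by (auto simp: m_assoc[symmetric])
        then show "x \<in> h <#\<^bsub>G\<^esub> B" by (auto simp: l_coset_def)
      qed (use h measurable_subset[OF h(2)] in \<open>auto simp: l_coset_def m_assoc[symmetric]\<close>)
      moreover have "(\<lambda>x. inv h \<otimes> x) \<in> measurable \<mu> \<mu>"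
      proof (rule measurable_sigma_sets[where \<Omega> = "carrier G" and A = "{U. openin T U}"])
        show "sets \<mu> = sigma_sets (carrier G) {U. openin T U}" by (simp add: sets_mu borel_sets_def topspace_T)
        show "{U. openin T U} \<subseteq> Pow (carrier G)" using openin_subset topspace_T by blast
        show "(\<lambda>x. inv h \<otimes> x) \<in> space \<mu> \<rightarrow> carrier G" using h by (auto simp: space_mu)
        fix U assume "U \<in> {U. openin T U}"
        then have U: "openin T U" by simp
        have "openin T {x \<in> carrier G. inv h \<otimes> x \<in> U}"
          unfolding openin_iff
        proof (intro conjI ballI)
          fix x assume x: "x \<in> {x \<in> carrier G. inv h \<otimes> x \<in> U}"
          then obtain n where "(inv h \<otimes> x) <#\<^bsub>G\<^esub> Kn n \<subseteq> U" using U openin_iff by blast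
          then have "x <#\<^bsub>G\<^esub> Kn n \<subseteq> {x \<in> carrier G. inv h \<otimes> x \<in> U}"
            using x h Kn_carrier by (auto simp: l_coset_def m_assoc)
          then show "\<exists>n. x <#\<^bsub>G\<^esub> Kn n \<subseteq> {x \<in> carrier G. inv h \<otimes> x \<in> U}" ..
        qed auto
        then have "{x \<in> carrier G. inv h \<otimes> x \<in> U} \<in> sets \<mu>" by (rule open_measurable)
        then show "(\<lambda>x. inv h \<otimes> x) -` U \<inter> space \<mu> \<in> sets \<mu>"
          by (simp add: space_mu vimage_def Int_def conj_commute)
      qed
      from measurable_sets[OF this h(2)] have "{x \<in> carrier G. inv h \<otimes> x \<in> B} \<in> sets \<mu>"
        by (simp add: space_mu vimage_def Int_def conj_commute)
      ultimately show ?thesis by simp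
    qed
    show "emeasure ?L (h <#\<^bsub>G\<^esub> B) = emeasure ?L B"
      unfolding emeasure_right_translate[OF g hB] emeasure_right_translate[OF g h(2)]
        left_coset_preimage[OF h(1) g measurable_subset[OF h(2)]]
      by (rule left_invariant[OF h(1) meas[OF h(2)]])
  qed (use fin emeasure_right_translate[OF g Kn_measurable] in auto)
  then show "modular g (emeasure \<mu> {x \<in> carrier G. x \<otimes> g \<in> Kn 0})"
    unfolding modular_def emeasure_right_translate[OF g Kn_measurable] .
qed

lemma modular_value:
  assumes "g \<in> carrier G" "modular g r"
  shows "emeasure \<mu> {x \<in> carrier G. x \<otimes> g \<in> Kn 0} = r"
  using emeasure_right_translate[OF assms(1) Kn_measurable, of 0] assms(2) normalized
  by (simp add: modular_def)

lemma modular_mult: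
  assumes g: "g \<in> carrier G" "modular g r" and h: "h \<in> carrier G" "modular h s"
  shows "modular (g \<otimes> h) (r * s)"
proof -
  note meas = right_translation_measurable
  have "distr \<mu> \<mu> (\<lambda>x. x \<otimes> (g \<otimes> h)) = distr \<mu> \<mu> ((\<lambda>x. x \<otimes> h) \<circ> (\<lambda>x. x \<otimes> g))"
    by (rule distr_cong) (use g h in \<open>auto simp: space_mu m_assoc\<close>)
  also have "\<dots> = distr (distr \<mu> \<mu> (\<lambda>x. x \<otimes> g)) \<mu> (\<lambda>x. x \<otimes> h)"
    by (rule distr_distr[symmetric]) (use meas g h in auto)
  also have "\<dots> = scale_measure r (distr \<mu> \<mu> (\<lambda>x. x \<otimes> h))"
    unfolding g(2)[unfolded modular_def]
  proof (rule measure_eqI)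
    fix B assume "B \<in> sets (distr (scale_measure r \<mu>) \<mu> (\<lambda>x. x \<otimes> h))"
    then have B: "B \<in> sets \<mu>" by simp
    have m: "(\<lambda>x. x \<otimes> h) \<in> measurable (scale_measure r \<mu>) \<mu>" using meas[OF h(1)] by simp
    show "emeasure (distr (scale_measure r \<mu>) \<mu> (\<lambda>x. x \<otimes> h)) B = emeasure (scale_measure r (distr \<mu> \<mu> (\<lambda>x. x \<otimes> h))) B"
      by (simp add: emeasure_distr[OF m B] emeasure_distr[OF meas[OF h(1)] B] space_scale_measure)
  qed simp
  also have "\<dots> = scale_measure (r * s) \<mu>" using h(2) by (simp add: modular_def scale_scale_measure)
  finally show ?thesis by (simp add: modular_def)
qed

lemma modular_Kn: "k \<in> Kn 0 \<Longrightarrow> modular k 1"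
proof -
  assume k: "k \<in> Kn 0"
  have kc: "k \<in> carrier G" using k Kn_carrier by blast
  have "{x \<in> carrier G. x \<otimes> k \<in> Kn 0} = Kn 0"
  proof (intro equalityI subsetI)
    fix x assume "x \<in> {x \<in> carrier G. x \<otimes> k \<in> Kn 0}"
    then have "x \<in> carrier G" "x \<otimes> k \<otimes> inv k \<in> Kn 0"
      using k subgroup.m_closed[OF sub] subgroup.m_inv_closed[OF sub] by auto
    then show "x \<in> Kn 0" using kc by (simp add: m_assoc)
  qed (use k Kn_carrier subgroup.m_closed[OF sub] in auto)
  then show ?thesis using modular_ex(1)[OF kc] normalized by simp
qed

text \<open>The factor of g is finite, and 1 is the only nonnegative real number with cube
  1.\<close>

lemma modular_cube:
  assumes "g \<in> carrier G" "modular (g \<otimes> g \<otimes> g) 1"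
  shows "modular g 1"
proof -
  let ?r = "emeasure \<mu> {x \<in> carrier G. x \<otimes> g \<in> Kn 0}"
  have r: "modular g ?r" "?r \<noteq> \<infinity>" using modular_ex[OF assms(1)] by auto
  have "modular (g \<otimes> g \<otimes> g) (?r * ?r * ?r)" using modular_mult assms(1) r(1) by blast
  then have eq: "?r * ?r * ?r = 1"
    using modular_value[OF _ assms(2)] modular_value[of "g \<otimes> g \<otimes> g"] assms(1) by simp
  obtain x where x: "?r = ennreal x" "x \<ge> 0" using r(2) by (cases ?r) auto
  have "ennreal (x * x * x) = ennreal 1" using eq x by (simp add: ennreal_mult)
  then have "x * x * x = 1" using x(2) by (subst (asm) ennreal_inj) auto
  then have "x ^ 3 = 1" by (simp add: power3_eq_cube)
  then have "x = 1" using x(2) by (metis power_eq_1_iff abs_of_nonneg zero_neq_numeral real_norm_def)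
  then show ?thesis using r(1) x by simp
qed

lemma nn_integral_right_translate:
  assumes "g \<in> carrier G" "modular g 1" "f \<in> borel_measurable \<mu>"
  shows "(\<integral>\<^sup>+x. f (x \<otimes> g) \<partial>\<mu>) = (\<integral>\<^sup>+x. f x \<partial>\<mu>)"
proof -
  have "distr \<mu> \<mu> (\<lambda>x. x \<otimes> g) = \<mu>" using assms(2) by (simp add: modular_def scale_measure_1)
  then show ?thesis
    using nn_integral_distr[OF right_translation_measurable[OF assms(1)], of f] assms(3) by simp
qed

end

text \<open>The trivial intersection with \<open>Kn m0\<close> gives discreteness and makes the
  projection injective on each coset of \<open>Kn m0\<close>; measurability questions on the
  quotient are settled on these pieces.\<close>

locale filtered_group_lattice = filtered_group_haar +
  fixes \<Gamma> :: "'a set" and m0 :: nat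
  assumes Gamma: "subgroup \<Gamma> G" "countable \<Gamma>" and trivial: "Kn m0 \<inter> \<Gamma> = {\<one>}"
    and unimodular: "\<And>\<gamma>. \<gamma> \<in> \<Gamma> \<Longrightarrow> modular \<gamma> 1"
begin

lemma Gamma_carrier: "\<gamma> \<in> \<Gamma> \<Longrightarrow> \<gamma> \<in> carrier G"
  using subgroup.subset[OF Gamma(1)] by blast

lemma discrete: "subtopology T \<Gamma> = discrete_topology \<Gamma>"
proof -
  have "openin (subtopology T \<Gamma>) {\<gamma>}" if g: "\<gamma> \<in> \<Gamma>" for \<gamma>
  proof -
    have "(\<gamma> <#\<^bsub>G\<^esub> Kn m0) \<inter> \<Gamma> = {\<gamma>}"
    proof (intro equalityI subsetI)
      fix x assume "x \<in> (\<gamma> <#\<^bsub>G\<^esub> Kn m0) \<inter> \<Gamma>"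
      then obtain k where k: "k \<in> Kn m0" "x = \<gamma> \<otimes> k" "x \<in> \<Gamma>" by (auto simp: l_coset_def)
      have "k = inv \<gamma> \<otimes> x" using k g Gamma_carrier Kn_carrier by (simp add: m_assoc[symmetric])
      then have "k \<in> \<Gamma>" using k(3) g subgroup.m_closed[OF Gamma(1)] subgroup.m_inv_closed[OF Gamma(1)] by simp
      then have "k = \<one>" using k(1) trivial by blast
      then show "x \<in> {\<gamma>}" using k(2) g Gamma_carrier by simp
    qed (use g coset_self Gamma_carrier in auto)
    then show ?thesis using coset_open[OF Gamma_carrier[OF g], of m0] by (metis openin_subtopology)
  qed
  moreover have "topspace (subtopology T \<Gamma>) = \<Gamma>"
    using subgroup.subset[OF Gamma(1)] by (auto simp: topspace_T)
  ultimately show ?thesis by (metis discrete_topology_unique)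
qed

section \<open>The coset space and Weil's formula\<close>

definition proj :: "'a \<Rightarrow> 'a set" where "proj g = g <#\<^bsub>G\<^esub> \<Gamma>"

definition quot :: "'a set topology" where "quot = quotient_topology T (\<lambda>g. g <#\<^bsub>G\<^esub> \<Gamma>)"

text \<open>Carries only the sigma-algebra of the coset space; its measure is 0.\<close>

definition N0 :: "'a set measure" where "N0 = sigma (lcosets \<Gamma>) {U. openin quot U}"

lemma lcosets_eq: "lcosets \<Gamma> = proj ` carrier G"
  by (auto simp: LCOSETS_def proj_def)

lemma openin_quot: "openin quot U \<longleftrightarrow> U \<subseteq> lcosets \<Gamma> \<and> openin T {x \<in> carrier G. proj x \<in> U}"
  unfolding quot_def openin_quotient_topology lcosets_eq proj_def topspace_T ..

lemma topspace_quot: "topspace quot = lcosets \<Gamma>"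
proof
  show "topspace quot \<subseteq> lcosets \<Gamma>" using openin_quot[of "topspace quot"] by simp
  have "{x \<in> carrier G. proj x \<in> lcosets \<Gamma>} = carrier G" by (auto simp: lcosets_eq)
  then have "openin quot (lcosets \<Gamma>)" using openin_quot[of "lcosets \<Gamma>"] topspace_T by (metis openin_topspace order_refl)
  then show "lcosets \<Gamma> \<subseteq> topspace quot" by (rule openin_subset)
qed

lemma space_N0: "space N0 = lcosets \<Gamma>" and sets_N0: "sets N0 = borel_sets quot"
proof -
  have "{U. openin quot U} \<subseteq> Pow (lcosets \<Gamma>)" using openin_quot by auto
  then show "space N0 = lcosets \<Gamma>" "sets N0 = borel_sets quot"
    by (simp_all add: N0_def borel_sets_def topspace_quot)
qed

lemma proj_measurable: "proj \<in> measurable \<mu> N0"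
  unfolding N0_def
proof (rule measurable_measure_of)
  show "{U. openin quot U} \<subseteq> Pow (lcosets \<Gamma>)" using openin_quot by auto
  show "proj \<in> space \<mu> \<rightarrow> lcosets \<Gamma>" by (auto simp: space_mu lcosets_eq)
  fix U assume "U \<in> {U. openin quot U}"
  then have "{x \<in> carrier G. proj x \<in> U} \<in> sets \<mu>" using openin_quot open_measurable by blast
  then show "proj -` U \<inter> space \<mu> \<in> sets \<mu>" by (simp add: space_mu vimage_def Int_def conj_commute)
qed

lemma proj_eq_iff: "x \<in> carrier G \<Longrightarrow> y \<in> carrier G \<Longrightarrow> proj x = proj y \<longleftrightarrow> inv x \<otimes> y \<in> \<Gamma>"
proof
  assume xy: "x \<in> carrier G" "y \<in> carrier G" "proj x = proj y"
  then have "y \<in> x <#\<^bsub>G\<^esub> \<Gamma>" using lcos_self[OF _ Gamma(1)] by (auto simp: proj_def)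
  then show "inv x \<otimes> y \<in> \<Gamma>" using xy subgroup.lcos_module_imp[OF Gamma(1) group_axioms] by blast
next
  assume xy: "x \<in> carrier G" "y \<in> carrier G" "inv x \<otimes> y \<in> \<Gamma>"
  then have "y = x \<otimes> (inv x \<otimes> y)" by (simp add: m_assoc[symmetric])
  then have "y \<in> x <#\<^bsub>G\<^esub> \<Gamma>" using xy by (auto simp: l_coset_def)
  then show "proj x = proj y" using xy l_repr_independence[OF _ _ Gamma(1)] by (simp add: proj_def)
qed

lemma proj_open_map:
  assumes "openin T U"
  shows "openin quot (proj ` U)"
proof -
  have Uc: "U \<subseteq> carrier G" using assms openin_iff by blast
  have "{x \<in> carrier G. proj x \<in> proj ` U} = (\<Union>\<gamma>\<in>\<Gamma>. {x \<in> carrier G. x \<otimes> \<gamma> \<in> U})"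
  proof (intro equalityI subsetI)
    fix x assume "x \<in> {x \<in> carrier G. proj x \<in> proj ` U}"
    then obtain u where u: "x \<in> carrier G" "u \<in> U" "proj x = proj u" by auto
    then have "inv x \<otimes> u \<in> \<Gamma>" using proj_eq_iff Uc by blast
    moreover have "x \<otimes> (inv x \<otimes> u) = u" using u Uc by (auto simp: m_assoc[symmetric])
    ultimately show "x \<in> (\<Union>\<gamma>\<in>\<Gamma>. {x \<in> carrier G. x \<otimes> \<gamma> \<in> U})" using u by (intro UN_I[of "inv x \<otimes> u"]) auto
  next
    fix x assume "x \<in> (\<Union>\<gamma>\<in>\<Gamma>. {x \<in> carrier G. x \<otimes> \<gamma> \<in> U})"
    then obtain \<gamma> where g: "\<gamma> \<in> \<Gamma>" "x \<in> carrier G" "x \<otimes> \<gamma> \<in> U" by auto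
    have "proj x = proj (x \<otimes> \<gamma>)"
      using g Gamma_carrier by (subst proj_eq_iff) (auto simp: m_assoc[symmetric])
    then show "x \<in> {x \<in> carrier G. proj x \<in> proj ` U}" using g by auto
  qed
  moreover have "openin T (\<Union>\<gamma>\<in>\<Gamma>. {x \<in> carrier G. x \<otimes> \<gamma> \<in> U})"
    using open_right_translate[OF assms] Gamma_carrier by blast
  ultimately show ?thesis using Uc by (auto simp: openin_quot lcosets_eq)
qed

lemma proj_inj_on_coset: "x \<in> carrier G \<Longrightarrow> inj_on proj (x <#\<^bsub>G\<^esub> Kn m0)"
proof (rule inj_onI)
  fix y z assume x: "x \<in> carrier G" and yz: "y \<in> x <#\<^bsub>G\<^esub> Kn m0" "z \<in> x <#\<^bsub>G\<^esub> Kn m0" "proj y = proj z"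
  obtain k l where k: "k \<in> Kn m0" "y = x \<otimes> k" and l: "l \<in> Kn m0" "z = x \<otimes> l" using yz by (auto simp: l_coset_def)
  have c: "k \<in> carrier G" "l \<in> carrier G" using k l Kn_carrier by auto
  have "inv y \<otimes> z \<in> \<Gamma>" using proj_eq_iff[of y z] yz(3) x k l c by simp
  moreover have "inv y \<otimes> z = inv k \<otimes> l"
  proof -
    have "inv (x \<otimes> k) \<otimes> (x \<otimes> l) = inv k \<otimes> (inv x \<otimes> (x \<otimes> l))"
      using x c by (simp add: inv_mult_group m_assoc)
    also have "inv x \<otimes> (x \<otimes> l) = l" using x c by (simp add: m_assoc[symmetric])
    finally show ?thesis unfolding k(2) l(2) .
  qed
  moreover have "inv k \<otimes> l \<in> Kn m0"
    using k l subgroup.m_closed[OF sub] subgroup.m_inv_closed[OF sub] by blast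
  ultimately have "inv k \<otimes> l \<in> Kn m0 \<inter> \<Gamma>" by simp
  then have "inv k \<otimes> l = \<one>" unfolding trivial by simp
  then have "k \<otimes> (inv k \<otimes> l) = k" using c by simp
  moreover have "k \<otimes> (inv k \<otimes> l) = l" using c by (simp add: m_assoc[symmetric])
  ultimately have "k = l" by simp
  then show "y = z" using k l by simp
qed

text \<open>Induction over the sigma-algebra: the projection is open, and injectivity on a coset of
  \<open>Kn m0\<close> makes taking images commute with complements there.\<close>

lemma proj_image_measurable:
  assumes x: "x \<in> carrier G" and B: "B \<in> sets \<mu>"
  shows "proj ` (B \<inter> (x <#\<^bsub>G\<^esub> Kn m0)) \<in> sets N0"
proof -
  let ?D = "x <#\<^bsub>G\<^esub> Kn m0"
  have D: "openin T ?D" "?D \<subseteq> carrier G" using x coset_open coset_carrier by auto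
  have op: "proj ` U \<in> sets N0" if "openin T U" for U
    using proj_open_map[OF that] by (auto simp: sets_N0 borel_sets_def)
  have "B \<in> sigma_sets (carrier G) {U. openin T U}" using B by (simp add: sets_mu borel_sets_def topspace_T)
  then show ?thesis
  proof (induction rule: sigma_sets.induct)
    case (Basic U)
    then show ?case using op D by auto
  next
    case Empty
    then show ?case by simp
  next
    case (Compl A)
    have eq: "(carrier G - A) \<inter> ?D = ?D - (A \<inter> ?D)" using D(2) by blast
    have "proj ` ((carrier G - A) \<inter> ?D) = proj ` ?D - proj ` (A \<inter> ?D)"
      unfolding eq by (rule inj_on_image_set_diff[OF proj_inj_on_coset[OF x]]) auto
    then show ?case using Compl.IH op[OF D(1)] by auto
  next
    case (Union A)
    have "proj ` ((\<Union>i. A i) \<inter> ?D) = (\<Union>i. proj ` (A i \<inter> ?D))" by auto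
    then show ?case using Union.IH by auto
  qed
qed

text \<open>The integrand of Weil's formula, which counts the points of a set in a coset.\<close>

definition num :: "'a set \<Rightarrow> 'a set \<Rightarrow> ennreal" where
  "num B c = emeasure (count_space UNIV) (B \<inter> c)"

text \<open>The set is cut into countably many disjoint pieces, each inside a coset of
  \<open>Kn m0\<close>. A coset of \<open>\<Gamma>\<close> meets such a piece at most once, so
  \<open>num B\<close> is the sum of the indicators of the projected pieces.\<close>

lemma num_measurable:
  assumes B: "B \<in> sets \<mu>"
  shows "num B \<in> borel_measurable N0"
proof -
  have ne: "cosets m0 \<noteq> {}" by (auto simp: cosets_def)
  define d where "d = from_nat_into (cosets m0)"
  have "d i \<in> cosets m0" for i using from_nat_into[OF ne, of i] by (simp add: d_def)
  then have "\<forall>i. \<exists>x. x \<in> carrier G \<and> d i = x <#\<^bsub>G\<^esub> Kn m0"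
    by (simp add: cosets_def image_iff Bex_def)
  from choice[OF this] obtain r where r: "\<forall>i. r i \<in> carrier G \<and> d i = r i <#\<^bsub>G\<^esub> Kn m0" ..
  then have rc: "r i \<in> carrier G" and dr: "d i = r i <#\<^bsub>G\<^esub> Kn m0" for i by simp_all
  have dm: "range d \<subseteq> sets \<mu>" by (simp add: image_subset_iff dr coset_measurable rc)
  have un: "(\<Union>i. d i) = carrier G"
  proof
    show "(\<Union>i. d i) \<subseteq> carrier G" by (simp add: UN_subset_iff dr coset_carrier rc)
    show "carrier G \<subseteq> (\<Union>i. d i)"
    proof
      fix x assume x: "x \<in> carrier G"
      then have "x <#\<^bsub>G\<^esub> Kn m0 \<in> cosets m0" by (auto simp: cosets_def)
      then obtain i where "d i = x <#\<^bsub>G\<^esub> Kn m0"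
        unfolding d_def using from_nat_into_surj[OF countable_cosets[of m0]] by blast
      then have "x \<in> d i" using coset_self[OF x] by simp
      then show "x \<in> (\<Union>i. d i)" by (rule UN_I[OF UNIV_I])
    qed
  qed
  define A where "A i = B \<inter> disjointed d i" for i
  have A: "A i \<in> sets \<mu>" for i
    using B sets.range_disjointed_sets[OF dm] by (auto simp: A_def)
  have pA: "proj ` A i \<in> sets N0" for i
  proof -
    have "A i \<inter> (r i <#\<^bsub>G\<^esub> Kn m0) = A i" using disjointed_subset[of d i] unfolding A_def dr by blast
    then show ?thesis using proj_image_measurable[OF rc[of i] A[of i]] by simp
  qed
  have one: "emeasure (count_space UNIV) (A i \<inter> c) = indicator (proj ` A i) c" if c: "c \<in> lcosets \<Gamma>" for i c
  proof -
    obtain y where y: "y \<in> carrier G" "c = proj y" using c by (auto simp: lcosets_eq)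
    have sub': "A i \<subseteq> r i <#\<^bsub>G\<^esub> Kn m0" using disjointed_subset[of d i] unfolding A_def dr by blast
    have Ac: "A i \<subseteq> carrier G" by (rule measurable_subset[OF A])
    have mem: "z \<in> c \<longleftrightarrow> proj z = c" if z: "z \<in> A i" for z
    proof -
      have "z \<in> carrier G" using z Ac by blast
      then show ?thesis
        using y l_repr_independence[OF _ y(1) Gamma(1), of z] lcos_self[OF _ Gamma(1), of z] by (auto simp: proj_def)
    qed
    show ?thesis
    proof (cases "c \<in> proj ` A i")
      case True
      then obtain z where z: "z \<in> A i" "c = proj z" by blast
      have "A i \<inter> c = {z}"
      proof (intro equalityI subsetI)
        fix w assume "w \<in> A i \<inter> c"
        then have "w \<in> A i" "proj w = proj z" using mem z by auto
        then have "w = z" using sub' z(1) by (intro inj_onD[OF proj_inj_on_coset[OF rc[of i]]]) auto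
        then show "w \<in> {z}" by simp
      qed (use z mem in auto)
      then show ?thesis using True by simp
    next
      case False
      then have "A i \<inter> c = {}" using mem by auto
      then show ?thesis using False by simp
    qed
  qed
  have "num B c = (\<Sum>i. indicator (proj ` A i) c)" if c: "c \<in> space N0" for c
  proof -
    have c': "c \<in> lcosets \<Gamma>" using c space_N0 by simp
    have "disjoint_family (\<lambda>i. A i \<inter> c)"
      using disjoint_family_disjointed[of d] by (auto simp: disjoint_family_on_def A_def)
    then have "(\<Sum>i. emeasure (count_space UNIV) (A i \<inter> c)) = emeasure (count_space UNIV) (\<Union>i. A i \<inter> c)"
      by (intro suminf_emeasure) auto
    moreover have "(\<Union>i. A i \<inter> c) = B \<inter> c"
      using UN_disjointed_eq[of d] un measurable_subset[OF B] by (auto simp: A_def)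
    ultimately show ?thesis using one[OF c'] by (simp add: num_def)
  qed
  moreover have "(\<lambda>c. \<Sum>i. indicator (proj ` A i) c :: ennreal) \<in> borel_measurable N0"
    by (rule borel_measurable_suminf_order) (rule borel_measurable_indicator[OF pA])
  ultimately show ?thesis by (subst measurable_cong) auto
qed

lemma num_proj:
  assumes x: "x \<in> carrier G"
  shows "num B (proj x) = emeasure (count_space \<Gamma>) {\<gamma> \<in> \<Gamma>. x \<otimes> \<gamma> \<in> B}"
proof -
  let ?S = "{\<gamma> \<in> \<Gamma>. x \<otimes> \<gamma> \<in> B}"
  have bij: "bij_betw (\<lambda>\<gamma>. x \<otimes> \<gamma>) ?S (B \<inter> proj x)"
    using x Gamma_carrier by (auto simp: bij_betw_def inj_on_def proj_def l_coset_def)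
  have "emeasure (count_space \<Gamma>) ?S = emeasure (count_space UNIV) (B \<inter> proj x)"
    using bij_betw_finite[OF bij] bij_betw_same_card[OF bij]
    by (cases "finite ?S") (simp_all add: emeasure_count_space)
  then show ?thesis by (simp add: num_def)
qed

lemma num_eq_integral:
  assumes x: "x \<in> carrier G"
  shows "num B (proj x) = (\<integral>\<^sup>+\<gamma>. indicator B (x \<otimes> \<gamma>) \<partial>count_space \<Gamma>)"
proof -
  let ?S = "{\<gamma> \<in> \<Gamma>. x \<otimes> \<gamma> \<in> B}"
  have "(\<integral>\<^sup>+\<gamma>. indicator B (x \<otimes> \<gamma>) \<partial>count_space \<Gamma>) = (\<integral>\<^sup>+\<gamma>. indicator ?S \<gamma> \<partial>count_space \<Gamma>)"
    by (rule nn_integral_cong) (auto simp: indicator_def)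
  also have "\<dots> = emeasure (count_space \<Gamma>) ?S" by (rule nn_integral_indicator) auto
  finally show ?thesis by (simp add: num_proj[OF x])
qed

text \<open>The function w, with sum 1 over each coset, stands in for the indicator of a fundamental
  domain: pushing forward the density w yields Weil's formula by unfolding. Conversely, integrating
  1, written as the sum of \<open>a i * num (S i)\<close>, against any measure satisfying Weil's
  formula determines its total mass, so the definite description in \<open>covolume\<close> has a
  unique solution.\<close>

lemma weighted_fundamental_domain:
  fixes a :: "'i \<Rightarrow> ennreal" and S :: "'i \<Rightarrow> 'a set"
  assumes I: "finite I" and S: "\<And>i. i \<in> I \<Longrightarrow> S i \<in> sets \<mu>"
    and one: "\<And>x. x \<in> carrier G \<Longrightarrow> (\<Sum>i\<in>I. a i * num (S i) (proj x)) = 1"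
  shows "\<exists>\<nu>. coset_measure G T \<mu> \<Gamma> \<nu>"
    and "\<And>\<nu>. coset_measure G T \<mu> \<Gamma> \<nu> \<Longrightarrow> emeasure \<nu> (space \<nu>) = (\<Sum>i\<in>I. a i * emeasure \<mu> (S i))"
proof -
  define w where "w x = (\<Sum>i\<in>I. a i * indicator (S i) x)" for x
  have w: "w \<in> borel_measurable \<mu>"
    unfolding w_def using S by (intro borel_measurable_sum borel_measurable_times) auto
  have W: "(\<integral>\<^sup>+\<gamma>. w (x \<otimes> \<gamma>) \<partial>count_space \<Gamma>) = 1" if "x \<in> carrier G" for x
    unfolding w_def one[OF that, symmetric] num_eq_integral[OF that]
    by (subst nn_integral_sum) (simp_all add: nn_integral_cmult)
  define \<nu> where "\<nu> = distr (density \<mu> w) N0 proj"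
  have pm: "proj \<in> measurable (density \<mu> w) N0" using proj_measurable by simp
  have "emeasure \<mu> B = (\<integral>\<^sup>+c. num B c \<partial>\<nu>)" if B: "B \<in> sets \<mu>" for B
  proof -
    have nm: "(\<lambda>x. num B (proj x)) \<in> borel_measurable \<mu>"
      using measurable_compose[OF proj_measurable num_measurable[OF B]] .
    have Bm: "(\<lambda>x. indicator B (x \<otimes> \<gamma>) :: ennreal) \<in> borel_measurable \<mu>"
      and wm: "(\<lambda>x. w (x \<otimes> inv \<gamma>)) \<in> borel_measurable \<mu>" if "\<gamma> \<in> \<Gamma>" for \<gamma>
    proof -
      show "(\<lambda>x. indicator B (x \<otimes> \<gamma>) :: ennreal) \<in> borel_measurable \<mu>"
        by (rule measurable_compose[OF right_translation_measurable[OF Gamma_carrier[OF that]]])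
          (use B in simp)
      show "(\<lambda>x. w (x \<otimes> inv \<gamma>)) \<in> borel_measurable \<mu>"
        by (rule measurable_compose[OF right_translation_measurable w])
          (use Gamma_carrier[OF that] in simp)
    qed
    have "(\<integral>\<^sup>+c. num B c \<partial>\<nu>) = (\<integral>\<^sup>+x. num B (proj x) \<partial>density \<mu> w)"
      unfolding \<nu>_def by (rule nn_integral_distr[OF pm]) (simp add: num_measurable[OF B])
    also have "\<dots> = (\<integral>\<^sup>+x. w x * num B (proj x) \<partial>\<mu>)"
      by (rule nn_integral_density[OF w nm])
    also have "\<dots> = (\<integral>\<^sup>+x. \<integral>\<^sup>+\<gamma>. w x * indicator B (x \<otimes> \<gamma>) \<partial>count_space \<Gamma> \<partial>\<mu>)"
      by (rule nn_integral_cong) (simp add: space_mu num_eq_integral nn_integral_cmult)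
    also have "\<dots> = (\<integral>\<^sup>+\<gamma>. \<integral>\<^sup>+x. w x * indicator B (x \<otimes> \<gamma>) \<partial>\<mu> \<partial>count_space \<Gamma>)"
      by (rule nn_integral_count_space_nn_integral[OF Gamma(2)]) (use Bm w in auto)
    \<comment> \<open>This substitution is a right translation by an element of
      \<open>\<Gamma>\<close> and is where unimodularity enters.\<close>
    also have "\<dots> = (\<integral>\<^sup>+\<gamma>. \<integral>\<^sup>+x. w (x \<otimes> inv \<gamma>) * indicator B x \<partial>\<mu> \<partial>count_space \<Gamma>)"
    proof (rule nn_integral_cong)
      fix \<gamma> assume "\<gamma> \<in> space (count_space \<Gamma>)"
      then have g: "\<gamma> \<in> \<Gamma>" by simp
      have "(\<integral>\<^sup>+x. w x * indicator B (x \<otimes> \<gamma>) \<partial>\<mu>) = (\<integral>\<^sup>+x. w ((x \<otimes> \<gamma>) \<otimes> inv \<gamma>) * indicator B (x \<otimes> \<gamma>) \<partial>\<mu>)"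
        by (rule nn_integral_cong) (use g Gamma_carrier in \<open>simp add: space_mu m_assoc\<close>)
      also have "\<dots> = (\<integral>\<^sup>+x. w (x \<otimes> inv \<gamma>) * indicator B x \<partial>\<mu>)"
        by (rule nn_integral_right_translate[OF Gamma_carrier[OF g] unimodular[OF g]])
          (use wm[OF g] B in auto)
      finally show "(\<integral>\<^sup>+x. w x * indicator B (x \<otimes> \<gamma>) \<partial>\<mu>) = (\<integral>\<^sup>+x. w (x \<otimes> inv \<gamma>) * indicator B x \<partial>\<mu>)" .
    qed
    also have "\<dots> = (\<integral>\<^sup>+x. \<integral>\<^sup>+\<gamma>. w (x \<otimes> inv \<gamma>) * indicator B x \<partial>count_space \<Gamma> \<partial>\<mu>)"
      by (rule nn_integral_count_space_nn_integral[symmetric, OF Gamma(2)]) (use wm B in auto)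
    also have "\<dots> = (\<integral>\<^sup>+x. indicator B x \<partial>\<mu>)"
    proof (rule nn_integral_cong)
      fix x assume "x \<in> space \<mu>"
      then have x: "x \<in> carrier G" by (simp add: space_mu)
      have bij: "bij_betw (\<lambda>\<gamma>. inv \<gamma>) \<Gamma> \<Gamma>"
        by (rule bij_betw_byWitness[where f' = "\<lambda>\<gamma>. inv \<gamma>"])
          (use Gamma_carrier subgroup.m_inv_closed[OF Gamma(1)] in auto)
      have "(\<integral>\<^sup>+\<gamma>. w (x \<otimes> inv \<gamma>) \<partial>count_space \<Gamma>) = 1"
        using nn_integral_bij_count_space[OF bij, of "\<lambda>\<gamma>. w (x \<otimes> \<gamma>)"] W[OF x] by simp
      then show "(\<integral>\<^sup>+\<gamma>. w (x \<otimes> inv \<gamma>) * indicator B x \<partial>count_space \<Gamma>) = indicator B x"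
        by (simp add: nn_integral_multc)
    qed
    also have "\<dots> = emeasure \<mu> B" using B by simp
    finally show ?thesis by simp
  qed
  then have "coset_measure G T \<mu> \<Gamma> \<nu>"
    using space_N0 sets_N0 by (simp add: coset_measure_def \<nu>_def quot_def num_def)
  then show "\<exists>\<nu>. coset_measure G T \<mu> \<Gamma> \<nu>" ..
  fix \<nu>' assume n: "coset_measure G T \<mu> \<Gamma> \<nu>'"
  have sp: "space \<nu>' = lcosets \<Gamma>" and se: "sets \<nu>' = sets N0"
    and weil: "\<And>B. B \<in> sets \<mu> \<Longrightarrow> emeasure \<mu> B = (\<integral>\<^sup>+c. num B c \<partial>\<nu>')"
    using n by (simp_all add: coset_measure_def sets_N0 quot_def num_def)
  have nm: "num (S i) \<in> borel_measurable \<nu>'" if "i \<in> I" for i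
    using num_measurable[OF S[OF that]] measurable_cong_sets[OF se refl] by blast
  have "(\<Sum>i\<in>I. a i * emeasure \<mu> (S i)) = (\<Sum>i\<in>I. \<integral>\<^sup>+c. a i * num (S i) c \<partial>\<nu>')"
    by (rule sum.cong) (simp_all add: weil S nm nn_integral_cmult)
  also have "\<dots> = (\<integral>\<^sup>+c. (\<Sum>i\<in>I. a i * num (S i) c) \<partial>\<nu>')"
    by (rule nn_integral_sum[symmetric]) (use nm in auto)
  also have "\<dots> = (\<integral>\<^sup>+c. 1 \<partial>\<nu>')"
    by (rule nn_integral_cong) (use one in \<open>auto simp: sp lcosets_eq\<close>)
  also have "\<dots> = emeasure \<nu>' (space \<nu>')" by simp
  finally show "emeasure \<nu>' (space \<nu>') = (\<Sum>i\<in>I. a i * emeasure \<mu> (S i))" by simp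
qed

lemma covolume_weighted:
  fixes a :: "'i \<Rightarrow> ennreal" and S :: "'i \<Rightarrow> 'a set"
  assumes "finite I" "\<And>i. i \<in> I \<Longrightarrow> S i \<in> sets \<mu>"
    and "\<And>x. x \<in> carrier G \<Longrightarrow> (\<Sum>i\<in>I. a i * num (S i) (proj x)) = 1"
  shows "covolume G T \<mu> \<Gamma> = (\<Sum>i\<in>I. a i * emeasure \<mu> (S i))"
  unfolding covolume_def using weighted_fundamental_domain[of I S a] assms by (intro the_equality) blast+

end

section \<open>The congruence filtration and the covolume\<close>

text \<open>Formulated for an abstract base so that it applies twice: to vectors over Q_2, and then
  to matrices as vectors of vectors.\<close>

lemma open_vec_iff_base:
  fixes N :: "'a::topological_space \<Rightarrow> nat \<Rightarrow> 'a set" and S :: "('a ^ 'n) set"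
  assumes base: "\<And>S :: 'a set. open S \<longleftrightarrow> (\<forall>x\<in>S. \<exists>n. N x n \<subseteq> S)"
    and self: "\<And>x n. x \<in> N x n" and dec: "\<And>x m n. m \<le> n \<Longrightarrow> N x n \<subseteq> N x m"
    and tr: "\<And>x y n. y \<in> N x n \<Longrightarrow> N y n \<subseteq> N x n"
  shows "open S \<longleftrightarrow> (\<forall>x\<in>S. \<exists>n. {y. \<forall>i. y $ i \<in> N (x $ i) n} \<subseteq> S)"
proof (intro iffI ballI)
  fix x assume "open S" "x \<in> S"
  then obtain A where A: "\<And>i. open (A i)" "\<And>i. x $ i \<in> A i" "\<And>y. (\<And>i. y $ i \<in> A i) \<Longrightarrow> y \<in> S"
    unfolding open_vec_def by metis
  have "\<forall>i. \<exists>n. N (x $ i) n \<subseteq> A i" using A(1,2) base by blast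
  from choice[OF this] obtain n where n: "\<forall>i. N (x $ i) (n i) \<subseteq> A i" ..
  let ?m = "Max (range n)"
  have "N (x $ i) ?m \<subseteq> A i" for i
    using n dec[of "n i" ?m "x $ i"] by (meson Max_ge finite finite_imageI rangeI subset_trans)
  then have "{y. \<forall>i. y $ i \<in> N (x $ i) ?m} \<subseteq> S" using A(3) by blast
  then show "\<exists>n. {y. \<forall>i. y $ i \<in> N (x $ i) n} \<subseteq> S" ..
next
  assume *: "\<forall>x\<in>S. \<exists>n. {y. \<forall>i. y $ i \<in> N (x $ i) n} \<subseteq> S"
  have op: "open (N x n)" for x n using base tr by blast
  show "open S"
    unfolding open_vec_def
  proof (intro ballI)
    fix x assume "x \<in> S"
    then obtain n where n: "{y. \<forall>i. y $ i \<in> N (x $ i) n} \<subseteq> S" using * by blast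
    show "\<exists>A. (\<forall>i. open (A i) \<and> x $ i \<in> A i) \<and> (\<forall>y. (\<forall>i. y $ i \<in> A i) \<longrightarrow> y \<in> S)"
      using n op self by (intro exI[of _ "\<lambda>i. N (x $ i) n"]) auto
  qed
qed

section \<open>Congruence neighbourhoods of matrices\<close>

definition nbq :: "q2 \<Rightarrow> nat \<Rightarrow> q2 set" where "nbq x n = {y. (y - x) / 2 ^ n \<in> ZZ}"

definition nbm :: "q2 ^ 3 ^ 3 \<Rightarrow> nat \<Rightarrow> (q2 ^ 3 ^ 3) set" where
  "nbm A n = {B. \<forall>i j. B $ i $ j \<in> nbq (A $ i $ j) n}"

lemma nbq_base: "open S \<longleftrightarrow> (\<forall>x\<in>S. \<exists>n. nbq x n \<subseteq> S)"
proof -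
  have "nbq x n = range (\<lambda>a. x + 2 ^ n * of_z2 a)" for x n
  proof (intro equalityI subsetI)
    fix y assume "y \<in> nbq x n"
    then obtain a where "(y - x) / 2 ^ n = of_z2 a" by (auto simp: nbq_def ZZ_def)
    then have "y = x + 2 ^ n * of_z2 a" by (simp add: field_simps)
    then show "y \<in> range (\<lambda>a. x + 2 ^ n * of_z2 a)" by blast
  qed (auto simp: nbq_def)
  then show ?thesis by (simp add: open_q2_def image_subset_iff)
qed

lemma nbq_self: "x \<in> nbq x n"
  by (simp add: nbq_def)

lemma nbq_dec: "m \<le> n \<Longrightarrow> nbq x n \<subseteq> nbq x m"
proof
  fix y assume mn: "m \<le> n" and "y \<in> nbq x n"
  then have "2 ^ (n - m) * ((y - x) / 2 ^ n) \<in> ZZ" unfolding nbq_def by (intro ZZ_mult) simp_all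
  moreover have "2 ^ (n - m) * ((y - x) / 2 ^ n) = (y - x) / 2 ^ m" using mn by (simp add: power_diff)
  ultimately show "y \<in> nbq x m" unfolding nbq_def by simp
qed

lemma nbq_trans: "y \<in> nbq x n \<Longrightarrow> nbq y n \<subseteq> nbq x n"
proof
  fix z assume "y \<in> nbq x n" "z \<in> nbq y n"
  then have "(z - y) / 2 ^ n + (y - x) / 2 ^ n \<in> ZZ" unfolding nbq_def by blast
  then show "z \<in> nbq x n" unfolding nbq_def add_divide_distrib[symmetric] by simp
qed

lemma nbq_sym: "y \<in> nbq x n \<Longrightarrow> x \<in> nbq y n"
proof -
  assume "y \<in> nbq x n"
  then have "- ((y - x) / 2 ^ n) \<in> ZZ" unfolding nbq_def by blast
  then show ?thesis unfolding nbq_def minus_divide_left by simp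
qed

lemma open_matrix_iff: "open S \<longleftrightarrow> (\<forall>A\<in>S. \<exists>n. nbm A n \<subseteq> S)"
  unfolding nbm_def
proof (rule open_vec_iff_base[where N = "\<lambda>x n. {y. \<forall>i. y $ i \<in> nbq (x $ i) n}", simplified mem_Collect_eq])
  show "open S \<longleftrightarrow> (\<forall>x\<in>S. \<exists>n. {y. \<forall>i. y $ i \<in> nbq (x $ i) n} \<subseteq> S)" for S :: "(q2 ^ 3) set"
    by (rule open_vec_iff_base[OF nbq_base nbq_self nbq_dec nbq_trans])
qed (use nbq_self nbq_dec nbq_trans in blast)+

lemma nbm_trans: "B \<in> nbm A n \<Longrightarrow> C \<in> nbm B n \<Longrightarrow> C \<in> nbm A n"
  unfolding nbm_def using nbq_trans by blast

lemma nbm_sym: "B \<in> nbm A n \<Longrightarrow> A \<in> nbm B n"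
  unfolding nbm_def using nbq_sym by blast

text \<open>If 2 ^ k clears the denominators of the multiplier, multiplication costs k levels of
  precision.\<close>

lemma nbm_mult_left:
  assumes "zmat (mat (2 ^ k) ** A)" "B \<in> nbm C (n + k)"
  shows "A ** B \<in> nbm (A ** C) n"
proof -
  have "((A ** B) $ i $ j - (A ** C) $ i $ j) / 2 ^ n \<in> ZZ" for i j
  proof -
    have "((A ** B) $ i $ j - (A ** C) $ i $ j) / 2 ^ n =
        (\<Sum>l\<in>UNIV. (2 ^ k * A $ i $ l) * ((B $ l $ j - C $ l $ j) / 2 ^ (n + k)))"
      unfolding matrix_matrix_mult_def vec_lambda_beta sum_subtractf[symmetric] sum_divide_distrib
      by (rule sum.cong) (simp_all add: power_add field_simps)
    also have "\<dots> \<in> ZZ"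
      by (intro ZZ_sum; rule ZZ_mult; use assms in \<open>simp add: zmat_def nbm_def nbq_def\<close>)
    finally show ?thesis .
  qed
  then show ?thesis by (simp add: nbm_def nbq_def)
qed

lemma nbm_mult_right:
  assumes "zmat (mat (2 ^ k) ** A)" "B \<in> nbm C (n + k)"
  shows "B ** A \<in> nbm (C ** A) n"
proof -
  have "((B ** A) $ i $ j - (C ** A) $ i $ j) / 2 ^ n \<in> ZZ" for i j
  proof -
    have "((B ** A) $ i $ j - (C ** A) $ i $ j) / 2 ^ n =
        (\<Sum>l\<in>UNIV. ((B $ i $ l - C $ i $ l) / 2 ^ (n + k)) * (2 ^ k * A $ l $ j))"
      unfolding matrix_matrix_mult_def vec_lambda_beta sum_subtractf[symmetric] sum_divide_distrib
      by (rule sum.cong) (simp_all add: power_add field_simps)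
    also have "\<dots> \<in> ZZ"
      by (intro ZZ_sum; rule ZZ_mult; use assms in \<open>simp add: zmat_def nbm_def nbq_def\<close>)
    finally show ?thesis .
  qed
  then show ?thesis by (simp add: nbm_def nbq_def)
qed

lemma zmat_scale_0: "zmat A \<Longrightarrow> zmat (mat (2 ^ 0) ** A)"
  by simp

text \<open>The principal congruence subgroup of level 2 ^ n in GL_3(Z_2), which for n = 0 is the
  whole group.\<close>

definition Cn :: "nat \<Rightarrow> (q2 ^ 3 ^ 3) set" where "Cn n = GLZ \<inter> nbm (mat 1) n"

definition Kn :: "nat \<Rightarrow> (q2 ^ 3 ^ 3) set set" where "Kn n = to_PGL3 ` Cn n"

lemma Cn_GLZ: "A \<in> Cn n \<Longrightarrow> A \<in> GLZ" and Cn_nbm: "A \<in> Cn n \<Longrightarrow> A \<in> nbm (mat 1) n"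
  by (auto simp: Cn_def)

lemma Cn_invertible: "A \<in> Cn n \<Longrightarrow> invertible A"
  using Cn_GLZ GLZ_invertible by blast

lemma Cn_1: "mat 1 \<in> Cn n"
  by (simp add: Cn_def nbm_def nbq_self)

lemma Cn_0: "Cn 0 = GLZ"
proof -
  have "A \<in> nbm (mat 1) 0" if "A \<in> GLZ" for A
  proof -
    have "A $ i $ j - mat 1 $ i $ j \<in> ZZ" for i j
      using GLZ_zmat[OF that] zmat_1 unfolding zmat_def by (intro ZZ_diff) blast+
    then show ?thesis by (simp add: nbm_def nbq_def)
  qed
  then show ?thesis by (auto simp: Cn_def)
qed

lemma Kn_0: "Kn 0 = PGL3_Z2"
  by (simp add: Kn_def Cn_0 PGL3_Z2_eq)

lemma Cn_dec: "Cn (Suc n) \<subseteq> Cn n"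
proof -
  have "nbq x (Suc n) \<subseteq> nbq x n" for x by (rule nbq_dec) simp
  then show ?thesis unfolding Cn_def nbm_def by blast
qed

lemma Cn_mult:
  assumes "A \<in> Cn n" "B \<in> Cn n" shows "A ** B \<in> Cn n"
proof -
  have "A ** B \<in> nbm (A ** mat 1) n"
    using nbm_mult_left[OF zmat_scale_0[OF GLZ_zmat[OF Cn_GLZ[OF assms(1)]]], of B "mat 1" n] Cn_nbm[OF assms(2)] by simp
  then have "A ** B \<in> nbm (mat 1) n" using nbm_trans[OF Cn_nbm[OF assms(1)]] by simp
  then show ?thesis using assms GLZ_mult Cn_GLZ by (simp add: Cn_def)
qed

lemma Cn_inv:
  assumes "A \<in> Cn n" shows "matrix_inv A \<in> Cn n"
proof -
  have G: "matrix_inv A \<in> GLZ" using assms Cn_GLZ GLZ_inv by blast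
  have "matrix_inv A ** A \<in> nbm (matrix_inv A ** mat 1) n"
    using nbm_mult_left[OF zmat_scale_0[OF GLZ_zmat[OF G]], of A "mat 1" n] Cn_nbm[OF assms] by simp
  then have "mat 1 \<in> nbm (matrix_inv A) n" using Cn_invertible[OF assms] by simp
  then show ?thesis using G nbm_sym by (simp add: Cn_def)
qed

text \<open>The successor guarantees congruence to the identity modulo 2, which forces invertibility
  over Z_2; congruence modulo 1 would give integrality only.\<close>

lemma nbm_1_Cn:
  assumes "B \<in> nbm (mat 1) (Suc n)"
  shows "B \<in> Cn n"
proof -
  have z: "\<exists>z\<in>ZZ. B $ i $ j = mat 1 $ i $ j + 2 * z" for i j
  proof -
    have "(B $ i $ j - mat 1 $ i $ j) / 2 ^ Suc n \<in> ZZ" using assms by (simp add: nbm_def nbq_def)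
    then have "2 ^ n * ((B $ i $ j - mat 1 $ i $ j) / 2 ^ Suc n) \<in> ZZ" by (intro ZZ_mult) simp_all
    moreover have "2 * (2 ^ n * (d / 2 ^ Suc n)) = d" for d :: q2 by simp
    then have "B $ i $ j = mat 1 $ i $ j + 2 * (2 ^ n * ((B $ i $ j - mat 1 $ i $ j) / 2 ^ Suc n))" by (simp only:) simp
    ultimately show ?thesis by blast
  qed
  have z1: "(mat 1 :: q2 ^ 3 ^ 3) $ i $ j \<in> ZZ" for i j using zmat_1[where 'a = 3] by (simp add: zmat_def)
  have "zmat B" unfolding zmat_def
  proof (intro allI)
    fix i j show "B $ i $ j \<in> ZZ" using z[of i j] z1[of i j] by auto
  qed
  moreover have "bmat B = mat 1"
  proof -
    have "red (B $ i $ j) = mat 1 $ i $ j" for i j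
    proof -
      obtain x where x: "x \<in> ZZ" "B $ i $ j = mat 1 $ i $ j + 2 * x" using z by blast
      then have "red (B $ i $ j) = red (mat 1 $ i $ j)" using z1[of i j] by (simp add: red_add)
      then show ?thesis by (simp add: mat_def)
    qed
    then show ?thesis by (simp add: vec_eq_iff)
  qed
  ultimately have "B \<in> GLZ" by (simp add: GLZ_iff_bmat)
  moreover have "nbq x (Suc n) \<subseteq> nbq x n" for x by (rule nbq_dec) simp
  then have "B \<in> nbm (mat 1) n" using assms unfolding nbm_def by blast
  ultimately show ?thesis by (simp add: Cn_def)
qed

lemma coset_Kn: "invertible A \<Longrightarrow> to_PGL3 A <#\<^bsub>PGL3\<^esub> Kn n = (\<lambda>B. to_PGL3 (A ** B)) ` Cn n"
  unfolding l_coset_def Kn_def using Cn_invertible by auto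

text \<open>Additive congruence neighbourhoods of a matrix are compared with its multiplicative
  translates of \<open>Cn n\<close>. The shift in level comes from the denominators of the matrix in
  one direction and of its inverse in the other.\<close>

lemma openin_PGL3_iff:
  "openin PGL3_top U \<longleftrightarrow> U \<subseteq> carrier PGL3 \<and> (\<forall>x\<in>U. \<exists>n. x <#\<^bsub>PGL3\<^esub> Kn n \<subseteq> U)"
proof -
  let ?S = "{A :: q2 ^ 3 ^ 3. invertible A}"
  let ?T = "{A \<in> ?S. to_PGL3 A \<in> U}"
  have op: "openin PGL3_top U \<longleftrightarrow> U \<subseteq> carrier PGL3 \<and> openin (top_of_set ?S) ?T"
    unfolding PGL3_top_def openin_quotient_topology carrier_PGL3 by simp
  have "openin (top_of_set ?S) ?T \<longleftrightarrow> (\<forall>x\<in>U. \<exists>n. x <#\<^bsub>PGL3\<^esub> Kn n \<subseteq> U)" if U: "U \<subseteq> carrier PGL3"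
  proof
    assume "openin (top_of_set ?S) ?T"
    then obtain V where V: "open V" "?T = ?S \<inter> V" unfolding openin_open by blast
    show "\<forall>x\<in>U. \<exists>n. x <#\<^bsub>PGL3\<^esub> Kn n \<subseteq> U"
    proof
      fix x assume x: "x \<in> U"
      then obtain A where A: "invertible A" "x = to_PGL3 A" using U by (auto simp: carrier_PGL3)
      then have "A \<in> V" using x V(2) by blast
      then obtain n where n: "nbm A n \<subseteq> V" using V(1) open_matrix_iff by blast
      obtain k where k: "zmat (mat (2 ^ k) ** A)" using matrix_denominator by blast
      have "to_PGL3 (A ** B) \<in> U" if "B \<in> Cn (n + k)" for B
      proof -
        have "A ** B \<in> nbm A n" using nbm_mult_left[OF k Cn_nbm[OF that]] by simp
        then have "A ** B \<in> V" using n by blast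
        moreover have "A ** B \<in> ?S" using A(1) Cn_invertible[OF that] by (simp add: invertible_mult')
        ultimately show ?thesis using V(2) by blast
      qed
      then have "x <#\<^bsub>PGL3\<^esub> Kn (n + k) \<subseteq> U" unfolding A(2) coset_Kn[OF A(1)] by blast
      then show "\<exists>n. x <#\<^bsub>PGL3\<^esub> Kn n \<subseteq> U" ..
    qed
  next
    assume *: "\<forall>x\<in>U. \<exists>n. x <#\<^bsub>PGL3\<^esub> Kn n \<subseteq> U"
    have "open ?T"
      unfolding open_matrix_iff
    proof
      fix A assume A: "A \<in> ?T"
      then have inv: "invertible A" by simp
      obtain n where n: "to_PGL3 A <#\<^bsub>PGL3\<^esub> Kn n \<subseteq> U" using * A by blast
      obtain k where k: "zmat (mat (2 ^ k) ** matrix_inv A)" using matrix_denominator by blast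
      have "C \<in> ?T" if C: "C \<in> nbm A (Suc n + k)" for C
      proof -
        have "matrix_inv A ** C \<in> nbm (mat 1) (Suc n)" using nbm_mult_left[OF k C] inv by simp
        then have D: "matrix_inv A ** C \<in> Cn n" by (rule nbm_1_Cn)
        have AC: "A ** (matrix_inv A ** C) = C" using inv by (simp add: matrix_mul_assoc)
        then have "to_PGL3 C \<in> U" using n D unfolding coset_Kn[OF inv] by (metis image_subset_iff)
        moreover have "invertible C" using invertible_mult'[OF inv Cn_invertible[OF D]] AC by simp
        ultimately show ?thesis by simp
      qed
      then show "\<exists>n. nbm A n \<subseteq> ?T" by blast
    qed
    then show "openin (top_of_set ?S) ?T" unfolding openin_open by blast
  qed
  then show ?thesis using op by blast
qed

lemma Kn_subgroup: "subgroup (Kn n) PGL3"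
proof (rule PGL3.subgroupI)
  show "Kn n \<subseteq> carrier PGL3" using Cn_invertible by (auto simp: Kn_def)
  show "Kn n \<noteq> {}" using Cn_1 by (auto simp: Kn_def)
  fix a assume "a \<in> Kn n"
  then show "inv\<^bsub>PGL3\<^esub> a \<in> Kn n" using Cn_inv Cn_invertible by (auto simp: Kn_def PGL3_inv)
next
  fix a b assume "a \<in> Kn n" "b \<in> Kn n"
  then show "a \<otimes>\<^bsub>PGL3\<^esub> b \<in> Kn n" using Cn_mult Cn_invertible by (auto simp: Kn_def)
qed

lemma Kn_conj:
  assumes "g \<in> carrier PGL3"
  shows "\<exists>m. \<forall>k\<in>Kn m. g \<otimes>\<^bsub>PGL3\<^esub> k \<otimes>\<^bsub>PGL3\<^esub> inv\<^bsub>PGL3\<^esub> g \<in> Kn n"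
proof -
  obtain A where A: "invertible A" "g = to_PGL3 A" using assms by (auto simp: carrier_PGL3)
  obtain k where k: "zmat (mat (2 ^ k) ** A)" using matrix_denominator by blast
  obtain l where l: "zmat (mat (2 ^ l) ** matrix_inv A)" using matrix_denominator by blast
  have "g \<otimes>\<^bsub>PGL3\<^esub> x \<otimes>\<^bsub>PGL3\<^esub> inv\<^bsub>PGL3\<^esub> g \<in> Kn n" if x: "x \<in> Kn (Suc n + l + k)" for x
  proof -
    obtain B where B: "B \<in> Cn (Suc n + l + k)" "x = to_PGL3 B" using x unfolding Kn_def by blast
    have "A ** B \<in> nbm A (Suc n + l)" using nbm_mult_left[OF k Cn_nbm[OF B(1)]] by simp
    then have "A ** B ** matrix_inv A \<in> nbm (mat 1) (Suc n)" using nbm_mult_right[OF l] A by fastforce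
    then have "A ** B ** matrix_inv A \<in> Cn n" by (rule nbm_1_Cn)
    then show ?thesis
      using A B Cn_invertible[OF B(1)] by (simp add: PGL3_inv invertible_mult' invertible_matrix_inv Kn_def)
  qed
  then show ?thesis by blast
qed

lemma residue_0_dvd: "residue a n = 0 \<Longrightarrow> \<exists>b. a = 2 ^ n * b"
proof (induction n arbitrary: a)
  case (Suc n)
  have 1: "residue a 1 = 0" using residue_mod[of a 1 n] Suc.prems by simp
  have "residue (z2_half a) n = 0" using Suc.prems by (simp add: residue_z2_half)
  then obtain b where "z2_half a = 2 ^ n * b" using Suc.IH by blast
  then have "a = 2 ^ Suc n * b" using z2_half[OF 1] by (simp add: mult.assoc)
  then show ?case ..
qed simp

text \<open>Matrices in \<open>GLZ\<close> with equal residues modulo 2 ^ n lie in the same coset,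
  and there are finitely many tables of residues.\<close>

lemma Kn_finite_index:
  "\<exists>F. finite F \<and> F \<subseteq> Kn 0 \<and> Kn 0 \<subseteq> (\<Union>f\<in>F. f <#\<^bsub>PGL3\<^esub> Kn n)"
proof -
  define rs :: "q2 ^ 3 ^ 3 \<Rightarrow> 3 \<times> 3 \<Rightarrow> int" where
    "rs A = (\<lambda>(i, j). residue (inv_into UNIV of_z2 (A $ i $ j)) n)" for A
  have "rs ` GLZ \<subseteq> PiE UNIV (\<lambda>_. {0..<2 ^ n})" by (auto simp: rs_def residue_range)
  then have "finite (rs ` GLZ)" by (rule finite_subset) (auto intro!: finite_PiE)
  then obtain C where C: "C \<subseteq> GLZ" "finite C" "rs ` GLZ = rs ` C"
    using finite_subset_image[of "rs ` GLZ" rs GLZ] by blast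
  have same: "B \<in> nbm A n" if "A \<in> GLZ" "B \<in> GLZ" "rs A = rs B" for A B
  proof -
    have "(B $ i $ j - A $ i $ j) / 2 ^ n \<in> ZZ" for i j
    proof -
      have AZ: "A $ i $ j \<in> range of_z2" "B $ i $ j \<in> range of_z2"
        using GLZ_zmat that by (auto simp: zmat_def ZZ_def)
      define a b where "a = inv_into UNIV of_z2 (A $ i $ j)" and "b = inv_into UNIV of_z2 (B $ i $ j)"
      have ab: "of_z2 a = A $ i $ j" "of_z2 b = B $ i $ j" using AZ by (simp_all add: a_def b_def f_inv_into_f)
      have "residue a n = residue b n" using fun_cong[OF that(3), of "(i, j)"] by (simp add: rs_def a_def b_def)
      then have "residue (b - a) n = 0" by (simp add: minus_z2.rep_eq)
      then obtain c where "b - a = 2 ^ n * c" using residue_0_dvd by blast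
      then have "B $ i $ j - A $ i $ j = 2 ^ n * of_z2 c"
        unfolding ab[symmetric] by (metis of_z2_simps(4,6) of_z2_power of_z2_numeral)
      then show ?thesis by simp
    qed
    then show ?thesis by (simp add: nbm_def nbq_def)
  qed
  have "Kn 0 \<subseteq> (\<Union>f\<in>to_PGL3 ` C. f <#\<^bsub>PGL3\<^esub> Kn n)"
  proof
    fix x assume "x \<in> Kn 0"
    then obtain B where B: "B \<in> GLZ" "x = to_PGL3 B" by (auto simp: Kn_def Cn_0)
    then obtain A where A: "A \<in> C" "rs A = rs B" using C(3) by (metis imageE imageI)
    have AG: "A \<in> GLZ" using A C by blast
    have inv: "invertible A" "matrix_inv A \<in> GLZ" using AG GLZ_invertible GLZ_inv by auto
    have "matrix_inv A ** B \<in> nbm (matrix_inv A ** A) n"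
      using nbm_mult_left[OF zmat_scale_0[OF GLZ_zmat[OF inv(2)]], of B A n] same[OF AG B(1) A(2)] by simp
    then have "matrix_inv A ** B \<in> Cn n" using inv B GLZ_mult by (simp add: Cn_def)
    moreover have "A ** (matrix_inv A ** B) = B" using inv by (simp add: matrix_mul_assoc)
    ultimately have "x \<in> to_PGL3 A <#\<^bsub>PGL3\<^esub> Kn n"
      unfolding coset_Kn[OF inv(1)] B(2) by (metis imageI)
    then show "x \<in> (\<Union>f\<in>to_PGL3 ` C. f <#\<^bsub>PGL3\<^esub> Kn n)" using A by blast
  qed
  moreover have "to_PGL3 ` C \<subseteq> Kn 0" using C(1) by (auto simp: Kn_def Cn_0)
  ultimately show ?thesis using C(2) by blast
qed

section \<open>Countability, and triviality of small intersections\<close>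

lemma countable_O_half: "countable O_half"
proof -
  have "O_half \<subseteq> (\<lambda>(a, b, n). (of_int a + of_int b * lam) / 2 ^ n) ` (UNIV :: (int \<times> int \<times> nat) set)"
  proof
    fix x assume "x \<in> O_half"
    then obtain a b n where "x = (of_int a + of_int b * lam) / 2 ^ n" by (auto simp: O_half_def O_lam_def)
    then show "x \<in> (\<lambda>(a, b, n). (of_int a + of_int b * lam) / 2 ^ n) ` (UNIV :: (int \<times> int \<times> nat) set)"
      by (intro image_eqI[of _ _ "(a, b, n)"]) simp_all
  qed
  then show ?thesis by (rule countable_subset) simp
qed

lemma countable_U_half: "countable U_half"
proof -
  define v where "v A = (\<lambda>(i, j). A $ i $ j)" for A :: "complex ^ 3 ^ 3"
  have "inj v" by (auto simp: inj_def v_def fun_eq_iff vec_eq_iff)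
  have "v ` U_half \<subseteq> PiE UNIV (\<lambda>_. O_half)"
    using U_half_over(1) by (auto simp: v_def over_def)
  then have "countable (v ` U_half)"
    by (rule countable_subset) (auto intro!: countable_PiE countable_O_half)
  then show ?thesis
    using \<open>inj v\<close> by (metis countable_image_inj_eq inj_on_subset subset_UNIV)
qed

context dyadic
begin

text \<open>Cosets of \<open>Kn 0\<close> correspond to vertices, and by \<open>all_good\<close>
  every vertex is a translate of one of two by an element of a countable group.\<close>

lemma countable_index_PGL3:
  "\<exists>C. countable C \<and> C \<subseteq> carrier PGL3 \<and> carrier PGL3 \<subseteq> (\<Union>c\<in>C. c <#\<^bsub>PGL3\<^esub> Kn 0)"
proof -
  let ?C = "(\<lambda>A. to_PGL3 (im A)) ` U_half \<union> (\<lambda>A. to_PGL3 (im A ** im Bmat)) ` U_half"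
  have inv: "invertible (im A)" "invertible (im A ** im Bmat)" if "A \<in> U_half" for A
    using im_unitary_invertible[OF that] by (simp_all add: invertible_mult')
  have "x \<in> (\<Union>c\<in>?C. c <#\<^bsub>PGL3\<^esub> Kn 0)" if x: "x \<in> carrier PGL3" for x
  proof -
    obtain X where X: "invertible X" "x = to_PGL3 X" using x by (auto simp: carrier_PGL3)
    obtain A where A: "A \<in> U_half" "vtx X = vtx (im A) \<or> vtx X = vtx (im A ** im Bmat)"
      using all_good[OF X(1)] GG_U_half unfolding good_def by blast
    have "\<exists>Y. invertible Y \<and> to_PGL3 Y \<in> ?C \<and> vtx Y = vtx X"
      using A inv[OF A(1)] by auto
    then obtain Y where Y: "invertible Y" "to_PGL3 Y \<in> ?C" "vtx Y = vtx X" by blast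
    then obtain c U where "c \<noteq> 0" "U \<in> GLZ" "X = mat c ** Y ** U" using vtx_eq_iff X(1) by metis
    then have "x = to_PGL3 (Y ** U)" "U \<in> Cn 0" using X(2) by (auto simp: Cn_0 matrix_mul_assoc[symmetric])
    then have "x \<in> to_PGL3 Y <#\<^bsub>PGL3\<^esub> Kn 0" using coset_Kn[OF Y(1)] by blast
    then show ?thesis using Y(2) by blast
  qed
  then have "carrier PGL3 \<subseteq> (\<Union>c\<in>?C. c <#\<^bsub>PGL3\<^esub> Kn 0)" by (rule subsetI)
  moreover have "countable ?C" using countable_U_half by simp
  moreover have "?C \<subseteq> carrier PGL3" using inv by auto
  ultimately show ?thesis by (intro exI[of _ ?C] conjI)
qed

lemma filtered_group_PGL3: "filtered_group PGL3 PGL3_top Kn"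
  unfolding filtered_group_def filtered_group_axioms_def
proof (intro conjI allI impI)
  show "Group.group PGL3" by (rule PGL3.is_group)
  show "subgroup (Kn n) PGL3" for n by (rule Kn_subgroup)
  show "Kn (Suc n) \<subseteq> Kn n" for n unfolding Kn_def using Cn_dec by blast
  show "openin PGL3_top U \<longleftrightarrow> U \<subseteq> carrier PGL3 \<and> (\<forall>x\<in>U. \<exists>n. x <#\<^bsub>PGL3\<^esub> Kn n \<subseteq> U)" for U
    by (rule openin_PGL3_iff)
  show "\<exists>m. \<forall>k\<in>Kn m. g \<otimes>\<^bsub>PGL3\<^esub> k \<otimes>\<^bsub>PGL3\<^esub> inv\<^bsub>PGL3\<^esub> g \<in> Kn n" if "g \<in> carrier PGL3" for g n
    using that by (rule Kn_conj)
  show "\<exists>F. finite F \<and> F \<subseteq> Kn 0 \<and> Kn 0 \<subseteq> (\<Union>f\<in>F. f <#\<^bsub>PGL3\<^esub> Kn n)" for n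
    by (rule Kn_finite_index)
  show "\<exists>C. countable C \<and> C \<subseteq> carrier PGL3 \<and> carrier PGL3 \<subseteq> (\<Union>c\<in>C. c <#\<^bsub>PGL3\<^esub> Kn 0)"
    by (rule countable_index_PGL3)
qed

sublocale filtered_group PGL3 PGL3_top Kn
  by (rule filtered_group_PGL3)

lemma Kn_0_iff: "invertible Y \<Longrightarrow> to_PGL3 Y \<in> Kn 0 \<longleftrightarrow> vtx Y = vtx (mat 1)"
proof
  assume Y: "invertible Y" "to_PGL3 Y \<in> Kn 0"
  then obtain U where U: "U \<in> GLZ" "to_PGL3 U = to_PGL3 Y" by (auto simp: Kn_def Cn_0)
  then obtain c where "c \<noteq> 0" "Y = mat c ** U" using to_PGL3_eq_iff by blast
  then show "vtx Y = vtx (mat 1)" using vtx_mult_GLZ[OF U(1), of "mat 1"] by simp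
next
  assume Y: "invertible Y" "vtx Y = vtx (mat 1)"
  then obtain c U where c: "c \<noteq> 0" "U \<in> GLZ" "Y = mat c ** mat 1 ** U"
    using vtx_eq_iff[of "mat 1" Y] invertible_mat1 by metis
  then have "to_PGL3 Y = to_PGL3 U" by simp
  then show "to_PGL3 Y \<in> Kn 0" using c(2) by (auto simp: Kn_def Cn_0)
qed

text \<open>An element of the intersection fixes the standard vertex, so it comes from a signed
  permutation matrix. Level 2 is the first that works: diag(1, -1, -1) is the identity modulo 2, but
  1 and -1 differ modulo 4.\<close>

lemma K2_trivial: "Kn 2 \<inter> PG = {\<one>\<^bsub>PGL3\<^esub>}"
proof (intro equalityI subsetI)
  fix g assume g: "g \<in> Kn 2 \<inter> PG"
  obtain B where B: "B \<in> Cn 2" "g = to_PGL3 B" using g by (auto simp: Kn_def)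
  have "to_PGL3 B \<in> Kn 0" using B Cn_GLZ by (auto simp: Kn_def Cn_0)
  then have "vtx B = vtx (mat 1)" using Kn_0_iff Cn_invertible[OF B(1)] by blast
  then have "g \<in> stabilizer (PGL3\<lparr>carrier := PG\<rparr>) vertex_action (vtx (mat 1))"
    using g B by (simp add: stabilizer_def)
  then obtain A where A: "over O_lam A" "unitary A" "g = to_PGL3 (im A)"
    unfolding stabilizer_standard by blast
  obtain c where c: "c \<noteq> 0" "im A = mat c ** B" using A(3) B(2) to_PGL3_eq_iff by metis
  obtain \<pi> s where s: "\<And>i. s i = 1 \<or> s i = -1" and Am: "A = (\<chi> i j. if j = \<pi> i then s i else 0)"
    using integral_unitary_monomial[OF A(1,2)] by blast
  have Bii: "\<exists>z\<in>ZZ. B $ i $ i = 1 + 4 * z" for i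
  proof -
    have "(B $ i $ i - mat 1 $ i $ i) / 2 ^ 2 \<in> ZZ" using Cn_nbm[OF B(1)] unfolding nbm_def nbq_def by blast
    then have "(B $ i $ i - 1) / 4 \<in> ZZ" by (simp add: mat_def)
    moreover have "4 * (d / 4) = d" for d :: q2 by simp
    then have "B $ i $ i = 1 + 4 * ((B $ i $ i - 1) / 4)" by (simp only:) simp
    ultimately show ?thesis by blast
  qed
  have Bnz: "B $ i $ i \<noteq> 0" for i
  proof
    assume "B $ i $ i = 0"
    then obtain z where "z \<in> ZZ" "1 + 4 * z = 0" using Bii[of i] by auto
    then have "inverse 2 = - 2 * z" by (simp add: field_simps add_eq_0_iff)
    then show False using half_not_ZZ \<open>z \<in> ZZ\<close> by (metis ZZ_minus_iff ZZ_mult ZZ_numeral)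
  qed
  have cB: "\<iota> (A $ i $ i) = c * B $ i $ i" for i using arg_cong[OF c(2), of "\<lambda>M. M $ i $ i"] by simp
  have \<pi>: "\<pi> i = i" for i
  proof (rule ccontr)
    assume "\<pi> i \<noteq> i"
    then have "A $ i $ i = 0" by (simp add: Am)
    then show False using cB[of i] c(1) Bnz[of i] by simp
  qed
  have sB: "\<iota> (s i) = c * B $ i $ i" for i using cB[of i] by (simp add: Am \<pi>)
  have "s i = s 1" for i
  proof (rule ccontr)
    assume "s i \<noteq> s 1"
    then have "s i = - s 1" "s 1 \<in> O_lam" using s[of i] s[of 1] by auto
    then have "c * B $ i $ i = - (c * B $ 1 $ 1)" unfolding sB[symmetric] by simp
    then have neg: "B $ i $ i = - B $ 1 $ 1" using c(1) by (metis mult_cancel_left mult_minus_right)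
    obtain x y where xy: "x \<in> ZZ" "B $ i $ i = 1 + 4 * x" "y \<in> ZZ" "B $ 1 $ 1 = 1 + 4 * y" using Bii by meson
    have "4 * (inverse 2 :: q2) = 2" by simp
    also have "1 + 4 * x = - (1 + 4 * y)" using neg xy(2,4) by simp
    then have "2 = 4 * (- (x + y))" by algebra
    finally have "inverse 2 = - (x + y)" by (simp only: mult_cancel_left) simp
    then show False using half_not_ZZ xy by (metis ZZ_add ZZ_minus_iff)
  qed
  then have "A = mat (s 1)" by (simp add: Am \<pi> vec_eq_iff mat_def)
  then have "im A = mat (\<iota> (s 1)) ** mat 1" by simp
  moreover have "\<iota> (s 1) \<noteq> 0" using s[of 1] by auto
  ultimately have "g = to_PGL3 (mat 1)" using A(3) by (metis to_PGL3_smult)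
  then show "g \<in> {\<one>\<^bsub>PGL3\<^esub>}" by (simp add: PGL3_one)
next
  fix g assume "g \<in> {\<one>\<^bsub>PGL3\<^esub>}"
  then show "g \<in> Kn 2 \<inter> PG" using subgroup.one_closed[OF Kn_subgroup] subgroup.one_closed[OF PG_subgroup] by simp
qed

text \<open>The elements that carry a vertex to a given translate form a left coset of its
  stabilizer.\<close>

lemma card_translate:
  assumes A: "A \<in> U_half" and W: "invertible W"
  shows "card {\<gamma> \<in> PG. vertex_action \<gamma> (vtx W) = vtx (im A ** W)} =
    card (stabilizer (PGL3\<lparr>carrier := PG\<rparr>) vertex_action (vtx W))"
proof -
  let ?S = "{D \<in> U_half. vtx (im D ** W) = vtx W}"
  have invA: "invertible (im A)" using A im_unitary_invertible by blast
  have st: "stabilizer (PGL3\<lparr>carrier := PG\<rparr>) vertex_action (vtx W) = (\<lambda>D. to_PGL3 (im D)) ` ?S"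
  proof (intro equalityI subsetI)
    fix g assume "g \<in> stabilizer (PGL3\<lparr>carrier := PG\<rparr>) vertex_action (vtx W)"
    then have g: "g \<in> PG" "vertex_action g (vtx W) = vtx W" by (simp_all add: stabilizer_def)
    then obtain D where D: "D \<in> U_half" "g = to_PGL3 (im D)" unfolding PG_def by blast
    then have "vtx (im D ** W) = vtx W"
      using g(2) W im_unitary_invertible(1)[OF D(1)] by simp
    then show "g \<in> (\<lambda>D. to_PGL3 (im D)) ` ?S" using D by blast
  next
    fix g assume "g \<in> (\<lambda>D. to_PGL3 (im D)) ` ?S"
    then obtain D where D: "D \<in> U_half" "vtx (im D ** W) = vtx W" "g = to_PGL3 (im D)" by blast
    have "g \<in> PG" unfolding PG_def using D(1,3) by blast
    moreover have "vertex_action g (vtx W) = vtx W"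
      unfolding D(3) using D(2) W im_unitary_invertible(1)[OF D(1)] by simp
    ultimately show "g \<in> stabilizer (PGL3\<lparr>carrier := PG\<rparr>) vertex_action (vtx W)"
      by (simp add: stabilizer_def)
  qed
  have inPG: "to_PGL3 (im A) \<in> PG" using A by (auto simp: PG_def)
  let ?a = "to_PGL3 (im A)"
  have eq: "{\<gamma> \<in> PG. vertex_action \<gamma> (vtx W) = vtx (im A ** W)} =
    (\<lambda>s. ?a \<otimes>\<^bsub>PGL3\<^esub> s) ` stabilizer (PGL3\<lparr>carrier := PG\<rparr>) vertex_action (vtx W)"
  proof (intro equalityI subsetI)
    fix \<gamma> assume "\<gamma> \<in> {\<gamma> \<in> PG. vertex_action \<gamma> (vtx W) = vtx (im A ** W)}"
    then obtain D where D: "D \<in> U_half" "\<gamma> = to_PGL3 (im D)" "vtx (im D ** W) = vtx (im A ** W)"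
      using W by (auto simp: PG_def)
    let ?D = "adj A ** D"
    have D': "?D \<in> U_half" using A D U_half_mult U_half_adj by blast
    have invD: "invertible (im D)" using D im_unitary_invertible by blast
    have aA: "im (adj A) ** im A = mat 1" using im_unitary_invertible[OF A] by (metis matrix_inv_left)
    have "vtx (im (adj A) ** (im D ** W)) = vtx (im (adj A) ** (im A ** W))"
      by (rule vtx_mult_cong) (simp_all add: D(3) invertible_mult' invD invA W)
    then have "vtx (im ?D ** W) = vtx W"
      using D U_half_adj[OF A] by (simp add: im_mult matrix_mul_assoc aA)
    then have "to_PGL3 (im ?D) \<in> stabilizer (PGL3\<lparr>carrier := PG\<rparr>) vertex_action (vtx W)"
      unfolding st using D' by blast
    moreover have "\<gamma> = ?a \<otimes>\<^bsub>PGL3\<^esub> to_PGL3 (im ?D)"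
    proof -
      have "A ** ?D = D" using A by (simp add: matrix_mul_assoc unitary_right U_half_unitary)
      then show ?thesis using D PG_mult[OF A D'] by simp
    qed
    ultimately show "\<gamma> \<in> (\<lambda>s. ?a \<otimes>\<^bsub>PGL3\<^esub> s) ` stabilizer (PGL3\<lparr>carrier := PG\<rparr>) vertex_action (vtx W)" by blast
  next
    fix \<gamma> assume "\<gamma> \<in> (\<lambda>s. ?a \<otimes>\<^bsub>PGL3\<^esub> s) ` stabilizer (PGL3\<lparr>carrier := PG\<rparr>) vertex_action (vtx W)"
    then obtain D where D: "D \<in> U_half" "vtx (im D ** W) = vtx W" "\<gamma> = to_PGL3 (im (A ** D))"
      unfolding st using PG_mult[OF A] by auto
    have invD: "invertible (im D)" using D im_unitary_invertible by blast
    have "vtx (im A ** (im D ** W)) = vtx (im A ** W)"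
      by (rule vtx_mult_cong) (simp_all add: D(2) invertible_mult' invD W)
    then have "vtx (im (A ** D) ** W) = vtx (im A ** W)" using A D by (simp add: im_mult matrix_mul_assoc)
    then show "\<gamma> \<in> {\<gamma> \<in> PG. vertex_action \<gamma> (vtx W) = vtx (im A ** W)}"
      using D U_half_mult[OF A D(1)] W by (auto simp: PG_def)
  qed
  have "inj_on (\<lambda>s. ?a \<otimes>\<^bsub>PGL3\<^esub> s) (stabilizer (PGL3\<lparr>carrier := PG\<rparr>) vertex_action (vtx W))"
  proof (rule inj_onI)
    fix s t assume "s \<in> stabilizer (PGL3\<lparr>carrier := PG\<rparr>) vertex_action (vtx W)"
      "t \<in> stabilizer (PGL3\<lparr>carrier := PG\<rparr>) vertex_action (vtx W)" "?a \<otimes>\<^bsub>PGL3\<^esub> s = ?a \<otimes>\<^bsub>PGL3\<^esub> t"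
    then show "s = t" using subgroup.subset[OF PG_subgroup] invA by (auto simp: stabilizer_def subset_iff)
  qed
  then show ?thesis unfolding eq by (rule card_image)
qed

end

section \<open>Unimodularity and the covolume\<close>

locale dyadic_haar = dyadic +
  fixes \<mu> :: "(q2 ^ 3 ^ 3) set measure"
  assumes mu: "haar_measure PGL3 PGL3_top \<mu>" "emeasure \<mu> PGL3_Z2 = 1"
begin

sublocale filtered_group_haar PGL3 PGL3_top Kn \<mu>
  by unfold_locales (simp_all add: mu Kn_0)

text \<open>The cube of the product of \<open>dmat\<close> and a cyclic permutation matrix is scalar, so the modular
  function is trivial on \<open>dmat\<close>.\<close>

lemma modular_dmat: "modular (to_PGL3 dmat) 1"
proof -
  define s t :: "q2 ^ 3 ^ 3" where st: "s = mk3 0 1 0 0 0 1 1 0 0" "t = mk3 0 0 1 1 0 0 0 1 0"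
  have ts: "s ** t = mat 1" "t ** s = mat 1" by (simp_all add: st mk3_mult mat1_mk3)
  have "zmat s" "zmat t" by (simp_all add: st zmat_def forall_3)
  then have tG: "t \<in> GLZ" "s \<in> GLZ" using ts unfolding GLZ_def by blast+
  define D where "D = dmat ** s"
  have dm: "dmat = mk3 2 0 0 0 1 0 0 0 1" by (simp add: dmat_def mk3_def)
  have "D ** D ** D = mat 2 ** mat 1"
    unfolding D_def dm st by (simp add: mk3_mult mat1_mk3 mat_mk3)
  moreover have invD: "invertible D" unfolding D_def using tG GLZ_invertible by (intro invertible_mult') simp_all
  moreover have "to_PGL3 (mat 2 ** mat 1 :: q2 ^ 3 ^ 3) = to_PGL3 (mat 1)" by (rule to_PGL3_smult) simp
  ultimately have cube: "to_PGL3 D \<otimes>\<^bsub>PGL3\<^esub> to_PGL3 D \<otimes>\<^bsub>PGL3\<^esub> to_PGL3 D = to_PGL3 (mat 1)"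
    by (simp add: invertible_mult')
  have "modular (to_PGL3 (mat 1)) 1"
    by (rule modular_Kn) (auto simp: Kn_def Cn_1)
  then have mD: "modular (to_PGL3 D) 1"
    by (rule modular_cube[OF to_PGL3_carrier[OF invD], unfolded cube])
  have mt: "modular (to_PGL3 t) 1" by (rule modular_Kn) (auto simp: Kn_def Cn_0 tG)
  have "to_PGL3 t \<in> carrier PGL3" "to_PGL3 D \<in> carrier PGL3" using invD tG GLZ_invertible by simp_all
  then have "modular (to_PGL3 D \<otimes>\<^bsub>PGL3\<^esub> to_PGL3 t) (1 * 1)"
    using modular_mult mD mt by blast
  moreover have "D ** t = dmat" unfolding D_def by (simp add: matrix_mul_assoc[symmetric] ts)
  then have "to_PGL3 D \<otimes>\<^bsub>PGL3\<^esub> to_PGL3 t = to_PGL3 dmat" using invD GLZ_invertible[OF tG(1)] by simp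
  ultimately show ?thesis by simp
qed

lemma modular_trivial: "invertible X \<Longrightarrow> modular (to_PGL3 X) 1"
proof (induction X rule: GL3_induct)
  case one
  show ?case by (rule modular_Kn) (auto simp: Kn_def Cn_1)
next
  case (smult c A)
  then show ?case by simp
next
  case (GLZ A U)
  have "modular (to_PGL3 U) 1" by (rule modular_Kn) (auto simp: Kn_def Cn_0 GLZ)
  then show ?case
    using modular_mult[of "to_PGL3 A" 1 "to_PGL3 U" 1] GLZ GLZ_invertible by simp
next
  case (dmat A)
  then show ?case using modular_mult[of "to_PGL3 A" 1 "to_PGL3 dmat" 1] modular_dmat by simp
qed

sublocale filtered_group_lattice PGL3 PGL3_top Kn \<mu> PG 2
proof (intro filtered_group_lattice.intro filtered_group_lattice_axioms.intro filtered_group_haar_axioms)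
  show "countable PG" unfolding PG_def using countable_U_half by simp
  show "modular \<gamma> 1" if "\<gamma> \<in> PG" for \<gamma>
    using that modular_trivial im_unitary_invertible by (auto simp: PG_def)
qed (rule PG_subgroup K2_trivial; assumption?)+

text \<open>The elements that move the vertex chosen by b, the standard one or that of L, to the
  standard vertex. This is a right translate of \<open>Kn 0\<close>, so it has measure 1 by
  unimodularity.\<close>

definition Sset :: "bool \<Rightarrow> (q2 ^ 3 ^ 3) set set" where
  "Sset b = {x \<in> carrier PGL3. x \<otimes>\<^bsub>PGL3\<^esub> to_PGL3 (if b then mat 1 else im Bmat) \<in> Kn 0}"

definition weight :: "bool \<Rightarrow> ennreal" where "weight b = ennreal (if b then 1 / 24 else 1 / 168)"

lemma Sset_measure: "Sset b \<in> sets \<mu>" "emeasure \<mu> (Sset b) = 1"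
proof -
  let ?W = "if b then mat 1 else im Bmat"
  have inv: "to_PGL3 ?W \<in> carrier PGL3" "modular (to_PGL3 ?W) 1" using modular_trivial[of ?W] by auto
  show "emeasure \<mu> (Sset b) = 1" unfolding Sset_def by (rule modular_value[OF inv])
  show "Sset b \<in> sets \<mu>"
    unfolding Sset_def using measurable_sets[OF right_translation_measurable[OF inv(1)] Kn_measurable[of 0]]
    by (simp add: space_mu vimage_def Int_def conj_commute)
qed

text \<open>The vertex of \<open>matrix_inv X\<close> is equivalent to exactly one of the two base
  vertices. The elements of \<open>PG\<close> carrying that base vertex to it form a coset of the
  stabilizer, whose order cancels the weight; the other base vertex contributes 0.\<close>

lemma weighted_count:
  assumes x: "x \<in> carrier PGL3"
  shows "(\<Sum>b\<in>UNIV. weight b * num (Sset b) (proj x)) = 1"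
proof -
  obtain X where X: "invertible X" "x = to_PGL3 X" using x by (auto simp: carrier_PGL3)
  let ?Y = "matrix_inv X"
  have Y: "invertible ?Y" using X invertible_matrix_inv by blast
  let ?W = "\<lambda>b. if b then mat 1 else im Bmat"
  have W: "invertible (?W b)" for b by simp
  have set: "{\<gamma> \<in> PG. x \<otimes>\<^bsub>PGL3\<^esub> \<gamma> \<in> Sset b} = {\<gamma> \<in> PG. vertex_action \<gamma> (vtx (?W b)) = vtx ?Y}" for b
  proof -
    have "x \<otimes>\<^bsub>PGL3\<^esub> \<gamma> \<in> Sset b \<longleftrightarrow> vertex_action \<gamma> (vtx (?W b)) = vtx ?Y" if g: "\<gamma> \<in> PG" for \<gamma>
    proof -
      obtain A where A: "A \<in> U_half" "\<gamma> = to_PGL3 (im A)" using g by (auto simp: PG_def)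
      have invA: "invertible (im A)" using A im_unitary_invertible by blast
      have "x \<otimes>\<^bsub>PGL3\<^esub> \<gamma> \<in> Sset b \<longleftrightarrow> to_PGL3 (X ** im A ** ?W b) \<in> Kn 0"
        using X A invA W[of b] by (simp add: Sset_def invertible_mult')
      also have "\<dots> \<longleftrightarrow> vtx (X ** (im A ** ?W b)) = vtx (mat 1)"
        using Kn_0_iff[of "X ** im A ** ?W b"] X invA W[of b] by (simp add: invertible_mult' matrix_mul_assoc)
      also have "\<dots> \<longleftrightarrow> vtx (im A ** ?W b) = vtx ?Y"
      proof
        assume "vtx (X ** (im A ** ?W b)) = vtx (mat 1)"
        then have "vtx (?Y ** (X ** (im A ** ?W b))) = vtx (?Y ** mat 1)"
          using X invA W[of b] by (intro vtx_mult_cong) (simp_all add: invertible_mult')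
        then show "vtx (im A ** ?W b) = vtx ?Y" using X by (simp add: matrix_mul_assoc)
      next
        assume "vtx (im A ** ?W b) = vtx ?Y"
        then have "vtx (X ** (im A ** ?W b)) = vtx (X ** ?Y)"
          using Y invA W[of b] by (intro vtx_mult_cong) (simp_all add: invertible_mult')
        then show "vtx (X ** (im A ** ?W b)) = vtx (mat 1)" using X by simp
      qed
      finally show ?thesis using A W[of b] by simp
    qed
    then show ?thesis by blast
  qed
  have cnt: "num (Sset b) (proj x) = emeasure (count_space PG) {\<gamma> \<in> PG. vertex_action \<gamma> (vtx (?W b)) = vtx ?Y}" for b
    unfolding num_proj[OF x] set ..
  have stab: "card (stabilizer (PGL3\<lparr>carrier := PG\<rparr>) vertex_action (vtx (?W b))) = (if b then 24 else 168)" for b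
    using card_PIsom_L PS_iso(2) stabilizer_L stabilizer_standard by (simp add: PS_def)
  have full: "num (Sset b) (proj x) = (if b then 24 else 168)" if "A \<in> U_half" "vtx ?Y = vtx (im A ** ?W b)" for A b
  proof -
    have c: "card {\<gamma> \<in> PG. vertex_action \<gamma> (vtx (?W b)) = vtx ?Y} = (if b then 24 else 168)"
      using card_translate[OF that(1) W[of b]] stab[of b] that(2) by simp
    \<comment> \<open>A nonzero value of \<open>card\<close> certifies finiteness, since
      \<open>card\<close> is 0 on infinite sets; only then does the counting measure agree with
      it.\<close>
    then have "finite {\<gamma> \<in> PG. vertex_action \<gamma> (vtx (?W b)) = vtx ?Y}"
      by (intro card_ge_0_finite) (simp split: if_splits)
    then show ?thesis unfolding cnt using c by (subst emeasure_count_space) auto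
  qed
  have empty: "num (Sset b) (proj x) = 0" if AA: "A \<in> U_half" "vtx ?Y = vtx (im A ** ?W (\<not> b))" for A b
  proof -
    have none: "{\<gamma> \<in> PG. vertex_action \<gamma> (vtx (?W b)) = vtx ?Y} = {}"
    proof (rule ccontr)
      assume "\<not> ?thesis"
      then obtain A' where A': "A' \<in> U_half" "vtx (im A' ** ?W b) = vtx (im A ** ?W (\<not> b))"
        using W[of b] AA(2) by (auto simp: PG_def)
      have neq: "vtx (im C ** im Bmat) \<noteq> vtx (im C')" if C: "C \<in> U_half" "C' \<in> U_half" for C C'
      proof
        assume e: "vtx (im C ** im Bmat) = vtx (im C')"
        have i: "invertible (im C ** im Bmat)" "invertible (im C')"
          using C im_unitary_invertible by (auto intro!: invertible_mult')
        have "vtx (im (adj C') ** (im C ** im Bmat)) = vtx (im (adj C') ** im C')"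
          by (rule vtx_mult_cong[OF i e])
        moreover have "im (adj C') ** im C' = mat 1"
          using im_unitary_invertible[OF C(2)] by (metis matrix_inv_left)
        moreover have "im (adj C') ** (im C ** im Bmat) = im (adj C' ** C) ** im Bmat"
          using C U_half_adj by (simp add: im_mult matrix_mul_assoc)
        ultimately show False
          using vtx_not_equivalent[of "adj C' ** C"] C U_half_mult U_half_adj by metis
      qed
      show False using A' neq[of A' A] neq[of A A'] AA(1) by (cases b) auto
    qed
    show ?thesis unfolding cnt none by simp
  qed
  obtain A b where A: "A \<in> U_half" "vtx ?Y = vtx (im A ** ?W b)"
  proof -
    obtain A where "A \<in> GG" "vtx ?Y = vtx (im A) \<or> vtx ?Y = vtx (im A ** im Bmat)"
      using all_good[OF Y] by (auto simp: good_def)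
    then show thesis using that[of A True] that[of A False] GG_U_half by auto
  qed
  have one: "weight b * (if b then 24 else 168) = 1" for b
    by (simp add: weight_def ennreal_mult[symmetric] flip: ennreal_numeral)
  show ?thesis
    using full[OF A] empty[of A "\<not> b"] A one[of b] by (cases b) (simp_all add: UNIV_bool)
qed

lemma covolume_PG:
  "\<exists>\<nu>. coset_measure PGL3 PGL3_top \<mu> PG \<nu>" "covolume PGL3 PGL3_top \<mu> PG = ennreal (1 / 21)"
proof -
  show "\<exists>\<nu>. coset_measure PGL3 PGL3_top \<mu> PG \<nu>"
    by (rule weighted_fundamental_domain(1)[of UNIV Sset weight]) (simp_all only: Sset_measure weighted_count finite)
  have "covolume PGL3 PGL3_top \<mu> PG = (\<Sum>b\<in>UNIV. weight b * emeasure \<mu> (Sset b))"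
    by (rule covolume_weighted) (simp_all only: Sset_measure weighted_count finite)
  also have "\<dots> = ennreal (1 / 21)"
    by (simp add: Sset_measure UNIV_bool weight_def ennreal_plus[symmetric] del: ennreal_plus)
  finally show "covolume PGL3 PGL3_top \<mu> PG = ennreal (1 / 21)" .
qed

end

theorem theorem3p2:
  fixes \<iota> :: "complex \<Rightarrow> q2" and \<mu> :: "(q2 ^ 3 ^ 3) set measure"
  assumes "dyadic_embedding \<iota>"
    and "haar_measure PGL3 PGL3_top \<mu>" and "emeasure \<mu> PGL3_Z2 = 1"
  shows "is_lattice_in PGL3 PGL3_top \<mu> (PGamma_L \<iota>) \<and>
    covolume PGL3 PGL3_top \<mu> (PGamma_L \<iota>) = ennreal (1 / 21) \<and>
    PGamma_L \<iota> = generate PGL3 (PIsom_L \<iota> \<union> {to_PGL3 (map_matrix \<iota> beta_L)}) \<and>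
    group_action (PGL3\<lparr>carrier := PGamma_L \<iota>\<rparr>) (\<Union>building) vertex_action \<and>
    (\<exists>O1 O2. O1 \<noteq> O2 \<and>
       orbits (PGL3\<lparr>carrier := PGamma_L \<iota>\<rparr>) (\<Union>building) vertex_action = {O1, O2} \<and>
       (\<forall>V\<in>O1. PGL3\<lparr>carrier := stabilizer (PGL3\<lparr>carrier := PGamma_L \<iota>\<rparr>) vertex_action V\<rparr> \<cong> L3_2) \<and>
       (\<forall>V\<in>O2. PGL3\<lparr>carrier := stabilizer (PGL3\<lparr>carrier := PGamma_L \<iota>\<rparr>) vertex_action V\<rparr> \<cong> sym_group 4))"
proof -
  interpret dyadic_haar \<iota> \<mu> using assms by unfold_locales
  have "is_lattice_in PGL3 PGL3_top \<mu> PG"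
    unfolding is_lattice_in_def using PG_subgroup discrete covolume_PG by simp
  then show ?thesis
    unfolding PGamma_L_eq Union_building
    using covolume_PG(2) PG_eq_Gen subgroup_group_action[OF PG_subgroup] orbits_PG
    by (simp only: Gen_def im_def)
qed

end
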